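(* Let $\mathbf k_1,\dots,\mathbf k_s\in\mathbf N\cap|\Sigma|$ be such that for every $n$-dimensional cone $\sigma\in\Sigma$ $$\mathbf N\cap\sigma=\bigcup_{1\le i\le s:\ \overline{\mathbf k_i}\in\sigma}\Big(\mathbf k_i+\sum_{\mathbf l\in S:\ \overline{\mathbf l}\in\sigma}\mathbb Z_{\ge0}\,\mathbf l\Big).$$ (1) As a $\mathcal D$-module, the fan $D$-module $\mathcal M(\boldsymbol\Sigma,G)$ is generated by $\mathbb 1_{\mathbf k_1},\dots,\mathbb 1_{\mathbf k_s}$, and all relations among $\mathbb 1_{\mathbf k_1},\dots,\mathbb 1_{\mathbf k_s}$ are generated by $\mathcal R_{i,\mathbf k_j}$ and $\mathcal P_{d_1,d_2;a,a';\mathbf k_j,\mathbf k_l}$ with $1\le i\le m$, $1\le j,l\le s$. (2) As a $\mathcal D'$-module, the reduced fan $D$-module $\mathcal M_{\rm red}(\boldsymbol\Sigma,G)$ is generated by $\mathbb 1_{\mathbf k_1},\dots,\mathbb 1_{\mathbf k_s}$, and all relations among $\mathbb 1_{\mathbf k_1},\dots,\mathbb 1_{\mathbf k_s}$ are generated by $\mathcal P'_{d_1,d_2;a,a';\mathbf k_j,\mathbf k_l}$ with $1\le j,l\le s$.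
   Context: **Stacky fan.** $\boldsymbol\Sigma=(\mathbf N,\Sigma,\beta)$: $\mathbf N$ is a finitely generated abelian group of rank $n$; $\overline{\mathbf k}$ is the image of $\mathbf k\in\mathbf N$ in $\mathbf N_{\mathbb R}=\mathbf N\otimes\mathbb R$; $\Sigma$ is a rational simplicial fan in $\mathbf N_{\mathbb R}$; $\beta\colon\mathbb Z^m\to\mathbf N$ is a homomorphism such that, with $b_i=\beta(e_i)$, the rays $\mathbb R_{\ge0}\overline b_1,\dots,\mathbb R_{\ge0}\overline b_m$ are exactly the (distinct) one-dimensional cones of $\Sigma$. Standing assumptions: $\Sigma$ has an $n$-dimensional cone, its support $|\Sigma|$ is convex, and there is a strictly convex function $|\Sigma|\to\mathbb R$ linear on each cone. A cone $\sigma$ is identified with $\{i:\overline b_i\in\sigma\}$; $\mathbf N\cap|\Sigma|=\{\mathbf k:\overline{\mathbf k}\in|\Sigma|\}$, $\mathbf N\cap\sigma=\{\mathbf k:\overline{\mathbf k}\in\sigma\}$. $\mathbb L=\ker\beta$; $D_i\in\mathbb L^\star$ is the $i$-th coordinate restricted to $\mathbb L$. **Lattices.** If $\sigma$ is the minimal cone containing $\overline{\mathbf k}$ and $\overline{\mathbf k}=\sum_{i\in\sigma}c_i\overline b_i$, then $\Psi(\mathbf k)\in(\mathbb Q_{\ge0})^m$ has $\Psi_i(\mathbf k)=c_i$ for $i\in\sigma$ and $0$ otherwise; $d(\mathbf k,\mathbf l)=\Psi(\mathbf k)+\Psi(\mathbf l)-\Psi(\mathbf k+\mathbf l)$. $\mathbb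 O\subset\mathbb Q^m\oplus\mathbf N$ is the subgroup generated by all $(\Psi(\mathbf k),\mathbf k)$, $\mathbf k\in\mathbf N\cap|\Sigma|$; $\boldsymbol\Lambda=\{\lambda:(\lambda,0)\in\mathbb O\}\subset\mathbb L_{\mathbb Q}$; $\boldsymbol\Lambda_+=\boldsymbol\Lambda\cap\sum_{\sigma\in\Sigma}C_\sigma$ with $C_\sigma=\{\lambda\in\mathbb L_{\mathbb R}:D_i\cdot\lambda\ge0\ \forall i\notin\sigma\}$; $d(\mathbf k,\mathbf l)\in\boldsymbol\Lambda_+$. $\mathbb C[z][\boldsymbol\Lambda_+]$ is the monoid ring with monomials $Q^d$. **Fan $D$-module.** $G\subset\mathbf N\cap|\Sigma|$ is finite, disjoint from $\{b_1,\dots,b_m\}$; $S=\{b_1,\dots,b_m\}\cup G$; $y=(y_{\mathbf k})_{\mathbf k\in S}$ are variables, $y_i:=y_{b_i}$, $\partial_{\mathbf k}=\partial/\partial y_{\mathbf k}$, $\partial_i=\partial_{b_i}$. $\mathcal D=\mathbb C[z][\boldsymbol\Lambda_+][y]\langle z\vartheta_1,\dots,z\vartheta_m,\{z\partial_{\mathbf l}\}_{\mathbf l\in S}\rangle$ and $\mathcal D'=\mathbb C[z][\boldsymbol\Lambda_+][\{y_{\mathbf l}\}_{\mathbf l\in G}]\langle z\vartheta_1,\dots,z\vartheta_m,\{z\partial_{\mathbf l}\}_{\mathbf l\in G}\rangle$, with relations $[z\vartheta_i,Q^d]=z(D_i\cdot d)Q^d$, $[z\partial_{\mathbf l},y_{\mathbf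 k}]=z\delta_{\mathbf k,\mathbf l}$, all other commutators of generators zero. $\mathcal M(\boldsymbol\Sigma,G)=\bigoplus_{\mathbf k\in\mathbf N\cap|\Sigma|}\mathbb C[z][\boldsymbol\Lambda_+][y]\mathbb 1_{\mathbf k}$ is the $\mathcal D$-module with $$z\vartheta_i\cdot\mathbb 1_{\mathbf k}=z\Psi_i(\mathbf k)\mathbb 1_{\mathbf k}+\sum_{\mathbf l\in S}\Psi_i(\mathbf l)y_{\mathbf l}Q^{d(\mathbf k,\mathbf l)}\mathbb 1_{\mathbf k+\mathbf l},\qquad z\partial_{\mathbf l}\cdot\mathbb 1_{\mathbf k}=Q^{d(\mathbf k,\mathbf l)}\mathbb 1_{\mathbf k+\mathbf l}.$$ $\mathcal M_{\rm red}(\boldsymbol\Sigma,G)=\mathcal M(\boldsymbol\Sigma,G)/(y_1-1,\dots,y_m-1)$ with the induced action of $\mathcal D'$. **Relations.** For $1\le i\le m$, $\mathbf k\in\mathbf N\cap|\Sigma|$: $$\mathcal R_{i,\mathbf k}=z\vartheta_i\mathbb 1_{\mathbf k}-\Big(z\Psi_i(\mathbf k)+zy_i\partial_i+\sum_{\mathbf l\in G}\Psi_i(\mathbf l)\,zy_{\mathbf l}\partial_{\mathbf l}\Big)\mathbb 1_{\mathbf k}.$$ For $d_1,d_2\in\boldsymbol\Lambda_+$, $a,a'\in(\mathbb Z_{\ge0})^S$, $\mathbf k,\mathbf k'\in\mathbf N\cap|\Sigma|$ satisfying $\mathbf k+\sum_{\mathbf l\in S}a_{\mathbf l}\mathbf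 l=\mathbf k'+\sum_{\mathbf l\in S}a'_{\mathbf l}\mathbf l$ in $\mathbf N$ and $d_1+\sum a_{\mathbf l}\Psi(\mathbf l)+\Psi(\mathbf k)=d_2+\sum a'_{\mathbf l}\Psi(\mathbf l)+\Psi(\mathbf k')$ in $\mathbb Q^m$ (write $a_i=a_{b_i}$): $$\mathcal P_{d_1,d_2;a,a';\mathbf k,\mathbf k'}=Q^{d_1}\prod_{\mathbf l\in S}(z\partial_{\mathbf l})^{a_{\mathbf l}}\mathbb 1_{\mathbf k}-Q^{d_2}\prod_{\mathbf l\in S}(z\partial_{\mathbf l})^{a'_{\mathbf l}}\mathbb 1_{\mathbf k'},$$ $$\mathcal P'_{d_1,d_2;a,a';\mathbf k,\mathbf k'}=Q^{d_1}\prod_{\mathbf l\in G}(z\partial_{\mathbf l})^{a_{\mathbf l}}\prod_{i=1}^m\prod_{\nu=0}^{a_i-1}\Big(z\vartheta_i-z(\nu+\Psi_i(\mathbf k))-\sum_{\mathbf l\in G}\Psi_i(\mathbf l)zy_{\mathbf l}\partial_{\mathbf l}\Big)\mathbb 1_{\mathbf k}-Q^{d_2}\prod_{\mathbf l\in G}(z\partial_{\mathbf l})^{a'_{\mathbf l}}\prod_{i=1}^m\prod_{\nu=0}^{a'_i-1}\Big(z\vartheta_i-z(\nu+\Psi_i(\mathbf k'))-\sum_{\mathbf l\in G}\Psi_i(\mathbf l)zy_{\mathbf l}\partial_{\mathbf l}\Big)\mathbb 1_{\mathbf k'}.$$ "All relations are generated by ..." means that the kernel of $\bigoplus_{j=1}^s\mathcal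 D\,\mathbb 1_{\mathbf k_j}\to\mathcal M(\boldsymbol\Sigma,G)$ (free left module to the fan $D$-module), resp. of $\bigoplus_j\mathcal D'\mathbb 1_{\mathbf k_j}\to\mathcal M_{\rm red}(\boldsymbol\Sigma,G)$, is the left submodule generated by the listed elements, for all admissible $(d_1,d_2,a,a')$. *)

theory Defs
  imports
    "HOL-Analysis.Finite_Function_Topology"
    "HOL-Analysis.Polytope"
    "HOL-Algebra.QuotRing"
    "HOL-Algebra.Module"
    "HOL-Computational_Algebra.Group_Closure"
begin

abbreviation keys :: "('a \<Rightarrow>\<^sub>0 'b::zero) \<Rightarrow> 'a set" where
  "keys \<equiv> Poly_Mapping.keys"

abbreviation lookup :: "('a \<Rightarrow>\<^sub>0 'b::zero) \<Rightarrow> 'a \<Rightarrow> 'b" where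
  "lookup \<equiv> Poly_Mapping.lookup"

section \<open>The real vector space of an abelian group\<close>

text \<open>The tensor product of an abelian group with the reals: the real vector space freely
  generated by the elements of the group, modulo additivity.\<close>

definition additivity_relations :: "('n::ab_group_add \<Rightarrow>\<^sub>0 real) set" where
  "additivity_relations =
     {Poly_Mapping.single (x + y) 1 - Poly_Mapping.single x 1 - Poly_Mapping.single y 1 | x y. True}"

definition tensor_eq :: "('n::ab_group_add \<Rightarrow>\<^sub>0 real) \<Rightarrow> ('n \<Rightarrow>\<^sub>0 real) \<Rightarrow> bool" where
  "tensor_eq p q \<longleftrightarrow> p - q \<in> span additivity_relations"

quotient_type (overloaded) 'n real_tensor = "('n::ab_group_add) \<Rightarrow>\<^sub>0 real" / tensor_eq
proof (rule equivpI)
  show "reflp tensor_eq"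
    by (simp add: reflp_def tensor_eq_def span_zero)
  show "symp tensor_eq"
    using span_neg by (fastforce simp: symp_def tensor_eq_def)
  show "transp tensor_eq"
    using span_add by (fastforce simp: transp_def tensor_eq_def)
qed

instantiation real_tensor :: (ab_group_add) real_vector
begin

lift_definition zero_real_tensor :: "'a real_tensor" is 0 .

lift_definition plus_real_tensor :: "'a real_tensor \<Rightarrow> 'a real_tensor \<Rightarrow> 'a real_tensor" is "(+)"
  unfolding tensor_eq_def by (simp add: add_diff_add span_add)

lift_definition minus_real_tensor :: "'a real_tensor \<Rightarrow> 'a real_tensor \<Rightarrow> 'a real_tensor" is "(-)"
proof -
  fix p p' q q' :: "'a \<Rightarrow>\<^sub>0 real"
  assume "tensor_eq p p'" "tensor_eq q q'"
  then have "(p - p') - (q - q') \<in> span additivity_relations"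
    unfolding tensor_eq_def by (rule span_diff)
  moreover have "(p - p') - (q - q') = (p - q) - (p' - q')"
    by (simp add: algebra_simps)
  ultimately show "tensor_eq (p - q) (p' - q')"
    unfolding tensor_eq_def by simp
qed

lift_definition uminus_real_tensor :: "'a real_tensor \<Rightarrow> 'a real_tensor" is "uminus"
  unfolding tensor_eq_def by (simp only: minus_diff_minus span_neg)

lift_definition scaleR_real_tensor :: "real \<Rightarrow> 'a real_tensor \<Rightarrow> 'a real_tensor" is scaleR
  unfolding tensor_eq_def by (simp only: scaleR_diff_right[symmetric] span_scale)

instance
proof
  fix x y z :: "'a real_tensor" and r s :: real
  show "x + y + z = x + (y + z)"
    by transfer (simp add: tensor_eq_def span_zero add.assoc)
  show "x + y = y + x"
    by transfer (simp add: tensor_eq_def span_zero add.commute)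
  show "0 + x = x"
    by transfer (simp add: tensor_eq_def span_zero)
  show "- x + x = 0"
    by transfer (simp add: tensor_eq_def span_zero)
  show "x - y = x + - y"
    by transfer (simp add: tensor_eq_def span_zero)
  show "r *\<^sub>R (x + y) = r *\<^sub>R x + r *\<^sub>R y"
    by transfer (simp add: tensor_eq_def span_zero scaleR_add_right)
  show "(r + s) *\<^sub>R x = r *\<^sub>R x + s *\<^sub>R x"
    by transfer (simp add: tensor_eq_def span_zero scaleR_add_left)
  show "r *\<^sub>R s *\<^sub>R x = (r * s) *\<^sub>R x"
    by transfer (simp add: tensor_eq_def span_zero)
  show "1 *\<^sub>R x = x"
    by transfer (simp add: tensor_eq_def span_zero)
qed

end

lift_definition real_image :: "'n::ab_group_add \<Rightarrow> 'n real_tensor" is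
  "\<lambda>x. Poly_Mapping.single x 1" .


section \<open>Stacky fans\<close>

definition rational_simplicial_cone :: "('n::ab_group_add) real_tensor set \<Rightarrow> bool" where
  "rational_simplicial_cone \<sigma> \<longleftrightarrow>
     (\<exists>B. finite B \<and> B \<subseteq> range real_image \<and> independent B \<and> \<sigma> = convex_cone hull B)"

text \<open>Faces of polyhedral cones are non-empty by convention, whereas
  \<^term>\<open>{} face_of \<sigma>\<close> always holds.\<close>

definition rational_simplicial_fan :: "('n::ab_group_add) real_tensor set set \<Rightarrow> bool" where
  "rational_simplicial_fan \<Sigma> \<longleftrightarrow>
     finite \<Sigma> \<and> (\<forall>\<sigma>\<in>\<Sigma>. rational_simplicial_cone \<sigma>) \<and>
     (\<forall>\<sigma>\<in>\<Sigma>. \<forall>\<tau>. \<tau> face_of \<sigma> \<and> \<tau> \<noteq> {} \<longrightarrow> \<tau> \<in> \<Sigma>) \<and>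
     (\<forall>\<sigma>\<in>\<Sigma>. \<forall>\<tau>\<in>\<Sigma>. \<sigma> \<inter> \<tau> face_of \<sigma> \<and> \<sigma> \<inter> \<tau> face_of \<tau>)"

text \<open>A function that is linear on the cones of a fan with convex support is strictly convex
  if it is convex and is affine only on those segments that lie in a single cone.\<close>

definition strictly_convex_pl ::
  "('n::ab_group_add) real_tensor set set \<Rightarrow> ('n real_tensor \<Rightarrow> real) \<Rightarrow> bool" where
  "strictly_convex_pl \<Sigma> \<phi> \<longleftrightarrow>
     (\<forall>\<sigma>\<in>\<Sigma>. \<exists>f. linear f \<and> (\<forall>x\<in>\<sigma>. \<phi> x = f x)) \<and>
     convex_on (\<Union>\<Sigma>) \<phi> \<and>
     (\<forall>x\<in>\<Union>\<Sigma>. \<forall>y\<in>\<Union>\<Sigma>. \<forall>t. 0 < t \<and> t < 1 \<and> \<not> (\<exists>\<sigma>\<in>\<Sigma>. x \<in> \<sigma> \<and> y \<in> \<sigma>) \<longrightarrow>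
        \<phi> ((1 - t) *\<^sub>R x + t *\<^sub>R y) < (1 - t) * \<phi> x + t * \<phi> y)"

text \<open>The group \<open>\<int>\<^sup>m\<close> consists of the finitely supported functions on \<open>nat\<close> with support in
  \<open>{1..m}\<close>; the values of \<open>beta\<close> elsewhere are irrelevant. The same convention applies
  to \<open>\<rat>\<^sup>m\<close> below.\<close>

record (overloaded) ('n::ab_group_add) stacky_data =
  nrays :: nat
  beta :: "(nat \<Rightarrow>\<^sub>0 int) \<Rightarrow> 'n"
  cones :: "'n real_tensor set set"

definition rays :: "('n::ab_group_add) stacky_data \<Rightarrow> nat set" where
  "rays X = {1..nrays X}"

definition bvec :: "('n::ab_group_add) stacky_data \<Rightarrow> nat \<Rightarrow> 'n" where
  "bvec X i = beta X (Poly_Mapping.single i 1)"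

text \<open>The rank of a finitely generated group is the dimension of its tensor product with the
  reals.\<close>

definition max_dim :: "('n::ab_group_add) real_tensor set \<Rightarrow> bool" where
  "max_dim \<sigma> \<longleftrightarrow> dim \<sigma> = dim (UNIV :: 'n real_tensor set)"

definition stacky_fan :: "('n::ab_group_add) stacky_data \<Rightarrow> bool" where
  "stacky_fan X \<longleftrightarrow>
     (\<exists>A. finite A \<and> group_closure A = (UNIV :: 'n set)) \<and>
     (\<forall>v w. keys v \<subseteq> rays X \<and> keys w \<subseteq> rays X \<longrightarrow> beta X (v + w) = beta X v + beta X w) \<and>
     rational_simplicial_fan (cones X) \<and>
     bij_betw (\<lambda>i. {t *\<^sub>R real_image (bvec X i) | t. 0 \<le> t}) (rays X) {\<sigma>\<in>cones X. dim \<sigma> = 1} \<and>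
     (\<exists>\<sigma>\<in>cones X. max_dim \<sigma>) \<and>
     convex (\<Union>(cones X)) \<and>
     (\<exists>\<phi>. strictly_convex_pl (cones X) \<phi>)"

definition NSupp :: "('n::ab_group_add) stacky_data \<Rightarrow> 'n set" where
  "NSupp X = {k. real_image k \<in> \<Union>(cones X)}"

definition cone_rays :: "('n::ab_group_add) stacky_data \<Rightarrow> 'n real_tensor set \<Rightarrow> nat set" where
  "cone_rays X \<sigma> = {i\<in>rays X. real_image (bvec X i) \<in> \<sigma>}"


section \<open>The lattices\<close>

definition Psi :: "('n::ab_group_add) stacky_data \<Rightarrow> 'n \<Rightarrow> (nat \<Rightarrow>\<^sub>0 rat)" where
  "Psi X k = (THE c. \<exists>\<sigma>\<in>cones X. real_image k \<in> \<sigma> \<and>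
     (\<forall>\<tau>\<in>cones X. real_image k \<in> \<tau> \<longrightarrow> \<sigma> \<subseteq> \<tau>) \<and>
     keys c \<subseteq> cone_rays X \<sigma> \<and>
     real_image k = (\<Sum>i\<in>cone_rays X \<sigma>. of_rat (lookup c i) *\<^sub>R real_image (bvec X i)))"

definition ddeg :: "('n::ab_group_add) stacky_data \<Rightarrow> 'n \<Rightarrow> 'n \<Rightarrow> (nat \<Rightarrow>\<^sub>0 rat)" where
  "ddeg X k l = Psi X k + Psi X l - Psi X (k + l)"

definition refined_lattice :: "('n::ab_group_add) stacky_data \<Rightarrow> ((nat \<Rightarrow>\<^sub>0 rat) \<times> 'n) set" where
  "refined_lattice X = group_closure ((\<lambda>k. (Psi X k, k)) ` NSupp X)"

definition Lam :: "('n::ab_group_add) stacky_data \<Rightarrow> (nat \<Rightarrow>\<^sub>0 rat) set" where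
  "Lam X = {d. (d, 0) \<in> refined_lattice X}"

definition L_int :: "('n::ab_group_add) stacky_data \<Rightarrow> (nat \<Rightarrow>\<^sub>0 int) set" where
  "L_int X = {v. keys v \<subseteq> rays X \<and> beta X v = 0}"

text \<open>\<open>\<bbbL> \<otimes> \<real>\<close> is identified with the real span of \<open>\<bbbL>\<close> in \<open>\<real>\<^sup>m\<close>.\<close>

definition L_real :: "('n::ab_group_add) stacky_data \<Rightarrow> (nat \<Rightarrow> real) set" where
  "L_real X = {x. \<exists>A r. finite A \<and> A \<subseteq> L_int X \<and> x = (\<lambda>i. \<Sum>v\<in>A. r v * of_int (lookup v i))}"

definition C_cone :: "('n::ab_group_add) stacky_data \<Rightarrow> 'n real_tensor set \<Rightarrow> (nat \<Rightarrow> real) set" where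
  "C_cone X \<sigma> = {x\<in>L_real X. \<forall>i\<in>rays X - cone_rays X \<sigma>. 0 \<le> x i}"

definition Lam_plus :: "('n::ab_group_add) stacky_data \<Rightarrow> (nat \<Rightarrow>\<^sub>0 rat) set" where
  "Lam_plus X = {d\<in>Lam X. \<exists>f. (\<forall>\<sigma>\<in>cones X. f \<sigma> \<in> C_cone X \<sigma>) \<and>
     (\<forall>i. of_rat (lookup d i) = (\<Sum>\<sigma>\<in>cones X. f \<sigma> i))}"


section \<open>Left modules over non-commutative rings\<close>

definition submodule_generated ::
  "('r, 'c) ring_scheme \<Rightarrow> ('r, 'v, 'e) module_scheme \<Rightarrow> 'v set \<Rightarrow> 'v set" where
  "submodule_generated R M A = \<Inter>{H. submodule H R M \<and> A \<subseteq> H}"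

definition free_module :: "('r, 'c) ring_scheme \<Rightarrow> 'i set \<Rightarrow> ('r, 'i \<Rightarrow> 'r) module" where
  "free_module R I =
     \<lparr>carrier = (\<Pi>\<^sub>E i\<in>I. carrier R), mult = (\<lambda>x y. undefined), one = undefined,
      zero = (\<lambda>i\<in>I. \<zero>\<^bsub>R\<^esub>), add = (\<lambda>x y. \<lambda>i\<in>I. x i \<oplus>\<^bsub>R\<^esub> y i),
      smult = (\<lambda>r x. \<lambda>i\<in>I. r \<otimes>\<^bsub>R\<^esub> x i)\<rparr>"

definition free_elt :: "('r, 'c) ring_scheme \<Rightarrow> 'i set \<Rightarrow> 'r \<Rightarrow> 'i \<Rightarrow> ('i \<Rightarrow> 'r)" where
  "free_elt R I r j = (\<lambda>i\<in>I. if i = j then r else \<zero>\<^bsub>R\<^esub>)"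

definition relations_among ::
  "('r, 'c) ring_scheme \<Rightarrow> ('r, 'v, 'e) module_scheme \<Rightarrow> 'i set \<Rightarrow> ('i \<Rightarrow> 'v) \<Rightarrow> ('i \<Rightarrow> 'r) set" where
  "relations_among R M I g =
     {x\<in>carrier (free_module R I). (\<Oplus>\<^bsub>M\<^esub>i\<in>I. x i \<odot>\<^bsub>M\<^esub> g i) = \<zero>\<^bsub>M\<^esub>}"

definition quotient_module ::
  "('r, 'v, 'e) module_scheme \<Rightarrow> 'v set \<Rightarrow> ('r, 'v set) module" where
  "quotient_module M H =
     \<lparr>carrier = a_rcosets\<^bsub>M\<^esub> H, mult = (\<lambda>x y. undefined), one = undefined,
      zero = H, add = set_add M,
      smult = (\<lambda>r A. \<Union>x\<in>A. H +>\<^bsub>M\<^esub> (r \<odot>\<^bsub>M\<^esub> x))\<rparr>"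


section \<open>Rings by generators and relations\<close>

text \<open>Lists form the free monoid, so \<^typ>\<open>'g list \<Rightarrow>\<^sub>0 complex\<close> is the free associative
  algebra on the set of all elements of type \<open>'g\<close>.\<close>

instantiation list :: (type) monoid_add
begin
definition zero_list :: "'a list" where "zero_list = []"
definition plus_list :: "'a list \<Rightarrow> 'a list \<Rightarrow> 'a list" where "plus_list = (@)"
instance by standard (simp_all add: zero_list_def plus_list_def)
end

type_synonym 'g free_alg = "'g list \<Rightarrow>\<^sub>0 complex"

definition gen :: "'g \<Rightarrow> 'g free_alg" where
  "gen g = Poly_Mapping.single [g] 1"

definition const :: "complex \<Rightarrow> 'g free_alg" where
  "const c = Poly_Mapping.single [] c"

definition free_algebra_on :: "'g set \<Rightarrow> 'g free_alg ring" where
  "free_algebra_on A =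
     \<lparr>carrier = {p. \<forall>w\<in>keys p. set w \<subseteq> A}, mult = (*), one = 1, zero = 0, add = (+)\<rparr>"

definition presented_ring :: "'g set \<Rightarrow> 'g free_alg set \<Rightarrow> 'g free_alg set ring" where
  "presented_ring A rels = free_algebra_on A Quot (genideal (free_algebra_on A) rels)"

definition presented_class :: "'g set \<Rightarrow> 'g free_alg set \<Rightarrow> 'g free_alg \<Rightarrow> 'g free_alg set" where
  "presented_class A rels p =
     genideal (free_algebra_on A) rels +>\<^bsub>free_algebra_on A\<^esub> p"


section \<open>The rings of differential operators\<close>

text \<open>The generators \<open>z\<close>, \<open>Q\<^sup>d\<close>, \<open>y\<^sub>k\<close>, \<open>z\<theta>\<^sub>i\<close> and \<open>z\<partial>\<^sub>l\<close>. The factor \<open>z\<close> is part of the last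
  two generators.\<close>

datatype 'n fan_gen = GZ | GQ "nat \<Rightarrow>\<^sub>0 rat" | GY 'n | GTheta nat | GDel 'n

text \<open>With \<open>T = S\<close> the following data present the ring \<open>\<D>\<close>, and with \<open>T = G\<close> the ring \<open>\<D>'\<close>.
  The relations for products of the \<open>Q\<^sup>d\<close> are those of the monoid ring; \<open>z\<close>, the
  \<open>Q\<^sup>d\<close> and the \<open>y\<^sub>k\<close> commute because \<open>fan_bracket\<close> vanishes on them.\<close>

definition fan_gens :: "('n::ab_group_add) stacky_data \<Rightarrow> 'n set \<Rightarrow> 'n fan_gen set" where
  "fan_gens X T = {GZ} \<union> GQ ` Lam_plus X \<union> GY ` T \<union> GTheta ` rays X \<union> GDel ` T"

fun fan_bracket :: "'n fan_gen \<Rightarrow> 'n fan_gen \<Rightarrow> 'n fan_gen free_alg" where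
  "fan_bracket (GTheta i) (GQ d) = const (of_rat (lookup d i)) * gen GZ * gen (GQ d)"
| "fan_bracket (GQ d) (GTheta i) = - (const (of_rat (lookup d i)) * gen GZ * gen (GQ d))"
| "fan_bracket (GDel l) (GY k) = (if k = l then gen GZ else 0)"
| "fan_bracket (GY k) (GDel l) = (if k = l then - gen GZ else 0)"
| "fan_bracket _ _ = 0"

definition fan_rels :: "('n::ab_group_add) stacky_data \<Rightarrow> 'n set \<Rightarrow> 'n fan_gen free_alg set" where
  "fan_rels X T =
     {gen (GQ 0) - 1} \<union>
     {gen (GQ d) * gen (GQ e) - gen (GQ (d + e)) | d e. d \<in> Lam_plus X \<and> e \<in> Lam_plus X} \<union>
     {gen g * gen h - gen h * gen g - fan_bracket g h | g h. g \<in> fan_gens X T \<and> h \<in> fan_gens X T}"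

definition fan_ring :: "('n::ab_group_add) stacky_data \<Rightarrow> 'n set \<Rightarrow> 'n fan_gen free_alg set ring" where
  "fan_ring X T = presented_ring (fan_gens X T) (fan_rels X T)"

definition fan_op ::
  "('n::ab_group_add) stacky_data \<Rightarrow> 'n set \<Rightarrow> 'n fan_gen free_alg \<Rightarrow> 'n fan_gen free_alg set" where
  "fan_op X T = presented_class (fan_gens X T) (fan_rels X T)"


section \<open>The fan D-module\<close>

text \<open>The commutative ring \<open>\<complex>[z][\<Lambda>\<^sub>+][y]\<close> is the monoid algebra over \<open>\<complex>\<close> of the monoid of
  triples \<open>(n, d, e)\<close>, which stand for the monomials \<open>z\<^sup>n Q\<^sup>d y\<^sup>e\<close>.\<close>

type_synonym 'n fan_coeff = "(nat \<times> (nat \<Rightarrow>\<^sub>0 rat) \<times> ('n \<Rightarrow>\<^sub>0 nat)) \<Rightarrow>\<^sub>0 complex"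
type_synonym 'n fan_vec = "'n \<Rightarrow>\<^sub>0 'n fan_coeff"

definition coeff_ring :: "('n::ab_group_add) stacky_data \<Rightarrow> 'n set \<Rightarrow> 'n fan_coeff set" where
  "coeff_ring X S = {f. \<forall>(n, d, e)\<in>keys f. d \<in> Lam_plus X \<and> keys e \<subseteq> S}"

definition cst :: "complex \<Rightarrow> 'n fan_coeff" where
  "cst c = Poly_Mapping.single 0 c"

definition zvar :: "'n fan_coeff" where
  "zvar = Poly_Mapping.single (1, 0, 0) 1"

definition Qvar :: "(nat \<Rightarrow>\<^sub>0 rat) \<Rightarrow> 'n fan_coeff" where
  "Qvar d = Poly_Mapping.single (0, d, 0) 1"

definition yvar :: "'n \<Rightarrow> 'n fan_coeff" where
  "yvar k = Poly_Mapping.single (0, 0, Poly_Mapping.single k 1) 1"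

definition theta_coeff :: "nat \<Rightarrow> 'n fan_coeff \<Rightarrow> 'n fan_coeff" where
  "theta_coeff i f = (\<Sum>(n, d, e)\<in>keys f.
     Poly_Mapping.single (n + 1, d, e) (of_rat (lookup d i) * lookup f (n, d, e)))"

definition del_coeff :: "'n \<Rightarrow> 'n fan_coeff \<Rightarrow> 'n fan_coeff" where
  "del_coeff l f = (\<Sum>(n, d, e)\<in>keys f.
     Poly_Mapping.single (n + 1, d, e - Poly_Mapping.single l 1)
       (of_nat (lookup e l) * lookup f (n, d, e)))"

definition coeff_scale :: "'n fan_coeff \<Rightarrow> 'n fan_vec \<Rightarrow> 'n fan_vec" where
  "coeff_scale f v = Poly_Mapping.map ((*) f) v"

definition unit_vec :: "'n \<Rightarrow> 'n fan_vec" where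
  "unit_vec k = Poly_Mapping.single k 1"

definition S_set :: "('n::ab_group_add) stacky_data \<Rightarrow> 'n set \<Rightarrow> 'n set" where
  "S_set X G = bvec X ` rays X \<union> G"

text \<open>The operators \<open>z\<theta>\<^sub>i\<close> and \<open>z\<partial>\<^sub>l\<close> are prescribed on the basis vectors; the commutation relations
  with the coefficients then dictate the Leibniz rule.\<close>

definition theta_unit ::
  "('n::ab_group_add) stacky_data \<Rightarrow> 'n set \<Rightarrow> nat \<Rightarrow> 'n \<Rightarrow> 'n fan_vec" where
  "theta_unit X G i k =
     coeff_scale (zvar * cst (of_rat (lookup (Psi X k) i))) (unit_vec k) +
     (\<Sum>l\<in>S_set X G. coeff_scale
        (cst (of_rat (lookup (Psi X l) i)) * yvar l * Qvar (ddeg X k l)) (unit_vec (k + l)))"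

definition del_unit :: "('n::ab_group_add) stacky_data \<Rightarrow> 'n \<Rightarrow> 'n \<Rightarrow> 'n fan_vec" where
  "del_unit X l k = coeff_scale (Qvar (ddeg X k l)) (unit_vec (k + l))"

fun gen_act ::
  "('n::ab_group_add) stacky_data \<Rightarrow> 'n set \<Rightarrow> 'n fan_gen \<Rightarrow> 'n fan_vec \<Rightarrow> 'n fan_vec" where
  "gen_act X G GZ v = coeff_scale zvar v"
| "gen_act X G (GQ d) v = coeff_scale (Qvar d) v"
| "gen_act X G (GY k) v = coeff_scale (yvar k) v"
| "gen_act X G (GTheta i) v = (\<Sum>k\<in>keys v.
     coeff_scale (theta_coeff i (lookup v k)) (unit_vec k) +
     coeff_scale (lookup v k) (theta_unit X G i k))"
| "gen_act X G (GDel l) v = (\<Sum>k\<in>keys v.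
     coeff_scale (del_coeff l (lookup v k)) (unit_vec k) +
     coeff_scale (lookup v k) (del_unit X l k))"

definition free_act ::
  "('n::ab_group_add) stacky_data \<Rightarrow> 'n set \<Rightarrow> 'n fan_gen free_alg \<Rightarrow> 'n fan_vec \<Rightarrow> 'n fan_vec" where
  "free_act X G p v =
     (\<Sum>w\<in>keys p. coeff_scale (cst (lookup p w)) (foldr (gen_act X G) w v))"

text \<open>A residue class of the free algebra acts through any of its representatives. Hence the same
  record is a module over \<open>\<D>\<close> and, by restriction of scalars, over \<open>\<D>'\<close>.\<close>

definition fan_module ::
  "('n::ab_group_add) stacky_data \<Rightarrow> 'n set \<Rightarrow> ('n fan_gen free_alg set, 'n fan_vec) module" where
  "fan_module X G =
     \<lparr>carrier = {v. keys v \<subseteq> NSupp X \<and> (\<forall>k. lookup v k \<in> coeff_ring X (S_set X G))},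
      mult = (\<lambda>x y. undefined), one = undefined, zero = 0, add = (+),
      smult = (\<lambda>P v. the_elem ((\<lambda>p. free_act X G p v) ` P))\<rparr>"

definition red_submodule :: "('n::ab_group_add) stacky_data \<Rightarrow> 'n set \<Rightarrow> 'n fan_vec set" where
  "red_submodule X G =
     {\<Sum>i\<in>rays X. coeff_scale (yvar (bvec X i) - 1) (w i) | w.
        \<forall>i\<in>rays X. w i \<in> carrier (fan_module X G)}"

definition red_fan_module ::
  "('n::ab_group_add) stacky_data \<Rightarrow> 'n set \<Rightarrow> ('n fan_gen free_alg set, 'n fan_vec set) module" where
  "red_fan_module X G = quotient_module (fan_module X G) (red_submodule X G)"

definition red_unit_vec :: "('n::ab_group_add) stacky_data \<Rightarrow> 'n set \<Rightarrow> 'n \<Rightarrow> 'n fan_vec set" where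
  "red_unit_vec X G k = red_submodule X G +>\<^bsub>fan_module X G\<^esub> unit_vec k"


section \<open>The relations\<close>

definition nmul :: "nat \<Rightarrow> 'a::comm_monoid_add \<Rightarrow> 'a" where
  "nmul n x = (\<Sum>i<n. x)"

text \<open>The relations live in the free module with basis indexed by \<open>J\<close>, whose \<open>j\<close>-th basis element
  stands for the generator attached to \<open>\<kappa> j\<close>.\<close>

definition R_rel ::
  "('n::ab_group_add) stacky_data \<Rightarrow> 'n set \<Rightarrow> 'j set \<Rightarrow> ('j \<Rightarrow> 'n) \<Rightarrow> nat \<Rightarrow> 'j \<Rightarrow>
   ('j \<Rightarrow> 'n fan_gen free_alg set)" where
  "R_rel X G J \<kappa> i j =
     (let S = S_set X G in
      free_elt (fan_ring X S) J
        (fan_op X S (gen (GTheta i) -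
           (const (of_rat (lookup (Psi X (\<kappa> j)) i)) * gen GZ +
            gen (GY (bvec X i)) * gen (GDel (bvec X i)) +
            (\<Sum>l\<in>G. const (of_rat (lookup (Psi X l) i)) * gen (GY l) * gen (GDel l))))) j)"

definition admissible ::
  "('n::ab_group_add) stacky_data \<Rightarrow> 'n set \<Rightarrow> (nat \<Rightarrow>\<^sub>0 rat) \<Rightarrow> (nat \<Rightarrow>\<^sub>0 rat) \<Rightarrow>
   ('n \<Rightarrow> nat) \<Rightarrow> ('n \<Rightarrow> nat) \<Rightarrow> 'n \<Rightarrow> 'n \<Rightarrow> bool" where
  "admissible X G d1 d2 a a' k k' \<longleftrightarrow>
     d1 \<in> Lam_plus X \<and> d2 \<in> Lam_plus X \<and>
     k + (\<Sum>l\<in>S_set X G. nmul (a l) l) = k' + (\<Sum>l\<in>S_set X G. nmul (a' l) l) \<and>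
     d1 + (\<Sum>l\<in>S_set X G. nmul (a l) (Psi X l)) + Psi X k =
       d2 + (\<Sum>l\<in>S_set X G. nmul (a' l) (Psi X l)) + Psi X k'"

text \<open>In the operators below the factors of each product \<open>\<Otimes>\<close> commute with each other in the
  respective ring, so these products do not depend on an ordering.\<close>

definition P_op ::
  "('n::ab_group_add) stacky_data \<Rightarrow> 'n set \<Rightarrow> (nat \<Rightarrow>\<^sub>0 rat) \<Rightarrow> ('n \<Rightarrow> nat) \<Rightarrow> 'n fan_gen free_alg set" where
  "P_op X G d a =
     (let S = S_set X G; \<D> = fan_ring X S in
      fan_op X S (gen (GQ d)) \<otimes>\<^bsub>\<D>\<^esub> (\<Otimes>\<^bsub>\<D>\<^esub>l\<in>S. fan_op X S (gen (GDel l)) [^]\<^bsub>\<D>\<^esub> a l))"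

definition P_rel ::
  "('n::ab_group_add) stacky_data \<Rightarrow> 'n set \<Rightarrow> 'j set \<Rightarrow> (nat \<Rightarrow>\<^sub>0 rat) \<Rightarrow> (nat \<Rightarrow>\<^sub>0 rat) \<Rightarrow>
   ('n \<Rightarrow> nat) \<Rightarrow> ('n \<Rightarrow> nat) \<Rightarrow> 'j \<Rightarrow> 'j \<Rightarrow> ('j \<Rightarrow> 'n fan_gen free_alg set)" where
  "P_rel X G J d1 d2 a a' j j' =
     (let \<D> = fan_ring X (S_set X G) in
      free_elt \<D> J (P_op X G d1 a) j \<ominus>\<^bsub>free_module \<D> J\<^esub> free_elt \<D> J (P_op X G d2 a') j')"

definition P_red_factor ::
  "('n::ab_group_add) stacky_data \<Rightarrow> 'n set \<Rightarrow> 'n \<Rightarrow> nat \<Rightarrow> nat \<Rightarrow> 'n fan_gen free_alg set" where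
  "P_red_factor X G k i \<nu> =
     fan_op X G (gen (GTheta i) - const (of_nat \<nu> + of_rat (lookup (Psi X k) i)) * gen GZ -
       (\<Sum>l\<in>G. const (of_rat (lookup (Psi X l) i)) * gen (GY l) * gen (GDel l)))"

definition P_red_op ::
  "('n::ab_group_add) stacky_data \<Rightarrow> 'n set \<Rightarrow> 'n \<Rightarrow> (nat \<Rightarrow>\<^sub>0 rat) \<Rightarrow> ('n \<Rightarrow> nat) \<Rightarrow>
   'n fan_gen free_alg set" where
  "P_red_op X G k d a =
     (let \<D>' = fan_ring X G in
      fan_op X G (gen (GQ d)) \<otimes>\<^bsub>\<D>'\<^esub> (\<Otimes>\<^bsub>\<D>'\<^esub>l\<in>G. fan_op X G (gen (GDel l)) [^]\<^bsub>\<D>'\<^esub> a l)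
      \<otimes>\<^bsub>\<D>'\<^esub> (\<Otimes>\<^bsub>\<D>'\<^esub>i\<in>rays X. \<Otimes>\<^bsub>\<D>'\<^esub>\<nu>\<in>{..<a (bvec X i)}. P_red_factor X G k i \<nu>))"

definition P_red_rel ::
  "('n::ab_group_add) stacky_data \<Rightarrow> 'n set \<Rightarrow> 'j set \<Rightarrow> ('j \<Rightarrow> 'n) \<Rightarrow> (nat \<Rightarrow>\<^sub>0 rat) \<Rightarrow> (nat \<Rightarrow>\<^sub>0 rat) \<Rightarrow>
   ('n \<Rightarrow> nat) \<Rightarrow> ('n \<Rightarrow> nat) \<Rightarrow> 'j \<Rightarrow> 'j \<Rightarrow> ('j \<Rightarrow> 'n fan_gen free_alg set)" where
  "P_red_rel X G J \<kappa> d1 d2 a a' j j' =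
     (let \<D>' = fan_ring X G in
      free_elt \<D>' J (P_red_op X G (\<kappa> j) d1 a) j
      \<ominus>\<^bsub>free_module \<D>' J\<^esub> free_elt \<D>' J (P_red_op X G (\<kappa> j') d2 a') j')"

end

(* The module F/H, for a submodule H of a free D-module that contains the listed relations, is a
   representation of the generators. The fan D-module has a mapping property: to map it into a
   representation W it suffices to give vectors w_k, for k in N \<inter> |\<Sigma>|, on which the z\<partial>_l and z\<vartheta>_i act
   as on the basis vectors; in the reduced case the missing y_i act as 1. Every k lies in a
   full-dimensional cone, so k = k_j + \<Sum> a_l l with all terms in one cone, where \<Psi> is additive. One
   takes for w_k the image of the class of k_j under the monomial operator with exponent a. The
   relations P (resp. P') say that the choices do not matter and that z\<partial>_l (resp. z\<vartheta>_i) acts as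
   required; the relations R give the action of z\<vartheta>_i. The map so
   obtained sends the j-th generator to the class of the j-th basis vector; applied to a relation
   among the generators, it shows that the relation lies in H. *)

theory Submission
  imports Defs
begin

section \<open>The real vector space of an abelian group\<close>

text \<open>A pair (x, k) labels the vector Q^(x - \<Psi>(k)) 1_k. The monomial operator with data
  d, a sends the basis vector of k_j to the vector labelled (d + \<Sum> a_l \<Psi>(l) + \<Psi>(k_j),
  k_j + \<Sum> a_l l). Admissibility is equality of two such labels, which is why the relations P
  hold. The factors of P' come from P: y_i^a \<partial>_i^a is the falling factorial of y_i
  \<partial>_i, and by R the operator z y_i \<partial>_i equals z\<vartheta>_i minus the terms of G
  and the weight z \<Psi>_i(k). At y_i = 1 the product replaces (z\<partial>_i)^a, which D' does not
  contain. The obstacle is that F/H depends on H and that the fan rings are known only by generators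
  and relations. So a representation is a family of operators, one for each generator, on a subspace
  of a fixed complex vector space; F/H is realised there by a projection. Identities in the fan
  rings, such as the commutation of the factors of P', are tested on all such representations, one
  of which is faithful. Rationality needs care because N_R is formed over the reals while \<Psi>(k)
  and \<Lambda> are rational.\<close>

lemma lookup_scaleR [simp]: "lookup (r *\<^sub>R p) x = r *\<^sub>R lookup p x"
  for p :: "'a \<Rightarrow>\<^sub>0 'b::real_vector"
proof -
  have "finite {i. r *\<^sub>R lookup p i \<noteq> 0}"
    by (rule finite_subset[OF _ finite_keys[of p]]) (auto simp: in_keys_iff)
  then show ?thesis by (simp add: scaleR_poly_mapping_def)
qed

lemma real_image_add: "real_image (x + y) = real_image x + real_image y"
proof (transfer, unfold tensor_eq_def)
  fix x y :: 'a
  have "Poly_Mapping.single (x + y) (1::real) - Poly_Mapping.single x 1 - Poly_Mapping.single y 1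
      \<in> additivity_relations"
    unfolding additivity_relations_def by blast
  then show "Poly_Mapping.single (x + y) (1::real) -
      (Poly_Mapping.single x 1 + Poly_Mapping.single y 1) \<in> span additivity_relations"
    by (simp add: span_base diff_diff_eq)
qed

lemma real_image_0 [simp]: "real_image 0 = 0"
  using real_image_add[of 0 0] by simp

lemma real_image_minus: "real_image (- x) = - real_image x"
  using real_image_add[of x "- x"] by (simp add: minus_unique)

lemma nmul_0 [simp]: "nmul 0 x = 0"
  and nmul_Suc: "nmul (Suc n) x = x + nmul n x"
  and nmul_1 [simp]: "nmul (Suc 0) x = x"
  and nmul_zero [simp]: "nmul n 0 = 0"
  by (simp_all add: nmul_def add.commute)

lemma nmul_add: "nmul (m + n) x = nmul m x + nmul n x"
  by (induction m) (simp_all add: nmul_Suc add.assoc)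

lemma real_image_nmul: "real_image (nmul n x) = of_nat n *\<^sub>R real_image x"
  by (induction n) (simp_all add: nmul_Suc real_image_add scaleR_add_left)

lemma real_image_sum: "real_image (\<Sum>i\<in>A. f i) = (\<Sum>i\<in>A. real_image (f i))"
  by (induction A rule: infinite_finite_induct) (simp_all add: real_image_add)

text \<open>The integer multiple of \<open>x\<close>, split into its positive and its negative part;
  one of the two terms is always 0.\<close>

definition zmul :: "int \<Rightarrow> 'a::ab_group_add \<Rightarrow> 'a" where
  "zmul k x = nmul (nat k) x - nmul (nat (- k)) x"

lemma zmul_diff_nat: "zmul (int m - int n) x = nmul m x - nmul n x"
proof (cases "n \<le> m")
  case True
  then have "nmul m x = nmul (m - n) x + nmul n x"
    by (metis le_add_diff_inverse2 nmul_add)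
  with True show ?thesis by (simp add: zmul_def nat_diff_distrib')
next
  case False
  then have "nmul n x = nmul (n - m) x + nmul m x"
    by (metis le_add_diff_inverse2 nat_le_linear nmul_add)
  with False show ?thesis by (simp add: zmul_def nat_diff_distrib')
qed

lemma zmul_0 [simp]: "zmul 0 x = 0" and zmul_1 [simp]: "zmul 1 x = x"
  by (simp_all add: zmul_def nmul_def)

lemma zmul_add: "zmul (a + b) x = zmul a x + zmul b x"
proof -
  obtain m n where a: "a = int m - int n" by (rule int_diff_cases)
  obtain p q where b: "b = int p - int q" by (rule int_diff_cases)
  have "a + b = int (m + p) - int (n + q)" by (simp add: a b)
  then show ?thesis by (simp only: a b zmul_diff_nat nmul_add) (simp add: a b zmul_diff_nat)
qed

lemma zmul_minus: "zmul (- a) x = - zmul a x"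
  by (simp add: zmul_def)

lemma real_image_zmul: "real_image (zmul k x) = of_int k *\<^sub>R real_image x"
proof -
  obtain m n where k: "k = int m - int n" by (rule int_diff_cases)
  then show ?thesis
    by (simp add: zmul_diff_nat real_image_add[of _ "- _", simplified] real_image_minus
        real_image_nmul scaleR_left_diff_distrib)
qed

text \<open>A \<open>\<rat>\<close>-linear retraction \<open>\<real> \<rightarrow> \<rat>\<close> turns linear relations between images of group elements
  into relations with rational coefficients. Hence the coordinates \<open>\<Psi>(k)\<close> are rational, and
  \<^const>\<open>real_image\<close> kills only torsion.\<close>

lemma exists_rat_linear_retraction:
  "\<exists>\<rho> :: real \<Rightarrow> rat. (\<forall>x y. \<rho> (x + y) = \<rho> x + \<rho> y) \<and> (\<forall>q. \<rho> (of_rat q) = q)"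
proof -
  interpret R: vector_space "\<lambda>(q::rat) (x::real). of_rat q * x"
    by unfold_locales (simp_all add: algebra_simps of_rat_add of_rat_mult)
  interpret Q: vector_space "\<lambda>(q::rat) (x::rat). q * x"
    by unfold_locales (simp_all add: algebra_simps)
  interpret P: vector_space_pair "\<lambda>(q::rat) (x::real). of_rat q * x" "\<lambda>(q::rat) (x::rat). q * x" ..
  have "R.independent {1}" by (simp add: R.dependent_single)
  then obtain g where g: "Vector_Spaces.linear (\<lambda>(q::rat) (x::real). of_rat q * x) (\<lambda>q x. q * x) g"
    "g 1 = 1"
    using P.linear_independent_extend[of "{1}" "\<lambda>_. 1"] by auto
  interpret g: Vector_Spaces.linear "\<lambda>(q::rat) (x::real). of_rat q * x" "\<lambda>q x. q * x" g by fact
  have "g (of_rat q) = q" for q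
    using g.scale[of q 1] g(2) by simp
  then show ?thesis using g.add by blast
qed

locale rat_retraction =
  fixes \<rho> :: "real \<Rightarrow> rat"
  assumes rho_add: "\<rho> (x + y) = \<rho> x + \<rho> y" and rho_rat: "\<rho> (of_rat q) = q"
begin

lemma rho_0 [simp]: "\<rho> 0 = 0"
  using rho_rat[of 0] by simp

lemma rho_minus: "\<rho> (- x) = - \<rho> x"
  using rho_add[of x "- x"] by (simp add: minus_unique)

lemma rho_mult_nat: "\<rho> (x * of_nat n) = \<rho> x * of_nat n"
  by (induction n) (simp_all add: distrib_left rho_add)

lemma rho_mult_int: "\<rho> (x * of_int n) = \<rho> x * of_int n"
  by (cases n rule: int_diff_cases)
    (simp add: right_diff_distrib rho_add[of _ "- _", simplified] rho_minus rho_mult_nat)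

definition coeff_map :: "('a \<Rightarrow>\<^sub>0 real) \<Rightarrow> ('a \<Rightarrow>\<^sub>0 real)" where
  "coeff_map p = Poly_Mapping.map (\<lambda>r. of_rat (\<rho> r)) p"

lemma lookup_coeff_map [simp]: "lookup (coeff_map p) x = of_rat (\<rho> (lookup p x))"
  by (simp add: coeff_map_def Poly_Mapping.map.rep_eq when_def)

lemma coeff_map_add: "coeff_map (p + q) = coeff_map p + coeff_map q"
  by (rule poly_mapping_eqI) (simp add: lookup_add rho_add of_rat_add)

lemma coeff_map_single: "coeff_map (Poly_Mapping.single x c) = Poly_Mapping.single x (of_rat (\<rho> c))"
  by (rule poly_mapping_eqI) (simp add: lookup_single when_def)

lemma coeff_map_0 [simp]: "coeff_map 0 = 0"
  by (rule poly_mapping_eqI) simp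

lemma coeff_map_sum: "coeff_map (\<Sum>i\<in>A. f i) = (\<Sum>i\<in>A. coeff_map (f i))"
  by (induction A rule: infinite_finite_induct) (simp_all add: coeff_map_add)

text \<open>As \<open>\<rho>\<close> is linear over \<rat> only, \<open>coeff_map\<close> is not
  real-linear. It still respects real multiples of an additivity relation, because the coefficients
  of the relation are integers and \<open>\<rho>\<close> commutes with integer factors.\<close>

lemma coeff_map_scale_relation:
  assumes "a \<in> additivity_relations"
  shows "coeff_map (c *\<^sub>R a) = of_rat (\<rho> c) *\<^sub>R a"
proof (rule poly_mapping_eqI)
  fix z
  from assms obtain x y where a: "a = Poly_Mapping.single (x + y) 1 - Poly_Mapping.single x 1 -
      Poly_Mapping.single y 1"
    unfolding additivity_relations_def by blast
  \<comment> \<open>The three contributions at \<open>z\<close> are added up, since x + y, x and y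
    may coincide.\<close>
  define n :: int where "n = (1 when x + y = z) - (1 when x = z) - (1 when y = z)"
  have "lookup a z = of_int n"
    by (simp add: a n_def lookup_minus lookup_single when_def)
  then show "lookup (coeff_map (c *\<^sub>R a)) z = lookup (of_rat (\<rho> c) *\<^sub>R a) z"
    by (simp add: rho_mult_int of_rat_mult)
qed

lemma coeff_map_in_span:
  assumes "p \<in> span additivity_relations"
  shows "coeff_map p \<in> span additivity_relations"
  using assms
proof (induction rule: span_induct_alt)
  case base then show ?case by (simp add: span_zero)
next
  case (step c x y)
  then show ?case
    by (simp add: coeff_map_add coeff_map_scale_relation span_add span_scale span_base)
qed

text \<open>Equality in the tensor product means that a formal sum lies in the span of the
  additivity relations, and \<open>coeff_map\<close> preserves this span. The coefficient 1 of
  \<open>k\<close> is rational and hence unchanged.\<close>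

lemma real_image_sum_rational:
  assumes "finite I" "real_image k = (\<Sum>i\<in>I. c i *\<^sub>R real_image (b i))"
  shows "real_image k = (\<Sum>i\<in>I. of_rat (\<rho> (c i)) *\<^sub>R real_image (b i))"
proof -
  have rep: "(\<Sum>i\<in>I. d i *\<^sub>R real_image (b i)) =
      abs_real_tensor (\<Sum>i\<in>I. Poly_Mapping.single (b i) (d i))" for d
    using assms(1)
  proof (induction I rule: finite_induct)
    case empty
    then show ?case by (simp add: zero_real_tensor.abs_eq)
  next
    case (insert i I)
    have "Poly_Mapping.single (b i) (d i) = d i *\<^sub>R Poly_Mapping.single (b i) 1"
      by (rule poly_mapping_eqI) (simp add: lookup_single when_def)
    then show ?case
      using insert by (simp add: real_image.abs_eq scaleR_real_tensor.abs_eq plus_real_tensor.abs_eq)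
  qed
  have "Poly_Mapping.single k 1 - (\<Sum>i\<in>I. Poly_Mapping.single (b i) (c i)) \<in> span additivity_relations"
    using assms(2) unfolding rep unfolding real_image.abs_eq real_tensor.abs_eq_iff tensor_eq_def .
  from coeff_map_in_span[OF this]
  have "Poly_Mapping.single k 1 - (\<Sum>i\<in>I. Poly_Mapping.single (b i) (of_rat (\<rho> (c i))))
      \<in> span additivity_relations"
  proof -
    have "coeff_map (Poly_Mapping.single k 1 - (\<Sum>i\<in>I. Poly_Mapping.single (b i) (c i)))
       + coeff_map (\<Sum>i\<in>I. Poly_Mapping.single (b i) (c i)) = coeff_map (Poly_Mapping.single k 1)"
      by (simp flip: coeff_map_add)
    moreover have "\<rho> 1 = 1" using rho_rat[of 1] by simp
    ultimately have "coeff_map (Poly_Mapping.single k 1 - (\<Sum>i\<in>I. Poly_Mapping.single (b i) (c i)))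
      = Poly_Mapping.single k 1 - (\<Sum>i\<in>I. Poly_Mapping.single (b i) (of_rat (\<rho> (c i))))"
      by (simp add: coeff_map_sum coeff_map_single algebra_simps)
    then show ?thesis
      using \<open>coeff_map _ \<in> _\<close> by simp
  qed
  then show ?thesis
    unfolding rep unfolding real_image.abs_eq real_tensor.abs_eq_iff tensor_eq_def .
qed

end

text \<open>The evaluation homomorphism from the free abelian group on the elements of a group to
  the group itself.\<close>

definition zeval :: "('a::ab_group_add \<Rightarrow>\<^sub>0 int) \<Rightarrow> 'a" where
  "zeval u = (\<Sum>x\<in>keys u. zmul (lookup u x) x)"

lemma zeval_superset:
  assumes "finite A" "keys u \<subseteq> A"
  shows "zeval u = (\<Sum>x\<in>A. zmul (lookup u x) x)"
  unfolding zeval_def using assms by (intro sum.mono_neutral_left) (auto simp: in_keys_iff)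

lemma zeval_add: "zeval (u + v) = zeval u + zeval v"
proof -
  let ?A = "keys u \<union> keys v"
  have "zeval (u + v) = (\<Sum>x\<in>?A. zmul (lookup (u + v) x) x)"
    by (rule zeval_superset) (use keys_add[of u v] in auto)
  also have "\<dots> = (\<Sum>x\<in>?A. zmul (lookup u x) x) + (\<Sum>x\<in>?A. zmul (lookup v x) x)"
    by (simp add: lookup_add zmul_add sum.distrib)
  also have "\<dots> = zeval u + zeval v"
    by (simp add: zeval_superset[of ?A])
  finally show ?thesis .
qed

lemma zeval_0 [simp]: "zeval 0 = 0"
  by (simp add: zeval_def)

lemma zeval_minus: "zeval (- u) = - zeval u"
  using zeval_add[of u "- u"] by (simp add: minus_unique)

lemma zeval_diff: "zeval (u - v) = zeval u - zeval v"
  using zeval_add[of u "- v"] by (simp add: zeval_minus)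

lemma zeval_single: "zeval (Poly_Mapping.single x c) = zmul c x"
  by (cases "c = 0") (simp_all add: zeval_def)

lemma zeval_frag_cmul: "zeval u = 0 \<Longrightarrow> zeval (frag_cmul a u) = 0"
proof (induction a rule: int_induct[where k = 0])
  case (step2 i)
  then show ?case using zeval_add[of "frag_cmul i u" "- u"]
    by (simp add: frag_cmul_diff_distrib zeval_minus)
qed (simp_all add: frag_cmul_distrib zeval_add)

text \<open>The retraction makes the coefficients rational in a presentation of [x] as a combination
  of additivity relations. After clearing denominators, N [x] is an integral combination of these
  relations in the free abelian group, where evaluation kills the relations and sends N [x] to N
  x.\<close>

lemma real_image_eq_0_imp_torsion:
  assumes "real_image x = 0"
  shows "\<exists>N>0. nmul N x = 0"
proof -
  obtain \<rho> :: "real \<Rightarrow> rat" where \<rho>: "rat_retraction \<rho>"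
    using exists_rat_linear_retraction unfolding rat_retraction_def by blast
  interpret rat_retraction \<rho> by fact
  \<comment> \<open>\<open>P p\<close> says that some positive integral multiple of \<open>p\<close>
    has integer coefficients and evaluates to 0 in the group.\<close>
  define P where "P p \<longleftrightarrow> (\<exists>N>0. \<exists>u. zeval u = 0 \<and>
    (\<forall>x. of_nat N * lookup p x = of_int (lookup u x)))" for p :: "'a \<Rightarrow>\<^sub>0 real"
  have "P (coeff_map p)" if "p \<in> span additivity_relations" for p :: "'a \<Rightarrow>\<^sub>0 real"
    using that
  proof (induction rule: span_induct_alt)
    case base
    show ?case unfolding P_def by (intro exI[of _ 1] conjI exI[of _ 0]) simp_all
  next
    case (step c a p)
    obtain m n where "quotient_of (\<rho> c) = (m, n)" by fastforce
    then have mn: "\<rho> c = of_int m / of_int n" "n > 0"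
      by (simp_all add: quotient_of_div quotient_of_denom_pos)
    from step.hyps obtain x y where a: "a = Poly_Mapping.single (x + y) 1 -
        Poly_Mapping.single x 1 - Poly_Mapping.single y 1"
      unfolding additivity_relations_def by blast
    define v :: "'a \<Rightarrow>\<^sub>0 int" where "v = Poly_Mapping.single (x + y) 1 -
      Poly_Mapping.single x 1 - Poly_Mapping.single y 1"
    have v: "zeval v = 0" "of_int (lookup v z) = lookup a z" for z
      by (simp_all add: v_def a zeval_diff zeval_single lookup_add lookup_minus
          lookup_single when_def)
    from step.IH obtain N u where N: "N > 0" "zeval u = 0"
      "\<And>x. of_nat N * lookup (coeff_map p) x = of_int (lookup u x)"
      unfolding P_def by blast
    \<comment> \<open>Over the common denominator N n, the new summand (m / n) a has numerator N m v
      and the old sum has numerator n u.\<close>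
    let ?w = "frag_cmul (int N * m) v + frag_cmul n u"
    have "zeval ?w = 0" by (simp add: zeval_add zeval_frag_cmul v(1) N(2))
    moreover have "of_nat (N * nat n) * lookup (coeff_map (c *\<^sub>R a + p)) z = of_int (lookup ?w z)" for z
    proof -
      have "real_of_int n * (of_nat N * lookup (coeff_map p) z) = of_int n * of_int (lookup u z)"
        using N(3) by simp
      moreover have "lookup (coeff_map (c *\<^sub>R a)) z = of_rat (\<rho> c) * lookup a z"
        using coeff_map_scale_relation[OF step.hyps, of c] by simp
      ultimately show ?thesis
        using mn(2) by (simp add: coeff_map_add lookup_add mn(1) of_rat_divide v(2)[symmetric]
            field_simps del: lookup_coeff_map)
    qed
    moreover have "N * nat n > 0" using N mn by simp
    ultimately show ?case unfolding P_def by blast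
  qed
  moreover have "Poly_Mapping.single x 1 \<in> span additivity_relations"
    using assms by (simp add: real_image.abs_eq zero_real_tensor.abs_eq real_tensor.abs_eq_iff tensor_eq_def)
  moreover have "\<rho> 1 = 1" using rho_rat[of 1] by simp
  ultimately have "P (Poly_Mapping.single x 1)"
    by (metis coeff_map_single of_rat_1)
  then obtain N u where N: "N > 0" "zeval u = 0"
      "\<And>z. of_nat N * lookup (Poly_Mapping.single x 1) z = real_of_int (lookup u z)"
    unfolding P_def by blast
  have "u = Poly_Mapping.single x (int N)"
  proof (rule poly_mapping_eqI)
    fix z show "lookup u z = lookup (Poly_Mapping.single x (int N)) z"
      using N(3)[of z] by (auto simp: lookup_single when_def split: if_splits)
  qed
  with N show ?thesis
    using zmul_diff_nat[of N 0 x] by (auto simp: zeval_single)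
qed

lemma span_real_image:
  assumes "group_closure A = (UNIV :: 'n::ab_group_add set)"
  shows "span (real_image ` A) = (UNIV :: 'n real_tensor set)"
proof -
  have gen: "real_image x \<in> span (real_image ` A)" for x
  proof -
    have "x \<in> group_closure A" using assms by simp
    then show ?thesis
    proof induction
      case (base s) then show ?case by (auto simp: span_zero intro: span_base)
    next
      case (diff s t)
      have "real_image (s - t) = real_image s - real_image t"
        using real_image_add[of s "- t"] by (simp add: real_image_minus)
      with diff show ?case by (simp add: span_diff)
    qed
  qed
  have "abs_real_tensor p \<in> span (real_image ` A)" for p
  proof (induction p rule: update_induct)
    case const then show ?case by (simp add: span_zero flip: zero_real_tensor.abs_eq)
  next
    case (update f a b)
    have "Poly_Mapping.update a b f = f + b *\<^sub>R Poly_Mapping.single a 1"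
      using update(1) by (intro poly_mapping_eqI)
        (auto simp: lookup_update lookup_add lookup_single when_def in_keys_iff)
    with update gen[of a] show ?case
      by (simp add: span_add span_scale real_image.abs_eq flip: plus_real_tensor.abs_eq scaleR_real_tensor.abs_eq)
  qed
  moreover have "t \<in> range abs_real_tensor" for t :: "'n real_tensor"
    by (metis Quotient3_abs_rep Quotient3_real_tensor rangeI)
  ultimately have "t \<in> span (real_image ` A)" for t :: "'n real_tensor"
    by (metis rangeE)
  then show ?thesis by blast
qed

section \<open>Geometry of stacky fans\<close>

lemma convex_cone_hull_finite:
  assumes "finite B"
  shows "convex_cone hull B = {\<Sum>b\<in>B. c b *\<^sub>R b | c. \<forall>b\<in>B. 0 \<le> c b}" (is "_ = ?R")
proof
  show "convex_cone hull B \<subseteq> ?R"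
  proof (rule hull_minimal)
    show "B \<subseteq> ?R"
    proof
      fix b assume "b \<in> B"
      then have "b = (\<Sum>b'\<in>B. (if b' = b then 1 else 0) *\<^sub>R b')"
        using assms by (simp add: if_distrib[of "\<lambda>r. r *\<^sub>R _"] cong: if_cong)
      then show "b \<in> ?R" by (intro CollectI exI[of _ "\<lambda>b'. if b' = b then 1 else 0"]) auto
    qed
    show "convex_cone ?R"
      unfolding convex_cone_iff
    proof (intro conjI ballI allI impI)
      show "0 \<in> ?R" by (intro CollectI exI[of _ "\<lambda>_. 0"]) auto
    next
      fix x y assume "x \<in> ?R" "y \<in> ?R"
      then obtain c d where "x = (\<Sum>b\<in>B. c b *\<^sub>R b)" "y = (\<Sum>b\<in>B. d b *\<^sub>R b)"
        "\<forall>b\<in>B. 0 \<le> c b" "\<forall>b\<in>B. 0 \<le> d b" by blast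
      then show "x + y \<in> ?R"
        by (intro CollectI exI[of _ "\<lambda>b. c b + d b"]) (simp add: scaleR_add_left sum.distrib)
    next
      fix x and r :: real assume "x \<in> ?R" "0 \<le> r"
      then obtain c where "x = (\<Sum>b\<in>B. c b *\<^sub>R b)" "\<forall>b\<in>B. 0 \<le> c b" by blast
      with \<open>0 \<le> r\<close> show "r *\<^sub>R x \<in> ?R"
        by (intro CollectI exI[of _ "\<lambda>b. r * c b"]) (simp add: scaleR_sum_right)
    qed
  qed
  show "?R \<subseteq> convex_cone hull B"
  proof
    fix x assume "x \<in> ?R"
    then obtain c where x: "x = (\<Sum>b\<in>B. c b *\<^sub>R b)" "\<forall>b\<in>B. 0 \<le> c b" by blast
    have "(\<Sum>b\<in>A. c b *\<^sub>R b) \<in> convex_cone hull B" if "A \<subseteq> B" for A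
      using finite_subset[OF that assms] that
    proof (induction A rule: finite_induct)
      case empty then show ?case by (simp add: convex_cone_hull_contains_0)
    next
      case (insert a A)
      then show ?case using x(2)
        by (simp add: convex_cone_hull_add convex_cone_hull_mul hull_inc)
    qed
    then show "x \<in> convex_cone hull B" by (simp add: x(1))
  qed
qed

lemma independent_sum_eq:
  assumes "independent B" "finite B" "(\<Sum>b\<in>B. c b *\<^sub>R b) = (\<Sum>b\<in>B. d b *\<^sub>R b)" "b \<in> B"
  shows "c b = d b"
proof -
  have "(\<Sum>b\<in>B. (c b - d b) *\<^sub>R b) = 0"
    using assms(3) by (simp add: scaleR_left_diff_distrib sum_subtractf)
  then have "c b - d b = 0"
    by (rule independentD[OF assms(1,2) subset_refl _ assms(4)])
  then show ?thesis by simp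
qed

text \<open>Independence allows coordinates to be compared. A point of the ray inside a segment has
  coordinate 0 at every generator other than \<open>b\<close>; both endpoints have non-negative
  coordinates, so theirs vanish there as well.\<close>

lemma generator_ray_face_of:
  assumes "independent B" "finite B" "b \<in> B"
  shows "{t *\<^sub>R b | t. 0 \<le> t} face_of (convex_cone hull B)" (is "?F face_of _")
  unfolding face_of_def
proof (intro conjI ballI impI)
  show "?F \<subseteq> convex_cone hull B"
    using assms(3) by (auto intro: convex_cone_hull_mul hull_inc)
  show "convex ?F"
    unfolding convex_def
  proof (intro ballI allI impI)
    fix x y and u v :: real
    assume "x \<in> ?F" "y \<in> ?F" "0 \<le> u" "0 \<le> v" "u + v = 1"
    then show "u *\<^sub>R x + v *\<^sub>R y \<in> ?F"
      by (smt (verit, ccfv_threshold) mem_Collect_eq mult_nonneg_nonneg scaleR_add_left scaleR_scaleR add_nonneg_nonneg)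
  qed
  fix x y z assume x: "x \<in> convex_cone hull B" and y: "y \<in> convex_cone hull B"
    and z: "z \<in> ?F" "z \<in> open_segment x y"
  from x y obtain c d where
    c: "x = (\<Sum>b\<in>B. c b *\<^sub>R b)" "\<forall>b\<in>B. 0 \<le> c b" and
    d: "y = (\<Sum>b\<in>B. d b *\<^sub>R b)" "\<forall>b\<in>B. 0 \<le> d b"
    unfolding convex_cone_hull_finite[OF assms(2)] by blast
  from z(2) obtain u where u: "0 < u" "u < 1" "z = (1 - u) *\<^sub>R x + u *\<^sub>R y"
    by (auto simp: in_segment)
  from z(1) obtain t where "z = t *\<^sub>R b" by blast
  then have "(\<Sum>b'\<in>B. ((1 - u) * c b' + u * d b') *\<^sub>R b') = (\<Sum>b'\<in>B. (if b' = b then t else 0) *\<^sub>R b')"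
    using u(3) assms(2,3) unfolding c(1) d(1)
    by (simp add: scaleR_sum_right scaleR_add_left sum.distrib if_distrib[of "\<lambda>r. r *\<^sub>R _"] cong: if_cong)
  then have "(1 - u) * c b' + u * d b' = 0" if "b' \<in> B" "b' \<noteq> b" for b'
    using independent_sum_eq[OF assms(1,2) _ that(1), of "\<lambda>b'. (1 - u) * c b' + u * d b'"] that(2) by force
  then have zero: "c b' = 0 \<and> d b' = 0" if "b' \<in> B" "b' \<noteq> b" for b'
    using that u c(2) d(2) by (metis add_nonneg_eq_0_iff diff_gt_0_iff_gt less_imp_le
        mult_nonneg_nonneg mult_eq_0_iff order_less_irrefl)
  have "(\<Sum>b'\<in>B. c b' *\<^sub>R b') = (\<Sum>b'\<in>{b}. c b' *\<^sub>R b')" "(\<Sum>b'\<in>B. d b' *\<^sub>R b') = (\<Sum>b'\<in>{b}. d b' *\<^sub>R b')"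
    by (rule sum.mono_neutral_right; use assms zero in auto)+
  then have "x = c b *\<^sub>R b" "y = d b *\<^sub>R b" using c(1) d(1) by simp_all
  with c(2) d(2) assms(3) show "x \<in> ?F" "y \<in> ?F" by blast+
qed

lemma dim_ray:
  fixes b :: "'a::real_vector"
  assumes "b \<noteq> 0"
  shows "dim {t *\<^sub>R b | t. 0 \<le> t} = 1"
proof -
  have "b = 1 *\<^sub>R b" by simp
  then have b: "b \<in> {t *\<^sub>R b | t. 0 \<le> t}" by (metis (mono_tags, lifting) mem_Collect_eq zero_le_one)
  have "span {t *\<^sub>R b | t. 0 \<le> t} = span {b}"
  proof
    show "span {t *\<^sub>R b | t. 0 \<le> t} \<subseteq> span {b}"
      by (rule span_minimal) (auto intro: span_scale span_base)
    show "span {b} \<subseteq> span {t *\<^sub>R b | t. 0 \<le> t}"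
      by (rule span_mono) (use b in auto)
  qed
  then have "dim {t *\<^sub>R b | t. 0 \<le> t} = dim {b}"
    by (metis dim_span)
  also have "\<dots> = 1"
    using assms dim_eq_card_independent[of "{b}"] by (simp add: dependent_single)
  finally show ?thesis .
qed

section \<open>Cones of a stacky fan in terms of the vectors b_i\<close>

locale stacky =
  fixes X :: "('n::ab_group_add) stacky_data"
  assumes fan: "stacky_fan X"
begin

abbreviation bv :: "nat \<Rightarrow> 'n real_tensor" where
  "bv i \<equiv> real_image (bvec X i)"

lemma finitely_generated: "\<exists>A. finite A \<and> group_closure A = (UNIV :: 'n set)"
  and beta_add: "keys v \<subseteq> rays X \<Longrightarrow> keys w \<subseteq> rays X \<Longrightarrow> beta X (v + w) = beta X v + beta X w"
  and rational_fan: "rational_simplicial_fan (cones X)"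
  and rays_bij: "bij_betw (\<lambda>i. {t *\<^sub>R bv i | t. 0 \<le> t}) (rays X) {\<sigma>\<in>cones X. dim \<sigma> = 1}"
  and ex_max_cone: "\<exists>\<sigma>\<in>cones X. max_dim \<sigma>"
  and support_convex: "convex (\<Union>(cones X))"
  using fan unfolding stacky_fan_def by blast+

lemma finite_rays [simp]: "finite (rays X)"
  by (simp add: rays_def)

lemma finite_cones: "finite (cones X)"
  and cone_simplicial: "\<sigma> \<in> cones X \<Longrightarrow> rational_simplicial_cone \<sigma>"
  and face_in_cones: "\<sigma> \<in> cones X \<Longrightarrow> \<tau> face_of \<sigma> \<Longrightarrow> \<tau> \<noteq> {} \<Longrightarrow> \<tau> \<in> cones X"
  and Int_face_of: "\<sigma> \<in> cones X \<Longrightarrow> \<tau> \<in> cones X \<Longrightarrow> \<sigma> \<inter> \<tau> face_of \<sigma>"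
  using rational_fan unfolding rational_simplicial_fan_def by blast+

lemma cone_is_convex_cone: "\<sigma> \<in> cones X \<Longrightarrow> convex_cone \<sigma>"
  using cone_simplicial[of \<sigma>] unfolding rational_simplicial_cone_def
  by (auto simp: convex_cone_convex_cone_hull)

lemmas cone_add = convex_cone_add[OF cone_is_convex_cone]
  and cone_scale = convex_cone_scaleR[OF cone_is_convex_cone]
  and cone_zero = convex_cone_contains_0[OF cone_is_convex_cone]

lemma finite_cone_rays [simp]: "finite (cone_rays X \<sigma>)"
  by (simp add: cone_rays_def)

lemma cone_rays_subset: "cone_rays X \<sigma> \<subseteq> rays X"
  by (auto simp: cone_rays_def)

lemma ray_cone: "i \<in> rays X \<Longrightarrow> {t *\<^sub>R bv i | t. 0 \<le> t} \<in> cones X"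
  and dim_ray_cone: "i \<in> rays X \<Longrightarrow> dim {t *\<^sub>R bv i | t. 0 \<le> t} = 1"
  using bij_betwE[OF rays_bij] by auto

lemma ray_eq_imp: "i \<in> rays X \<Longrightarrow> j \<in> rays X \<Longrightarrow>
    {t *\<^sub>R bv i | t. 0 \<le> t} = {t *\<^sub>R bv j | t. 0 \<le> t} \<Longrightarrow> i = j"
  using bij_betw_imp_inj_on[OF rays_bij] by (auto simp: inj_on_def)

lemma inj_bvec: "inj_on (bvec X) (rays X)"
  by (rule inj_onI, rule ray_eq_imp) auto

lemma bv_nonzero: "i \<in> rays X \<Longrightarrow> bv i \<noteq> 0"
proof
  assume i: "i \<in> rays X" "bv i = 0"
  have "{t *\<^sub>R bv i | t. 0 \<le> t} = {0}" using i(2) by auto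
  then have "dim (span ({} :: 'n real_tensor set)) = 1"
    using dim_ray_cone[OF i(1)] by simp
  moreover have "dim ({} :: 'n real_tensor set) = card ({} :: 'n real_tensor set)"
    by (rule dim_eq_card_independent) (rule independent_empty)
  ultimately show False unfolding dim_span by simp
qed

text \<open>A ray contained in \<sigma> is a face of \<sigma>, as cones of the fan meet in faces,
  and a face that contains a sum of two elements of the cone contains both summands. So b_i is a
  multiple of one generator. Conversely, a generator spans a one-dimensional face, which belongs to
  the fan and is therefore one of the rays.\<close>

lemma cone_generators_are_rays:
  assumes "\<sigma> \<in> cones X" "finite B" "independent B" "\<sigma> = convex_cone hull B"
  obtains f t where "bij_betw f (cone_rays X \<sigma>) B" "\<And>i. i \<in> cone_rays X \<sigma> \<Longrightarrow> 0 < t i"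
    "\<And>i. i \<in> cone_rays X \<sigma> \<Longrightarrow> bv i = t i *\<^sub>R f i"
proof -
  have "\<exists>b t. b \<in> B \<and> 0 < t \<and> bv i = t *\<^sub>R b" if i: "i \<in> cone_rays X \<sigma>" for i
  proof -
    from i have ir: "i \<in> rays X" and i\<sigma>: "bv i \<in> \<sigma>" by (auto simp: cone_rays_def)
    let ?\<rho> = "{t *\<^sub>R bv i | t. 0 \<le> t}"
    have "?\<rho> \<subseteq> \<sigma>" using cone_scale[OF assms(1)] i\<sigma> by blast
    then have face: "?\<rho> face_of \<sigma>"
      using Int_face_of[OF assms(1) ray_cone[OF ir]] by (simp add: Int_absorb1)
    from i\<sigma> obtain c where c: "bv i = (\<Sum>b\<in>B. c b *\<^sub>R b)" "\<forall>b\<in>B. 0 \<le> c b"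
      unfolding assms(4) convex_cone_hull_finite[OF assms(2)] by blast
    from c(1) bv_nonzero[OF ir] obtain b where b: "b \<in> B" "c b \<noteq> 0"
      by (metis (no_types, lifting) scaleR_zero_left sum.neutral)
    \<comment> \<open>\<open>b\<close> is a generator that occurs in b_i, and \<open>y\<close>
      collects the other terms. The face property will put the term of \<open>b\<close> on the ray
      of b_i.\<close>
    define y where "y = (\<Sum>b\<in>B - {b}. c b *\<^sub>R b)"
    have bv_eq: "bv i = c b *\<^sub>R b + y"
      unfolding y_def c(1) using assms(2) b(1) by (rule sum.remove)
    have bpos: "0 < c b" using b c(2) by (simp add: less_le)
    have "b \<in> \<sigma>" using b(1) assms(4) by (simp add: hull_inc)
    have y\<sigma>: "y \<in> \<sigma>"
      unfolding y_def assms(4) convex_cone_hull_finite[OF assms(2)]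
    proof (intro CollectI exI conjI ballI)
      show "(\<Sum>b\<in>B - {b}. c b *\<^sub>R b) = (\<Sum>b'\<in>B. (if b' = b then 0 else c b') *\<^sub>R b')"
        using assms(2) by (intro sum.mono_neutral_cong_left) auto
    qed (use c(2) in auto)
    have "c b *\<^sub>R b \<in> ?\<rho>"
    proof (cases "c b *\<^sub>R b = y")
      case True
      then have "c b *\<^sub>R b = (1/2) *\<^sub>R bv i" by (simp add: bv_eq flip: scaleR_2)
      then show ?thesis by (intro CollectI exI[of _ "1/2"]) simp
    next
      case False
      \<comment> \<open>The doubled summands are the endpoints of a segment with midpoint b_i. An
        open segment needs distinct endpoints, hence the case distinction.\<close>
      have "bv i \<in> open_segment (2 *\<^sub>R (c b *\<^sub>R b)) (2 *\<^sub>R y)"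
        unfolding in_segment
      proof
        show "2 *\<^sub>R (c b *\<^sub>R b) \<noteq> 2 *\<^sub>R y"
          using False by (metis scaleR_cancel_left zero_neq_numeral)
      qed (auto intro!: exI[of _ "1/2"] simp: bv_eq)
      moreover have "2 *\<^sub>R (c b *\<^sub>R b) \<in> \<sigma>" "2 *\<^sub>R y \<in> \<sigma>"
        using \<open>b \<in> \<sigma>\<close> y\<sigma> bpos by (simp_all add: cone_scale[OF assms(1)])
      moreover have "bv i \<in> ?\<rho>" by (intro CollectI exI[of _ 1]) simp
      ultimately have "2 *\<^sub>R (c b *\<^sub>R b) \<in> ?\<rho>"
        using face unfolding face_of_def by blast
      then obtain t where "2 *\<^sub>R (c b *\<^sub>R b) = t *\<^sub>R bv i" "0 \<le> t" by blast
      then have "(1/2) *\<^sub>R 2 *\<^sub>R (c b *\<^sub>R b) = (t/2) *\<^sub>R bv i" by simp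
      then have "c b *\<^sub>R b = (t/2) *\<^sub>R bv i" by simp
      with \<open>0 \<le> t\<close> show ?thesis by (intro CollectI exI[of _ "t/2"]) simp
    qed
    then obtain r where r: "c b *\<^sub>R b = r *\<^sub>R bv i" "0 \<le> r" by blast
    have "b \<noteq> 0" using assms(3) b(1) dependent_zero by blast
    then have "r \<noteq> 0" using r(1) bpos by auto
    then have "(1/r) *\<^sub>R (c b *\<^sub>R b) = bv i" using r(1) by simp
    then have "bv i = (c b / r) *\<^sub>R b" by simp
    with \<open>r \<noteq> 0\<close> r(2) bpos b(1) show ?thesis
      by (intro exI[of _ b] exI[of _ "c b / r"]) simp
  qed
  then obtain f t where ft: "\<And>i. i \<in> cone_rays X \<sigma> \<Longrightarrow> f i \<in> B \<and> 0 < t i \<and> bv i = t i *\<^sub>R f i"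
    by metis
  have rays_eq: "{r *\<^sub>R bv i | r. 0 \<le> r} = {r *\<^sub>R b | r. 0 \<le> r}" if "bv i = s *\<^sub>R b" "0 < s" for i b s
  proof (rule equalityI; rule subsetI)
    fix x assume "x \<in> {r *\<^sub>R bv i | r. 0 \<le> r}"
    then obtain r where "x = r *\<^sub>R bv i" "0 \<le> r" by blast
    then show "x \<in> {r *\<^sub>R b | r. 0 \<le> r}"
      using that by (intro CollectI exI[of _ "r * s"]) simp
  next
    fix x assume "x \<in> {r *\<^sub>R b | r. 0 \<le> r}"
    then obtain r where "x = r *\<^sub>R b" "0 \<le> r" by blast
    then show "x \<in> {r *\<^sub>R bv i | r. 0 \<le> r}"
      using that by (intro CollectI exI[of _ "r / s"]) simp
  qed
  have "inj_on f (cone_rays X \<sigma>)"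
  proof (rule inj_onI)
    fix i j assume ij: "i \<in> cone_rays X \<sigma>" "j \<in> cone_rays X \<sigma>" "f i = f j"
    then show "i = j"
      using rays_eq[of i "t i" "f i"] rays_eq[of j "t j" "f j"] ft[OF ij(1)] ft[OF ij(2)]
        cone_rays_subset[of \<sigma>]
      by (intro ray_eq_imp) auto
  qed
  moreover have "f ` cone_rays X \<sigma> = B"
  proof
    show "f ` cone_rays X \<sigma> \<subseteq> B" using ft by blast
    show "B \<subseteq> f ` cone_rays X \<sigma>"
    proof
      fix b assume b: "b \<in> B"
      let ?F = "{r *\<^sub>R b | r. 0 \<le> r}"
      have "b \<noteq> 0" using assms(3) b dependent_zero by blast
      have "?F face_of \<sigma>" using generator_ray_face_of[OF assms(3,2) b] assms(4) by simp
      then have "?F \<in> cones X" by (rule face_in_cones[OF assms(1)]) auto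
      then obtain i where i: "i \<in> rays X" "{r *\<^sub>R bv i | r. 0 \<le> r} = ?F"
        using dim_ray[OF \<open>b \<noteq> 0\<close>] bij_betw_imp_surj_on[OF rays_bij] by (smt (verit, ccfv_threshold) imageE mem_Collect_eq)
      have "bv i = 1 *\<^sub>R bv i" by simp
      then have "bv i \<in> ?F" unfolding i(2)[symmetric] using zero_le_one by blast
      then obtain s where s: "bv i = s *\<^sub>R b" "0 \<le> s" by blast
      with bv_nonzero[OF i(1)] have "0 < s" by (cases "s = 0") auto
      have "b \<in> \<sigma>" using b assms(4) by (simp add: hull_inc)
      then have i\<sigma>: "i \<in> cone_rays X \<sigma>"
        using i(1) s cone_scale[OF assms(1)] by (simp add: cone_rays_def)
      have "f i = b"
      proof (rule ccontr)
        assume "f i \<noteq> b"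
        have "(\<Sum>b'\<in>B. (if b' = f i then t i else 0) *\<^sub>R b') = (\<Sum>b'\<in>B. (if b' = b then s else 0) *\<^sub>R b')"
          using ft[OF i\<sigma>] s b assms(2) by (simp add: if_distrib[of "\<lambda>r. r *\<^sub>R _"] cong: if_cong)
        from independent_sum_eq[OF assms(3,2) this b] \<open>f i \<noteq> b\<close> \<open>0 < s\<close> show False by auto
      qed
      with i\<sigma> show "b \<in> f ` cone_rays X \<sigma>" by blast
    qed
  qed
  ultimately have "bij_betw f (cone_rays X \<sigma>) B" by (simp add: bij_betw_def)
  with ft that show ?thesis by blast
qed

text \<open>Coordinates with respect to the generators of the hull are rescaled by positive factors;
  independence of the generators gives uniqueness.\<close>

lemma cone_eq:
  assumes "\<sigma> \<in> cones X"
  shows "\<sigma> = {\<Sum>i\<in>cone_rays X \<sigma>. c i *\<^sub>R bv i | c. \<forall>i\<in>cone_rays X \<sigma>. 0 \<le> c i}" (is "_ = ?R")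
    and cone_coeffs_unique: "(\<Sum>i\<in>cone_rays X \<sigma>. c i *\<^sub>R bv i) = (\<Sum>i\<in>cone_rays X \<sigma>. d i *\<^sub>R bv i) \<Longrightarrow>
      i \<in> cone_rays X \<sigma> \<Longrightarrow> c i = d i"
proof -
  obtain B where B: "finite B" "independent B" "\<sigma> = convex_cone hull B"
    using cone_simplicial[OF assms] unfolding rational_simplicial_cone_def by blast
  from cone_generators_are_rays[OF assms B] obtain f t where
    f: "bij_betw f (cone_rays X \<sigma>) B" and t: "\<And>i. i \<in> cone_rays X \<sigma> \<Longrightarrow> 0 < t i"
    and bv: "\<And>i. i \<in> cone_rays X \<sigma> \<Longrightarrow> bv i = t i *\<^sub>R f i" by blast
  let ?g = "inv_into (cone_rays X \<sigma>) f"
  have g: "?g (f i) = i" if "i \<in> cone_rays X \<sigma>" for i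
    using f that by (simp add: bij_betw_def)
  have conv: "(\<Sum>i\<in>cone_rays X \<sigma>. c i *\<^sub>R bv i) = (\<Sum>b\<in>B. (c (?g b) * t (?g b)) *\<^sub>R b)" for c
    unfolding sum.reindex_bij_betw[OF f, symmetric] by (intro sum.cong) (simp_all add: bv g)
  have sub: "?R \<subseteq> \<sigma>"
  proof
    fix x assume "x \<in> ?R"
    then obtain c where x: "x = (\<Sum>i\<in>cone_rays X \<sigma>. c i *\<^sub>R bv i)" "\<forall>i\<in>cone_rays X \<sigma>. 0 \<le> c i"
      by blast
    have "(\<Sum>i\<in>A. c i *\<^sub>R bv i) \<in> \<sigma>" if "A \<subseteq> cone_rays X \<sigma>" for A
      using finite_subset[OF that finite_cone_rays] that
    proof (induction A rule: finite_induct)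
      case empty then show ?case by (simp add: cone_zero[OF assms])
    next
      case (insert a A)
      then have "c a *\<^sub>R bv a \<in> \<sigma>"
        using x(2) by (intro cone_scale[OF assms]) (auto simp: cone_rays_def)
      with insert show ?case by (simp add: cone_add[OF assms])
    qed
    then show "x \<in> \<sigma>" by (simp add: x(1))
  qed
  have "\<sigma> \<subseteq> ?R"
  proof
    fix x assume "x \<in> \<sigma>"
    then obtain c where c: "x = (\<Sum>b\<in>B. c b *\<^sub>R b)" "\<forall>b\<in>B. 0 \<le> c b"
      unfolding B(3) convex_cone_hull_finite[OF B(1)] by blast
    have "x = (\<Sum>i\<in>cone_rays X \<sigma>. (c (f i) / t i) *\<^sub>R bv i)"
      unfolding c(1) sum.reindex_bij_betw[OF f, symmetric]
      by (intro sum.cong) (use t bv in \<open>simp_all add: less_imp_neq[symmetric]\<close>)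
    moreover have "\<forall>i\<in>cone_rays X \<sigma>. 0 \<le> c (f i) / t i"
      using c(2) t f by (auto simp: bij_betw_def intro: divide_nonneg_pos)
    ultimately show "x \<in> ?R" by (intro CollectI exI[of _ "\<lambda>i. c (f i) / t i"]) blast
  qed
  with sub show "\<sigma> = ?R" by blast
  assume eq: "(\<Sum>i\<in>cone_rays X \<sigma>. c i *\<^sub>R bv i) = (\<Sum>i\<in>cone_rays X \<sigma>. d i *\<^sub>R bv i)"
    and i: "i \<in> cone_rays X \<sigma>"
  have "f i \<in> B" using f i by (auto simp: bij_betw_def)
  with independent_sum_eq[OF B(2,1) eq[unfolded conv]] g[OF i] t[OF i]
  show "c i = d i" by force
qed

section \<open>Minimal cones and the coordinates \<Psi>(k)\<close>

lemma ex_minimal_cone: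
  assumes "\<sigma> \<in> cones X" "x \<in> \<sigma>"
  shows "\<exists>\<sigma>0\<in>cones X. x \<in> \<sigma>0 \<and> (\<forall>\<tau>\<in>cones X. x \<in> \<tau> \<longrightarrow> \<sigma>0 \<subseteq> \<tau>)"
proof -
  let ?A = "{\<tau>\<in>cones X. x \<in> \<tau>}"
  have "finite ?A" "?A \<noteq> {}" using finite_cones assms by auto
  from finite_has_minimal[OF this] obtain \<sigma>0 where
    s: "\<sigma>0 \<in> ?A" "\<And>\<tau>. \<tau> \<in> ?A \<Longrightarrow> \<tau> \<subseteq> \<sigma>0 \<Longrightarrow> \<sigma>0 = \<tau>" by auto
  have "\<sigma>0 \<subseteq> \<tau>" if "\<tau> \<in> cones X" "x \<in> \<tau>" for \<tau>
  proof -
    \<comment> \<open>Cones of the fan meet in a common face. It contains \<open>x\<close>, so it is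
      non-empty and again a cone of the fan; hence a minimal element is the least one.\<close>
    have "\<sigma>0 \<inter> \<tau> \<in> ?A"
      using face_in_cones[OF _ Int_face_of[of \<sigma>0 \<tau>]] s(1) that by blast
    then show ?thesis using s(2)[of "\<sigma>0 \<inter> \<tau>"] by blast
  qed
  with s(1) show ?thesis by blast
qed

text \<open>Applying the rational retraction to the real coordinates of \<open>k\<close> gives
  coordinates of the same point. As coordinates in a simplicial cone are unique, the real ones are
  rational.\<close>

lemma Psi_ex:
  assumes "\<sigma> \<in> cones X" "real_image k \<in> \<sigma>"
  shows "\<exists>c. keys c \<subseteq> cone_rays X \<sigma> \<and> (\<forall>i. 0 \<le> lookup c i) \<and>
    real_image k = (\<Sum>i\<in>cone_rays X \<sigma>. of_rat (lookup c i) *\<^sub>R bv i)"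
proof -
  obtain \<rho> :: "real \<Rightarrow> rat" where \<rho>: "rat_retraction \<rho>"
    using exists_rat_linear_retraction unfolding rat_retraction_def by blast
  interpret rat_retraction \<rho> by fact
  from assms cone_eq[OF assms(1)] obtain c where
    c: "real_image k = (\<Sum>i\<in>cone_rays X \<sigma>. c i *\<^sub>R bv i)" "\<forall>i\<in>cone_rays X \<sigma>. 0 \<le> c i" by blast
  have "real_image k = (\<Sum>i\<in>cone_rays X \<sigma>. of_rat (\<rho> (c i)) *\<^sub>R bv i)"
    by (rule real_image_sum_rational) (use c in simp_all)
  then have eq: "of_rat (\<rho> (c i)) = c i" if "i \<in> cone_rays X \<sigma>" for i
    using cone_coeffs_unique[OF assms(1), of "\<lambda>i. of_rat (\<rho> (c i))" c, OF _ that] c(1) by (metis (no_types))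
  define d where "d = (\<Sum>i\<in>cone_rays X \<sigma>. Poly_Mapping.single i (\<rho> (c i)))"
  have d: "lookup d i = (if i \<in> cone_rays X \<sigma> then \<rho> (c i) else 0)" for i
    by (simp add: d_def lookup_sum lookup_single when_def)
  have "0 \<le> \<rho> (c i)" if "i \<in> cone_rays X \<sigma>" for i
    using eq[OF that] c(2) that by (metis zero_le_of_rat_iff)
  then have "(\<forall>i. 0 \<le> lookup d i)" by (simp add: d)
  moreover have "keys d \<subseteq> cone_rays X \<sigma>" by (auto simp: in_keys_iff d split: if_splits)
  moreover have "real_image k = (\<Sum>i\<in>cone_rays X \<sigma>. of_rat (lookup d i) *\<^sub>R bv i)"
    using c(1) by (simp add: d eq)
  ultimately show ?thesis by blast
qed

text \<open>\<Psi> is defined by the minimal cone, but every cone containing \<open>k\<close>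
  computes it: coordinates in the minimal cone, extended by 0, are coordinates in the larger one.
  This is what makes \<Psi> additive on each cone.\<close>

lemma Psi_eqI:
  assumes "\<sigma> \<in> cones X" "real_image k \<in> \<sigma>" "keys c \<subseteq> cone_rays X \<sigma>"
    "real_image k = (\<Sum>i\<in>cone_rays X \<sigma>. of_rat (lookup c i) *\<^sub>R bv i)"
  shows "Psi X k = c"
proof -
  have uniq: "d = e" if "\<tau> \<in> cones X" "keys d \<subseteq> cone_rays X \<tau>" "keys e \<subseteq> cone_rays X \<tau>"
    "(\<Sum>i\<in>cone_rays X \<tau>. of_rat (lookup d i) *\<^sub>R bv i) =
     (\<Sum>i\<in>cone_rays X \<tau>. of_rat (lookup e i) *\<^sub>R bv i)" for \<tau> d e
  proof (rule poly_mapping_eqI)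
    fix i show "lookup d i = lookup e i"
    proof (cases "i \<in> cone_rays X \<tau>")
      case True
      from cone_coeffs_unique[OF that(1,4) True] show ?thesis by simp
    next
      case False
      with that(2,3) show ?thesis by (metis in_keys_iff subsetD)
    qed
  qed
  have extend: "(\<Sum>i\<in>cone_rays X \<tau>. of_rat (lookup d i) *\<^sub>R bv i) =
      (\<Sum>i\<in>cone_rays X \<sigma>. of_rat (lookup d i) *\<^sub>R bv i)"
    if "keys d \<subseteq> cone_rays X \<tau>" "\<tau> \<subseteq> \<sigma>" for \<tau> d
    using that by (intro sum.mono_neutral_left) (auto simp: cone_rays_def in_keys_iff)
  obtain \<sigma>0 where s: "\<sigma>0 \<in> cones X" "real_image k \<in> \<sigma>0"
    "\<And>\<tau>. \<tau> \<in> cones X \<Longrightarrow> real_image k \<in> \<tau> \<Longrightarrow> \<sigma>0 \<subseteq> \<tau>"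
    using ex_minimal_cone[OF assms(1,2)] by blast
  obtain c0 where c0: "keys c0 \<subseteq> cone_rays X \<sigma>0"
    "real_image k = (\<Sum>i\<in>cone_rays X \<sigma>0. of_rat (lookup c0 i) *\<^sub>R bv i)"
    using Psi_ex[OF s(1,2)] by blast
  have sub: "\<sigma>0 \<subseteq> \<sigma>" using s(3) assms(1,2) by blast
  then have "cone_rays X \<sigma>0 \<subseteq> cone_rays X \<sigma>" by (auto simp: cone_rays_def)
  then have "c0 = c"
    using uniq[OF assms(1) _ assms(3)] c0 assms(4) extend[OF c0(1) sub] by auto
  moreover have "Psi X k = c0"
    unfolding Psi_def
  proof (rule the_equality)
    show "\<exists>\<sigma>\<in>cones X. real_image k \<in> \<sigma> \<and> (\<forall>\<tau>\<in>cones X. real_image k \<in> \<tau> \<longrightarrow> \<sigma> \<subseteq> \<tau>) \<and>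
       keys c0 \<subseteq> cone_rays X \<sigma> \<and> real_image k = (\<Sum>i\<in>cone_rays X \<sigma>. of_rat (lookup c0 i) *\<^sub>R bv i)"
      using s c0 by (intro bexI[of _ \<sigma>0]) auto
    fix d assume "\<exists>\<sigma>\<in>cones X. real_image k \<in> \<sigma> \<and> (\<forall>\<tau>\<in>cones X. real_image k \<in> \<tau> \<longrightarrow> \<sigma> \<subseteq> \<tau>) \<and>
       keys d \<subseteq> cone_rays X \<sigma> \<and> real_image k = (\<Sum>i\<in>cone_rays X \<sigma>. of_rat (lookup d i) *\<^sub>R bv i)"
    then obtain \<sigma>1 where s1: "\<sigma>1 \<in> cones X" "real_image k \<in> \<sigma>1"
      "\<forall>\<tau>\<in>cones X. real_image k \<in> \<tau> \<longrightarrow> \<sigma>1 \<subseteq> \<tau>" "keys d \<subseteq> cone_rays X \<sigma>1"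
      "real_image k = (\<Sum>i\<in>cone_rays X \<sigma>1. of_rat (lookup d i) *\<^sub>R bv i)" by blast
    have "\<sigma>1 = \<sigma>0" using s1(1-3) s by blast
    show "d = c0"
      by (rule uniq[OF s(1) s1(4)[unfolded \<open>\<sigma>1 = \<sigma>0\<close>] c0(1)])
        (use s1(5) c0(2) \<open>\<sigma>1 = \<sigma>0\<close> in simp)
  qed
  ultimately show ?thesis by simp
qed

lemma Psi_props:
  assumes "\<sigma> \<in> cones X" "real_image k \<in> \<sigma>"
  shows keys_Psi: "keys (Psi X k) \<subseteq> cone_rays X \<sigma>" and Psi_nonneg: "0 \<le> lookup (Psi X k) i"
    and real_image_Psi_cone: "real_image k = (\<Sum>i\<in>cone_rays X \<sigma>. of_rat (lookup (Psi X k) i) *\<^sub>R bv i)"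
proof -
  obtain c where "keys c \<subseteq> cone_rays X \<sigma>" "\<forall>i. 0 \<le> lookup c i"
    "real_image k = (\<Sum>i\<in>cone_rays X \<sigma>. of_rat (lookup c i) *\<^sub>R bv i)"
    using Psi_ex[OF assms] by blast
  with Psi_eqI[OF assms this(1,3)] show "keys (Psi X k) \<subseteq> cone_rays X \<sigma>"
    "0 \<le> lookup (Psi X k) i"
    "real_image k = (\<Sum>i\<in>cone_rays X \<sigma>. of_rat (lookup (Psi X k) i) *\<^sub>R bv i)" by auto
qed

lemma Psi_add:
  assumes "\<sigma> \<in> cones X" "real_image k \<in> \<sigma>" "real_image l \<in> \<sigma>"
  shows "Psi X (k + l) = Psi X k + Psi X l"
proof (rule Psi_eqI[OF assms(1)])
  show "real_image (k + l) \<in> \<sigma>"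
    using assms by (simp add: real_image_add cone_add)
  show "keys (Psi X k + Psi X l) \<subseteq> cone_rays X \<sigma>"
    using keys_Psi[OF assms(1,2)] keys_Psi[OF assms(1,3)] keys_add[of "Psi X k" "Psi X l"] by blast
  show "real_image (k + l) = (\<Sum>i\<in>cone_rays X \<sigma>. of_rat (lookup (Psi X k + Psi X l) i) *\<^sub>R bv i)"
    unfolding real_image_add real_image_Psi_cone[OF assms(1,2)] real_image_Psi_cone[OF assms(1,3)]
    by (simp add: lookup_add of_rat_add scaleR_add_left sum.distrib)
qed

lemma Psi_zero: "\<sigma> \<in> cones X \<Longrightarrow> Psi X 0 = 0"
  using Psi_eqI[of \<sigma> 0 0] by (simp add: cone_zero)

lemma Psi_nmul:
  assumes "\<sigma> \<in> cones X" "real_image l \<in> \<sigma>"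
  shows "real_image (nmul n l) \<in> \<sigma>" "Psi X (nmul n l) = nmul n (Psi X l)"
proof (induction n)
  case (Suc n)
  { case 1 show ?case using Suc.IH(1) assms by (simp add: nmul_Suc real_image_add cone_add) }
  { case 2 show ?case using Suc.IH assms by (simp add: nmul_Suc Psi_add[OF assms(1)]) }
qed (use assms in \<open>simp_all add: cone_zero Psi_zero\<close>)

lemma Psi_sum_nmul:
  assumes "\<sigma> \<in> cones X" "finite A" "\<And>l. l \<in> A \<Longrightarrow> real_image l \<in> \<sigma>"
  shows "real_image (\<Sum>l\<in>A. nmul (a l) l) \<in> \<sigma>"
    "Psi X (\<Sum>l\<in>A. nmul (a l) l) = (\<Sum>l\<in>A. nmul (a l) (Psi X l))"
  using assms(2,3)
proof (induction A rule: finite_induct)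
  case (insert x F)
  { case 1 then show ?case
      using insert assms(1) by (simp add: real_image_add cone_add Psi_nmul) }
  { case 2 then show ?case
      using insert by (simp add: Psi_add[OF assms(1)] Psi_nmul[OF assms(1)]) }
qed (use assms(1) in \<open>simp_all add: cone_zero Psi_zero\<close>)

lemma bvec_NSupp: "i \<in> rays X \<Longrightarrow> bvec X i \<in> NSupp X"
proof -
  assume "i \<in> rays X"
  moreover have "bv i \<in> {t *\<^sub>R bv i | t. 0 \<le> t}" by (intro CollectI exI[of _ 1]) simp
  ultimately show ?thesis using ray_cone unfolding NSupp_def by blast
qed

lemma Psi_bvec:
  assumes "i \<in> rays X"
  shows "Psi X (bvec X i) = Poly_Mapping.single i 1"
proof (rule Psi_eqI[OF ray_cone[OF assms]])
  show "bv i \<in> {t *\<^sub>R bv i | t. 0 \<le> t}" by (intro CollectI exI[of _ 1]) simp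
  with assms have i: "i \<in> cone_rays X {t *\<^sub>R bv i | t. 0 \<le> t}"
    by (simp add: cone_rays_def)
  then show "keys (Poly_Mapping.single i 1) \<subseteq> cone_rays X {t *\<^sub>R bv i | t. 0 \<le> t}"
    by simp
  from i show "bv i = (\<Sum>j\<in>cone_rays X {t *\<^sub>R bv i | t. 0 \<le> t}.
      of_rat (lookup (Poly_Mapping.single i 1) j) *\<^sub>R bv j)"
    by (simp add: lookup_single when_def if_distrib[of of_rat] if_distrib[of "\<lambda>r. r *\<^sub>R _"] cong: if_cong)
qed

text \<open>The midpoint of the two images lies in the convex support, and doubling does not leave
  its cone.\<close>

lemma NSupp_add:
  assumes "k \<in> NSupp X" "l \<in> NSupp X"
  shows "k + l \<in> NSupp X"
proof -
  have "(1/2) *\<^sub>R real_image k + (1/2) *\<^sub>R real_image l \<in> \<Union>(cones X)"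
    using assms by (intro convexD[OF support_convex]) (auto simp: NSupp_def)
  then obtain \<sigma> where \<sigma>: "\<sigma> \<in> cones X" "(1/2) *\<^sub>R (real_image k + real_image l) \<in> \<sigma>"
    by (auto simp: scaleR_add_right)
  from cone_scale[OF this(1) _ this(2), of 2] \<sigma>(1) show ?thesis
    by (auto simp: NSupp_def real_image_add)
qed

section \<open>The monoid \<Lambda>_+ and the degrees d(k, l)\<close>

lemma L_real_add: "x \<in> L_real X \<Longrightarrow> y \<in> L_real X \<Longrightarrow> (\<lambda>i. x i + y i) \<in> L_real X"
proof -
  assume "x \<in> L_real X" "y \<in> L_real X"
  then obtain A B r s where
    A: "finite A" "A \<subseteq> L_int X" "x = (\<lambda>i. \<Sum>v\<in>A. r v * of_int (lookup v i))" and
    B: "finite B" "B \<subseteq> L_int X" "y = (\<lambda>i. \<Sum>v\<in>B. s v * of_int (lookup v i))"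
    unfolding L_real_def by blast
  let ?r = "\<lambda>v. (if v \<in> A then r v else 0) + (if v \<in> B then s v else 0)"
  have "(\<Sum>v\<in>A. r v * of_int (lookup v i)) = (\<Sum>v\<in>A \<union> B. (if v \<in> A then r v else 0) * of_int (lookup v i))"
    "(\<Sum>v\<in>B. s v * of_int (lookup v i)) = (\<Sum>v\<in>A \<union> B. (if v \<in> B then s v else 0) * of_int (lookup v i))" for i
    using A(1) B(1) by (auto intro!: sum.mono_neutral_cong_left)
  then have "(\<lambda>i. x i + y i) = (\<lambda>i. \<Sum>v\<in>A \<union> B. ?r v * of_int (lookup v i))"
    by (simp add: A(3) B(3) distrib_right sum.distrib)
  with A B show ?thesis
    unfolding L_real_def by (intro CollectI exI[of _ "A \<union> B"] exI[of _ ?r]) auto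
qed

lemma L_real_0: "(\<lambda>i. 0) \<in> L_real X"
  unfolding L_real_def by (intro CollectI exI[of _ "{}"]) auto

lemma Lam_plus_0: "0 \<in> Lam_plus X"
proof -
  have "0 \<in> Lam X" by (simp add: Lam_def refined_lattice_def zero_prod_def[symmetric])
  moreover have "(\<lambda>i. 0) \<in> C_cone X \<sigma>" for \<sigma>
    using L_real_0 by (simp add: C_cone_def)
  ultimately show ?thesis
    unfolding Lam_plus_def by (intro CollectI conjI exI[of _ "\<lambda>\<sigma> i. 0"]) auto
qed

lemma Lam_plus_add:
  assumes "d \<in> Lam_plus X" "e \<in> Lam_plus X"
  shows "d + e \<in> Lam_plus X"
proof -
  from assms obtain f g where
    f: "\<forall>\<sigma>\<in>cones X. f \<sigma> \<in> C_cone X \<sigma>" "\<forall>i. of_rat (lookup d i) = (\<Sum>\<sigma>\<in>cones X. f \<sigma> i)" and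
    g: "\<forall>\<sigma>\<in>cones X. g \<sigma> \<in> C_cone X \<sigma>" "\<forall>i. of_rat (lookup e i) = (\<Sum>\<sigma>\<in>cones X. g \<sigma> i)"
    and "(d, 0) \<in> refined_lattice X" "(e, 0) \<in> refined_lattice X"
    unfolding Lam_plus_def Lam_def by blast
  then have "(d, 0) + (e, 0) \<in> refined_lattice X"
    unfolding refined_lattice_def by (intro group_closure_add)
  then have "d + e \<in> Lam X" by (simp add: Lam_def)
  moreover have "(\<lambda>i. f \<sigma> i + g \<sigma> i) \<in> C_cone X \<sigma>" if "\<sigma> \<in> cones X" for \<sigma>
    using f(1) g(1) that by (auto simp: C_cone_def L_real_add)
  moreover have "of_rat (lookup (d + e) i) = (\<Sum>\<sigma>\<in>cones X. f \<sigma> i + g \<sigma> i)" for i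
    using f(2) g(2) by (simp add: lookup_add of_rat_add sum.distrib)
  ultimately show ?thesis
    unfolding Lam_plus_def by (intro CollectI conjI exI[of _ "\<lambda>\<sigma> i. f \<sigma> i + g \<sigma> i"]) auto
qed

lemma real_image_Psi:
  assumes "k \<in> NSupp X"
  shows "keys (Psi X k) \<subseteq> rays X"
    and "real_image k = (\<Sum>i\<in>rays X. of_rat (lookup (Psi X k) i) *\<^sub>R bv i)"
proof -
  from assms obtain \<sigma> where \<sigma>: "\<sigma> \<in> cones X" "real_image k \<in> \<sigma>" by (auto simp: NSupp_def)
  show "keys (Psi X k) \<subseteq> rays X" using keys_Psi[OF \<sigma>] cone_rays_subset by blast
  have "(\<Sum>i\<in>cone_rays X \<sigma>. of_rat (lookup (Psi X k) i) *\<^sub>R bv i) =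
      (\<Sum>i\<in>rays X. of_rat (lookup (Psi X k) i) *\<^sub>R bv i)"
    using keys_Psi[OF \<sigma>] cone_rays_subset
    by (intro sum.mono_neutral_left) (auto simp: in_keys_iff)
  with real_image_Psi_cone[OF \<sigma>]
  show "real_image k = (\<Sum>i\<in>rays X. of_rat (lookup (Psi X k) i) *\<^sub>R bv i)" by simp
qed

lemma beta_0: "beta X 0 = 0"
  using beta_add[of 0 0] by simp

lemma beta_minus: "keys v \<subseteq> rays X \<Longrightarrow> beta X (- v) = - beta X v"
  using beta_add[of v "- v"] by (simp add: beta_0 minus_unique)

lemma beta_frag_cmul: "keys v \<subseteq> rays X \<Longrightarrow> beta X (frag_cmul a v) = zmul a (beta X v)"
proof (induction a rule: int_induct[where k = 0])
  case base
  then show ?case by (simp add: beta_0)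
next
  case (step1 a)
  have "keys (frag_cmul a v) \<subseteq> rays X" using step1.prems keys_cmul by blast
  with step1 show ?case by (simp add: frag_cmul_distrib beta_add zmul_add)
next
  case (step2 a)
  have "keys (frag_cmul a v) \<subseteq> rays X" using step2.prems keys_cmul by blast
  with step2 beta_add[of "frag_cmul a v" "- v"] show ?case
    using zmul_add[of a "-1" "beta X v"]
    by (simp add: frag_cmul_diff_distrib beta_minus zmul_minus)
qed

lemma beta_sum_single:
  assumes "A \<subseteq> rays X"
  shows "keys (\<Sum>i\<in>A. Poly_Mapping.single i (z i)) \<subseteq> A"
    "beta X (\<Sum>i\<in>A. Poly_Mapping.single i (z i)) = (\<Sum>i\<in>A. zmul (z i) (bvec X i))"
proof -
  have fin: "finite A" using assms finite_rays finite_subset by blast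
  show keys: "keys (\<Sum>i\<in>A. Poly_Mapping.single i (z i)) \<subseteq> A" for A
    using keys_sum[of "\<lambda>i. Poly_Mapping.single i (z i)" A] by (auto split: if_splits)
  show "beta X (\<Sum>i\<in>A. Poly_Mapping.single i (z i)) = (\<Sum>i\<in>A. zmul (z i) (bvec X i))"
    using fin assms
  proof (induction A rule: finite_induct)
    case empty then show ?case by (simp add: beta_0)
  next
    case (insert i A)
    have "Poly_Mapping.single i (z i) = frag_cmul (z i) (Poly_Mapping.single i 1)"
      by (rule poly_mapping_eqI) (simp add: lookup_single when_def)
    moreover have "beta X (frag_cmul (z i) (Poly_Mapping.single i 1)) = zmul (z i) (bvec X i)"
      using insert.prems by (subst beta_frag_cmul) (simp_all add: bvec_def)
    ultimately have "beta X (Poly_Mapping.single i (z i)) = zmul (z i) (bvec X i)"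
      by metis
    moreover have "keys (\<Sum>i\<in>A. Poly_Mapping.single i (z i)) \<subseteq> rays X"
      using keys[of A] insert.prems by blast
    moreover have "keys (Poly_Mapping.single i (z i)) \<subseteq> rays X"
      using insert.prems by (auto split: if_splits)
    ultimately show ?case
      using insert by (simp add: beta_add)
  qed
qed

lemma common_denominator:
  fixes c :: "'a \<Rightarrow> rat"
  assumes "finite A"
  shows "\<exists>N>0. \<exists>z. \<forall>i\<in>A. of_nat N * c i = of_int (z i)"
  using assms
proof (induction A rule: finite_induct)
  case empty
  show ?case by (intro exI[of _ 1]) auto
next
  case (insert i A)
  then obtain N z where N: "N > 0" "\<forall>i\<in>A. of_nat N * c i = of_int (z i)" by blast
  obtain m n where "quotient_of (c i) = (m, n)" by fastforce
  then have mn: "c i = of_int m / of_int n" "n > 0"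
    by (simp_all add: quotient_of_div quotient_of_denom_pos)
  let ?z = "\<lambda>j. if j = i then int N * m else n * z j"
  have "of_nat (N * nat n) * c j = of_int (?z j)" if "j \<in> insert i A" for j
  proof (cases "j = i")
    case True with mn show ?thesis by simp
  next
    case False
    with that N(2) have "of_int n * (of_nat N * c j) = of_int n * of_int (z j)" by simp
    with False mn(2) show ?thesis by (simp add: ac_simps)
  qed
  moreover have "N * nat n > 0" using N(1) mn(2) by simp
  ultimately show ?case by (intro exI[of _ "N * nat n"] conjI exI[of _ ?z] ballI)
qed

text \<open>Multiplying by a common denominator N gives an integer vector \<open>v\<close>. The
  image of \<beta>(v) in the real vector space is 0, so \<beta>(v) is torsion and some multiple M v
  lies in the kernel of \<beta>; this explains the coefficient 1 / (M N).\<close>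

lemma rational_relation_in_L_real:
  assumes "keys d \<subseteq> rays X" "(\<Sum>i\<in>rays X. of_rat (lookup d i) *\<^sub>R bv i) = 0"
  shows "(\<lambda>i. of_rat (lookup d i)) \<in> L_real X"
proof -
  obtain N z where N: "N > 0" "\<And>i. i \<in> rays X \<Longrightarrow> of_nat N * lookup d i = of_int (z i)"
    using common_denominator[OF finite_rays, of "lookup d"] by blast
  define v where "v = (\<Sum>i\<in>rays X. Poly_Mapping.single i (z i))"
  have v: "lookup v i = (if i \<in> rays X then z i else 0)" for i
    by (simp add: v_def lookup_sum lookup_single when_def)
  have z_eq: "real_of_int (z i) = of_nat N * of_rat (lookup d i)" if "i \<in> rays X" for i
    using N(2)[OF that] by (metis of_rat_mult of_rat_of_int_eq of_rat_of_nat_eq)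
  have keys_v: "keys v \<subseteq> rays X" unfolding v_def by (rule beta_sum_single) simp
  have "real_image (beta X v) = (\<Sum>i\<in>rays X. of_nat N *\<^sub>R of_rat (lookup d i) *\<^sub>R bv i)"
    unfolding v_def by (subst beta_sum_single(2))
      (simp_all add: real_image_sum real_image_zmul z_eq)
  also have "\<dots> = of_nat N *\<^sub>R (\<Sum>i\<in>rays X. of_rat (lookup d i) *\<^sub>R bv i)"
    by (simp add: scaleR_sum_right)
  also have "\<dots> = 0"
    using assms(2) by simp
  finally obtain M where M: "M > 0" "nmul M (beta X v) = 0"
    using real_image_eq_0_imp_torsion by blast
  let ?w = "frag_cmul (int M) v"
  have "?w \<in> L_int X"
    using keys_v keys_cmul[of "int M" v] zmul_diff_nat[of M 0 "beta X v"] M(2)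
    by (auto simp: L_int_def beta_frag_cmul)
  moreover have "of_rat (lookup d i) = (\<Sum>w\<in>{?w}. (1 / (real M * real N)) * of_int (lookup w i))" for i
  proof (cases "i \<in> rays X")
    case True
    then show ?thesis using M(1) N(1) by (simp add: v z_eq)
  next
    case False
    then show ?thesis using assms(1) by (auto simp: v in_keys_iff)
  qed
  ultimately show ?thesis
    unfolding L_real_def
    by (intro CollectI exI[of _ "{?w}"] exI[of _ "\<lambda>_. 1 / (real M * real N)"]) auto
qed

text \<open>One summand suffices in the sum of the C_\<sigma>: for a cone \<sigma> that contains k +
  l, \<Psi>(k + l) vanishes off \<sigma>, where only the non-negative \<Psi>(k) + \<Psi>(l)
  remains.\<close>

lemma ddeg_Lam_plus:
  assumes "k \<in> NSupp X" "l \<in> NSupp X"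
  shows "ddeg X k l \<in> Lam_plus X"
proof -
  note kl = NSupp_add[OF assms]
  have "(Psi X m, m) \<in> refined_lattice X" if "m \<in> NSupp X" for m
    unfolding refined_lattice_def using that by (auto intro: group_closure.base)
  with assms kl have "(Psi X k, k) + (Psi X l, l) - (Psi X (k + l), k + l) \<in> refined_lattice X"
    unfolding refined_lattice_def by (intro group_closure.diff group_closure_add)
  then have "ddeg X k l \<in> Lam X" by (simp add: Lam_def ddeg_def)
  have keys: "keys (ddeg X k l) \<subseteq> rays X"
    unfolding ddeg_def using real_image_Psi(1)[OF assms(1)] real_image_Psi(1)[OF assms(2)]
      real_image_Psi(1)[OF kl]
    by (auto simp: in_keys_iff lookup_minus lookup_add)
      (metis add_cancel_right_right diff_self in_keys_iff subsetD)
  have "(\<Sum>i\<in>rays X. of_rat (lookup (ddeg X k l) i) *\<^sub>R bv i) =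
      real_image k + real_image l - real_image (k + l)"
    unfolding real_image_Psi(2)[OF assms(1)] real_image_Psi(2)[OF assms(2)] real_image_Psi(2)[OF kl]
    by (simp add: ddeg_def lookup_add lookup_minus of_rat_add of_rat_diff scaleR_add_left
        scaleR_left_diff_distrib sum.distrib sum_subtractf)
  then have L: "(\<lambda>i. of_rat (lookup (ddeg X k l) i)) \<in> L_real X"
    by (intro rational_relation_in_L_real keys) (simp add: real_image_add)
  obtain \<sigma> where \<sigma>: "\<sigma> \<in> cones X" "real_image (k + l) \<in> \<sigma>"
    using kl by (auto simp: NSupp_def)
  have nonneg: "0 \<le> lookup (ddeg X k l) i" if "i \<in> rays X - cone_rays X \<sigma>" for i
  proof -
    have "lookup (Psi X (k + l)) i = 0" using keys_Psi[OF \<sigma>] that by (auto simp: in_keys_iff)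
    moreover have "0 \<le> lookup (Psi X k) i" "0 \<le> lookup (Psi X l) i"
      using assms Psi_nonneg by (auto simp: NSupp_def)
    ultimately show ?thesis by (simp add: ddeg_def lookup_add lookup_minus)
  qed
  define f where "f \<tau> = (if \<tau> = \<sigma> then (\<lambda>i. of_rat (lookup (ddeg X k l) i)) else (\<lambda>i. 0 :: real))" for \<tau>
  have "f \<tau> \<in> C_cone X \<tau>" for \<tau>
    using L nonneg L_real_0 by (simp add: f_def C_cone_def)
  moreover have "(\<Sum>\<tau>\<in>cones X. f \<tau> i) = of_rat (lookup (ddeg X k l) i)" for i
  proof -
    have "(\<Sum>\<tau>\<in>cones X. f \<tau> i) = (\<Sum>\<tau>\<in>cones X. if \<tau> = \<sigma> then of_rat (lookup (ddeg X k l) i) else 0)"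
      by (intro sum.cong) (simp_all add: f_def)
    then show ?thesis using \<sigma>(1) finite_cones by simp
  qed
  ultimately show ?thesis
    using \<open>ddeg X k l \<in> Lam X\<close> unfolding Lam_plus_def
    by (intro CollectI conjI exI[of _ f]) auto
qed

section \<open>Full-dimensional cones cover the support\<close>

lemma independent_full_card_spans:
  fixes B :: "'n real_tensor set"
  assumes "finite B" "independent B" "card B = dim (UNIV :: 'n real_tensor set)"
  shows "span B = UNIV"
proof (rule ccontr)
  assume "span B \<noteq> UNIV"
  then obtain v where v: "v \<notin> span B" by blast
  then have ind: "independent (insert v B)" using assms(2) by (simp add: independent_insertI)
  obtain A :: "'n set" where A: "finite A" "group_closure A = UNIV"
    using finitely_generated by blast
  obtain C where C: "insert v B \<subseteq> C" "independent C" "UNIV \<subseteq> span C"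
    using maximal_independent_subset_extend[OF _ ind, of UNIV] by auto
  \<comment> \<open>The images of finitely many group generators span the real vector space and
    bound every independent set, so that cardinalities can be compared.\<close>
  have "finite C" using independent_span_bound[of "real_image ` A" C] A C(2)
    by (simp add: span_real_image)
  have "card C = dim (UNIV :: 'n real_tensor set)"
    using C dim_unique[of C UNIV] by auto
  moreover have "card (insert v B) \<le> card C" using \<open>finite C\<close> C(1) by (rule card_mono)
  moreover have "v \<notin> B" using v span_base by blast
  ultimately show False using assms by simp
qed

text \<open>A point \<open>p\<close> on the moment curve of a full-dimensional cone avoids the spans of all
  lower-dimensional cones. As \<open>|\<Sigma>|\<close> is convex, it contains the segment from \<open>x\<close> to \<open>p\<close>; the points
  of that segment close to \<open>x\<close> lie in a single cone, whose span contains \<open>p\<close>.\<close>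

lemma ex_generic_point:
  "\<exists>p\<in>\<Union>(cones X). \<forall>\<tau>\<in>cones X. p \<in> span \<tau> \<longrightarrow> max_dim \<tau>"
proof -
  obtain \<sigma> where \<sigma>: "\<sigma> \<in> cones X" "max_dim \<sigma>" using ex_max_cone by blast
  obtain B where B: "finite B" "independent B" "\<sigma> = convex_cone hull B"
    using cone_simplicial[OF \<sigma>(1)] unfolding rational_simplicial_cone_def by blast
  have "span \<sigma> = span B"
  proof
    show "span B \<subseteq> span \<sigma>" by (rule span_mono) (auto simp: B(3) hull_inc)
    show "span \<sigma> \<subseteq> span B"
      unfolding B(3) convex_cone_hull_finite[OF B(1)]
      by (rule span_minimal) (auto intro: span_sum span_scale span_base)
  qed
  then have "dim \<sigma> = card B" using B(2) by (metis dim_eq_card_independent dim_span)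
  then have spanB: "span B = UNIV"
    using independent_full_card_spans[OF B(1,2)] \<sigma>(2) by (simp add: max_dim_def)
  obtain h where h: "bij_betw h {..<card B} B"
    using ex_bij_betw_nat_finite[OF B(1)] by (auto simp: atLeast0LessThan)
  define p where "p t = (\<Sum>i<card B. t ^ i *\<^sub>R h i)" for t :: real
  have p\<sigma>: "p t \<in> \<sigma>" if "0 < t" for t
  proof -
    have "p t = (\<Sum>b\<in>B. (t ^ inv_into {..<card B} h b) *\<^sub>R b)"
      unfolding p_def sum.reindex_bij_betw[OF h, symmetric]
      by (intro sum.cong) (use h in \<open>auto simp: bij_betw_def\<close>)
    then show ?thesis
      unfolding B(3) convex_cone_hull_finite[OF B(1)] using that
      by (intro CollectI exI[of _ "\<lambda>b. t ^ inv_into {..<card B} h b"]) auto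
  qed
  have fin: "finite {t. 0 < t \<and> p t \<in> span \<tau>}" if "\<not> max_dim \<tau>" for \<tau> :: "'n real_tensor set"
  proof -
    have "span \<tau> \<noteq> UNIV" using that by (metis dim_span max_dim_def)
    then obtain v where v: "v \<notin> span \<tau>" by blast
    obtain C where C: "C \<subseteq> \<tau>" "independent C" "\<tau> \<subseteq> span C"
      using maximal_independent_subset by blast
    have spanC: "span C = span \<tau>"
      using C(1,3) by (metis span_mono span_span subset_antisym)
    have "independent (insert v C)" using v C(2) by (simp add: spanC independent_insertI)
    \<comment> \<open>A linear form that is 0 on \<tau> and 1 at \<open>v\<close>. As
      \<open>B\<close> spans, the form is non-zero at some generator; along the curve it is then a
      non-zero polynomial in t, which has finitely many roots.\<close>
    then obtain f :: "'n real_tensor \<Rightarrow> real" where f: "linear f"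
      "\<forall>x\<in>insert v C. f x = (if x = v then 1 else 0)"
      using linear_independent_extend[of "insert v C" "\<lambda>x. if x = v then 1 else (0::real)"] by blast
    have vC: "v \<notin> C" using v span_base spanC by blast
    have f0: "f x = 0" if "x \<in> span \<tau>" for x
    proof (rule linear_eq_0_on_span[OF f(1), of C])
      show "f y = 0" if "y \<in> C" for y using f(2) that vC by auto
    qed (use that spanC in simp)
    have "\<exists>b\<in>B. f b \<noteq> 0"
      using linear_eq_0_on_span[OF f(1), of B v] f(2) spanB by auto
    then obtain i where i: "i < card B" "f (h i) \<noteq> 0"
      using bij_betw_imp_surj_on[OF h] by (metis imageE lessThan_iff)
    have "finite {t. (\<Sum>i\<le>card B - 1. f (h i) * t ^ i) = 0}"
      unfolding polyfun_finite_roots using i by (intro exI[of _ i]) auto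
    moreover have "f (p t) = (\<Sum>i\<le>card B - 1. f (h i) * t ^ i)" for t
    proof -
      have "{..<card B} = {..card B - 1}" using i(1) by auto
      then show ?thesis
        by (simp add: p_def linear_sum[OF f(1)] linear_scale[OF f(1)] mult.commute)
    qed
    ultimately have "finite {t. f (p t) = 0}" by simp
    then show ?thesis by (rule finite_subset[rotated]) (use f0 in auto)
  qed
  let ?Bad = "\<Union>\<tau>\<in>{\<tau>\<in>cones X. \<not> max_dim \<tau>}. {t. 0 < t \<and> p t \<in> span \<tau>}"
  have "finite ?Bad" using finite_cones fin by auto
  moreover have "infinite {0<..(1::real)}" by simp
  ultimately obtain t where t: "t \<in> {0<..1}" "t \<notin> ?Bad"
    by (meson finite_subset subsetI)
  then have "0 < t" by simp
  with t(2) p\<sigma>[OF this] \<sigma>(1) show ?thesis by (intro bexI[of _ "p t"]) auto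
qed

text \<open>Two different members of the sequence determine \<open>y\<close> and then
  \<open>x\<close>, so both lie in the span of \<sigma>. The coordinates of the members are
  non-negative and converge to those of \<open>x\<close>; working in coordinates, closedness of the
  cone needs only limits of real sequences.\<close>

lemma cone_limit:
  fixes r :: "nat \<Rightarrow> nat"
  assumes "\<sigma> \<in> cones X" "\<And>n. x + (1 / real (Suc (r n))) *\<^sub>R y \<in> \<sigma>" "strict_mono r"
  shows "x \<in> \<sigma>" "x + y \<in> span \<sigma>"
proof -
  have neq: "1 / real (Suc (r 0)) \<noteq> 1 / real (Suc (r 1))"
    using strict_monoD[OF assms(3), of 0 1] by auto
  let ?s = "1 / real (Suc (r 0))" and ?t = "1 / real (Suc (r 1))"
  have "(x + ?s *\<^sub>R y) - (x + ?t *\<^sub>R y) \<in> span \<sigma>"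
    using assms(2) by (intro span_diff span_base)
  then have "(?s - ?t) *\<^sub>R y \<in> span \<sigma>" by (simp add: scaleR_left_diff_distrib)
  then have "(1 / (?s - ?t)) *\<^sub>R (?s - ?t) *\<^sub>R y \<in> span \<sigma>" by (rule span_scale)
  then have y: "y \<in> span \<sigma>" using neq by simp
  have "(x + ?s *\<^sub>R y) - ?s *\<^sub>R y \<in> span \<sigma>"
    by (rule span_diff[OF span_base[OF assms(2)] span_scale[OF y]])
  then have x: "x \<in> span \<sigma>" by simp
  then show "x + y \<in> span \<sigma>" using y by (rule span_add)
  have "\<sigma> \<subseteq> {\<Sum>i\<in>cone_rays X \<sigma>. c i *\<^sub>R bv i | c. True}"
    by (subst cone_eq[OF assms(1)]) blast
  moreover have "subspace {\<Sum>i\<in>cone_rays X \<sigma>. c i *\<^sub>R bv i | c. True}"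
    unfolding subspace_def
  proof (intro conjI ballI allI)
    fix u v and r :: real
    assume "u \<in> {\<Sum>i\<in>cone_rays X \<sigma>. c i *\<^sub>R bv i | c. True}"
    then obtain c where c: "u = (\<Sum>i\<in>cone_rays X \<sigma>. c i *\<^sub>R bv i)" by blast
    show "r *\<^sub>R u \<in> {\<Sum>i\<in>cone_rays X \<sigma>. c i *\<^sub>R bv i | c. True}"
      by (intro CollectI exI[of _ "\<lambda>i. r * c i"]) (simp add: c scaleR_sum_right)
    assume "v \<in> {\<Sum>i\<in>cone_rays X \<sigma>. c i *\<^sub>R bv i | c. True}"
    then obtain d where d: "v = (\<Sum>i\<in>cone_rays X \<sigma>. d i *\<^sub>R bv i)" by blast
    show "u + v \<in> {\<Sum>i\<in>cone_rays X \<sigma>. c i *\<^sub>R bv i | c. True}"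
      by (intro CollectI exI[of _ "\<lambda>i. c i + d i"]) (simp add: c d scaleR_add_left sum.distrib)
  next
    show "0 \<in> {\<Sum>i\<in>cone_rays X \<sigma>. c i *\<^sub>R bv i | c. True}"
      by (intro CollectI exI[of _ "\<lambda>i. 0"]) simp
  qed
  ultimately have "span \<sigma> \<subseteq> {\<Sum>i\<in>cone_rays X \<sigma>. c i *\<^sub>R bv i | c. True}"
    by (rule span_minimal)
  with x y obtain c d where c: "x = (\<Sum>i\<in>cone_rays X \<sigma>. c i *\<^sub>R bv i)"
    and d: "y = (\<Sum>i\<in>cone_rays X \<sigma>. d i *\<^sub>R bv i)" by blast
  have "0 \<le> c i" if i: "i \<in> cone_rays X \<sigma>" for i
  proof -
    have nonneg: "0 \<le> c i + (1 / real (Suc (r n))) * d i" for n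
    proof -
      have "x + (1 / real (Suc (r n))) *\<^sub>R y = (\<Sum>i\<in>cone_rays X \<sigma>. (c i + (1 / real (Suc (r n))) * d i) *\<^sub>R bv i)"
        by (simp add: c d scaleR_add_left sum.distrib scaleR_sum_right)
      moreover obtain e where "x + (1 / real (Suc (r n))) *\<^sub>R y = (\<Sum>i\<in>cone_rays X \<sigma>. e i *\<^sub>R bv i)"
        "\<forall>i\<in>cone_rays X \<sigma>. 0 \<le> e i"
        using assms(2)[of n] cone_eq[OF assms(1)] by blast
      ultimately show ?thesis
        using cone_coeffs_unique[OF assms(1) _ i, of "\<lambda>i. c i + (1 / real (Suc (r n))) * d i" e] i by auto
    qed
    have "(\<lambda>n. c i + inverse (real (Suc (r n))) * d i) \<longlonglongrightarrow> c i + 0 * d i"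
      by (intro tendsto_intros LIMSEQ_subseq_LIMSEQ[OF LIMSEQ_inverse_real_of_nat assms(3), unfolded comp_def])
    then show ?thesis
      using nonneg by (intro LIMSEQ_le_const) (auto simp: inverse_eq_divide)
  qed
  then show "x \<in> \<sigma>" by (subst cone_eq[OF assms(1)]) (use c in blast)
qed

lemma ex_max_cone_containing:
  assumes "k \<in> NSupp X"
  shows "\<exists>\<sigma>\<in>cones X. max_dim \<sigma> \<and> real_image k \<in> \<sigma>"
proof -
  obtain p where p: "p \<in> \<Union>(cones X)" "\<And>\<tau>. \<tau> \<in> cones X \<Longrightarrow> p \<in> span \<tau> \<Longrightarrow> max_dim \<tau>"
    using ex_generic_point by blast
  define x where "x = real_image k"
  have x: "x \<in> \<Union>(cones X)" using assms by (simp add: x_def NSupp_def)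
  have "\<exists>\<sigma>\<in>cones X. x + (1 / real (Suc n)) *\<^sub>R (p - x) \<in> \<sigma>" for n
  proof -
    have "(1 - 1 / real (Suc n)) *\<^sub>R x + (1 / real (Suc n)) *\<^sub>R p \<in> \<Union>(cones X)"
      using x p(1) by (intro convexD[OF support_convex]) (auto simp: field_simps)
    then show ?thesis by (simp add: algebra_simps)
  qed
  then obtain S where S: "\<And>n. S n \<in> cones X" "\<And>n. x + (1 / real (Suc n)) *\<^sub>R (p - x) \<in> S n"
    by metis
  have "finite (range S)" using S(1) finite_cones by (meson finite_subset image_subsetI)
  \<comment> \<open>There are finitely many cones, so infinitely many points of the sequence lie in
    one of them. Its span contains the generic point \<open>p\<close>, which makes the cone
    full-dimensional.\<close>
  then obtain n0 where n0: "infinite {n. S n = S n0}"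
    using pigeonhole_infinite[of UNIV S] by auto
  then obtain r :: "nat \<Rightarrow> nat" where r: "strict_mono r" "\<And>n. r n \<in> {n. S n = S n0}"
    using infinite_enumerate[OF n0] by blast
  have inS: "x + (1 / real (Suc (r n))) *\<^sub>R (p - x) \<in> S n0" for n
    using S(2)[of "r n"] r(2)[of n] by simp
  have "x \<in> S n0" "x + (p - x) \<in> span (S n0)"
    using cone_limit[OF S(1) inS r(1)] by auto
  with p(2)[OF S(1)] S(1) show ?thesis by (auto simp: x_def)
qed

end

section \<open>Left modules\<close>

text \<open>Modules over a ring that need not be commutative, as is the case for the fan
  rings.\<close>

locale left_module = R?: ring R + M?: abelian_group M
  for R :: "('r, 'c) ring_scheme" (structure) and M :: "('r, 'v, 'e) module_scheme" (structure) +
  assumes smult_closed [simp, intro]: "\<lbrakk>a \<in> carrier R; x \<in> carrier M\<rbrakk> \<Longrightarrow> a \<odot>\<^bsub>M\<^esub> x \<in> carrier M"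
    and smult_l_distr: "\<lbrakk>a \<in> carrier R; b \<in> carrier R; x \<in> carrier M\<rbrakk> \<Longrightarrow>
      (a \<oplus>\<^bsub>R\<^esub> b) \<odot>\<^bsub>M\<^esub> x = a \<odot>\<^bsub>M\<^esub> x \<oplus>\<^bsub>M\<^esub> b \<odot>\<^bsub>M\<^esub> x"
    and smult_r_distr: "\<lbrakk>a \<in> carrier R; x \<in> carrier M; y \<in> carrier M\<rbrakk> \<Longrightarrow>
      a \<odot>\<^bsub>M\<^esub> (x \<oplus>\<^bsub>M\<^esub> y) = a \<odot>\<^bsub>M\<^esub> x \<oplus>\<^bsub>M\<^esub> a \<odot>\<^bsub>M\<^esub> y"
    and smult_assoc: "\<lbrakk>a \<in> carrier R; b \<in> carrier R; x \<in> carrier M\<rbrakk> \<Longrightarrow>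
      (a \<otimes>\<^bsub>R\<^esub> b) \<odot>\<^bsub>M\<^esub> x = a \<odot>\<^bsub>M\<^esub> (b \<odot>\<^bsub>M\<^esub> x)"
    and smult_one: "x \<in> carrier M \<Longrightarrow> \<one>\<^bsub>R\<^esub> \<odot>\<^bsub>M\<^esub> x = x"
begin

lemma smult_zero_left: "x \<in> carrier M \<Longrightarrow> \<zero>\<^bsub>R\<^esub> \<odot>\<^bsub>M\<^esub> x = \<zero>\<^bsub>M\<^esub>"
  using smult_l_distr[of "\<zero>\<^bsub>R\<^esub>" "\<zero>\<^bsub>R\<^esub>" x] by simp

lemma smult_zero_right: "a \<in> carrier R \<Longrightarrow> a \<odot>\<^bsub>M\<^esub> \<zero>\<^bsub>M\<^esub> = \<zero>\<^bsub>M\<^esub>"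
  using smult_r_distr[of a "\<zero>\<^bsub>M\<^esub>" "\<zero>\<^bsub>M\<^esub>"] by simp

lemma a_inv_eq_smult: "x \<in> carrier M \<Longrightarrow> \<ominus>\<^bsub>M\<^esub> x = (\<ominus>\<^bsub>R\<^esub> \<one>\<^bsub>R\<^esub>) \<odot>\<^bsub>M\<^esub> x"
  using smult_l_distr[of "\<ominus>\<^bsub>R\<^esub> \<one>\<^bsub>R\<^esub>" "\<one>\<^bsub>R\<^esub>" x]
  by (intro M.minus_equality) (simp_all add: smult_one smult_zero_left R.l_neg)

lemma submodule_intro:
  assumes "H \<subseteq> carrier M" "\<zero>\<^bsub>M\<^esub> \<in> H"
    and "\<And>a b. a \<in> H \<Longrightarrow> b \<in> H \<Longrightarrow> a \<oplus>\<^bsub>M\<^esub> b \<in> H"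
    and smult: "\<And>a x. a \<in> carrier R \<Longrightarrow> x \<in> H \<Longrightarrow> a \<odot>\<^bsub>M\<^esub> x \<in> H"
  shows "submodule H R M"
proof -
  have "\<ominus>\<^bsub>M\<^esub> x \<in> H" if "x \<in> H" for x
    using a_inv_eq_smult smult that assms(1) by (metis R.a_inv_closed R.one_closed subsetD)
  with assms show ?thesis
    by (intro submodule.intro subgroup.intro) (simp_all add: submodule_axioms_def a_inv_def)
qed

lemma submodule_dest:
  assumes "submodule H R M"
  shows "H \<subseteq> carrier M" "\<zero>\<^bsub>M\<^esub> \<in> H" "\<And>a b. a \<in> H \<Longrightarrow> b \<in> H \<Longrightarrow> a \<oplus>\<^bsub>M\<^esub> b \<in> H"
    "\<And>a x. a \<in> carrier R \<Longrightarrow> x \<in> H \<Longrightarrow> a \<odot>\<^bsub>M\<^esub> x \<in> H" "\<And>a. a \<in> H \<Longrightarrow> \<ominus>\<^bsub>M\<^esub> a \<in> H"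
proof -
  interpret submodule H R M by fact
  show "H \<subseteq> carrier M" "\<zero>\<^bsub>M\<^esub> \<in> H" "\<And>a b. a \<in> H \<Longrightarrow> b \<in> H \<Longrightarrow> a \<oplus>\<^bsub>M\<^esub> b \<in> H"
    "\<And>a. a \<in> H \<Longrightarrow> \<ominus>\<^bsub>M\<^esub> a \<in> H"
    using subset one_closed m_closed m_inv_closed by (simp_all add: a_inv_def)
  show "\<And>a x. a \<in> carrier R \<Longrightarrow> x \<in> H \<Longrightarrow> a \<odot>\<^bsub>M\<^esub> x \<in> H" by (rule smult_closed)
qed

lemma submodule_carrier: "submodule (carrier M) R M"
  by (rule submodule_intro) auto

lemma finsum_smult:
  assumes "a \<in> carrier R" "finite I" "f \<in> I \<rightarrow> carrier M"
  shows "a \<odot>\<^bsub>M\<^esub> (\<Oplus>\<^bsub>M\<^esub>i\<in>I. f i) = (\<Oplus>\<^bsub>M\<^esub>i\<in>I. a \<odot>\<^bsub>M\<^esub> f i)"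
  using assms(2,3)
proof (induction I rule: finite_induct)
  case empty
  with assms(1) show ?case by (simp add: smult_zero_right)
next
  case (insert i I)
  then have "f i \<in> carrier M" "f \<in> I \<rightarrow> carrier M" by auto
  with insert assms(1) show ?case
    by (simp add: smult_r_distr Pi_def)
qed

end

context ring
begin

lemma free_left_module: "left_module R (free_module R I)"
proof (intro left_module.intro left_module_axioms.intro)
  show "abelian_group (free_module R I)"
  proof (rule abelian_groupI)
    fix x assume x: "x \<in> carrier (free_module R I)"
    show "\<exists>y\<in>carrier (free_module R I). y \<oplus>\<^bsub>free_module R I\<^esub> x = \<zero>\<^bsub>free_module R I\<^esub>"
      using x by (intro bexI[of _ "\<lambda>i\<in>I. \<ominus>\<^bsub>R\<^esub> x i"])
        (auto simp: free_module_def l_neg dest: PiE_mem intro!: restrict_ext)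
    show "\<zero>\<^bsub>free_module R I\<^esub> \<oplus>\<^bsub>free_module R I\<^esub> x = x"
      using x by (auto simp: free_module_def PiE_def extensional_def fun_eq_iff restrict_def
          intro!: l_zero)
  qed (auto simp: free_module_def a_ac PiE_mem[of _ I "\<lambda>_. carrier R"]
      intro!: restrict_ext restrict_PiE_iff[THEN iffD2])
  fix x assume "x \<in> carrier (free_module R I)"
  then show "\<one>\<^bsub>R\<^esub> \<odot>\<^bsub>free_module R I\<^esub> x = x"
    by (auto simp: free_module_def PiE_def extensional_def fun_eq_iff restrict_def intro!: l_one)
qed (auto simp: free_module_def l_distr r_distr m_assoc ring_axioms
    PiE_mem[of _ I "\<lambda>_. carrier R"]
    intro!: restrict_ext restrict_PiE_iff[THEN iffD2])

lemma free_module_minus: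
  assumes "x \<in> carrier (free_module R I)" "y \<in> carrier (free_module R I)"
  shows "x \<ominus>\<^bsub>free_module R I\<^esub> y = (\<lambda>i\<in>I. x i \<ominus>\<^bsub>R\<^esub> y i)"
proof -
  interpret F: left_module R "free_module R I" by (rule free_left_module)
  have "\<ominus>\<^bsub>free_module R I\<^esub> y = (\<lambda>i\<in>I. \<ominus>\<^bsub>R\<^esub> y i)"
    using assms(2) by (intro F.M.minus_equality)
      (auto simp: free_module_def l_neg dest: PiE_mem intro!: restrict_ext)
  then show ?thesis
    by (auto simp: a_minus_def free_module_def intro!: restrict_ext)
qed

end

context left_module
begin

lemma submodule_relations_among:
  assumes "finite I" "g \<in> I \<rightarrow> carrier M"
  shows "submodule (relations_among R M I g) R (free_module R I)"
proof -
  interpret F: left_module R "free_module R I" by (rule R.free_left_module)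
  show ?thesis
  proof (rule F.submodule_intro)
    show "relations_among R M I g \<subseteq> carrier (free_module R I)"
      by (auto simp: relations_among_def)
    have "(\<Oplus>\<^bsub>M\<^esub>i\<in>I. \<zero>\<^bsub>free_module R I\<^esub> i \<odot>\<^bsub>M\<^esub> g i) = (\<Oplus>\<^bsub>M\<^esub>i\<in>I. \<zero>\<^bsub>M\<^esub>)"
      using assms(2) by (intro M.finsum_cong') (auto simp: free_module_def intro!: smult_zero_left)
    then show "\<zero>\<^bsub>free_module R I\<^esub> \<in> relations_among R M I g"
      by (simp add: relations_among_def)
  next
    fix x y assume xy: "x \<in> relations_among R M I g" "y \<in> relations_among R M I g"
    then have c: "x i \<in> carrier R" "y i \<in> carrier R" "g i \<in> carrier M" if "i \<in> I" for i
      using that assms(2) by (auto simp: relations_among_def free_module_def PiE_mem)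
    have "(\<Oplus>\<^bsub>M\<^esub>i\<in>I. (x \<oplus>\<^bsub>free_module R I\<^esub> y) i \<odot>\<^bsub>M\<^esub> g i) =
       (\<Oplus>\<^bsub>M\<^esub>i\<in>I. x i \<odot>\<^bsub>M\<^esub> g i \<oplus>\<^bsub>M\<^esub> y i \<odot>\<^bsub>M\<^esub> g i)"
      using c by (intro M.finsum_cong') (auto simp: free_module_def smult_l_distr)
    also have "\<dots> = (\<Oplus>\<^bsub>M\<^esub>i\<in>I. x i \<odot>\<^bsub>M\<^esub> g i) \<oplus>\<^bsub>M\<^esub> (\<Oplus>\<^bsub>M\<^esub>i\<in>I. y i \<odot>\<^bsub>M\<^esub> g i)"
      using c by (intro M.finsum_addf) auto
    finally show "x \<oplus>\<^bsub>free_module R I\<^esub> y \<in> relations_among R M I g"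
      using xy by (simp add: relations_among_def)
  next
    fix a x assume a: "a \<in> carrier R" and x: "x \<in> relations_among R M I g"
    then have c: "x i \<in> carrier R" "g i \<in> carrier M" if "i \<in> I" for i
      using that assms(2) by (auto simp: relations_among_def free_module_def PiE_mem)
    have "(\<Oplus>\<^bsub>M\<^esub>i\<in>I. (a \<odot>\<^bsub>free_module R I\<^esub> x) i \<odot>\<^bsub>M\<^esub> g i) = (\<Oplus>\<^bsub>M\<^esub>i\<in>I. a \<odot>\<^bsub>M\<^esub> (x i \<odot>\<^bsub>M\<^esub> g i))"
      using c a by (intro M.finsum_cong') (auto simp: free_module_def smult_assoc)
    also have "\<dots> = a \<odot>\<^bsub>M\<^esub> (\<Oplus>\<^bsub>M\<^esub>i\<in>I. x i \<odot>\<^bsub>M\<^esub> g i)"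
      using c a assms(1) by (intro finsum_smult[symmetric]) auto
    finally show "a \<odot>\<^bsub>free_module R I\<^esub> x \<in> relations_among R M I g"
      using x a by (simp add: relations_among_def smult_zero_right)
  qed
qed

lemma free_elt_closed: "r \<in> carrier R \<Longrightarrow> free_elt R I r j \<in> carrier (free_module R I)"
  by (auto simp: free_elt_def free_module_def)

lemma finsum_free_elt:
  assumes "finite I" "g \<in> I \<rightarrow> carrier M" "j \<in> I" "r \<in> carrier R"
  shows "(\<Oplus>\<^bsub>M\<^esub>i\<in>I. free_elt R I r j i \<odot>\<^bsub>M\<^esub> g i) = r \<odot>\<^bsub>M\<^esub> g j"
proof -
  have g: "g i \<in> carrier M" if "i \<in> I" for i using assms(2) that by auto
  have "(\<Oplus>\<^bsub>M\<^esub>i\<in>I. free_elt R I r j i \<odot>\<^bsub>M\<^esub> g i) = (\<Oplus>\<^bsub>M\<^esub>i\<in>I. if j = i then r \<odot>\<^bsub>M\<^esub> g i else \<zero>\<^bsub>M\<^esub>)"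
    using assms g by (intro M.finsum_cong') (auto simp: free_elt_def smult_zero_left)
  also have "\<dots> = r \<odot>\<^bsub>M\<^esub> g j"
    using assms g by (intro M.add.finprod_singleton) auto
  finally show ?thesis .
qed

lemma free_elt_relation:
  assumes "finite I" "g \<in> I \<rightarrow> carrier M" "j \<in> I" "r \<in> carrier R" "r \<odot>\<^bsub>M\<^esub> g j = \<zero>\<^bsub>M\<^esub>"
  shows "free_elt R I r j \<in> relations_among R M I g"
  using assms by (simp add: relations_among_def free_elt_closed finsum_free_elt)

lemma free_elt_diff_relation:
  assumes "finite I" "g \<in> I \<rightarrow> carrier M" "j \<in> I" "l \<in> I" "a \<in> carrier R" "b \<in> carrier R"
    and eq: "a \<odot>\<^bsub>M\<^esub> g j = b \<odot>\<^bsub>M\<^esub> g l"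
  shows "free_elt R I a j \<ominus>\<^bsub>free_module R I\<^esub> free_elt R I b l \<in> relations_among R M I g"
proof -
  interpret F: left_module R "free_module R I" by (rule R.free_left_module)
  let ?a = "free_elt R I a j" and ?b = "free_elt R I b l"
  have c: "?a \<in> carrier (free_module R I)" "?b \<in> carrier (free_module R I)"
    using assms by (simp_all add: free_elt_closed)
  have ci: "?a i \<in> carrier R" "?b i \<in> carrier R" "g i \<in> carrier M" if "i \<in> I" for i
    using that assms by (auto simp: free_elt_def)
  have "a \<odot>\<^bsub>M\<^esub> g j = (\<Oplus>\<^bsub>M\<^esub>i\<in>I. (?a i \<ominus>\<^bsub>R\<^esub> ?b i) \<odot>\<^bsub>M\<^esub> g i \<oplus>\<^bsub>M\<^esub> ?b i \<odot>\<^bsub>M\<^esub> g i)"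
    unfolding finsum_free_elt[OF assms(1-3,5), symmetric]
    using ci by (intro M.finsum_cong') (auto simp: smult_l_distr[symmetric] a_minus_def R.a_assoc R.l_neg)
  also have "\<dots> = (\<Oplus>\<^bsub>M\<^esub>i\<in>I. (?a i \<ominus>\<^bsub>R\<^esub> ?b i) \<odot>\<^bsub>M\<^esub> g i) \<oplus>\<^bsub>M\<^esub> b \<odot>\<^bsub>M\<^esub> g l"
    unfolding finsum_free_elt[OF assms(1,2,4,6), symmetric] using ci by (intro M.finsum_addf) auto
  finally have "(\<Oplus>\<^bsub>M\<^esub>i\<in>I. (?a i \<ominus>\<^bsub>R\<^esub> ?b i) \<odot>\<^bsub>M\<^esub> g i) \<oplus>\<^bsub>M\<^esub> b \<odot>\<^bsub>M\<^esub> g l = \<zero>\<^bsub>M\<^esub> \<oplus>\<^bsub>M\<^esub> b \<odot>\<^bsub>M\<^esub> g l"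
    using eq ci(3)[OF assms(4)] assms(6) by simp
  then have "(\<Oplus>\<^bsub>M\<^esub>i\<in>I. (?a i \<ominus>\<^bsub>R\<^esub> ?b i) \<odot>\<^bsub>M\<^esub> g i) = \<zero>\<^bsub>M\<^esub>"
    using ci assms by (subst (asm) M.add.right_cancel) (auto intro!: M.finsum_closed)
  moreover have "(\<Oplus>\<^bsub>M\<^esub>i\<in>I. (?a \<ominus>\<^bsub>free_module R I\<^esub> ?b) i \<odot>\<^bsub>M\<^esub> g i) = (\<Oplus>\<^bsub>M\<^esub>i\<in>I. (?a i \<ominus>\<^bsub>R\<^esub> ?b i) \<odot>\<^bsub>M\<^esub> g i)"
    using ci by (intro M.finsum_cong') (auto simp: R.free_module_minus[OF c])
  ultimately show ?thesis
    using c by (simp add: relations_among_def F.M.minus_closed)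
qed

section \<open>Quotients of left modules\<close>

lemma abelian_subgroup_submodule: "submodule H R M \<Longrightarrow> abelian_subgroup H M"
  by (intro abelian_subgroupI3 additive_subgroup.intro submodule.axioms(1) M.abelian_group_axioms)

text \<open>For y in H + x, the element a y differs from a x by an element of H, so all cosets in
  the union that defines the scalar multiplication coincide.\<close>

lemma quotient_smult:
  assumes "submodule H R M" "a \<in> carrier R" "x \<in> carrier M"
  shows "a \<odot>\<^bsub>quotient_module M H\<^esub> (H +>\<^bsub>M\<^esub> x) = H +>\<^bsub>M\<^esub> (a \<odot>\<^bsub>M\<^esub> x)"
proof -
  interpret H: abelian_subgroup H M by (rule abelian_subgroup_submodule[OF assms(1)])
  have "H +>\<^bsub>M\<^esub> (a \<odot>\<^bsub>M\<^esub> y) = H +>\<^bsub>M\<^esub> (a \<odot>\<^bsub>M\<^esub> x)" if y: "y \<in> H +>\<^bsub>M\<^esub> x" for y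
  proof -
    obtain h where h: "h \<in> H" "y = h \<oplus>\<^bsub>M\<^esub> x" using y by (auto simp: a_r_coset_def')
    then have "a \<odot>\<^bsub>M\<^esub> y = a \<odot>\<^bsub>M\<^esub> h \<oplus>\<^bsub>M\<^esub> a \<odot>\<^bsub>M\<^esub> x"
      using assms submodule_dest(1)[OF assms(1)] by (auto simp: smult_r_distr)
    moreover have "a \<odot>\<^bsub>M\<^esub> h \<in> H" using submodule_dest(4)[OF assms(1,2) h(1)] .
    ultimately have "a \<odot>\<^bsub>M\<^esub> y \<in> H +>\<^bsub>M\<^esub> (a \<odot>\<^bsub>M\<^esub> x)" by (auto simp: a_r_coset_def')
    then show ?thesis using H.a_repr_independence' assms by simp
  qed
  moreover have "x \<in> H +>\<^bsub>M\<^esub> x" using assms(3) by (rule H.a_rcos_self)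
  ultimately have "(\<Union>y\<in>H +>\<^bsub>M\<^esub> x. H +>\<^bsub>M\<^esub> (a \<odot>\<^bsub>M\<^esub> y)) = H +>\<^bsub>M\<^esub> (a \<odot>\<^bsub>M\<^esub> x)" by blast
  then show ?thesis by (simp add: quotient_module_def)
qed

lemma quotient_add:
  assumes "submodule H R M" "x \<in> carrier M" "y \<in> carrier M"
  shows "(H +>\<^bsub>M\<^esub> x) \<oplus>\<^bsub>quotient_module M H\<^esub> (H +>\<^bsub>M\<^esub> y) = H +>\<^bsub>M\<^esub> (x \<oplus>\<^bsub>M\<^esub> y)"
proof -
  interpret H: abelian_subgroup H M by (rule abelian_subgroup_submodule[OF assms(1)])
  show ?thesis using H.a_rcos_sum[OF assms(2,3)] by (simp add: quotient_module_def)
qed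

lemma quotient_carrier: "carrier (quotient_module M H) = {H +>\<^bsub>M\<^esub> x | x. x \<in> carrier M}"
  by (auto simp: quotient_module_def A_RCOSETS_def')

lemma quotient_zero:
  assumes "submodule H R M"
  shows "\<zero>\<^bsub>quotient_module M H\<^esub> = H +>\<^bsub>M\<^esub> \<zero>\<^bsub>M\<^esub>"
  using M.a_coset_add_zero[OF submodule_dest(1)[OF assms]] by (simp add: quotient_module_def)

lemma quotient_left_module:
  assumes "submodule H R M"
  shows "left_module R (quotient_module M H)"
proof -
  interpret H: abelian_subgroup H M by (rule abelian_subgroup_submodule[OF assms])
  have ag: "abelian_group (quotient_module M H)"
  proof (rule abelian_groupI)
    fix A B assume "A \<in> carrier (quotient_module M H)" "B \<in> carrier (quotient_module M H)"
    then obtain x y where A: "A = H +>\<^bsub>M\<^esub> x" "x \<in> carrier M" and B: "B = H +>\<^bsub>M\<^esub> y" "y \<in> carrier M"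
      by (auto simp: quotient_carrier)
    show "A \<oplus>\<^bsub>quotient_module M H\<^esub> B \<in> carrier (quotient_module M H)"
      using A B by (auto simp: quotient_add[OF assms] quotient_carrier)
    show "A \<oplus>\<^bsub>quotient_module M H\<^esub> B = B \<oplus>\<^bsub>quotient_module M H\<^esub> A"
      using A B by (simp add: quotient_add[OF assms] M.a_comm)
    fix C assume "C \<in> carrier (quotient_module M H)"
    then obtain z where C: "C = H +>\<^bsub>M\<^esub> z" "z \<in> carrier M" by (auto simp: quotient_carrier)
    show "A \<oplus>\<^bsub>quotient_module M H\<^esub> B \<oplus>\<^bsub>quotient_module M H\<^esub> C =
        A \<oplus>\<^bsub>quotient_module M H\<^esub> (B \<oplus>\<^bsub>quotient_module M H\<^esub> C)"
      using A B C by (simp add: quotient_add[OF assms] M.a_assoc)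
  next
    show "\<zero>\<^bsub>quotient_module M H\<^esub> \<in> carrier (quotient_module M H)"
      by (auto simp: quotient_zero[OF assms] quotient_carrier)
  next
    fix A assume "A \<in> carrier (quotient_module M H)"
    then obtain x where A: "A = H +>\<^bsub>M\<^esub> x" "x \<in> carrier M" by (auto simp: quotient_carrier)
    show "\<zero>\<^bsub>quotient_module M H\<^esub> \<oplus>\<^bsub>quotient_module M H\<^esub> A = A"
      using A by (simp add: quotient_zero[OF assms] quotient_add[OF assms])
    show "\<exists>B\<in>carrier (quotient_module M H). B \<oplus>\<^bsub>quotient_module M H\<^esub> A = \<zero>\<^bsub>quotient_module M H\<^esub>"
      using A by (intro bexI[of _ "H +>\<^bsub>M\<^esub> (\<ominus>\<^bsub>M\<^esub> x)"])
        (auto simp: quotient_zero[OF assms] quotient_add[OF assms] M.l_neg quotient_carrier)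
  qed
  show ?thesis
  proof (intro left_module.intro left_module_axioms.intro R.ring_axioms ag)
    fix A assume "A \<in> carrier (quotient_module M H)"
    then obtain x where A: "A = H +>\<^bsub>M\<^esub> x" and x: "x \<in> carrier M" by (auto simp: quotient_carrier)
    show "\<one>\<^bsub>R\<^esub> \<odot>\<^bsub>quotient_module M H\<^esub> A = A"
      using x by (simp add: A quotient_smult[OF assms] smult_one)
    fix a assume a: "a \<in> carrier R"
    show "a \<odot>\<^bsub>quotient_module M H\<^esub> A \<in> carrier (quotient_module M H)"
      using a x by (auto simp: A quotient_smult[OF assms] quotient_carrier)
    { fix b assume b: "b \<in> carrier R"
      show "(a \<oplus>\<^bsub>R\<^esub> b) \<odot>\<^bsub>quotient_module M H\<^esub> A =
        a \<odot>\<^bsub>quotient_module M H\<^esub> A \<oplus>\<^bsub>quotient_module M H\<^esub> b \<odot>\<^bsub>quotient_module M H\<^esub> A"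
        using a b x by (simp add: A quotient_smult[OF assms] quotient_add[OF assms] smult_l_distr)
      show "(a \<otimes>\<^bsub>R\<^esub> b) \<odot>\<^bsub>quotient_module M H\<^esub> A = a \<odot>\<^bsub>quotient_module M H\<^esub> (b \<odot>\<^bsub>quotient_module M H\<^esub> A)"
        using a b x by (simp add: A quotient_smult[OF assms] smult_assoc) }
    fix B assume "B \<in> carrier (quotient_module M H)"
    then obtain y where B: "B = H +>\<^bsub>M\<^esub> y" and y: "y \<in> carrier M" by (auto simp: quotient_carrier)
    show "a \<odot>\<^bsub>quotient_module M H\<^esub> (A \<oplus>\<^bsub>quotient_module M H\<^esub> B) =
      a \<odot>\<^bsub>quotient_module M H\<^esub> A \<oplus>\<^bsub>quotient_module M H\<^esub> a \<odot>\<^bsub>quotient_module M H\<^esub> B"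
      using a x y by (simp add: A B quotient_smult[OF assms] quotient_add[OF assms] smult_r_distr)
  qed
qed

lemma quotient_finsum:
  assumes "submodule H R M" "finite I" "f \<in> I \<rightarrow> carrier M"
  shows "(\<Oplus>\<^bsub>quotient_module M H\<^esub>i\<in>I. H +>\<^bsub>M\<^esub> f i) = H +>\<^bsub>M\<^esub> (\<Oplus>\<^bsub>M\<^esub>i\<in>I. f i)"
proof -
  interpret Q: left_module R "quotient_module M H" by (rule quotient_left_module[OF assms(1)])
  interpret H: abelian_subgroup H M by (rule abelian_subgroup_submodule[OF assms(1)])
  show ?thesis
    using assms(2,3)
  proof (induction I rule: finite_induct)
    case empty
    show ?case by (simp add: quotient_zero[OF assms(1)])
  next
    case (insert i I)
    then have c: "f i \<in> carrier M" "f \<in> I \<rightarrow> carrier M" by auto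
    with insert quotient_carrier[of H] show ?case
      by (subst Q.M.finsum_insert) (auto simp: quotient_add[OF assms(1)])
  qed
qed

lemma quotient_eq_zero_iff:
  assumes "submodule H R M" "x \<in> carrier M"
  shows "H +>\<^bsub>M\<^esub> x = \<zero>\<^bsub>quotient_module M H\<^esub> \<longleftrightarrow> x \<in> H"
proof -
  interpret H: abelian_subgroup H M by (rule abelian_subgroup_submodule[OF assms(1)])
  show ?thesis
    using H.a_rcos_self[OF assms(2)] H.a_rcos_const[of x] by (auto simp: quotient_module_def)
qed

end

lemma submodule_generated_eqI:
  assumes "submodule N R M" "A \<subseteq> N" "\<And>H. submodule H R M \<Longrightarrow> A \<subseteq> H \<Longrightarrow> N \<subseteq> H"
  shows "submodule_generated R M A = N"
  using assms unfolding submodule_generated_def by blast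

section \<open>Products of commuting elements\<close>

text \<open>In a non-commutative monoid \<^const>\<open>finprod\<close> is meaningful as long as the factors commute.\<close>

context monoid
begin

definition commuting :: "('i \<Rightarrow> 'a) \<Rightarrow> 'i set \<Rightarrow> bool" where
  "commuting f A \<longleftrightarrow> (\<forall>i\<in>A. f i \<in> carrier G) \<and> (\<forall>i\<in>A. \<forall>j\<in>A. f i \<otimes> f j = f j \<otimes> f i)"

lemma commuting_subset: "commuting f A \<Longrightarrow> B \<subseteq> A \<Longrightarrow> commuting f B"
  by (auto simp: commuting_def)

text \<open>\<open>finprod\<close> is a fold over a set, and \<open>LCD\<close>, left-commutativity
  of the folded operation, makes such a fold independent of the order. Associativity reduces it to
  the commutation of pairs of factors.\<close>

lemma commuting_LCD: "commuting f A \<Longrightarrow> LCD A (carrier G) ((\<otimes>) \<circ> f)"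
proof (unfold_locales, simp_all add: commuting_def)
  fix x y z
  assume *: "(\<forall>i\<in>A. f i \<in> carrier G) \<and> (\<forall>i\<in>A. \<forall>j\<in>A. f i \<otimes> f j = f j \<otimes> f i)"
    "x \<in> A" "y \<in> A" "z \<in> carrier G"
  then have "f x \<otimes> f y \<otimes> z = f y \<otimes> f x \<otimes> z" "f x \<in> carrier G" "f y \<in> carrier G" by auto
  with *(4) show "f x \<otimes> (f y \<otimes> z) = f y \<otimes> (f x \<otimes> z)" by (simp add: m_assoc)
qed

lemma finprod_commuting_insert:
  assumes "finite A" "a \<notin> A" "commuting f (insert a A)"
  shows "finprod G f (insert a A) = f a \<otimes> finprod G f A"
  using assms LCD.foldD_insert[OF commuting_LCD[OF assms(3)] assms(1,2), of \<one>]
  by (simp add: finprod_def subset_insertI)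

lemma finprod_commuting_closed:
  assumes "finite A" "commuting f A"
  shows "finprod G f A \<in> carrier G"
  using LCD.foldD_closed[OF commuting_LCD[OF assms(2)] assms(1), of \<one>] assms(1)
  by (simp add: finprod_def)

lemma finprod_commuting_commute:
  assumes "finite A" "commuting f A" "x \<in> carrier G" "\<And>i. i \<in> A \<Longrightarrow> x \<otimes> f i = f i \<otimes> x"
  shows "x \<otimes> finprod G f A = finprod G f A \<otimes> x"
  using assms
proof (induction A rule: finite_induct)
  case empty
  then show ?case by (simp add: finprod_def)
next
  case (insert a A)
  note A = commuting_subset[OF insert.prems(1) subset_insertI]
  have c: "f a \<in> carrier G" "finprod G f A \<in> carrier G"
    using insert.prems(1) finprod_commuting_closed[OF insert.hyps(1) A] by (auto simp: commuting_def)
  have "x \<otimes> (f a \<otimes> finprod G f A) = f a \<otimes> (x \<otimes> finprod G f A)"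
    using c insert.prems(2) insert.prems(3)[of a] by (simp flip: m_assoc)
  also have "\<dots> = f a \<otimes> finprod G f A \<otimes> x"
    using c insert A by (simp add: m_assoc)
  finally show ?case
    using finprod_commuting_insert[OF insert.hyps(1,2) insert.prems(1)] by simp
qed

lemma finprod_commuting_cong:
  assumes "finite A" "commuting f A" "\<And>i. i \<in> A \<Longrightarrow> f i = g i"
  shows "finprod G f A = finprod G g A"
  using assms
proof (induction A rule: finite_induct)
  case (insert a A)
  note A = commuting_subset[OF insert.prems(1) subset_insertI]
  have gf: "g i = f i" if "i \<in> insert a A" for i
    using insert.prems(2)[OF that] by (rule sym)
  have "commuting g (insert a A)"
    using insert.prems(1) gf unfolding commuting_def by (metis (no_types, lifting))
  note finprod_commuting_insert[OF insert.hyps(1,2) this]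
    finprod_commuting_insert[OF insert.hyps(1,2) insert.prems(1)]
  moreover have "finprod G f A = finprod G g A"
    by (rule insert.IH[OF A], rule insert.prems(2)) simp
  ultimately show ?case using insert.prems(2)[OF insertI1] by simp
qed (simp add: finprod_def)

text \<open>A factor that commutes with all others can be moved to the front. This will describe how
  a monomial operator changes when one of its exponents grows by one.\<close>

lemma finprod_commuting_update:
  assumes "finite A" "commuting f A" "a \<in> A" "x \<in> carrier G"
    "\<And>i. i \<in> A \<Longrightarrow> x \<otimes> f i = f i \<otimes> x"
  shows "finprod G (f(a := x \<otimes> f a)) A = x \<otimes> finprod G f A"
proof -
  have A: "A = insert a (A - {a})" using assms(3) by blast
  have c: "f a \<in> carrier G" using assms(2,3) by (auto simp: commuting_def)
  have com: "commuting (f(a := x \<otimes> f a)) A"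
    unfolding commuting_def
  proof (intro conjI ballI)
    fix i assume i: "i \<in> A"
    then show "(f(a := x \<otimes> f a)) i \<in> carrier G" using assms(2,4) c by (auto simp: commuting_def)
    fix j assume j: "j \<in> A"
    have "x \<otimes> f a \<otimes> f k = f k \<otimes> (x \<otimes> f a)" if "k \<in> A" for k
    proof -
      have fk: "f k \<in> carrier G" "f a \<otimes> f k = f k \<otimes> f a" using that assms(2,3) by (auto simp: commuting_def)
      then have "x \<otimes> f a \<otimes> f k = (x \<otimes> f k) \<otimes> f a" using assms(4) c by (simp add: m_assoc)
      also have "\<dots> = f k \<otimes> (x \<otimes> f a)" using assms(4) assms(5)[OF that] c fk by (simp add: m_assoc)
      finally show ?thesis .
    qed
    with i j assms(2) show "(f(a := x \<otimes> f a)) i \<otimes> (f(a := x \<otimes> f a)) j =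
        (f(a := x \<otimes> f a)) j \<otimes> (f(a := x \<otimes> f a)) i"
      by (auto simp: commuting_def)
  qed
  have com': "commuting f (A - {a})" "commuting (f(a := x \<otimes> f a)) (A - {a})"
    using commuting_subset assms(2) com by blast+
  have "finprod G (f(a := x \<otimes> f a)) A = (f(a := x \<otimes> f a)) a \<otimes> finprod G (f(a := x \<otimes> f a)) (A - {a})"
    by (subst A, rule finprod_commuting_insert) (use A com assms(1) in auto)
  also have "finprod G (f(a := x \<otimes> f a)) (A - {a}) = finprod G f (A - {a})"
    using assms(1) com'(2) by (intro finprod_commuting_cong) auto
  also have "(f(a := x \<otimes> f a)) a \<otimes> finprod G f (A - {a}) = x \<otimes> (f a \<otimes> finprod G f (A - {a}))"
    using assms(1,4) c finprod_commuting_closed[OF _ com'(1)] by (simp add: m_assoc)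
  also have "f a \<otimes> finprod G f (A - {a}) = finprod G f (insert a (A - {a}))"
    by (rule finprod_commuting_insert[symmetric]) (use A assms(1,2) in auto)
  finally show ?thesis by (simp only: A[symmetric])
qed

lemma pow_commute:
  assumes "x \<in> carrier G" "y \<in> carrier G" "x \<otimes> y = y \<otimes> x"
  shows "x \<otimes> y [^] (n::nat) = y [^] n \<otimes> x"
  using group_commutes_pow[of y x n] assms by simp

lemma commuting_pow: "commuting f A \<Longrightarrow> commuting (\<lambda>i. f i [^] (a i :: nat)) A"
  unfolding commuting_def
proof (intro conjI ballI)
  fix i j assume *: "(\<forall>i\<in>A. f i \<in> carrier G) \<and> (\<forall>i\<in>A. \<forall>j\<in>A. f i \<otimes> f j = f j \<otimes> f i)"
    "i \<in> A" "j \<in> A"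
  then have "f i \<otimes> f j [^] a j = f j [^] a j \<otimes> f i"
    by (intro pow_commute) auto
  then have "f j [^] a j \<otimes> f i [^] a i = f i [^] a i \<otimes> f j [^] a j"
    using * by (intro pow_commute) auto
  then show "f i [^] a i \<otimes> f j [^] a j = f j [^] a j \<otimes> f i [^] a i" by simp
qed auto

lemma finprod_pow_Suc:
  assumes "finite A" "commuting f A" "l \<in> A"
  shows "finprod G (\<lambda>i. f i [^] ((a(l := Suc (a l))) i)) A = f l \<otimes> finprod G (\<lambda>i. f i [^] (a i :: nat)) A"
proof -
  have l: "f l \<in> carrier G" using assms by (auto simp: commuting_def)
  have "(\<lambda>i. f i [^] ((a(l := Suc (a l))) i)) = (\<lambda>i. f i [^] a i)(l := f l \<otimes> f l [^] a l)"
    using l pow_commute[OF l l] by (auto simp: fun_eq_iff)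
  moreover have "finprod G ((\<lambda>i. f i [^] a i)(l := f l \<otimes> f l [^] a l)) A = f l \<otimes> finprod G (\<lambda>i. f i [^] a i) A"
    using assms l by (intro finprod_commuting_update commuting_pow) (auto simp: commuting_def intro!: pow_commute)
  ultimately show ?thesis by simp
qed

end

section \<open>Representations of presented rings\<close>

lemma lookup_map: "f 0 = 0 \<Longrightarrow> lookup (Poly_Mapping.map f p) k = f (lookup p k)"
  by (simp add: Poly_Mapping.map.rep_eq when_def)

lemma const_add: "const (a + b) = const a + const b"
  and const_mult: "const (a * b) = const a * const b"
  by (simp_all add: const_def single_add mult_single plus_list_def)

lemma const_1: "const 1 = 1"
  by (simp add: const_def flip: zero_list_def)

lemma const_commute: "const a * p = p * const a"
proof (induction p rule: update_induct)
  case (update f b v)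
  have "Poly_Mapping.update b v f = f + Poly_Mapping.single b v"
    using update(1) by (intro poly_mapping_eqI)
      (auto simp: lookup_update lookup_add lookup_single when_def in_keys_iff)
  moreover have "const a * Poly_Mapping.single b v = Poly_Mapping.single b v * const a"
    by (simp add: const_def mult_single mult.commute plus_list_def)
  ultimately show ?case using update by (simp add: distrib_left distrib_right)
qed simp

lemma free_alg_expansion: "p = (\<Sum>w\<in>keys p. const (lookup p w) * Poly_Mapping.single w 1)"
  by (rule poly_mapping_eqI)
    (simp add: const_def mult_single plus_list_def lookup_sum lookup_single when_def in_keys_iff)

lemma single_Nil: "Poly_Mapping.single [] 1 = (1 :: 'g free_alg)"
  by (simp flip: zero_list_def)

lemma single_Cons: "Poly_Mapping.single (g # w) 1 = gen g * (Poly_Mapping.single w 1 :: 'g free_alg)"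
  by (simp add: gen_def mult_single plus_list_def)

definition alg_act ::
  "(complex \<Rightarrow> 'w \<Rightarrow> 'w) \<Rightarrow> ('g \<Rightarrow> 'w \<Rightarrow> 'w) \<Rightarrow> 'g free_alg \<Rightarrow> 'w::ab_group_add \<Rightarrow> 'w" where
  "alg_act sc act p v = (\<Sum>w\<in>keys p. sc (lookup p w) (foldr act w v))"

text \<open>\<open>the_elem\<close> is meaningful when all representatives of the class act on
  \<open>v\<close> in the same way. The form agrees with the scalar multiplication of the fan
  module.\<close>

definition class_act ::
  "(complex \<Rightarrow> 'w \<Rightarrow> 'w) \<Rightarrow> ('g \<Rightarrow> 'w \<Rightarrow> 'w) \<Rightarrow> 'g free_alg set \<Rightarrow> 'w::ab_group_add \<Rightarrow> 'w" where
  "class_act sc act P v = the_elem ((\<lambda>p. alg_act sc act p v) ` P)"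

lemma free_algebra_on_ring: "ring (free_algebra_on A)"
proof (rule ringI)
  show "abelian_group (free_algebra_on A)"
  proof (rule abelian_groupI)
    fix p assume "p \<in> carrier (free_algebra_on A)"
    then show "\<exists>q\<in>carrier (free_algebra_on A). q \<oplus>\<^bsub>free_algebra_on A\<^esub> p = \<zero>\<^bsub>free_algebra_on A\<^esub>"
      by (intro bexI[of _ "- p"]) (auto simp: free_algebra_on_def in_keys_iff)
  next
    fix p q assume "p \<in> carrier (free_algebra_on A)" "q \<in> carrier (free_algebra_on A)"
    then show "p \<oplus>\<^bsub>free_algebra_on A\<^esub> q \<in> carrier (free_algebra_on A)"
      using keys_add[of p q] by (auto simp: free_algebra_on_def)
  qed (auto simp: free_algebra_on_def algebra_simps)
  show "monoid (free_algebra_on A)"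
  proof (rule monoidI)
    fix p q assume "p \<in> carrier (free_algebra_on A)" "q \<in> carrier (free_algebra_on A)"
    then show "p \<otimes>\<^bsub>free_algebra_on A\<^esub> q \<in> carrier (free_algebra_on A)"
      using keys_mult[of p q] by (fastforce simp: free_algebra_on_def plus_list_def)
  qed (auto simp: free_algebra_on_def mult.assoc zero_list_def)
qed (auto simp: free_algebra_on_def algebra_simps)

lemma free_algebra_on_simps [simp]:
  "\<zero>\<^bsub>free_algebra_on A\<^esub> = 0" "\<one>\<^bsub>free_algebra_on A\<^esub> = 1"
  "p \<oplus>\<^bsub>free_algebra_on A\<^esub> q = p + q" "p \<otimes>\<^bsub>free_algebra_on A\<^esub> q = p * q"
  by (simp_all add: free_algebra_on_def)

lemma free_algebra_on_closed [intro]: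
  "0 \<in> carrier (free_algebra_on A)" "1 \<in> carrier (free_algebra_on A)"
  "p \<in> carrier (free_algebra_on A) \<Longrightarrow> q \<in> carrier (free_algebra_on A) \<Longrightarrow> p + q \<in> carrier (free_algebra_on A)"
  "p \<in> carrier (free_algebra_on A) \<Longrightarrow> q \<in> carrier (free_algebra_on A) \<Longrightarrow> p * q \<in> carrier (free_algebra_on A)"
  "p \<in> carrier (free_algebra_on A) \<Longrightarrow> - p \<in> carrier (free_algebra_on A)"
  "p \<in> carrier (free_algebra_on A) \<Longrightarrow> q \<in> carrier (free_algebra_on A) \<Longrightarrow> p - q \<in> carrier (free_algebra_on A)"
  "const c \<in> carrier (free_algebra_on A)"
  "g \<in> A \<Longrightarrow> gen g \<in> carrier (free_algebra_on A)"
proof -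
  interpret ring "free_algebra_on A" by (rule free_algebra_on_ring)
  show "0 \<in> carrier (free_algebra_on A)" "1 \<in> carrier (free_algebra_on A)"
    using zero_closed one_closed by simp_all
  show add: "p + q \<in> carrier (free_algebra_on A)"
    if "p \<in> carrier (free_algebra_on A)" "q \<in> carrier (free_algebra_on A)" for p q
    using a_closed[OF that] by simp
  show "p * q \<in> carrier (free_algebra_on A)"
    if "p \<in> carrier (free_algebra_on A)" "q \<in> carrier (free_algebra_on A)"
    using m_closed[OF that] by simp
  show minus: "- p \<in> carrier (free_algebra_on A)" if "p \<in> carrier (free_algebra_on A)" for p
    using that by (auto simp: free_algebra_on_def in_keys_iff)
  show "p - q \<in> carrier (free_algebra_on A)"
    if "p \<in> carrier (free_algebra_on A)" "q \<in> carrier (free_algebra_on A)"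
    using add[OF that(1) minus[OF that(2)]] by simp
  show "const c \<in> carrier (free_algebra_on A)" "g \<in> A \<Longrightarrow> gen g \<in> carrier (free_algebra_on A)"
    by (auto simp: free_algebra_on_def const_def gen_def)
qed

lemma free_algebra_on_sum:
  "(\<And>i. i \<in> I \<Longrightarrow> f i \<in> carrier (free_algebra_on A)) \<Longrightarrow> (\<Sum>i\<in>I. f i) \<in> carrier (free_algebra_on A)"
  by (induction I rule: infinite_finite_induct) auto

section \<open>Presented rings and their representations\<close>

locale presentation =
  fixes gens :: "'g set" and rels :: "'g free_alg set"
  assumes rels_subset: "rels \<subseteq> carrier (free_algebra_on gens)"
begin

abbreviation FA where "FA \<equiv> free_algebra_on gens"
abbreviation D where "D \<equiv> presented_ring gens rels"
abbreviation cls where "cls \<equiv> presented_class gens rels"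

sublocale F: ring FA
  by (rule free_algebra_on_ring)

sublocale I: ideal "genideal FA rels" FA
  by (rule F.genideal_ideal[OF rels_subset])

sublocale D: ring D
  unfolding presented_ring_def by (rule I.quotient_is_ring)

lemma cls_hom: "cls \<in> ring_hom FA D"
  using I.rcos_ring_hom unfolding presented_ring_def presented_class_def[abs_def] .

lemma carrier_D: "carrier D = cls ` carrier FA"
  by (auto simp: presented_ring_def presented_class_def FactRing_def A_RCOSETS_def')

lemma cls_closed [intro]: "p \<in> carrier FA \<Longrightarrow> cls p \<in> carrier D"
  by (simp add: carrier_D)

lemma cls_add: "p \<in> carrier FA \<Longrightarrow> q \<in> carrier FA \<Longrightarrow> cls (p + q) = cls p \<oplus>\<^bsub>D\<^esub> cls q"
  and cls_mult: "p \<in> carrier FA \<Longrightarrow> q \<in> carrier FA \<Longrightarrow> cls (p * q) = cls p \<otimes>\<^bsub>D\<^esub> cls q"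
  and cls_1: "cls 1 = \<one>\<^bsub>D\<^esub>"
  using ring_hom_add[OF cls_hom] ring_hom_mult[OF cls_hom] ring_hom_one[OF cls_hom] by simp_all

lemma ring_hom_ring_cls: "ring_hom_ring FA D cls"
  by (rule ring_hom_ringI2[OF F.ring_axioms D.ring_axioms cls_hom])

lemma cls_0: "cls 0 = \<zero>\<^bsub>D\<^esub>"
proof -
  interpret h: ring_hom_ring FA D cls by (rule ring_hom_ring_cls)
  show ?thesis using h.hom_zero by simp
qed

lemma cls_eq_zero_iff: "p \<in> carrier FA \<Longrightarrow> cls p = \<zero>\<^bsub>D\<^esub> \<longleftrightarrow> p \<in> genideal FA rels"
  unfolding presented_class_def presented_ring_def FactRing_def
  using I.a_rcos_self[of p] I.a_rcos_const[of p] by auto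

lemma mem_cls: "q \<in> cls p \<longleftrightarrow> (\<exists>h\<in>genideal FA rels. q = h + p)"
  by (auto simp: presented_class_def a_r_coset_def')

end

text \<open>The representation space is a subspace \<open>C\<close> of a type, not a whole type: the
  carrier of the fan module is such a subspace, and so is the image of a projection. Linearity of
  the generators is therefore required on \<open>C\<close> only.\<close>

locale generator_rep = presentation gens rels + vector_space sc
  for gens :: "'g set" and rels :: "'g free_alg set" and sc :: "complex \<Rightarrow> 'w::ab_group_add \<Rightarrow> 'w" +
  fixes act :: "'g \<Rightarrow> 'w \<Rightarrow> 'w" and C :: "'w set"
  assumes subspace_C: "subspace C"
    and act_closed: "g \<in> gens \<Longrightarrow> v \<in> C \<Longrightarrow> act g v \<in> C"
    and act_add: "g \<in> gens \<Longrightarrow> u \<in> C \<Longrightarrow> v \<in> C \<Longrightarrow> act g (u + v) = act g u + act g v"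
    and act_sc: "g \<in> gens \<Longrightarrow> v \<in> C \<Longrightarrow> act g (sc c v) = sc c (act g v)"
begin

abbreviation ext where "ext \<equiv> alg_act sc act"
abbreviation cact where "cact \<equiv> class_act sc act"

lemmas C_0 = subspace_0[OF subspace_C]
  and C_add = subspace_add[OF subspace_C]
  and C_sc = subspace_scale[OF subspace_C]
  and C_neg = subspace_neg[OF subspace_C]
  and C_diff = subspace_diff[OF subspace_C]
  and C_sum = subspace_sum[OF subspace_C]

lemma act_0: "g \<in> gens \<Longrightarrow> act g 0 = 0"
  using act_add[of g 0 0] C_0 by simp

lemma act_sum: "g \<in> gens \<Longrightarrow> (\<And>i. i \<in> I \<Longrightarrow> f i \<in> C) \<Longrightarrow> act g (\<Sum>i\<in>I. f i) = (\<Sum>i\<in>I. act g (f i))"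
  by (induction I rule: infinite_finite_induct) (auto simp: act_0 act_add C_sum)

lemma act_neg: "g \<in> gens \<Longrightarrow> v \<in> C \<Longrightarrow> act g (- v) = - act g v"
  using act_add[of g v "- v"] by (simp add: act_0 C_neg minus_unique)

lemma act_diff: "g \<in> gens \<Longrightarrow> u \<in> C \<Longrightarrow> v \<in> C \<Longrightarrow> act g (u - v) = act g u - act g v"
  using act_add[of g u "- v"] by (simp add: act_neg C_neg)

lemma word_closed: "set w \<subseteq> gens \<Longrightarrow> v \<in> C \<Longrightarrow> foldr act w v \<in> C"
  by (induction w) (auto intro: act_closed)

lemma word_add: "set w \<subseteq> gens \<Longrightarrow> u \<in> C \<Longrightarrow> v \<in> C \<Longrightarrow> foldr act w (u + v) = foldr act w u + foldr act w v"
  by (induction w) (auto simp: act_add word_closed)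

lemma word_sc: "set w \<subseteq> gens \<Longrightarrow> v \<in> C \<Longrightarrow> foldr act w (sc c v) = sc c (foldr act w v)"
  by (induction w) (auto simp: act_sc word_closed)

lemma FA_keys: "p \<in> carrier FA \<Longrightarrow> w \<in> keys p \<Longrightarrow> set w \<subseteq> gens"
  by (simp add: free_algebra_on_def)

lemma ext_superset:
  assumes "finite A" "keys p \<subseteq> A"
  shows "ext p v = (\<Sum>w\<in>A. sc (lookup p w) (foldr act w v))"
  unfolding alg_act_def using assms by (intro sum.mono_neutral_left) (auto simp: in_keys_iff)

lemma ext_add: "ext (p + q) v = ext p v + ext q v"
proof -
  let ?A = "keys p \<union> keys q"
  have "ext (p + q) v = (\<Sum>w\<in>?A. sc (lookup (p + q) w) (foldr act w v))"
    by (rule ext_superset) (use keys_add[of p q] in auto)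
  also have "\<dots> = ext p v + ext q v"
    by (simp add: lookup_add scale_left_distrib sum.distrib ext_superset[of ?A])
  finally show ?thesis .
qed

lemma ext_single: "ext (Poly_Mapping.single w c) v = sc c (foldr act w v)"
  by (cases "c = 0") (simp_all add: alg_act_def)

lemma ext_0: "ext 0 v = 0"
  by (simp add: alg_act_def)

lemma ext_sum: "ext (\<Sum>i\<in>I. f i) v = (\<Sum>i\<in>I. ext (f i) v)"
  by (induction I rule: infinite_finite_induct) (simp_all add: ext_0 ext_add)

lemma ext_neg: "ext (- p) v = - ext p v"
  using ext_add[of p "- p" v] by (simp add: ext_0 minus_unique)

lemma ext_diff: "ext (p - q) v = ext p v - ext q v"
  using ext_add[of p "- q" v] by (simp add: ext_neg)

lemma ext_1: "ext 1 v = v"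
  using ext_single[of "[]" 1 v] by (simp add: single_Nil)

lemma ext_gen: "ext (gen g) v = act g v"
  by (simp add: gen_def ext_single)

lemma ext_const: "ext (const c) v = sc c v"
  by (simp add: const_def ext_single)

lemma ext_closed: "p \<in> carrier FA \<Longrightarrow> v \<in> C \<Longrightarrow> ext p v \<in> C"
  unfolding alg_act_def by (intro C_sum C_sc word_closed) (auto dest: FA_keys)

lemma ext_add_right: "p \<in> carrier FA \<Longrightarrow> u \<in> C \<Longrightarrow> v \<in> C \<Longrightarrow> ext p (u + v) = ext p u + ext p v"
  unfolding alg_act_def sum.distrib[symmetric]
  using FA_keys[of p] by (auto intro!: sum.cong simp: word_add scale_right_distrib)

lemma ext_sc_right: "p \<in> carrier FA \<Longrightarrow> v \<in> C \<Longrightarrow> ext p (sc c v) = sc c (ext p v)"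
  unfolding alg_act_def scale_sum_right
  using FA_keys[of p] by (auto intro!: sum.cong simp: word_sc mult.commute)

lemma ext_0_right: "p \<in> carrier FA \<Longrightarrow> ext p 0 = 0"
  using ext_add_right[of p 0 0] C_0 by simp

lemma ext_sum_right:
  "p \<in> carrier FA \<Longrightarrow> (\<And>i. i \<in> I \<Longrightarrow> f i \<in> C) \<Longrightarrow> ext p (\<Sum>i\<in>I. f i) = (\<Sum>i\<in>I. ext p (f i))"
  by (induction I rule: infinite_finite_induct) (auto simp: ext_0_right ext_add_right C_sum)

lemma ext_single_mult:
  assumes "q \<in> carrier FA" "set w \<subseteq> gens" "v \<in> C"
  shows "ext (Poly_Mapping.single w c * q) v = sc c (foldr act w (ext q v))"
proof -
  have "Poly_Mapping.single w c * q = (\<Sum>u\<in>keys q. Poly_Mapping.single (w @ u) (c * lookup q u))"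
  proof -
    have "q = (\<Sum>u\<in>keys q. Poly_Mapping.single u (lookup q u))"
      by (rule poly_mapping_eqI) (simp add: lookup_sum lookup_single when_def in_keys_iff)
    then have "Poly_Mapping.single w c * q =
        (\<Sum>u\<in>keys q. Poly_Mapping.single w c * Poly_Mapping.single u (lookup q u))"
      by (metis sum_distrib_left)
    then show ?thesis by (simp add: mult_single plus_list_def)
  qed
  then have "ext (Poly_Mapping.single w c * q) v =
      (\<Sum>u\<in>keys q. sc (c * lookup q u) (foldr act w (foldr act u v)))"
    by (simp add: ext_sum ext_single)
  also have "\<dots> = (\<Sum>u\<in>keys q. sc c (ext (Poly_Mapping.single w 1) (sc (lookup q u) (foldr act u v))))"
    using assms FA_keys[OF assms(1)]
    by (intro sum.cong) (simp_all add: ext_single word_sc word_closed)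
  also have "\<dots> = sc c (ext (Poly_Mapping.single w 1) (ext q v))"
    unfolding scale_sum_right[symmetric] alg_act_def[of _ _ q]
    by (subst ext_sum_right)
      (use assms FA_keys[OF assms(1)] in \<open>auto simp: free_algebra_on_def C_sc word_closed\<close>)
  finally show ?thesis by (simp add: ext_single)
qed

lemma ext_mult:
  assumes "p \<in> carrier FA" "q \<in> carrier FA" "v \<in> C"
  shows "ext (p * q) v = ext p (ext q v)"
proof -
  have "p = (\<Sum>w\<in>keys p. Poly_Mapping.single w (lookup p w))"
    by (rule poly_mapping_eqI) (simp add: lookup_sum lookup_single when_def in_keys_iff)
  then have "p * q = (\<Sum>w\<in>keys p. Poly_Mapping.single w (lookup p w) * q)"
    by (metis sum_distrib_right)
  then have "ext (p * q) v = (\<Sum>w\<in>keys p. ext (Poly_Mapping.single w (lookup p w) * q) v)"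
    by (simp add: ext_sum)
  also have "\<dots> = (\<Sum>w\<in>keys p. sc (lookup p w) (foldr act w (ext q v)))"
    by (intro sum.cong refl ext_single_mult assms FA_keys[OF assms(1)])
  finally show ?thesis by (simp add: alg_act_def[of _ _ p])
qed

end

locale presented_rep = generator_rep gens rels sc act C
  for gens :: "'g set" and rels :: "'g free_alg set" and sc :: "complex \<Rightarrow> 'w::ab_group_add \<Rightarrow> 'w"
    and act :: "'g \<Rightarrow> 'w \<Rightarrow> 'w" and C :: "'w set" +
  assumes act_rels: "r \<in> rels \<Longrightarrow> v \<in> C \<Longrightarrow> alg_act sc act r v = 0"
begin

text \<open>The elements of the free algebra that annihilate \<open>C\<close> form a two-sided
  ideal; stability under right multiplication uses that \<open>C\<close> is invariant. This ideal
  contains the relations, hence everything they generate.\<close>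

lemma ext_ideal:
  assumes "p \<in> genideal FA rels" "v \<in> C"
  shows "ext p v = 0"
proof -
  let ?K = "{p \<in> carrier FA. \<forall>v\<in>C. ext p v = 0}"
  have "ideal ?K FA"
  proof (rule idealI[OF F.ring_axioms])
    show "subgroup ?K (add_monoid FA)"
    proof (rule group.subgroupI[OF F.add.is_group])
      show "?K \<noteq> {}" using F.zero_closed by (auto simp: ext_0)
      fix a assume "a \<in> ?K"
      moreover have "inv\<^bsub>add_monoid FA\<^esub> a = - a" if "a \<in> carrier FA"
        using that F.minus_equality[of "- a" a] by (simp add: a_inv_def free_algebra_on_closed)
      ultimately show "inv\<^bsub>add_monoid FA\<^esub> a \<in> ?K" by (auto simp: ext_neg)
    qed (auto simp: ext_add)
  qed (auto simp: ext_mult ext_0_right ext_closed)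
  moreover have "rels \<subseteq> ?K" using rels_subset act_rels by auto
  ultimately have "genideal FA rels \<subseteq> ?K" by (rule F.genideal_minimal)
  with assms show ?thesis by blast
qed

lemma cact_cls:
  assumes "p \<in> carrier FA" "v \<in> C"
  shows "cact (cls p) v = ext p v"
proof -
  have "(\<lambda>q. ext q v) ` cls p = {ext p v}"
    using assms I.zero_closed by (auto simp: mem_cls ext_add ext_ideal image_iff)
  then show ?thesis by (simp add: class_act_def)
qed

lemma cact_closed: "P \<in> carrier D \<Longrightarrow> v \<in> C \<Longrightarrow> cact P v \<in> C"
  by (auto simp: carrier_D cact_cls ext_closed)

lemma cact_mult: "P \<in> carrier D \<Longrightarrow> Q \<in> carrier D \<Longrightarrow> v \<in> C \<Longrightarrow> cact (P \<otimes>\<^bsub>D\<^esub> Q) v = cact P (cact Q v)"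
  by (auto simp: carrier_D cact_cls ext_closed ext_mult free_algebra_on_closed simp flip: cls_mult)

lemma cact_add: "P \<in> carrier D \<Longrightarrow> Q \<in> carrier D \<Longrightarrow> v \<in> C \<Longrightarrow> cact (P \<oplus>\<^bsub>D\<^esub> Q) v = cact P v + cact Q v"
  by (auto simp: carrier_D cact_cls ext_add free_algebra_on_closed simp flip: cls_add)

lemma cact_zero: "v \<in> C \<Longrightarrow> cact \<zero>\<^bsub>D\<^esub> v = 0"
  using cact_cls[of 0 v] by (simp add: free_algebra_on_closed cls_0 ext_0)

lemma cact_one: "v \<in> C \<Longrightarrow> cact \<one>\<^bsub>D\<^esub> v = v"
  using cact_cls[of 1 v] by (simp add: free_algebra_on_closed cls_1 ext_1)

lemma cact_neg: "P \<in> carrier D \<Longrightarrow> v \<in> C \<Longrightarrow> cact (\<ominus>\<^bsub>D\<^esub> P) v = - cact P v"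
  using cact_add[of P "\<ominus>\<^bsub>D\<^esub> P" v] by (simp add: D.r_neg cact_zero minus_unique)

lemma cact_diff: "P \<in> carrier D \<Longrightarrow> Q \<in> carrier D \<Longrightarrow> v \<in> C \<Longrightarrow> cact (P \<ominus>\<^bsub>D\<^esub> Q) v = cact P v - cact Q v"
  by (simp add: a_minus_def cact_add cact_neg)

lemma cact_add_right: "P \<in> carrier D \<Longrightarrow> u \<in> C \<Longrightarrow> v \<in> C \<Longrightarrow> cact P (u + v) = cact P u + cact P v"
  by (auto simp: carrier_D cact_cls C_add ext_add_right)

lemma sum_free_elt:
  assumes "finite J" "j \<in> J" "\<And>i. i \<in> J \<Longrightarrow> \<epsilon> i \<in> C"
  shows "(\<Sum>i\<in>J. cact (free_elt D J r j i) (\<epsilon> i)) = cact r (\<epsilon> j)"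
proof -
  have "(\<Sum>i\<in>J. cact (free_elt D J r j i) (\<epsilon> i)) = (\<Sum>i\<in>J. if i = j then cact r (\<epsilon> i) else 0)"
    using assms(3) by (intro sum.cong) (auto simp: free_elt_def cact_zero)
  then show ?thesis using assms by simp
qed

lemma sum_free_elt_diff:
  assumes "finite J" "j \<in> J" "l \<in> J" "\<And>i. i \<in> J \<Longrightarrow> \<epsilon> i \<in> C" "a \<in> carrier D" "b \<in> carrier D"
  shows "(\<Sum>i\<in>J. cact ((free_elt D J a j \<ominus>\<^bsub>free_module D J\<^esub> free_elt D J b l) i) (\<epsilon> i)) =
    cact a (\<epsilon> j) - cact b (\<epsilon> l)"
proof -
  have c: "free_elt D J a j \<in> carrier (free_module D J)" "free_elt D J b l \<in> carrier (free_module D J)"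
    using assms(5,6) by (auto simp: free_elt_def free_module_def)
  have "(free_elt D J a j \<ominus>\<^bsub>free_module D J\<^esub> free_elt D J b l) i =
      free_elt D J a j i \<ominus>\<^bsub>D\<^esub> free_elt D J b l i" if "i \<in> J" for i
    using that by (simp add: D.free_module_minus[OF c])
  moreover have "free_elt D J a j i \<in> carrier D" "free_elt D J b l i \<in> carrier D" if "i \<in> J" for i
    using that assms(5,6) by (simp_all add: free_elt_def)
  ultimately have "(\<Sum>i\<in>J. cact ((free_elt D J a j \<ominus>\<^bsub>free_module D J\<^esub> free_elt D J b l) i) (\<epsilon> i)) =
     (\<Sum>i\<in>J. cact (free_elt D J a j i) (\<epsilon> i) - cact (free_elt D J b l i) (\<epsilon> i))"
    using assms(4) by (intro sum.cong refl) (simp add: cact_diff)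
  then show ?thesis
    using assms by (simp add: sum_subtractf sum_free_elt)
qed

lemma class_act_module:
  assumes "carrier M = C" "zero M = 0" "add M = (+)" "smult M = cact"
  shows "left_module D M"
proof (intro left_module.intro left_module_axioms.intro)
  show "abelian_group M"
    by (rule abelian_groupI) (use assms C_0 C_add C_neg in \<open>auto simp: algebra_simps intro: bexI[of _ "- _"]\<close>)
qed (use assms in \<open>auto simp: D.ring_axioms cact_closed cact_mult cact_one cact_add cact_add_right\<close>)

end

text \<open>A linear map that commutes with the generators commutes with words, hence with their
  combinations. It will be applied to the map out of the fan module and to multiplication by y_i -
  1.\<close>

lemma intertwine:
  assumes "presented_rep gens rels sc act C" "presented_rep gens rels sc' act' C'"
    and add: "\<And>u v. u \<in> C \<Longrightarrow> v \<in> C \<Longrightarrow> s (u + v) = s u + s v"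
    and scale: "\<And>c v. v \<in> C \<Longrightarrow> s (sc c v) = sc' c (s v)"
    and act: "\<And>g v. g \<in> gens \<Longrightarrow> v \<in> C \<Longrightarrow> s (act g v) = act' g (s v)"
    and closed: "\<And>v. v \<in> C \<Longrightarrow> s v \<in> C'"
    and P: "P \<in> carrier (presented_ring gens rels)" and v: "v \<in> C"
  shows "s (class_act sc act P v) = class_act sc' act' P (s v)"
proof -
  interpret A: presented_rep gens rels sc act C by fact
  interpret B: presented_rep gens rels sc' act' C' by fact
  obtain p where p: "p \<in> carrier A.FA" "P = A.cls p" using P by (auto simp: A.carrier_D)
  have "s 0 = 0" using add[OF A.C_0 A.C_0] by simp
  then have sum: "s (\<Sum>i\<in>I. f i) = (\<Sum>i\<in>I. s (f i))" if "\<And>i. i \<in> I \<Longrightarrow> f i \<in> C" for I and f :: "_ \<Rightarrow> _"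
    using that by (induction I rule: infinite_finite_induct) (simp_all add: add A.C_sum)
  have word: "s (foldr act w v) = foldr act' w (s v)" if "set w \<subseteq> gens" for w
    using that by (induction w) (auto simp: act A.word_closed v)
  have "s (A.ext p v) = (\<Sum>w\<in>keys p. s (sc (lookup p w) (foldr act w v)))"
    unfolding alg_act_def by (rule sum) (use A.FA_keys[OF p(1)] v in \<open>auto intro: A.C_sc A.word_closed\<close>)
  also have "\<dots> = B.ext p (s v)"
    unfolding alg_act_def using A.FA_keys[OF p(1)] v
    by (intro sum.cong refl) (simp add: scale A.word_closed word)
  finally show ?thesis using p v closed by (simp add: A.cact_cls B.cact_cls)
qed


text \<open>A \<open>\<complex>\<close>-linear projection with kernel \<open>V\<close> realises the quotient \<open>W/V\<close> inside \<open>W\<close>.\<close>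

lemma (in vector_space) ex_projection_with_kernel:
  assumes "subspace V" "subspace W" "V \<subseteq> W"
  shows "\<exists>\<pi>. Vector_Spaces.linear scale scale \<pi> \<and> (\<forall>v\<in>V. \<pi> v = 0) \<and> (\<forall>v\<in>W. v - \<pi> v \<in> V)"
proof -
  interpret P: vector_space_pair scale scale ..
  obtain B where B: "B \<subseteq> V" "independent B" "V \<subseteq> span B"
    using maximal_independent_subset by blast
  obtain B' where B': "B \<subseteq> B'" "B' \<subseteq> W" "independent B'" "W \<subseteq> span B'"
    using maximal_independent_subset_extend[of B W] B assms(3) by blast
  obtain \<pi> where \<pi>: "Vector_Spaces.linear scale scale \<pi>" "\<forall>b\<in>B'. \<pi> b = (if b \<in> B then 0 else b)"
    using P.linear_independent_extend[OF B'(3), of "\<lambda>b. if b \<in> B then 0 else b"] by blast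
  interpret \<pi>: Vector_Spaces.linear scale scale \<pi> by fact
  have "\<pi> v = 0" if "v \<in> span B" for v
    using that
  proof (induction rule: span_induct_alt)
    case (step c x y)
    then show ?case using \<pi>(2) B'(1) by (auto simp: \<pi>.add \<pi>.scale)
  qed (rule \<pi>.zero)
  moreover have "v - \<pi> v \<in> V" if "v \<in> span B'" for v
    using that
  proof (induction rule: span_induct_alt)
    case base
    then show ?case using subspace_0[OF assms(1)] by (simp add: \<pi>.zero)
  next
    case (step c x y)
    have "x - \<pi> x \<in> V" using step.hyps \<pi>(2) B(1) subspace_0[OF assms(1)] by auto
    then have mem: "scale c (x - \<pi> x) + (y - \<pi> y) \<in> V"
      using step.IH assms(1) by (intro subspace_add subspace_scale)
    have eq: "scale c x + y - \<pi> (scale c x + y) = scale c (x - \<pi> x) + (y - \<pi> y)"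
      by (simp add: \<pi>.add \<pi>.scale scale_right_diff_distrib)
    show ?case unfolding eq by (rule mem)
  qed
  ultimately show ?thesis using \<pi>(1) B(3) B'(4) by blast
qed

section \<open>Quotients of free modules as representations\<close>

context presentation
begin

text \<open>The free module over the ring is covered by the space \<open>E\<close> of families over
  the free algebra. With \<open>V\<close> the preimage of \<open>H\<close>, the quotient by
  \<open>H\<close> is E / V, which becomes the image of \<open>E\<close> under a projection that
  kills exactly \<open>V\<close> in \<open>E\<close>. Thus the type of the representation space does
  not depend on \<open>H\<close>.\<close>

theorem ex_quotient_rep:
  fixes J :: "'j set"
  assumes J: "finite J" and H: "submodule H D (free_module D J)"
  shows "\<exists>sc act C. \<exists>\<epsilon> :: 'j \<Rightarrow> ('j \<Rightarrow>\<^sub>0 'g free_alg). presented_rep gens rels sc act C \<and> (\<forall>j\<in>J. \<epsilon> j \<in> C) \<and>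
    (\<forall>x\<in>carrier (free_module D J). (\<Sum>j\<in>J. class_act sc act (x j) (\<epsilon> j)) = 0 \<longleftrightarrow> x \<in> H)"
proof -
  interpret F': left_module D "free_module D J" by (rule D.free_left_module)
  define lmul :: "'g free_alg \<Rightarrow> ('j \<Rightarrow>\<^sub>0 'g free_alg) \<Rightarrow> ('j \<Rightarrow>\<^sub>0 'g free_alg)"
    where "lmul p u = Poly_Mapping.map ((*) p) u" for p u
  have lookup_lmul: "lookup (lmul p u) j = p * lookup u j" for p u j
    by (simp add: lmul_def lookup_map)
  have lmul_simps: "lmul (p + q) u = lmul p u + lmul q u" "lmul p (u + v) = lmul p u + lmul p v"
    "lmul (p * q) u = lmul p (lmul q u)" "lmul 1 u = u" "lmul p (u - v) = lmul p u - lmul p v" "lmul p 0 = 0"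
    for p q u v
    by (rule poly_mapping_eqI; simp add: lookup_lmul lookup_add lookup_minus algebra_simps)+
  have lmul_sum: "lmul (\<Sum>i\<in>K. f i) u = (\<Sum>i\<in>K. lmul (f i) u)" for K f u
    by (rule poly_mapping_eqI) (simp add: lookup_lmul lookup_sum sum_distrib_right)
  define sc :: "complex \<Rightarrow> ('j \<Rightarrow>\<^sub>0 'g free_alg) \<Rightarrow> ('j \<Rightarrow>\<^sub>0 'g free_alg)"
    where "sc c u = lmul (const c) u" for c u
  interpret vector_space sc
    by unfold_locales (simp_all add: sc_def const_add const_mult const_1 lmul_simps)
  have sc_lmul: "sc c (lmul p u) = lmul p (sc c u)" for c p u
    by (simp add: sc_def const_commute flip: lmul_simps(3))
  define E where "E = {u :: 'j \<Rightarrow>\<^sub>0 'g free_alg. keys u \<subseteq> J \<and> (\<forall>j. lookup u j \<in> carrier FA)}"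
  \<comment> \<open>\<open>q\<close> takes the classes of the components; it is semilinear over the
    passage from the free algebra to the presented ring.\<close>
  define q where "q u = (\<lambda>j\<in>J. cls (lookup u j))" for u :: "'j \<Rightarrow>\<^sub>0 'g free_alg"
  have E_lookup: "lookup u j \<in> carrier FA" if "u \<in> E" for u j using that by (simp add: E_def)
  have E_0: "0 \<in> E" by (auto simp: E_def)
  have E_add: "u + v \<in> E" if "u \<in> E" "v \<in> E" for u v
    using that keys_add[of u v] by (auto simp: E_def lookup_add)
  have E_lmul: "lmul p u \<in> E" if "p \<in> carrier FA" "u \<in> E" for p u
  proof -
    have "keys (lmul p u) \<subseteq> keys u" by (auto simp: in_keys_iff lookup_lmul)
    with that show ?thesis by (auto simp: E_def lookup_lmul)
  qed
  have E_sum: "(\<Sum>i\<in>K. f i) \<in> E" if "\<And>i. i \<in> K \<Longrightarrow> f i \<in> E" for K and f :: "'j \<Rightarrow> _"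
    using that by (induction K rule: infinite_finite_induct) (simp_all add: E_0 E_add)
  have sub_E: "subspace E"
    unfolding subspace_def by (auto simp: E_0 E_add sc_def intro!: E_lmul)
  have q_closed: "q u \<in> carrier (free_module D J)" if "u \<in> E" for u
    using that by (auto simp: q_def free_module_def E_lookup)
  have q_add: "q (u + v) = q u \<oplus>\<^bsub>free_module D J\<^esub> q v" if "u \<in> E" "v \<in> E" for u v
    using that by (auto simp: q_def free_module_def lookup_add cls_add E_lookup intro!: restrict_ext)
  have q_lmul: "q (lmul p u) = cls p \<odot>\<^bsub>free_module D J\<^esub> q u" if "p \<in> carrier FA" "u \<in> E" for p u
    using that by (auto simp: q_def free_module_def lookup_lmul cls_mult E_lookup intro!: restrict_ext)
  have q_0: "q 0 = \<zero>\<^bsub>free_module D J\<^esub>"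
    by (auto simp: q_def free_module_def cls_0 intro!: restrict_ext)
  define V where "V = {u \<in> E. q u \<in> H}"
  have V_lmul: "lmul p u \<in> V" if "p \<in> carrier FA" "u \<in> V" for p u
    using that by (auto simp: V_def E_lmul q_lmul intro!: F'.submodule_dest(4)[OF H] cls_closed)
  have sub_V: "subspace V"
    unfolding subspace_def
  proof (intro conjI ballI allI)
    show "0 \<in> V" using F'.submodule_dest(2)[OF H] by (simp add: V_def E_0 q_0)
    show "u + v \<in> V" if "u \<in> V" "v \<in> V" for u v
      using that F'.submodule_dest(3)[OF H] by (simp add: V_def E_add q_add)
    show "sc c u \<in> V" if "u \<in> V" for c u
      unfolding sc_def by (rule V_lmul[OF free_algebra_on_closed(7) that])
  qed
  have "V \<subseteq> E" by (auto simp: V_def)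
  then obtain \<pi> where lin: "Vector_Spaces.linear sc sc \<pi>" and \<pi>V: "\<And>v. v \<in> V \<Longrightarrow> \<pi> v = 0"
    and \<pi>E: "\<And>v. v \<in> E \<Longrightarrow> v - \<pi> v \<in> V"
    using ex_projection_with_kernel[OF sub_V sub_E] by blast
  interpret \<pi>: Vector_Spaces.linear sc sc \<pi> by (rule lin)
  have \<pi>_in_E: "\<pi> v \<in> E" if "v \<in> E" for v
    using subspace_diff[OF sub_E that, of "v - \<pi> v"] \<pi>E[OF that] \<open>V \<subseteq> E\<close> by auto
  have \<pi>_eq: "\<pi> u = \<pi> v" if "u - v \<in> V" for u v
    using \<pi>V[OF that] by (simp add: \<pi>.diff)
  have \<pi>_eq_0: "\<pi> v = 0 \<longleftrightarrow> v \<in> V" if "v \<in> E" for v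
    using \<pi>V \<pi>E[OF that] by auto
  \<comment> \<open>Changing the argument of \<open>lmul p\<close> by an element of \<open>V\<close>
    changes the value by an element of \<open>V\<close>, so left multiplication descends to the
    quotient.\<close>
  have \<pi>_lmul: "\<pi> (lmul p (\<pi> u)) = \<pi> (lmul p u)" if "p \<in> carrier FA" "u \<in> E" for p u
    using V_lmul[OF that(1) \<pi>E[OF that(2)]] by (intro \<pi>_eq[symmetric]) (simp add: lmul_simps)
  define act where "act g u = \<pi> (lmul (gen g) u)" for g u
  define C where "C = \<pi> ` E"
  have word: "foldr act w (\<pi> u) = \<pi> (lmul (Poly_Mapping.single w 1) u) \<and> Poly_Mapping.single w 1 \<in> carrier FA"
    if "set w \<subseteq> gens" "u \<in> E" for w u
    using that(1)
  proof (induction w)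
    case Nil
    have "\<pi> (\<pi> u) = \<pi> u" using \<pi>E[OF that(2)] by (intro \<pi>_eq[symmetric])
    then show ?case by (auto simp: lmul_simps single_Nil)
  next
    case (Cons g w)
    then have IH: "foldr act w (\<pi> u) = \<pi> (lmul (Poly_Mapping.single w 1) u)"
      "Poly_Mapping.single w 1 \<in> carrier FA" "gen g \<in> carrier FA" by auto
    then have "foldr act (g # w) (\<pi> u) = \<pi> (lmul (gen g) (lmul (Poly_Mapping.single w 1) u))"
      using \<pi>_lmul[of "gen g" "lmul (Poly_Mapping.single w 1) u"] E_lmul[OF IH(2) that(2)]
      by (simp add: act_def)
    with IH show ?case
      unfolding single_Cons by (auto simp: lmul_simps)
  qed
  have ext: "alg_act sc act p (\<pi> u) = \<pi> (lmul p u)" if "p \<in> carrier FA" "u \<in> E" for p u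
  proof -
    have "sc (lookup p w) (foldr act w (\<pi> u)) = \<pi> (lmul (const (lookup p w) * Poly_Mapping.single w 1) u)"
      if "w \<in> keys p" for w
    proof -
      have "set w \<subseteq> gens" using \<open>p \<in> carrier FA\<close> that by (auto simp: free_algebra_on_def)
      then have "sc (lookup p w) (foldr act w (\<pi> u)) = \<pi> (sc (lookup p w) (lmul (Poly_Mapping.single w 1) u))"
        using word[OF _ \<open>u \<in> E\<close>] by (simp add: \<pi>.scale)
      then show ?thesis by (simp add: sc_def lmul_simps)
    qed
    then have "alg_act sc act p (\<pi> u) = (\<Sum>w\<in>keys p. \<pi> (lmul (const (lookup p w) * Poly_Mapping.single w 1) u))"
      by (simp add: alg_act_def)
    also have "\<dots> = \<pi> (lmul p u)"
      by (simp flip: \<pi>.sum lmul_sum free_alg_expansion)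
    finally show ?thesis .
  qed
  have C_E: "C \<subseteq> E" using \<pi>_in_E by (auto simp: C_def)
  have sub_C: "subspace C" unfolding C_def by (rule \<pi>.subspace_image[OF sub_E])
  have rep: "presented_rep gens rels sc act C"
  proof unfold_locales
    show "subspace C" by (rule sub_C)
  next
    fix g v assume g: "g \<in> gens" and "v \<in> C"
    with C_E have v: "v \<in> E" by blast
    show "act g v \<in> C" using E_lmul[OF _ v, of "gen g"] g by (auto simp: act_def C_def)
    show "act g (sc c v) = sc c (act g v)" for c
      by (simp add: act_def flip: \<pi>.scale sc_lmul)
    show "act g (u + v) = act g u + act g v" for u
      by (simp add: act_def lmul_simps \<pi>.add)
  next
    fix r v assume r: "r \<in> rels" and "v \<in> C"
    then obtain u where u: "v = \<pi> u" "u \<in> E" by (auto simp: C_def)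
    have rI: "r \<in> genideal FA rels" "r \<in> carrier FA" using r rels_subset F.genideal_self[OF rels_subset] by auto
    \<comment> \<open>\<open>r\<close> multiplies arbitrary components from the left; as the ideal
      is two-sided, the products still have class 0.\<close>
    have "cls (r * lookup u j) = \<zero>\<^bsub>D\<^esub>" for j
      using cls_eq_zero_iff[OF free_algebra_on_closed(4)[OF rI(2) E_lookup[OF u(2)]]]
        I.I_r_closed[OF rI(1) E_lookup[OF u(2)]] by simp
    then have "q (lmul r u) = \<zero>\<^bsub>free_module D J\<^esub>"
      by (auto simp: q_def free_module_def lookup_lmul intro!: restrict_ext)
    then have "lmul r u \<in> V" using F'.submodule_dest(2)[OF H] E_lmul rI u by (simp add: V_def)
    then show "alg_act sc act r v = 0" using ext rI u \<pi>V by simp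
  qed
  interpret W: presented_rep gens rels sc act C by (rule rep)
  define \<epsilon> where "\<epsilon> j = \<pi> (Poly_Mapping.single j 1)" for j
  have single_E: "Poly_Mapping.single j p \<in> E" if "j \<in> J" "p \<in> carrier FA" for j p
    using that by (auto simp: E_def lookup_single when_def)
  have \<epsilon>C: "\<epsilon> j \<in> C" if "j \<in> J" for j
    using single_E[OF that] by (auto simp: \<epsilon>_def C_def)
  have main: "(\<Sum>j\<in>J. W.cact (x j) (\<epsilon> j)) = 0 \<longleftrightarrow> x \<in> H" if x: "x \<in> carrier (free_module D J)" for x
  proof -
    have "\<forall>j\<in>J. \<exists>p\<in>carrier FA. x j = cls p"
      using x by (auto simp: free_module_def carrier_D PiE_def Pi_def)
    then obtain p where p: "\<And>j. j \<in> J \<Longrightarrow> p j \<in> carrier FA" "\<And>j. j \<in> J \<Longrightarrow> x j = cls (p j)"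
      by metis
    \<comment> \<open>A lift of \<open>x\<close> to the free algebra, component by component; the
      sum in question is its image under \<open>\<pi>\<close>.\<close>
    define u where "u = (\<Sum>j\<in>J. Poly_Mapping.single j (p j))"
    have u: "u \<in> E" unfolding u_def by (intro E_sum single_E p)
    have "lookup u j = p j" if "j \<in> J" for j
      using J that by (simp add: u_def lookup_sum lookup_single when_def)
    then have qu: "q u = x"
      using x p(2) by (auto simp: q_def free_module_def PiE_def extensional_def fun_eq_iff restrict_def)
    have "W.cact (x j) (\<epsilon> j) = \<pi> (Poly_Mapping.single j (p j))" if "j \<in> J" for j
    proof -
      have "lmul (p j) (Poly_Mapping.single j 1) = Poly_Mapping.single j (p j)"
        by (rule poly_mapping_eqI) (simp add: lookup_lmul lookup_single when_def)
      then show ?thesis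
        using that p \<epsilon>C[OF that] ext[OF p(1)[OF that] single_E[OF that, of 1]]
        by (auto simp: W.cact_cls \<epsilon>_def)
    qed
    then have "(\<Sum>j\<in>J. W.cact (x j) (\<epsilon> j)) = \<pi> u" by (simp add: u_def \<pi>.sum)
    with \<pi>_eq_0[OF u] qu u show ?thesis by (simp add: V_def)
  qed
  show ?thesis
    using rep \<epsilon>C main by (intro exI[of _ sc] exI[of _ act] exI[of _ C] exI[of _ \<epsilon>]) auto
qed

text \<open>The quotient representation for \<open>J = {0}\<close> and the zero submodule is faithful.\<close>

corollary presented_ring_eqI:
  assumes P: "P \<in> carrier D" and Q: "Q \<in> carrier D"
    and eq: "\<And>sc act C and v :: nat \<Rightarrow>\<^sub>0 'g free_alg. presented_rep gens rels sc act C \<Longrightarrow> v \<in> C \<Longrightarrow>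
      class_act sc act P v = class_act sc act Q v"
  shows "P = Q"
proof -
  let ?J = "{0::nat}"
  interpret F': left_module D "free_module D ?J" by (rule D.free_left_module)
  have "submodule {\<zero>\<^bsub>free_module D ?J\<^esub>} D (free_module D ?J)"
    by (rule F'.submodule_intro) (auto simp: F'.smult_zero_right)
  from ex_quotient_rep[OF _ this] obtain sc act C and \<epsilon> :: "nat \<Rightarrow> (nat \<Rightarrow>\<^sub>0 'g free_alg)" where
    W: "presented_rep gens rels sc act C" "\<forall>j\<in>?J. \<epsilon> j \<in> C"
    and iff: "\<forall>x\<in>carrier (free_module D ?J).
      (\<Sum>j\<in>?J. class_act sc act (x j) (\<epsilon> j)) = 0 \<longleftrightarrow> x \<in> {\<zero>\<^bsub>free_module D ?J\<^esub>}"
    by auto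
  interpret W: presented_rep gens rels sc act C by fact
  let ?x = "\<lambda>j\<in>?J. P \<ominus>\<^bsub>D\<^esub> Q"
  have "W.cact (P \<ominus>\<^bsub>D\<^esub> Q) (\<epsilon> 0) = 0" using W P Q eq[OF W(1)] by (simp add: W.cact_diff)
  then have "(\<Sum>j\<in>?J. W.cact (?x j) (\<epsilon> j)) = 0" by simp
  moreover have "?x \<in> carrier (free_module D ?J)" using P Q by (simp add: free_module_def)
  ultimately have "?x = \<zero>\<^bsub>free_module D ?J\<^esub>" using iff by blast
  then have "?x 0 = (\<lambda>j\<in>?J. \<zero>\<^bsub>D\<^esub>) 0" by (simp add: free_module_def)
  then have "P \<ominus>\<^bsub>D\<^esub> Q = \<zero>\<^bsub>D\<^esub>" by simp
  then show ?thesis using P Q D.minus_equality[of P "\<ominus>\<^bsub>D\<^esub> Q"] by (simp add: a_minus_def)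
qed

end

section \<open>The fan D-module as a representation\<close>

lemma poly_mapping_add_induct [case_names zero add]:
  assumes "P 0" "\<And>k c p. P p \<Longrightarrow> P (Poly_Mapping.single k c + p)"
  shows "P p"
proof (induction p rule: update_induct)
  case (update f a b)
  have "Poly_Mapping.update a b f = Poly_Mapping.single a b + f"
    using update(1) by (intro poly_mapping_eqI)
      (auto simp: lookup_update lookup_add lookup_single when_def in_keys_iff)
  with update assms(2) show ?case by metis
qed (rule assms(1))

subsection \<open>Derivations of the coefficient ring\<close>

lemma theta_coeff_0 [simp]: "theta_coeff i 0 = 0"
  by (simp add: theta_coeff_def)

lemma theta_coeff_add: "theta_coeff i (f + g) = theta_coeff i f + theta_coeff i g"
  using setsum_keys_plus_distrib[of "\<lambda>(n, d, e) c. Poly_Mapping.single (n + 1, d, e) (of_rat (lookup d i) * c)" f g]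
  by (simp add: theta_coeff_def case_prod_unfold distrib_left single_add)

lemma theta_coeff_single:
  "theta_coeff i (Poly_Mapping.single (n, d, e) c) = Poly_Mapping.single (Suc n, d, e) (of_rat (lookup d i) * c)"
  by (cases "c = 0") (simp_all add: theta_coeff_def)

lemma del_coeff_0 [simp]: "del_coeff l 0 = 0"
  by (simp add: del_coeff_def)

lemma del_coeff_add: "del_coeff l (f + g) = del_coeff l f + del_coeff l g"
  using setsum_keys_plus_distrib[of "\<lambda>(n, d, e) c. Poly_Mapping.single (n + 1, d, e - Poly_Mapping.single l 1)
    (of_nat (lookup e l) * c)" f g]
  by (simp add: del_coeff_def case_prod_unfold distrib_left single_add)

lemma del_coeff_single:
  "del_coeff l (Poly_Mapping.single (n, d, e) c) =
     Poly_Mapping.single (Suc n, d, e - Poly_Mapping.single l 1) (of_nat (lookup e l) * c)"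
  by (cases "c = 0") (simp_all add: del_coeff_def)

text \<open>On monomials the factor d_i is additive in the exponent of Q, which is the product rule;
  the power of z grows by one on either side.\<close>

lemma theta_coeff_mult: "theta_coeff i (f * g) = theta_coeff i f * g + f * theta_coeff i g"
proof (induction f rule: poly_mapping_add_induct)
  case (add m c f)
  obtain n d e where m: "m = (n, d, e)" by (cases m)
  have "theta_coeff i (Poly_Mapping.single m c * g) =
      theta_coeff i (Poly_Mapping.single m c) * g + Poly_Mapping.single m c * theta_coeff i g"
  proof (induction g rule: poly_mapping_add_induct)
    case (add m' c' g)
    obtain n' d' e' where m': "m' = (n', d', e')" by (cases m')
    have "theta_coeff i (Poly_Mapping.single m c * Poly_Mapping.single m' c') =
      theta_coeff i (Poly_Mapping.single m c) * Poly_Mapping.single m' c' +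
      Poly_Mapping.single m c * theta_coeff i (Poly_Mapping.single m' c')"
      by (simp add: m m' mult_single theta_coeff_single lookup_add of_rat_add distrib_left distrib_right single_add ac_simps)
    with add show ?case by (simp add: distrib_left theta_coeff_add algebra_simps)
  qed simp
  with add show ?case by (simp add: distrib_right theta_coeff_add algebra_simps)
qed simp

lemma del_coeff_mult: "del_coeff l (f * g) = del_coeff l f * g + f * del_coeff l g"
proof (induction f rule: poly_mapping_add_induct)
  case (add m c f)
  obtain n d e where m: "m = (n, d, e)" by (cases m)
  have "del_coeff l (Poly_Mapping.single m c * g) =
      del_coeff l (Poly_Mapping.single m c) * g + Poly_Mapping.single m c * del_coeff l g"
  proof (induction g rule: poly_mapping_add_induct)
    case (add m' c' g)
    obtain n' d' e' where m': "m' = (n', d', e')" by (cases m')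
    \<comment> \<open>Subtraction of exponents is truncated. Where \<open>l\<close> does not occur
      in \<open>e\<close>, the two exponents may differ, but they carry the coefficient e_l =
      0.\<close>
    have shift: "lookup e l = 0 \<or> e + e' - Poly_Mapping.single l 1 = (e - Poly_Mapping.single l 1) + e'" for e e' :: "_ \<Rightarrow>\<^sub>0 nat"
      by (cases "lookup e l = 0") (auto intro!: poly_mapping_eqI simp: lookup_minus lookup_add lookup_single when_def)
    have "Poly_Mapping.single (Suc (n + n'), d + d', e + e' - Poly_Mapping.single l 1) (of_nat (lookup e l) * (c * c')) =
       Poly_Mapping.single (Suc (n + n'), d + d', (e - Poly_Mapping.single l 1) + e') (of_nat (lookup e l) * (c * c'))"
      using shift[of e e'] by auto
    moreover have "Poly_Mapping.single (Suc (n + n'), d + d', e + e' - Poly_Mapping.single l 1) (of_nat (lookup e' l) * (c * c')) =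
       Poly_Mapping.single (Suc (n + n'), d + d', e + (e' - Poly_Mapping.single l 1)) (of_nat (lookup e' l) * (c * c'))"
      using shift[of e' e] by (auto simp: add.commute)
    ultimately have "del_coeff l (Poly_Mapping.single m c * Poly_Mapping.single m' c') =
      del_coeff l (Poly_Mapping.single m c) * Poly_Mapping.single m' c' +
      Poly_Mapping.single m c * del_coeff l (Poly_Mapping.single m' c')"
      by (simp add: m m' mult_single del_coeff_single lookup_add distrib_left distrib_right single_add mult.left_commute mult.assoc)
    with add show ?case by (simp add: distrib_left del_coeff_add algebra_simps)
  qed simp
  with add show ?case by (simp add: distrib_right del_coeff_add algebra_simps)
qed simp

lemma theta_theta_coeff: "theta_coeff i (theta_coeff j f) = theta_coeff j (theta_coeff i f)"
proof (induction f rule: poly_mapping_add_induct)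
  case (add m c f)
  then show ?case
    by (cases m) (simp add: theta_coeff_add theta_coeff_single mult.left_commute)
qed simp

lemma theta_del_coeff: "theta_coeff i (del_coeff l f) = del_coeff l (theta_coeff i f)"
proof (induction f rule: poly_mapping_add_induct)
  case (add m c f)
  then show ?case
    by (cases m) (simp add: theta_coeff_add theta_coeff_single del_coeff_add del_coeff_single mult.left_commute)
qed simp

lemma del_del_coeff: "del_coeff k (del_coeff l f) = del_coeff l (del_coeff k f)"
proof (induction f rule: poly_mapping_add_induct)
  case (add m c f)
  obtain n d e where m: "m = (n, d, e)" by (cases m)
  have "e - Poly_Mapping.single l 1 - Poly_Mapping.single k 1 = e - Poly_Mapping.single k 1 - Poly_Mapping.single l 1"
    by (rule poly_mapping_eqI) (simp add: lookup_minus lookup_single when_def)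
  then show ?case using add
    by (cases "k = l") (simp_all add: m del_coeff_add del_coeff_single lookup_minus lookup_single mult.left_commute)
qed simp

lemma theta_coeff_vars:
  "theta_coeff i zvar = 0" "theta_coeff i (yvar k) = 0" "theta_coeff i (cst c) = 0"
  "theta_coeff i (Qvar d) = cst (of_rat (lookup d i)) * zvar * Qvar d"
  by (simp_all add: zvar_def yvar_def cst_def Qvar_def theta_coeff_single zero_prod_def mult_single)

lemma del_coeff_vars:
  "del_coeff l zvar = 0" "del_coeff l (Qvar d) = 0" "del_coeff l (cst c) = 0"
  "del_coeff l (yvar k) = (if k = l then zvar else 0)"
  by (simp_all add: zvar_def yvar_def cst_def Qvar_def del_coeff_single zero_prod_def lookup_single
      single_diff)

lemma cst_add: "cst (a + b) = cst a + cst b"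
  and cst_mult: "cst (a * b) = cst a * cst b"
  and cst_0 [simp]: "cst 0 = 0" and cst_1 [simp]: "cst 1 = 1"
  by (simp_all add: cst_def single_add mult_single)

lemma Qvar_add: "Qvar (d + e) = Qvar d * Qvar e"
  and Qvar_0 [simp]: "Qvar 0 = 1"
  by (simp_all add: Qvar_def mult_single flip: zero_prod_def)

subsection \<open>Vectors\<close>

lemma lookup_coeff_scale [simp]: "lookup (coeff_scale f v) k = f * lookup v k"
  by (simp add: coeff_scale_def lookup_map)

interpretation fv: Modules.module "coeff_scale :: 'n fan_coeff \<Rightarrow> 'n fan_vec \<Rightarrow> 'n fan_vec"
  by unfold_locales (rule poly_mapping_eqI; simp add: lookup_add algebra_simps)+

interpretation fvc: vector_space "\<lambda>c. coeff_scale (cst c :: 'n fan_coeff)"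
  by unfold_locales (simp_all add: fv.scale_right_distrib fv.scale_left_distrib cst_add cst_mult)

lemma coeff_scale_unit_vec: "coeff_scale f (unit_vec k) = Poly_Mapping.single k f"
  by (rule poly_mapping_eqI) (simp add: unit_vec_def lookup_single when_def)

lemma fan_vec_induct [case_names zero add]:
  assumes "P 0" "\<And>k f v. P v \<Longrightarrow> P (coeff_scale f (unit_vec k) + v)"
  shows "P v"
  by (rule poly_mapping_add_induct) (use assms in \<open>simp_all add: coeff_scale_unit_vec\<close>)

lemma theta_act_simps:
  shows theta_act_add: "gen_act X G (GTheta i) (u + v) = gen_act X G (GTheta i) u + gen_act X G (GTheta i) v"
    and theta_act_unit: "gen_act X G (GTheta i) (coeff_scale f (unit_vec k)) =
      coeff_scale (theta_coeff i f) (unit_vec k) + coeff_scale f (theta_unit X G i k)"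
    and theta_act_0: "gen_act X G (GTheta i) 0 = 0"
proof -
  show "gen_act X G (GTheta i) (u + v) = gen_act X G (GTheta i) u + gen_act X G (GTheta i) v"
    unfolding gen_act.simps
    by (rule setsum_keys_plus_distrib[where f = "\<lambda>k f. coeff_scale (theta_coeff i f) (unit_vec k) + coeff_scale f (theta_unit X G i k)"])
      (simp_all add: theta_coeff_add fv.scale_left_distrib)
qed (cases "f = 0"; simp add: coeff_scale_unit_vec)+

lemma theta_act_leibniz:
  "gen_act X G (GTheta i) (coeff_scale f v) =
     coeff_scale (theta_coeff i f) v + coeff_scale f (gen_act X G (GTheta i) v)"
proof (induction v rule: fan_vec_induct)
  case (add k g v)
  have "gen_act X G (GTheta i) (coeff_scale f (coeff_scale g (unit_vec k))) =
     coeff_scale (theta_coeff i f) (coeff_scale g (unit_vec k)) +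
     coeff_scale f (gen_act X G (GTheta i) (coeff_scale g (unit_vec k)))"
    by (simp only: fv.scale_scale theta_act_unit theta_coeff_mult fv.scale_left_distrib fv.scale_right_distrib)
      (simp add: ac_simps)
  with add show ?case
    by (simp only: theta_act_add fv.scale_right_distrib) (simp only: ac_simps)
qed (simp add: theta_act_0)

lemma del_act_simps:
  shows del_act_add: "gen_act X G (GDel l) (u + v) = gen_act X G (GDel l) u + gen_act X G (GDel l) v"
    and del_act_unit: "gen_act X G (GDel l) (coeff_scale f (unit_vec k)) =
      coeff_scale (del_coeff l f) (unit_vec k) + coeff_scale f (del_unit X l k)"
    and del_act_0: "gen_act X G (GDel l) 0 = 0"
proof -
  show "gen_act X G (GDel l) (u + v) = gen_act X G (GDel l) u + gen_act X G (GDel l) v"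
    unfolding gen_act.simps
    by (rule setsum_keys_plus_distrib[where f = "\<lambda>k f. coeff_scale (del_coeff l f) (unit_vec k) + coeff_scale f (del_unit X l k)"])
      (simp_all add: del_coeff_add fv.scale_left_distrib)
qed (cases "f = 0"; simp add: coeff_scale_unit_vec)+

lemma del_act_leibniz:
  "gen_act X G (GDel l) (coeff_scale f v) =
     coeff_scale (del_coeff l f) v + coeff_scale f (gen_act X G (GDel l) v)"
proof (induction v rule: fan_vec_induct)
  case (add k g v)
  have "gen_act X G (GDel l) (coeff_scale f (coeff_scale g (unit_vec k))) =
     coeff_scale (del_coeff l f) (coeff_scale g (unit_vec k)) +
     coeff_scale f (gen_act X G (GDel l) (coeff_scale g (unit_vec k)))"
    by (simp only: fv.scale_scale del_act_unit del_coeff_mult fv.scale_left_distrib fv.scale_right_distrib)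
      (simp add: ac_simps)
  with add show ?case
    by (simp only: del_act_add fv.scale_right_distrib) (simp only: ac_simps)
qed (simp add: del_act_0)

declare gen_act.simps(4,5) [simp del]

text \<open>The basis vector \<open>Q\<^bsup>x - \<Psi>(k)\<^esup> \<one>\<^sub>k\<close>, indexed by its total degree \<open>x\<close>: in these coordinates
  the operators no longer involve the defects \<open>d(k, l)\<close>.\<close>

definition deg_vec :: "('n::ab_group_add) stacky_data \<Rightarrow> (nat \<Rightarrow>\<^sub>0 rat) \<Rightarrow> 'n \<Rightarrow> 'n fan_vec" where
  "deg_vec X x k = coeff_scale (Qvar (x - Psi X k)) (unit_vec k)"

lemma unit_vec_deg: "unit_vec k = deg_vec X (Psi X k) k"
  by (simp add: deg_vec_def)

lemma Q_deg_vec: "coeff_scale (Qvar d) (deg_vec X x k) = deg_vec X (d + x) k"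
  by (simp add: deg_vec_def add_diff_eq flip: Qvar_add)

lemma scale_Q_ddeg: "coeff_scale (Qvar (x - Psi X k)) (coeff_scale (Qvar (ddeg X k l)) (unit_vec (k + l)))
    = deg_vec X (x + Psi X l) (k + l)"
proof -
  have eq: "x - Psi X k + ddeg X k l = x + Psi X l - Psi X (k + l)"
    by (simp add: ddeg_def)
  show ?thesis unfolding deg_vec_def fv.scale_scale Qvar_add[symmetric] eq ..
qed

lemma del_deg_vec: "gen_act X G (GDel l) (deg_vec X x k) = deg_vec X (x + Psi X l) (k + l)"
  unfolding deg_vec_def[of _ x] by (simp only: del_act_unit del_unit_def scale_Q_ddeg del_coeff_vars fv.scale_zero_left add_0)

text \<open>The Leibniz rule contributes x - \<Psi>(k) from the power of Q and the basis vector
  contributes \<Psi>(k); together the weight is x_i.\<close>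

lemma theta_deg_vec:
  "gen_act X G (GTheta i) (deg_vec X x k) =
     coeff_scale (zvar * cst (of_rat (lookup x i))) (deg_vec X x k) +
     (\<Sum>l\<in>S_set X G. coeff_scale (cst (of_rat (lookup (Psi X l) i)) * yvar l) (deg_vec X (x + Psi X l) (k + l)))"
proof -
  let ?Q = "Qvar (x - Psi X k) :: 'a fan_coeff"
  have "coeff_scale (cst (of_rat (lookup (x - Psi X k) i)) * zvar * ?Q) (unit_vec k) +
      coeff_scale ?Q (coeff_scale (zvar * cst (of_rat (lookup (Psi X k) i))) (unit_vec k)) =
      coeff_scale ((cst (of_rat (lookup (x - Psi X k) i)) + cst (of_rat (lookup (Psi X k) i))) * zvar * ?Q) (unit_vec k)"
    by (simp add: algebra_simps flip: fv.scale_left_distrib)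
  also have "cst (of_rat (lookup (x - Psi X k) i)) + cst (of_rat (lookup (Psi X k) i)) = (cst (of_rat (lookup x i)) :: 'a fan_coeff)"
    by (simp add: lookup_minus of_rat_diff flip: cst_add)
  finally have 1: "coeff_scale (cst (of_rat (lookup (x - Psi X k) i)) * zvar * ?Q) (unit_vec k) +
      coeff_scale ?Q (coeff_scale (zvar * cst (of_rat (lookup (Psi X k) i))) (unit_vec k)) =
      coeff_scale (zvar * cst (of_rat (lookup x i))) (deg_vec X x k)"
    by (simp add: deg_vec_def ac_simps)
  have 2: "coeff_scale ?Q (coeff_scale (c * yvar l * Qvar (ddeg X k l)) (unit_vec (k + l))) =
     coeff_scale (c * yvar l) (deg_vec X (x + Psi X l) (k + l))" for c l
  proof -
    have "coeff_scale ?Q (coeff_scale (c * yvar l * Qvar (ddeg X k l)) (unit_vec (k + l))) =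
      coeff_scale (c * yvar l) (coeff_scale ?Q (coeff_scale (Qvar (ddeg X k l)) (unit_vec (k + l))))"
      by (simp add: ac_simps)
    then show ?thesis by (simp only: scale_Q_ddeg)
  qed
  show ?thesis
    unfolding deg_vec_def[of _ x k]
    by (simp only: theta_act_unit theta_coeff_vars theta_unit_def fv.scale_right_distrib fv.scale_sum_right 2
        add.assoc[symmetric] 1) (simp only: deg_vec_def[of _ x k])
qed

text \<open>Two operators that satisfy Leibniz rules with commuting derivations commute as soon as they do
  on the basis vectors, because their commutator is linear over the coefficient ring.\<close>

lemma leibniz_commute:
  fixes A B :: "'n fan_vec \<Rightarrow> 'n fan_vec"
  assumes "\<And>u v. A (u + v) = A u + A v" "\<And>u v. B (u + v) = B u + B v" "A 0 = 0" "B 0 = 0"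
    and "\<And>f v. A (coeff_scale f v) = coeff_scale (a f) v + coeff_scale f (A v)"
    and "\<And>f v. B (coeff_scale f v) = coeff_scale (b f) v + coeff_scale f (B v)"
    and "\<And>f. a (b f) = b (a f)" "\<And>k. A (B (unit_vec k)) = B (A (unit_vec k))"
  shows "A (B v) = B (A v)"
proof (induction v rule: fan_vec_induct)
  case (add k f v)
  have "A (B (coeff_scale f (unit_vec k))) = B (A (coeff_scale f (unit_vec k)))"
    by (simp only: assms(1,2,5,6,7,8)) (simp only: ac_simps)
  with add show ?case by (simp add: assms(1,2))
qed (simp add: assms(3,4))

lemma del_del_act:
  "gen_act X G (GDel l) (gen_act X G (GDel k) v) = gen_act X G (GDel k) (gen_act X G (GDel l) v)"
proof (rule leibniz_commute[where A = "gen_act X G (GDel l)" and B = "gen_act X G (GDel k)" and a = "del_coeff l" and b = "del_coeff k",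
    OF del_act_add del_act_add del_act_0 del_act_0 del_act_leibniz del_act_leibniz del_del_coeff])
  show "gen_act X G (GDel l) (gen_act X G (GDel k) (unit_vec m)) = gen_act X G (GDel k) (gen_act X G (GDel l) (unit_vec m))" for m
    by (simp only: unit_vec_deg[of _ X] del_deg_vec) (simp only: ac_simps)
qed

lemma theta_act_sum: "gen_act X G (GTheta i) (\<Sum>l\<in>A. f l) = (\<Sum>l\<in>A. gen_act X G (GTheta i) (f l))"
  by (induction A rule: infinite_finite_induct) (simp_all add: theta_act_add theta_act_0)

lemma del_act_sum: "gen_act X G (GDel i) (\<Sum>l\<in>A. f l) = (\<Sum>l\<in>A. gen_act X G (GDel i) (f l))"
  by (induction A rule: infinite_finite_induct) (simp_all add: del_act_add del_act_0)

lemma theta_act_scale_y: "gen_act X G (GTheta i) (coeff_scale (cst c * yvar l) v) =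
    coeff_scale (cst c * yvar l) (gen_act X G (GTheta i) v)"
  by (simp add: theta_act_leibniz theta_coeff_mult theta_coeff_vars)

lemma theta_act_scale_z: "gen_act X G (GTheta i) (coeff_scale (zvar * cst c) v) =
    coeff_scale (zvar * cst c) (gen_act X G (GTheta i) v)"
  by (simp add: theta_act_leibniz theta_coeff_mult theta_coeff_vars)

text \<open>On a basis vector the composition expands into a diagonal term, a single sum and a
  double sum. The first two have coefficients symmetric in \<open>i\<close> and \<open>j\<close>; in
  the third, exchanging the summation indices exchanges \<open>i\<close> and
  \<open>j\<close>.\<close>

lemma theta_theta_act:
  "gen_act X G (GTheta i) (gen_act X G (GTheta j) v) = gen_act X G (GTheta j) (gen_act X G (GTheta i) v)"
proof (rule leibniz_commute[where A = "gen_act X G (GTheta i)" and B = "gen_act X G (GTheta j)" and a = "theta_coeff i" and b = "theta_coeff j",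
    OF theta_act_add theta_act_add theta_act_0 theta_act_0 theta_act_leibniz theta_act_leibniz theta_theta_coeff])
  fix k
  let ?U = "\<lambda>l. deg_vec X (Psi X k + Psi X l) (k + l)"
  let ?c = "\<lambda>x i. cst (of_rat (lookup x i)) :: 'a fan_coeff"
  have expand: "gen_act X G (GTheta i) (gen_act X G (GTheta j) (unit_vec k)) =
     coeff_scale (zvar * ?c (Psi X k) j * zvar * ?c (Psi X k) i) (unit_vec k) +
     (\<Sum>l\<in>S_set X G. coeff_scale ((zvar * ?c (Psi X k) j * ?c (Psi X l) i +
        zvar * ?c (Psi X k) i * ?c (Psi X l) j + zvar * ?c (Psi X l) i * ?c (Psi X l) j) * yvar l) (?U l)) +
     (\<Sum>l\<in>S_set X G. \<Sum>l'\<in>S_set X G. coeff_scale (?c (Psi X l) j * yvar l * (?c (Psi X l') i * yvar l'))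
        (deg_vec X (Psi X k + Psi X l + Psi X l') (k + l + l')))" for i j
  proof -
    have "gen_act X G (GTheta i) (gen_act X G (GTheta j) (unit_vec k)) =
      coeff_scale (zvar * ?c (Psi X k) j) (coeff_scale (zvar * ?c (Psi X k) i) (unit_vec k) +
         (\<Sum>l\<in>S_set X G. coeff_scale (?c (Psi X l) i * yvar l) (?U l))) +
      (\<Sum>l\<in>S_set X G. coeff_scale (?c (Psi X l) j * yvar l)
         (coeff_scale (zvar * ?c (Psi X k + Psi X l) i) (?U l) +
          (\<Sum>l'\<in>S_set X G. coeff_scale (?c (Psi X l') i * yvar l') (deg_vec X (Psi X k + Psi X l + Psi X l') (k + l + l')))))"
      by (simp only: unit_vec_deg[of k X] theta_deg_vec theta_act_add theta_act_sum theta_act_scale_y theta_act_scale_z)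
    also have "\<dots> = coeff_scale (zvar * ?c (Psi X k) j * zvar * ?c (Psi X k) i) (unit_vec k) +
       ((\<Sum>l\<in>S_set X G. coeff_scale (zvar * ?c (Psi X k) j * (?c (Psi X l) i * yvar l)) (?U l)) +
        (\<Sum>l\<in>S_set X G. coeff_scale (?c (Psi X l) j * yvar l * (zvar * ?c (Psi X k + Psi X l) i)) (?U l))) +
       (\<Sum>l\<in>S_set X G. \<Sum>l'\<in>S_set X G. coeff_scale (?c (Psi X l) j * yvar l * (?c (Psi X l') i * yvar l'))
        (deg_vec X (Psi X k + Psi X l + Psi X l') (k + l + l')))"
      by (simp only: fv.scale_right_distrib fv.scale_sum_right fv.scale_scale sum.distrib mult.assoc add.assoc)
    also have "(\<Sum>l\<in>S_set X G. coeff_scale (zvar * ?c (Psi X k) j * (?c (Psi X l) i * yvar l)) (?U l)) +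
        (\<Sum>l\<in>S_set X G. coeff_scale (?c (Psi X l) j * yvar l * (zvar * ?c (Psi X k + Psi X l) i)) (?U l)) =
       (\<Sum>l\<in>S_set X G. coeff_scale ((zvar * ?c (Psi X k) j * ?c (Psi X l) i +
        zvar * ?c (Psi X k) i * ?c (Psi X l) j + zvar * ?c (Psi X l) i * ?c (Psi X l) j) * yvar l) (?U l))"
      unfolding sum.distrib[symmetric] fv.scale_left_distrib[symmetric]
      by (intro sum.cong refl arg_cong2[where f = coeff_scale])
        (simp add: lookup_add of_rat_add cst_add algebra_simps)
    finally show ?thesis .
  qed
  have "(\<Sum>l\<in>S_set X G. \<Sum>l'\<in>S_set X G. coeff_scale (?c (Psi X l) j * yvar l * (?c (Psi X l') i * yvar l'))
        (deg_vec X (Psi X k + Psi X l + Psi X l') (k + l + l'))) =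
     (\<Sum>l\<in>S_set X G. \<Sum>l'\<in>S_set X G. coeff_scale (?c (Psi X l) i * yvar l * (?c (Psi X l') j * yvar l'))
        (deg_vec X (Psi X k + Psi X l + Psi X l') (k + l + l')))"
    by (subst sum.swap) (intro sum.cong refl; simp only: ac_simps)
  then show "gen_act X G (GTheta i) (gen_act X G (GTheta j) (unit_vec k)) =
      gen_act X G (GTheta j) (gen_act X G (GTheta i) (unit_vec k))"
    unfolding expand[of i j] expand[of j i] by (simp only: ac_simps)
qed

lemma del_act_scale_z: "gen_act X G (GDel i) (coeff_scale (zvar * cst c) v) =
    coeff_scale (zvar * cst c) (gen_act X G (GDel i) v)"
  by (simp add: del_act_leibniz del_coeff_mult del_coeff_vars)

text \<open>Applying z\<partial>_l to the factor y_l inside z\<vartheta>_i yields the extra term z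
  \<Psi>_i(l). This is the amount by which the weight z x_i grows when z\<partial>_l raises the
  degree by \<Psi>(l). The factor y_l does occur, since \<open>l\<close> lies in
  \<open>S_set X G\<close>.\<close>

lemma theta_del_act:
  assumes "finite (S_set X G)" "l \<in> S_set X G"
  shows "gen_act X G (GTheta i) (gen_act X G (GDel l) v) = gen_act X G (GDel l) (gen_act X G (GTheta i) v)"
proof (rule leibniz_commute[where A = "gen_act X G (GTheta i)" and B = "gen_act X G (GDel l)" and a = "theta_coeff i" and b = "del_coeff l",
    OF theta_act_add del_act_add theta_act_0 del_act_0 theta_act_leibniz del_act_leibniz theta_del_coeff])
  fix k
  let ?U = "\<lambda>l'. deg_vec X (Psi X k + Psi X l') (k + l')"
  let ?c = "\<lambda>x. cst (of_rat (lookup x i)) :: 'a fan_coeff"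
  have "gen_act X G (GDel l) (coeff_scale (?c (Psi X l') * yvar l') (?U l')) =
     (if l' = l then coeff_scale (zvar * ?c (Psi X l)) (?U l) else 0) +
     coeff_scale (?c (Psi X l') * yvar l') (deg_vec X (Psi X k + Psi X l + Psi X l') (k + l + l'))" for l'
    by (simp add: del_act_leibniz del_coeff_mult del_coeff_vars del_deg_vec ac_simps)
  then have "gen_act X G (GDel l) (gen_act X G (GTheta i) (unit_vec k)) =
     coeff_scale (zvar * ?c (Psi X k)) (?U l) +
     ((\<Sum>l'\<in>S_set X G. (if l' = l then coeff_scale (zvar * ?c (Psi X l)) (?U l) else 0)) +
      (\<Sum>l'\<in>S_set X G. coeff_scale (?c (Psi X l') * yvar l') (deg_vec X (Psi X k + Psi X l + Psi X l') (k + l + l'))))"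
    by (simp only: unit_vec_deg[of k X] theta_deg_vec del_act_add del_act_sum del_act_scale_z del_deg_vec sum.distrib)
  also have "(\<Sum>l'\<in>S_set X G. (if l' = l then coeff_scale (zvar * ?c (Psi X l)) (?U l) else 0)) =
      coeff_scale (zvar * ?c (Psi X l)) (?U l)"
    using assms by simp
  also have "coeff_scale (zvar * ?c (Psi X k)) (?U l) + (coeff_scale (zvar * ?c (Psi X l)) (?U l) +
      (\<Sum>l'\<in>S_set X G. coeff_scale (?c (Psi X l') * yvar l') (deg_vec X (Psi X k + Psi X l + Psi X l') (k + l + l')))) =
      gen_act X G (GTheta i) (?U l)"
    by (simp only: theta_deg_vec lookup_add of_rat_add cst_add distrib_left fv.scale_left_distrib add.assoc)
  finally show "gen_act X G (GTheta i) (gen_act X G (GDel l) (unit_vec k)) =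
      gen_act X G (GDel l) (gen_act X G (GTheta i) (unit_vec k))"
    by (simp only: unit_vec_deg[of k X] del_deg_vec)
qed

lemma (in stacky) fan_gens_iff [simp]:
  "GZ \<in> fan_gens X T" "GQ d \<in> fan_gens X T \<longleftrightarrow> d \<in> Lam_plus X" "GY k \<in> fan_gens X T \<longleftrightarrow> k \<in> T"
  "GTheta i \<in> fan_gens X T \<longleftrightarrow> i \<in> rays X" "GDel k \<in> fan_gens X T \<longleftrightarrow> k \<in> T"
  by (auto simp: fan_gens_def)

lemma fan_bracket_carrier:
  assumes "g \<in> fan_gens X T" "h \<in> fan_gens X T"
  shows "fan_bracket g h \<in> carrier (free_algebra_on (fan_gens X T))"
proof -
  have "GZ \<in> fan_gens X T" by (simp add: fan_gens_def)
  with assms show ?thesis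
    by (cases g; cases h) (auto intro!: free_algebra_on_closed)
qed

lemma (in stacky) presentation_fan: "presentation (fan_gens X T) (fan_rels X T)"
proof
  have "gen (GQ 0) - 1 \<in> carrier (free_algebra_on (fan_gens X T))"
    by (auto intro!: free_algebra_on_closed simp: Lam_plus_0)
  moreover have "gen (GQ d) * gen (GQ e) - gen (GQ (d + e)) \<in> carrier (free_algebra_on (fan_gens X T))"
    if "d \<in> Lam_plus X" "e \<in> Lam_plus X" for d e
    using that by (auto intro!: free_algebra_on_closed simp: Lam_plus_add)
  moreover have "gen g * gen h - gen h * gen g - fan_bracket g h \<in> carrier (free_algebra_on (fan_gens X T))"
    if "g \<in> fan_gens X T" "h \<in> fan_gens X T" for g h
    using that by (intro free_algebra_on_closed fan_bracket_carrier)
  ultimately show "fan_rels X T \<subseteq> carrier (free_algebra_on (fan_gens X T))"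
    unfolding fan_rels_def by blast
qed

section \<open>Coefficients, vectors and the action on the fan module\<close>

locale fan_setting = stacky X for X :: "('n::ab_group_add) stacky_data" +
  fixes G :: "'n set"
  assumes finite_G: "finite G" and G_NSupp: "G \<subseteq> NSupp X" and G_disjoint: "G \<inter> bvec X ` rays X = {}"
begin

abbreviation S where "S \<equiv> S_set X G"
abbreviation MC where "MC \<equiv> carrier (fan_module X G)"
abbreviation CR where "CR \<equiv> coeff_ring X S"

lemma finite_S: "finite S"
  by (simp add: S_set_def finite_G)

lemma S_NSupp: "l \<in> S \<Longrightarrow> l \<in> NSupp X"
  using G_NSupp bvec_NSupp by (auto simp: S_set_def)

lemma G_subset_S: "G \<subseteq> S"
  by (auto simp: S_set_def)

lemma bvec_S: "i \<in> rays X \<Longrightarrow> bvec X i \<in> S"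
  by (auto simp: S_set_def)

lemma sum_S: "(\<Sum>l\<in>S. f l) = (\<Sum>i\<in>rays X. f (bvec X i)) + (\<Sum>l\<in>G. f l)"
proof -
  have "(\<Sum>l\<in>S. f l) = (\<Sum>l\<in>bvec X ` rays X. f l) + (\<Sum>l\<in>G. f l)"
    unfolding S_set_def using finite_G G_disjoint by (intro sum.union_disjoint) auto
  then show ?thesis by (simp add: sum.reindex[OF inj_bvec])
qed

lemma CR_single: "d \<in> Lam_plus X \<Longrightarrow> keys e \<subseteq> S \<Longrightarrow> Poly_Mapping.single (n, d, e) c \<in> CR"
  by (cases "c = 0") (auto simp: coeff_ring_def)

lemma CR_0: "0 \<in> CR"
  by (simp add: coeff_ring_def)

lemma CR_add: "f \<in> CR \<Longrightarrow> g \<in> CR \<Longrightarrow> f + g \<in> CR"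
  unfolding coeff_ring_def using keys_add[of f g] by blast

lemma CR_sum: "(\<And>i. i \<in> I \<Longrightarrow> f i \<in> CR) \<Longrightarrow> (\<Sum>i\<in>I. f i) \<in> CR"
  by (induction I rule: infinite_finite_induct) (auto simp: CR_0 CR_add)

text \<open>The induction runs over sub-sums of \<open>f\<close>, which stay inside the coefficient
  ring, so membership is available in the step.\<close>

lemma CR_induct [consumes 1, case_names zero add]:
  assumes "f \<in> CR" "P 0"
    and step: "\<And>n d e c f. d \<in> Lam_plus X \<Longrightarrow> keys e \<subseteq> S \<Longrightarrow> f \<in> CR \<Longrightarrow> P f \<Longrightarrow>
      P (Poly_Mapping.single (n, d, e) c + f)"
  shows "P f"
proof -
  have partial: "P (\<Sum>m\<in>A. Poly_Mapping.single m (lookup f m))" if "finite A" "A \<subseteq> keys f" for A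
    using that
  proof (induction A rule: finite_induct)
    case (insert m A)
    obtain n d e where m: "m = (n, d, e)" by (cases m)
    have "(\<Sum>m\<in>A. Poly_Mapping.single m (lookup f m)) \<in> CR"
    proof (intro CR_sum)
      fix m' assume "m' \<in> A"
      then have "m' \<in> keys f" using insert.prems by blast
      with assms(1) show "Poly_Mapping.single m' (lookup f m') \<in> CR"
        by (cases m') (auto simp: coeff_ring_def intro!: CR_single[unfolded coeff_ring_def, simplified])
    qed
    with insert assms(1) show ?case by (auto simp: m coeff_ring_def intro!: step)
  qed (simp add: assms(2))
  have "(\<Sum>m\<in>keys f. Poly_Mapping.single m (lookup f m)) = f"
    by (rule poly_mapping_eqI) (simp add: lookup_sum lookup_single when_def in_keys_iff)
  with partial[of "keys f"] show ?thesis by simp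
qed

lemma CR_mult:
  assumes "f \<in> CR" "g \<in> CR"
  shows "f * g \<in> CR"
  unfolding coeff_ring_def
proof (intro CollectI ballI)
  fix m assume "m \<in> keys (f * g)"
  then obtain a b where ab: "m = a + b" "a \<in> keys f" "b \<in> keys g"
    using keys_mult[of f g] by blast
  obtain n d e n' d' e' where "a = (n, d, e)" "b = (n', d', e')" by (cases a, cases b)
  with ab assms show "case m of (n, d, e) \<Rightarrow> d \<in> Lam_plus X \<and> keys e \<subseteq> S"
    using keys_add[of e e'] by (fastforce simp: coeff_ring_def Lam_plus_add)
qed

lemma CR_vars: "cst c \<in> CR" "zvar \<in> CR" "d \<in> Lam_plus X \<Longrightarrow> Qvar d \<in> CR" "l \<in> S \<Longrightarrow> yvar l \<in> CR"
  by (auto simp: cst_def zvar_def Qvar_def yvar_def zero_prod_def intro!: CR_single Lam_plus_0)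

lemma CR_theta_coeff: "f \<in> CR \<Longrightarrow> theta_coeff i f \<in> CR"
  unfolding theta_coeff_def
proof (intro CR_sum)
  fix m assume f: "f \<in> CR" and m: "m \<in> keys f"
  obtain n d e where ne: "m = (n, d, e)" by (cases m)
  with f m have "d \<in> Lam_plus X" "keys e \<subseteq> S" by (auto simp: coeff_ring_def)
  then show "(case m of (n, d, e) \<Rightarrow> Poly_Mapping.single (n + 1, d, e)
      (of_rat (lookup d i) * lookup f (n, d, e))) \<in> CR"
    by (simp add: ne CR_single)
qed

lemma CR_del_coeff: "f \<in> CR \<Longrightarrow> del_coeff l f \<in> CR"
  unfolding del_coeff_def
proof (intro CR_sum)
  fix m assume f: "f \<in> CR" and m: "m \<in> keys f"
  obtain n d e where ne: "m = (n, d, e)" by (cases m)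
  have "keys (e - Poly_Mapping.single l 1) \<subseteq> keys e"
    by (auto simp: in_keys_iff lookup_minus)
  moreover from f m ne have "d \<in> Lam_plus X" "keys e \<subseteq> S" by (auto simp: coeff_ring_def)
  ultimately have "d \<in> Lam_plus X" "keys (e - Poly_Mapping.single l 1) \<subseteq> S" by auto
  then show "(case m of (n, d, e) \<Rightarrow> Poly_Mapping.single (n + 1, d, e - Poly_Mapping.single l 1)
      (of_nat (lookup e l) * lookup f (n, d, e))) \<in> CR"
    unfolding ne prod.case by (rule CR_single)
qed

lemma MC_iff: "v \<in> MC \<longleftrightarrow> keys v \<subseteq> NSupp X \<and> (\<forall>k. lookup v k \<in> CR)"
  by (simp add: fan_module_def)

lemma MC_0: "0 \<in> MC"
  by (simp add: MC_iff CR_0)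

lemma MC_add: "u \<in> MC \<Longrightarrow> v \<in> MC \<Longrightarrow> u + v \<in> MC"
  using keys_add[of u v] by (auto simp: MC_iff lookup_add CR_add)

lemma MC_scale: "f \<in> CR \<Longrightarrow> v \<in> MC \<Longrightarrow> coeff_scale f v \<in> MC"
proof -
  have "keys (coeff_scale f v) \<subseteq> keys v" by (auto simp: in_keys_iff)
  then show "f \<in> CR \<Longrightarrow> v \<in> MC \<Longrightarrow> coeff_scale f v \<in> MC" by (auto simp: MC_iff CR_mult)
qed

lemma MC_sum: "(\<And>i. i \<in> I \<Longrightarrow> f i \<in> MC) \<Longrightarrow> (\<Sum>i\<in>I. f i) \<in> MC"
  by (induction I rule: infinite_finite_induct) (auto simp: MC_0 MC_add)

lemma MC_unit: "k \<in> NSupp X \<Longrightarrow> unit_vec k \<in> MC"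
  using CR_0 CR_vars(1)[of 1] by (auto simp: MC_iff unit_vec_def lookup_single when_def)

lemma MC_theta_unit: "k \<in> NSupp X \<Longrightarrow> theta_unit X G i k \<in> MC"
  unfolding theta_unit_def
  by (auto intro!: MC_add MC_sum MC_scale MC_unit CR_mult CR_vars ddeg_Lam_plus NSupp_add intro: S_NSupp)

lemma MC_del_unit: "k \<in> NSupp X \<Longrightarrow> l \<in> S \<Longrightarrow> del_unit X l k \<in> MC"
  unfolding del_unit_def
  by (auto intro!: MC_scale MC_unit CR_vars ddeg_Lam_plus NSupp_add intro: S_NSupp)

lemma MC_act:
  assumes "g \<in> fan_gens X S" "v \<in> MC"
  shows "gen_act X G g v \<in> MC"
proof (cases g)
  case (GTheta i)
  show ?thesis
    unfolding GTheta gen_act.simps using assms(2)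
    by (intro MC_sum MC_add MC_scale MC_unit MC_theta_unit CR_theta_coeff) (auto simp: MC_iff)
next
  case (GDel l)
  then have "l \<in> S" using assms(1) by simp
  then show ?thesis
    unfolding GDel gen_act.simps using assms(2)
    by (intro MC_sum MC_add MC_scale MC_unit MC_del_unit CR_del_coeff) (auto simp: MC_iff)
qed (use assms in \<open>auto intro!: MC_scale CR_vars\<close>)

lemma MC_induct [consumes 1, case_names zero add]:
  assumes "v \<in> MC" "P 0"
    and step: "\<And>k f v. k \<in> NSupp X \<Longrightarrow> f \<in> CR \<Longrightarrow> v \<in> MC \<Longrightarrow> P v \<Longrightarrow> P (coeff_scale f (unit_vec k) + v)"
  shows "P v"
proof -
  have partial: "P (\<Sum>k\<in>A. coeff_scale (lookup v k) (unit_vec k))" if "finite A" "A \<subseteq> keys v" for A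
    using that
  proof (induction A rule: finite_induct)
    case (insert k A)
    have "(\<Sum>k\<in>A. coeff_scale (lookup v k) (unit_vec k)) \<in> MC"
      using insert.prems assms(1) by (intro MC_sum MC_scale MC_unit) (auto simp: MC_iff)
    with insert show ?case using assms(1) by (auto simp: MC_iff intro!: step)
  qed (simp add: assms(2))
  have "(\<Sum>k\<in>keys v. coeff_scale (lookup v k) (unit_vec k)) = v"
    by (rule poly_mapping_eqI)
      (simp add: coeff_scale_unit_vec lookup_sum lookup_single when_def in_keys_iff)
  with partial[of "keys v"] show ?thesis by simp
qed

text \<open>With T = S this is the action of D, with T = G that of D'. Only the commutators among
  the z\<vartheta>_i and z\<partial>_l involve the formulas on basis vectors; the others follow from
  the Leibniz rules.\<close>

lemma fan_module_rep:
  assumes "T \<subseteq> S"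
  shows "presented_rep (fan_gens X T) (fan_rels X T) (\<lambda>c. coeff_scale (cst c)) (gen_act X G) MC"
proof -
  have gens: "g \<in> fan_gens X S" if "g \<in> fan_gens X T" for g
    using that assms by (auto simp: fan_gens_def)
  interpret presentation "fan_gens X T" "fan_rels X T" by (rule presentation_fan)
  interpret generator_rep "fan_gens X T" "fan_rels X T" "\<lambda>c. coeff_scale (cst c)" "gen_act X G" MC
  proof
    show "fvc.subspace MC"
      unfolding fvc.subspace_def by (auto intro: MC_0 MC_add MC_scale CR_vars)
    fix g v assume g: "g \<in> fan_gens X T"
    show "gen_act X G g (u + v) = gen_act X G g u + gen_act X G g v" for u
      by (cases g) (simp_all add: fv.scale_right_distrib theta_act_add del_act_add)
    show "gen_act X G g (coeff_scale (cst c) v) = coeff_scale (cst c) (gen_act X G g v)" for c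
      by (cases g) (simp_all add: theta_act_leibniz theta_coeff_vars del_act_leibniz del_coeff_vars mult.commute)
    assume "v \<in> MC"
    then show "gen_act X G g v \<in> MC" by (rule MC_act[OF gens[OF g]])
  qed
  note FA = free_algebra_on_closed[where A = "fan_gens X T"]
  show ?thesis
  proof
    fix r v assume r: "r \<in> fan_rels X T" and v: "v \<in> MC"
    note ext = ext_diff ext_mult[OF _ _ v] ext_gen ext_1 ext_const
    from r consider "r = gen (GQ 0) - 1"
      | d e where "d \<in> Lam_plus X" "e \<in> Lam_plus X" "r = gen (GQ d) * gen (GQ e) - gen (GQ (d + e))"
      | g h where "g \<in> fan_gens X T" "h \<in> fan_gens X T" "r = gen g * gen h - gen h * gen g - fan_bracket g h"
      unfolding fan_rels_def by blast
    then show "ext r v = 0"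
    proof cases
      case 1
      then show ?thesis by (simp add: ext)
    next
      case 2
      then show ?thesis by (simp add: ext FA Qvar_add)
    next
      case 3
      have "gen_act X G g (gen_act X G h v) = gen_act X G h (gen_act X G g v) + ext (fan_bracket g h) v"
      proof -
        have MC_Q: "coeff_scale (Qvar d) v \<in> MC" if "d \<in> Lam_plus X" for d
          using that v by (intro MC_scale CR_vars)
        note simps = ext ext_mult[OF _ _ MC_Q] FA ext_0 ext_neg theta_act_leibniz theta_coeff_vars del_act_leibniz del_coeff_vars
        consider i j where "g = GTheta i" "h = GTheta j" | i l where "g = GTheta i" "h = GDel l" "l \<in> S"
          | i l where "g = GDel l" "h = GTheta i" "l \<in> S" | k l where "g = GDel k" "h = GDel l"
          | "\<forall>i l. g \<noteq> GTheta i \<and> g \<noteq> GDel l" | "\<forall>i l. h \<noteq> GTheta i \<and> h \<noteq> GDel l"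
          using 3(1,2) assms by (cases g; cases h) auto
        then show ?thesis
        proof cases
          case (1 i j)
          then show ?thesis using theta_theta_act[of X G i j v] by (simp add: ext_0)
        next
          case (2 i l)
          then show ?thesis using theta_del_act[OF finite_S, of l i v] by (simp add: ext_0)
        next
          case (3 i l)
          then show ?thesis using theta_del_act[OF finite_S, of l i v] by (simp add: ext_0)
        next
          case (4 k l)
          then show ?thesis using del_del_act[of X G k l v] by (simp add: ext_0)
        next
          case 5
          then show ?thesis using 3(1,2)
            by (cases g; cases h) (simp_all add: simps ac_simps)
        next
          case 6
          then show ?thesis using 3(1,2)
            by (cases g; cases h) (simp_all add: simps ac_simps)
        qed
      qed
      with 3 show ?thesis by (simp add: ext FA)
    qed
  qed
qed

end

section \<open>A mapping property of the fan D-module\<close>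

locale fan_rep = stacky X + presented_rep "fan_gens X T" "fan_rels X T" sc act C
  for X :: "('n::ab_group_add) stacky_data" and T :: "'n set"
    and sc :: "complex \<Rightarrow> 'w::ab_group_add \<Rightarrow> 'w" and act :: "'n fan_gen \<Rightarrow> 'w \<Rightarrow> 'w" and C :: "'w set"
begin

abbreviation Z where "Z \<equiv> act GZ"
abbreviation Q where "Q d \<equiv> act (GQ d)"
abbreviation Y where "Y l \<equiv> act (GY l)"
abbreviation Th where "Th i \<equiv> act (GTheta i)"
abbreviation De where "De l \<equiv> act (GDel l)"

lemma act_comm:
  assumes "g \<in> fan_gens X T" "h \<in> fan_gens X T" "v \<in> C"
  shows "act g (act h v) = act h (act g v) + ext (fan_bracket g h) v"
proof -
  have "gen g * gen h - gen h * gen g - fan_bracket g h \<in> fan_rels X T"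
    using assms unfolding fan_rels_def by blast
  from act_rels[OF this assms(3)]
  have "act g (act h v) - act h (act g v) = ext (fan_bracket g h) v"
    using assms by (simp add: ext_diff ext_mult free_algebra_on_closed ext_gen)
  then show ?thesis by (simp add: diff_eq_eq add.commute)
qed

lemma Q_0: "v \<in> C \<Longrightarrow> Q 0 v = v"
  using act_rels[of "gen (GQ 0) - 1" v] by (simp add: fan_rels_def ext_diff ext_gen ext_1)

lemma Q_add:
  assumes "d \<in> Lam_plus X" "e \<in> Lam_plus X" "v \<in> C"
  shows "Q (d + e) v = Q d (Q e v)"
proof -
  have "gen (GQ d) * gen (GQ e) - gen (GQ (d + e)) \<in> fan_rels X T"
    using assms unfolding fan_rels_def by blast
  from act_rels[OF this assms(3)] show ?thesis
    using assms by (simp add: ext_diff ext_mult free_algebra_on_closed ext_gen)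
qed

lemma Z_comm: "h \<in> fan_gens X T \<Longrightarrow> v \<in> C \<Longrightarrow> act h (Z v) = Z (act h v)"
  using act_comm[of h GZ v] by (cases h) (simp_all add: ext_0)

lemma Y_Q: "l \<in> T \<Longrightarrow> d \<in> Lam_plus X \<Longrightarrow> v \<in> C \<Longrightarrow> Y l (Q d v) = Q d (Y l v)"
  and De_Q: "l \<in> T \<Longrightarrow> d \<in> Lam_plus X \<Longrightarrow> v \<in> C \<Longrightarrow> De l (Q d v) = Q d (De l v)"
  and Q_Q: "d \<in> Lam_plus X \<Longrightarrow> e \<in> Lam_plus X \<Longrightarrow> v \<in> C \<Longrightarrow> Q d (Q e v) = Q e (Q d v)"
  and Y_Y: "l \<in> T \<Longrightarrow> k \<in> T \<Longrightarrow> v \<in> C \<Longrightarrow> Y l (Y k v) = Y k (Y l v)"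
  and De_De: "l \<in> T \<Longrightarrow> k \<in> T \<Longrightarrow> v \<in> C \<Longrightarrow> De l (De k v) = De k (De l v)"
  and Th_Th: "i \<in> rays X \<Longrightarrow> j \<in> rays X \<Longrightarrow> v \<in> C \<Longrightarrow> Th i (Th j v) = Th j (Th i v)"
  and Th_Y: "i \<in> rays X \<Longrightarrow> l \<in> T \<Longrightarrow> v \<in> C \<Longrightarrow> Th i (Y l v) = Y l (Th i v)"
  and Th_De: "i \<in> rays X \<Longrightarrow> l \<in> T \<Longrightarrow> v \<in> C \<Longrightarrow> Th i (De l v) = De l (Th i v)"
  and De_Y: "l \<in> T \<Longrightarrow> k \<in> T \<Longrightarrow> v \<in> C \<Longrightarrow> De l (Y k v) = Y k (De l v) + (if k = l then Z v else 0)"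
  using act_comm[of "GY l" "GQ d" v] act_comm[of "GDel l" "GQ d" v] act_comm[of "GQ d" "GQ e" v]
    act_comm[of "GY l" "GY k" v] act_comm[of "GDel l" "GDel k" v] act_comm[of "GTheta i" "GTheta j" v]
    act_comm[of "GTheta i" "GY l" v] act_comm[of "GTheta i" "GDel l" v] act_comm[of "GDel l" "GY k" v]
  by (simp_all add: ext_0 ext_gen)

lemma Th_Q:
  assumes "i \<in> rays X" "d \<in> Lam_plus X" "v \<in> C"
  shows "Th i (Q d v) = Q d (Th i v) + sc (of_rat (lookup d i)) (Z (Q d v))"
  using act_comm[of "GTheta i" "GQ d" v] assms
  by (simp add: ext_mult free_algebra_on_closed ext_gen ext_const act_closed)

lemma T_closed:
  "v \<in> C \<Longrightarrow> Z v \<in> C" "d \<in> Lam_plus X \<Longrightarrow> v \<in> C \<Longrightarrow> Q d v \<in> C" "l \<in> T \<Longrightarrow> v \<in> C \<Longrightarrow> Y l v \<in> C"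
  "i \<in> rays X \<Longrightarrow> v \<in> C \<Longrightarrow> Th i v \<in> C" "l \<in> T \<Longrightarrow> v \<in> C \<Longrightarrow> De l v \<in> C"
  by (simp_all add: act_closed)

definition op :: "('w \<Rightarrow> 'w) \<Rightarrow> bool" where
  "op A \<longleftrightarrow> (\<forall>v\<in>C. A v \<in> C) \<and> (\<forall>u\<in>C. \<forall>v\<in>C. A (u + v) = A u + A v) \<and> (\<forall>v\<in>C. \<forall>c. A (sc c v) = sc c (A v))"

lemma opD:
  assumes "op A"
  shows "v \<in> C \<Longrightarrow> A v \<in> C" "u \<in> C \<Longrightarrow> v \<in> C \<Longrightarrow> A (u + v) = A u + A v"
    "v \<in> C \<Longrightarrow> A (sc c v) = sc c (A v)"
  using assms by (auto simp: op_def)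

lemma op_0: "op A \<Longrightarrow> A 0 = 0"
  using opD(2)[of A 0 0] C_0 by simp

lemma op_sum: "op A \<Longrightarrow> (\<And>i. i \<in> I \<Longrightarrow> f i \<in> C) \<Longrightarrow> A (\<Sum>i\<in>I. f i) = (\<Sum>i\<in>I. A (f i))"
  by (induction I rule: infinite_finite_induct) (auto simp: op_0 opD(2) C_sum)

lemma op_act: "g \<in> fan_gens X T \<Longrightarrow> op (act g)"
  by (simp add: op_def act_closed act_add act_sc)

lemma op_cact: "P \<in> carrier D \<Longrightarrow> op (cact P)"
  by (auto simp: carrier_D op_def cact_cls ext_closed ext_add_right ext_sc_right C_add C_sc)

lemma op_funpow: "op A \<Longrightarrow> op (A ^^ n)"
  by (induction n) (auto simp: op_def)

lemma op_compose: "op A \<Longrightarrow> op B \<Longrightarrow> op (\<lambda>v. A (B v))"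
  by (auto simp: op_def)

lemma op_foldr: "(\<And>x. x \<in> set xs \<Longrightarrow> op (f x)) \<Longrightarrow> op (foldr f xs)"
  by (induction xs) (auto simp: op_def)

lemma commute_funpow:
  assumes "op A" "op B" "\<And>v. v \<in> C \<Longrightarrow> A (B v) = B (A v)" "v \<in> C"
  shows "A ((B ^^ n) v) = (B ^^ n) (A v)"
proof (induction n)
  case (Suc n)
  then show ?case using assms opD(1)[OF op_funpow[OF assms(2)]] by simp
qed simp

subsection \<open>The action of the coefficient ring\<close>

text \<open>The monomial y^e as an operator. A list fixes the order of the composition, which is
  immaterial on \<open>C\<close> for variables in \<open>T\<close>, since their operators commute.
  Variables outside \<open>xs\<close> are ignored and so act as 1, as the reduced case
  requires.\<close>

definition y_op :: "'n list \<Rightarrow> ('n \<Rightarrow>\<^sub>0 nat) \<Rightarrow> 'w \<Rightarrow> 'w" where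
  "y_op xs e = foldr (\<lambda>l. Y l ^^ lookup e l) xs"

lemma y_op_simps [simp]: "y_op [] e v = v" "y_op (l # xs) e v = (Y l ^^ lookup e l) (y_op xs e v)"
  by (simp_all add: y_op_def)

lemma op_y_op: "set xs \<subseteq> T \<Longrightarrow> op (y_op xs e)"
  unfolding y_op_def by (intro op_foldr op_funpow op_act) auto

lemma commute_y_op:
  assumes "op A" "set xs \<subseteq> T" "\<And>l v. l \<in> set xs \<Longrightarrow> v \<in> C \<Longrightarrow> A (Y l v) = Y l (A v)" "v \<in> C"
  shows "A (y_op xs e v) = y_op xs e (A v)"
  using assms(2,3)
proof (induction xs)
  case (Cons l xs)
  then have "A ((Y l ^^ lookup e l) (y_op xs e v)) = (Y l ^^ lookup e l) (A (y_op xs e v))"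
    using assms(1,4) by (intro commute_funpow op_act) (auto simp: opD(1)[OF op_y_op])
  with Cons show ?case by simp
qed simp

lemma y_op_add_single:
  assumes "set xs \<subseteq> T" "distinct xs" "v \<in> C"
  shows "y_op xs (Poly_Mapping.single l 1 + e) v = (if l \<in> set xs then Y l (y_op xs e v) else y_op xs e v)"
  using assms(1,2)
proof (induction xs)
  case (Cons k xs)
  then have kT: "k \<in> T" and c: "y_op xs e v \<in> C" using assms(3) by (auto simp: opD(1)[OF op_y_op])
  have "(Y k ^^ n) (Y l u) = Y l ((Y k ^^ n) u)" if "l \<in> T" "u \<in> C" for n u
    using that kT by (intro commute_funpow[symmetric] op_act) (auto simp: Y_Y)
  with Cons c show ?case
    by (auto simp: lookup_add lookup_single when_def)
qed simp

text \<open>The Weyl algebra identity for z\<partial> and a power of y. For n = 0 the truncated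
  exponent n - 1 is harmless, because its term has coefficient 0.\<close>

lemma De_Y_funpow:
  assumes "l \<in> T" "v \<in> C"
  shows "De l ((Y l ^^ n) v) = (Y l ^^ n) (De l v) + sc (of_nat n) (Z ((Y l ^^ (n - 1)) v))"
proof (induction n)
  case (Suc n)
  have c: "(Y l ^^ n) v \<in> C" "(Y l ^^ (n - 1)) v \<in> C" "(Y l ^^ n) (De l v) \<in> C" for n
    using assms by (auto intro!: opD(1)[OF op_funpow[OF op_act]] T_closed)
  have "De l ((Y l ^^ Suc n) v) = Y l (De l ((Y l ^^ n) v)) + Z ((Y l ^^ n) v)"
    using assms c by (simp add: De_Y)
  also have "Y l (De l ((Y l ^^ n) v)) = (Y l ^^ Suc n) (De l v) + sc (of_nat n) (Z (Y l ((Y l ^^ (n - 1)) v)))"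
    using assms c Suc by (simp add: act_add act_sc T_closed C_sc Z_comm)
  also have "sc (of_nat n) (Z (Y l ((Y l ^^ (n - 1)) v))) = sc (of_nat n) (Z ((Y l ^^ n) v))"
    by (cases n) simp_all
  finally show ?case by (simp add: scale_left_distrib)
qed (use assms in simp)

lemma De_y_op:
  assumes "set xs \<subseteq> T" "distinct xs" "v \<in> C" "l \<in> T"
  shows "De l (y_op xs e v) = y_op xs e (De l v) +
    (if l \<in> set xs then sc (of_nat (lookup e l)) (Z (y_op xs (e - Poly_Mapping.single l 1) v)) else 0)"
  using assms(1,2)
proof (induction xs)
  case (Cons k xs)
  then have kT: "k \<in> T" and c: "y_op xs e v \<in> C" "y_op xs e (De l v) \<in> C"
    and xs: "set xs \<subseteq> T" "distinct xs" "k \<notin> set xs" for e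
    using assms(3,4) by (auto simp: opD(1)[OF op_y_op] T_closed)
  note IH = Cons.IH[OF xs(1,2)]
  show ?case
  proof (cases "k = l")
    case True
    have "y_op ys (e - Poly_Mapping.single l 1) v = y_op ys e v" if "l \<notin> set ys" for ys
      using that by (induction ys) (auto simp: lookup_minus lookup_single when_def)
    then show ?thesis
      using True c xs IH assms(4) by (simp add: De_Y_funpow lookup_minus)
  next
    case False
    have op: "op (Y k ^^ lookup e k)" using kT by (intro op_funpow op_act) simp
    have "De l ((Y k ^^ lookup e k) (y_op xs e v)) = (Y k ^^ lookup e k) (De l (y_op xs e v))"
      using False kT assms(4) c by (intro commute_funpow op_act) (auto simp: De_Y)
    also have "\<dots> = (Y k ^^ lookup e k) (y_op xs e (De l v)) +
       (if l \<in> set xs then sc (of_nat (lookup e l)) (Z ((Y k ^^ lookup e k) (y_op xs (e - Poly_Mapping.single l 1) v))) else 0)"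
    proof -
      have "(Y k ^^ lookup e k) (Z u) = Z ((Y k ^^ lookup e k) u)" if "u \<in> C" for u
        using that kT by (intro commute_funpow[symmetric] op_act) (auto simp: Z_comm)
      then show ?thesis
        unfolding IH using c by (auto simp: opD[OF op] C_sc T_closed)
    qed
    finally show ?thesis using False by (simp add: lookup_minus lookup_single)
  qed
qed simp

definition mon_op :: "'n list \<Rightarrow> nat \<times> (nat \<Rightarrow>\<^sub>0 rat) \<times> ('n \<Rightarrow>\<^sub>0 nat) \<Rightarrow> 'w \<Rightarrow> 'w" where
  "mon_op xs = (\<lambda>(n, d, e) v. (Z ^^ n) (y_op xs e (Q d v)))"

text \<open>The action of the coefficient ring, put together from the operators of its generators.
  Compatibility with multiplication is needed for one generator at a time only, see
  \<open>co_z\<close>, \<open>co_Q\<close>, \<open>co_Y\<close> and \<open>co_cst\<close>.\<close>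

definition coeff_op :: "'n list \<Rightarrow> 'n fan_coeff \<Rightarrow> 'w \<Rightarrow> 'w" where
  "coeff_op xs f v = (\<Sum>m\<in>keys f. sc (lookup f m) (mon_op xs m v))"

lemma coeff_op_0: "coeff_op xs 0 v = 0"
  by (simp add: coeff_op_def)

lemma coeff_op_add: "coeff_op xs (f + g) v = coeff_op xs f v + coeff_op xs g v"
  unfolding coeff_op_def by (rule setsum_keys_plus_distrib) (simp_all add: scale_left_distrib)

lemma coeff_op_single: "coeff_op xs (Poly_Mapping.single m c) v = sc c (mon_op xs m v)"
  by (cases "c = 0") (simp_all add: coeff_op_def)

end

text \<open>The vectors \<open>w k\<close> satisfy the formulas for basis vectors; the
  \<open>if\<close> covers T = S and T = G at once, the second being the reduced case.\<close>

locale fan_mapping = fan_setting X G + fan_rep X T sc act C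
  for X :: "('n::ab_group_add) stacky_data" and G :: "'n set" and T :: "'n set"
    and sc :: "complex \<Rightarrow> 'w::ab_group_add \<Rightarrow> 'w" and act :: "'n fan_gen \<Rightarrow> 'w \<Rightarrow> 'w" and C :: "'w set" +
  fixes xs :: "'n list" and w :: "'n \<Rightarrow> 'w"
  assumes T_S: "T \<subseteq> S" and xs: "set xs = T" "distinct xs"
    and w_closed: "k \<in> NSupp X \<Longrightarrow> w k \<in> C"
    and De_w: "k \<in> NSupp X \<Longrightarrow> l \<in> T \<Longrightarrow> De l (w k) = Q (ddeg X k l) (w (k + l))"
    and Th_w: "k \<in> NSupp X \<Longrightarrow> i \<in> rays X \<Longrightarrow> Th i (w k) = sc (of_rat (lookup (Psi X k) i)) (Z (w k)) +
      (\<Sum>l\<in>S. sc (of_rat (lookup (Psi X l) i)) ((if l \<in> T then Y l else id) (Q (ddeg X k l) (w (k + l)))))"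
begin

abbreviation co where "co \<equiv> coeff_op xs"

lemma op_mon_op: "d \<in> Lam_plus X \<Longrightarrow> op (mon_op xs (n, d, e))"
proof -
  assume "d \<in> Lam_plus X"
  then have "op (\<lambda>v. y_op xs e (Q d v))"
    by (intro op_compose[OF op_y_op op_act]) (simp_all add: xs)
  then show ?thesis
    unfolding mon_op_def prod.case by (intro op_compose[OF op_funpow[OF op_act]]) simp_all
qed

lemma op_co: "f \<in> CR \<Longrightarrow> op (co f)"
proof -
  assume f: "f \<in> CR"
  then have mon: "op (mon_op xs m)" if "m \<in> keys f" for m
    using that by (cases m) (auto simp: coeff_ring_def intro: op_mon_op)
  show ?thesis
    unfolding op_def coeff_op_def
    by (auto intro!: C_sum C_sc sum.cong simp: opD[OF mon] scale_right_distrib scale_sum_right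
        mult.commute simp flip: sum.distrib)
qed

lemma commute_mon_op:
  assumes "op A" "\<And>v. v \<in> C \<Longrightarrow> A (Z v) = Z (A v)" "\<And>l v. l \<in> T \<Longrightarrow> v \<in> C \<Longrightarrow> A (Y l v) = Y l (A v)"
    "A (Q d v) = Q d (A v)" "d \<in> Lam_plus X" "v \<in> C"
  shows "A (mon_op xs (n, d, e) v) = mon_op xs (n, d, e) (A v)"
proof -
  have c: "Q d v \<in> C" "y_op xs e (Q d v) \<in> C" using assms by (simp_all add: T_closed opD(1)[OF op_y_op] xs)
  have "A ((Z ^^ n) (y_op xs e (Q d v))) = (Z ^^ n) (A (y_op xs e (Q d v)))"
    using assms c by (intro commute_funpow op_act) auto
  also have "A (y_op xs e (Q d v)) = y_op xs e (A (Q d v))"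
    using assms c xs by (intro commute_y_op) auto
  finally show ?thesis using assms by (simp add: mon_op_def)
qed

lemma commute_co:
  assumes "op A" "\<And>v. v \<in> C \<Longrightarrow> A (Z v) = Z (A v)" "\<And>l v. l \<in> T \<Longrightarrow> v \<in> C \<Longrightarrow> A (Y l v) = Y l (A v)"
    "\<And>d v. d \<in> Lam_plus X \<Longrightarrow> v \<in> C \<Longrightarrow> A (Q d v) = Q d (A v)" "f \<in> CR" "v \<in> C"
  shows "A (co f v) = co f (A v)"
proof -
  have m: "op (mon_op xs m)" "A (mon_op xs m v) = mon_op xs m (A v)" if "m \<in> keys f" for m
    using that assms by (cases m; auto simp: coeff_ring_def intro!: op_mon_op commute_mon_op)+
  have "A (co f v) = (\<Sum>m\<in>keys f. A (sc (lookup f m) (mon_op xs m v)))"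
    unfolding coeff_op_def using assms m by (intro op_sum) (auto intro!: C_sc simp: opD(1))
  also have "\<dots> = co f (A v)"
    unfolding coeff_op_def using assms m by (intro sum.cong refl) (simp add: opD[OF assms(1)] opD(1)[OF m(1)])
  finally show ?thesis .
qed

lemma co_z: "f \<in> CR \<Longrightarrow> v \<in> C \<Longrightarrow> co (zvar * f) v = Z (co f v)"
proof (induction f rule: CR_induct)
  case (add n d e c f)
  have "co (zvar * Poly_Mapping.single (n, d, e) c) v = Z (co (Poly_Mapping.single (n, d, e) c) v)"
    using add opD(1)[OF op_mon_op]
    by (simp add: zvar_def mult_single coeff_op_single act_sc) (simp add: mon_op_def)
  with add show ?case
    using opD(1)[OF op_co] CR_single by (simp add: distrib_left coeff_op_add act_add)
qed (simp_all add: coeff_op_0 act_0)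

lemma co_Q: "f \<in> CR \<Longrightarrow> v \<in> C \<Longrightarrow> d' \<in> Lam_plus X \<Longrightarrow> co (Qvar d' * f) v = co f (Q d' v)"
proof (induction f rule: CR_induct)
  case (add n d e c f)
  have "Q (d' + d) v = Q d (Q d' v)" using add by (simp add: Q_add Q_Q)
  then have "co (Qvar d' * Poly_Mapping.single (n, d, e) c) v = co (Poly_Mapping.single (n, d, e) c) (Q d' v)"
    by (simp add: Qvar_def mult_single coeff_op_single mon_op_def)
  with add show ?case by (simp add: distrib_left coeff_op_add)
qed (simp_all add: coeff_op_0)

lemma co_Y: "f \<in> CR \<Longrightarrow> v \<in> C \<Longrightarrow> l \<in> S \<Longrightarrow> co (yvar l * f) v = (if l \<in> T then Y l else id) (co f v)"
proof (induction f rule: CR_induct)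
  case (add n d e c f)
  have c: "Q d v \<in> C" "y_op xs e (Q d v) \<in> C" using add by (simp_all add: T_closed opD(1)[OF op_y_op] xs)
  have "(Z ^^ n) (Y l u) = Y l ((Z ^^ n) u)" if "l \<in> T" "u \<in> C" for u
    using that by (intro commute_funpow[symmetric] op_act) (auto simp: Z_comm)
  then have "mon_op xs (n, d, Poly_Mapping.single l 1 + e) v = (if l \<in> T then Y l else id) (mon_op xs (n, d, e) v)"
    unfolding mon_op_def prod.case using c by (subst y_op_add_single) (auto simp: xs)
  then have "co (yvar l * Poly_Mapping.single (n, d, e) c) v =
      (if l \<in> T then Y l else id) (co (Poly_Mapping.single (n, d, e) c) v)"
    using add opD(1)[OF op_mon_op] by (simp add: yvar_def mult_single coeff_op_single act_sc)
  with add show ?case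
    using opD(1)[OF op_co] CR_single by (auto simp: distrib_left coeff_op_add act_add)
qed (simp_all add: coeff_op_0 act_0)

lemma co_cst: "f \<in> CR \<Longrightarrow> v \<in> C \<Longrightarrow> co (cst c' * f) v = sc c' (co f v)"
proof (induction f rule: CR_induct)
  case (add n d e c f)
  then show ?case
    by (simp add: distrib_left coeff_op_add cst_def mult_single coeff_op_single scale_right_distrib)
qed (simp_all add: coeff_op_0)

lemma co_1: "v \<in> C \<Longrightarrow> co 1 v = v"
  using coeff_op_single[of xs "(0, 0, 0)" 1 v]
proof -
  assume "v \<in> C"
  moreover have "y_op ys 0 v = v" for ys by (induction ys) simp_all
  ultimately have "mon_op xs (0, 0, 0) v = v" by (simp add: mon_op_def Q_0)
  then show ?thesis using coeff_op_single[of xs "(0, 0, 0)" 1 v] by (simp flip: zero_prod_def)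
qed

text \<open>z\<vartheta>_i commutes with z and the y_l. The only contribution comes from Q^d and
  equals z d_i Q^d, which is what \<open>theta_coeff\<close> records.\<close>

lemma Th_co:
  assumes "f \<in> CR" "v \<in> C" "i \<in> rays X"
  shows "Th i (co f v) = co (theta_coeff i f) v + co f (Th i v)"
  using assms
proof (induction f rule: CR_induct)
  case (add n d e c f)
  have c: "Q d v \<in> C" "Q d (Th i v) \<in> C" "\<And>u. u \<in> C \<Longrightarrow> y_op xs e u \<in> C" "\<And>u. u \<in> C \<Longrightarrow> (Z ^^ n) u \<in> C"
    using add by (simp_all add: T_closed opD(1)[OF op_y_op] xs opD(1)[OF op_funpow[OF op_act]])
  have y: "y_op xs e (Z u) = Z (y_op xs e u)" "(Z ^^ n) (Z u) = Z ((Z ^^ n) u)" if "u \<in> C" for u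
    using that by (auto intro!: commute_y_op[symmetric] op_act simp: xs Z_comm funpow_swap1)
  have "Th i (mon_op xs (n, d, e) v) = (Z ^^ n) (y_op xs e (Th i (Q d v)))"
  proof -
    have "Th i ((Z ^^ n) (y_op xs e (Q d v))) = (Z ^^ n) (Th i (y_op xs e (Q d v)))"
      using add c by (intro commute_funpow op_act) (auto simp: Z_comm)
    also have "Th i (y_op xs e (Q d v)) = y_op xs e (Th i (Q d v))"
      using add c by (intro commute_y_op op_act) (auto simp: xs Th_Y)
    finally show ?thesis by (simp add: mon_op_def)
  qed
  also have "\<dots> = mon_op xs (n, d, e) (Th i v) + sc (of_rat (lookup d i)) (mon_op xs (Suc n, d, e) v)"
    using add c y by (simp add: Th_Q mon_op_def opD[OF op_y_op] xs opD[OF op_funpow[OF op_act]] C_sc T_closed)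
  finally have "Th i (co (Poly_Mapping.single (n, d, e) c) v) =
      co (theta_coeff i (Poly_Mapping.single (n, d, e) c)) v + co (Poly_Mapping.single (n, d, e) c) (Th i v)"
    using add opD(1)[OF op_mon_op]
    by (simp add: coeff_op_single theta_coeff_single act_sc scale_right_distrib mult.commute)
  with add show ?case
    using opD(1)[OF op_co] CR_single by (simp add: theta_coeff_add coeff_op_add act_add algebra_simps)
qed (simp_all add: coeff_op_0 act_0)

text \<open>Here z and Q^d commute with the operator, and only the powers of y_l contribute.\<close>

lemma De_co:
  assumes "f \<in> CR" "v \<in> C" "l \<in> T"
  shows "De l (co f v) = co (del_coeff l f) v + co f (De l v)"
  using assms
proof (induction f rule: CR_induct)
  case (add n d e c f)
  have c: "Q d v \<in> C" "Q d (De l v) \<in> C" "\<And>u e. u \<in> C \<Longrightarrow> y_op xs e u \<in> C" "\<And>u. u \<in> C \<Longrightarrow> (Z ^^ n) u \<in> C"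
    using add by (simp_all add: T_closed opD(1)[OF op_y_op] xs opD(1)[OF op_funpow[OF op_act]])
  have "De l (mon_op xs (n, d, e) v) = (Z ^^ n) (De l (y_op xs e (Q d v)))"
    unfolding mon_op_def prod.case using add c by (intro commute_funpow op_act) (auto simp: Z_comm)
  also have "De l (y_op xs e (Q d v)) = y_op xs e (Q d (De l v)) +
      sc (of_nat (lookup e l)) (Z (y_op xs (e - Poly_Mapping.single l 1) (Q d v)))"
    using add c by (subst De_y_op) (auto simp: xs De_Q)
  also have "(Z ^^ n) \<dots> = mon_op xs (n, d, e) (De l v) +
      sc (of_nat (lookup e l)) (mon_op xs (Suc n, d, e - Poly_Mapping.single l 1) v)"
    using c by (simp add: mon_op_def opD[OF op_funpow[OF op_act]] C_sc T_closed funpow_swap1)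
  finally have "De l (co (Poly_Mapping.single (n, d, e) c) v) =
      co (del_coeff l (Poly_Mapping.single (n, d, e) c)) v + co (Poly_Mapping.single (n, d, e) c) (De l v)"
    using add opD(1)[OF op_mon_op]
    by (simp add: coeff_op_single del_coeff_single act_sc scale_right_distrib mult.commute)
  with add show ?case
    using opD(1)[OF op_co] CR_single by (simp add: del_coeff_add coeff_op_add act_add algebra_simps)
qed (simp_all add: coeff_op_0 act_0)

definition lift :: "'n fan_vec \<Rightarrow> 'w" where
  "lift v = (\<Sum>k\<in>keys v. co (lookup v k) (w k))"

lemma lift_add: "lift (u + v) = lift u + lift v"
  unfolding lift_def
  by (rule setsum_keys_plus_distrib[where f = "\<lambda>k f. co f (w k)"]) (simp_all add: coeff_op_0 coeff_op_add)

lemma lift_0: "lift 0 = 0"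
  by (simp add: lift_def)

lemma lift_sum: "lift (\<Sum>i\<in>I. f i) = (\<Sum>i\<in>I. lift (f i))"
  by (induction I rule: infinite_finite_induct) (simp_all add: lift_0 lift_add)

lemma lift_scale_unit: "lift (coeff_scale f (unit_vec k)) = co f (w k)"
  by (cases "f = 0") (simp_all add: lift_def coeff_scale_unit_vec coeff_op_0)

lemma lift_unit: "k \<in> NSupp X \<Longrightarrow> lift (unit_vec k) = w k"
  using lift_scale_unit[of 1 k] by (simp add: co_1 w_closed)

lemma lift_closed: "v \<in> MC \<Longrightarrow> lift v \<in> C"
  by (induction v rule: MC_induct)
    (auto simp: lift_0 C_0 lift_add lift_scale_unit intro!: C_add opD(1)[OF op_co] w_closed)

lemma lift_scalars:
  assumes "v \<in> MC"
  shows lift_cst: "lift (coeff_scale (cst c) v) = sc c (lift v)"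
    and lift_z: "lift (coeff_scale zvar v) = Z (lift v)"
    and lift_Q: "d \<in> Lam_plus X \<Longrightarrow> lift (coeff_scale (Qvar d) v) = Q d (lift v)"
    and lift_y: "l \<in> S \<Longrightarrow> lift (coeff_scale (yvar l) v) = (if l \<in> T then Y l else id) (lift v)"
proof -
  have Q_co: "Q d (co f u) = co f (Q d u)" if "d \<in> Lam_plus X" "f \<in> CR" "u \<in> C" for d f u
    by (rule commute_co[where A = "Q d"]) (use that in \<open>auto simp: Z_comm Y_Q Q_Q op_act\<close>)
  have *: "lift (coeff_scale (cst c) v) = sc c (lift v) \<and> lift (coeff_scale zvar v) = Z (lift v) \<and>
    (d \<in> Lam_plus X \<longrightarrow> lift (coeff_scale (Qvar d) v) = Q d (lift v)) \<and>
    (l \<in> S \<longrightarrow> lift (coeff_scale (yvar l) v) = (if l \<in> T then Y l else id) (lift v))"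
    using assms
  proof (induction v rule: MC_induct)
    case (add k f v)
    note facts = lift_add fv.scale_right_distrib lift_scale_unit scale_right_distrib
      co_cst co_z co_Q co_Y w_closed Q_co act_add opD(1)[OF op_co] lift_closed
    show ?case using add by (auto simp: facts)
  qed (simp_all add: lift_0 act_0)
  then show "lift (coeff_scale (cst c) v) = sc c (lift v)" "lift (coeff_scale zvar v) = Z (lift v)"
    "d \<in> Lam_plus X \<Longrightarrow> lift (coeff_scale (Qvar d) v) = Q d (lift v)"
    "l \<in> S \<Longrightarrow> lift (coeff_scale (yvar l) v) = (if l \<in> T then Y l else id) (lift v)" by blast+
qed

text \<open>Both sides obey the same Leibniz rule with respect to coefficients, so it suffices to
  compare them on basis vectors, where the equation is the assumption \<open>Th_w\<close>.\<close>

lemma lift_Th: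
  assumes "v \<in> MC" "i \<in> rays X"
  shows "lift (gen_act X G (GTheta i) v) = Th i (lift v)"
  using assms(1)
proof (induction v rule: MC_induct)
  case zero
  then show ?case using assms(2) by (simp add: theta_act_0 lift_0 act_0)
next
  case (add k f v)
  have dd: "ddeg X k l \<in> Lam_plus X" "k + l \<in> NSupp X" "w (k + l) \<in> C" if "l \<in> S" for l
    using that add.hyps(1) by (auto intro!: ddeg_Lam_plus NSupp_add w_closed intro: S_NSupp)
  have commute_Z: "Z (co f u) = co f (Z u)" if "u \<in> C" for u
    by (rule commute_co[where A = Z])
      (use that add.hyps(2) in \<open>auto simp: Z_comm[of "GY _"] Z_comm[of "GQ _"] op_act\<close>)
  have commute_Y: "Y l (co f u) = co f (Y l u)" if "l \<in> T" "u \<in> C" for l u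
    by (rule commute_co[where A = "Y l"]) (use that add.hyps(2) in \<open>auto simp: Z_comm Y_Y Y_Q op_act\<close>)
  have "lift (coeff_scale f (theta_unit X G i k)) = co f (Th i (w k))"
  proof -
    have "lift (coeff_scale f (theta_unit X G i k)) =
      co (cst (of_rat (lookup (Psi X k) i)) * (zvar * f)) (w k) +
      (\<Sum>l\<in>S. co (cst (of_rat (lookup (Psi X l) i)) * (yvar l * (Qvar (ddeg X k l) * f))) (w (k + l)))"
      by (simp add: theta_unit_def fv.scale_right_distrib fv.scale_sum_right lift_add lift_sum lift_scale_unit
          mult.commute mult.left_commute mult.assoc)
    also have "\<dots> = sc (of_rat (lookup (Psi X k) i)) (co f (Z (w k))) +
      (\<Sum>l\<in>S. sc (of_rat (lookup (Psi X l) i)) (co f ((if l \<in> T then Y l else id) (Q (ddeg X k l) (w (k + l))))))"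
      using add.hyps dd
      by (intro arg_cong2[where f = "(+)"] sum.cong refl)
        (auto simp: co_cst co_z co_Y co_Q CR_mult CR_vars w_closed commute_Z commute_Y T_closed)
    also have "\<dots> = co f (Th i (w k))"
      using add.hyps dd assms(2) T_S
      by (subst Th_w) (auto simp: opD[OF op_co] op_sum[OF op_co] C_sum C_sc T_closed w_closed intro!: sum.cong)
    finally show ?thesis .
  qed
  then have "lift (gen_act X G (GTheta i) (coeff_scale f (unit_vec k))) = Th i (co f (w k))"
    using add.hyps assms(2) by (simp add: theta_act_unit lift_add lift_scale_unit Th_co w_closed)
  with add assms(2) show ?case
    using opD(1)[OF op_co] by (simp add: theta_act_add lift_add lift_scale_unit act_add w_closed lift_closed)
qed

lemma lift_De:
  assumes "v \<in> MC" "l \<in> T"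
  shows "lift (gen_act X G (GDel l) v) = De l (lift v)"
  using assms(1)
proof (induction v rule: MC_induct)
  case zero
  then show ?case using assms(2) by (simp add: del_act_0 lift_0 act_0)
next
  case (add k f v)
  have l: "l \<in> NSupp X" using assms(2) T_S S_NSupp by blast
  have "lift (coeff_scale f (del_unit X l k)) = co (Qvar (ddeg X k l) * f) (w (k + l))"
    by (simp add: del_unit_def lift_scale_unit mult.commute)
  also have "\<dots> = co f (De l (w k))"
    using add.hyps assms(2) l by (simp add: co_Q De_w w_closed NSupp_add ddeg_Lam_plus)
  finally have "lift (gen_act X G (GDel l) (coeff_scale f (unit_vec k))) = De l (co f (w k))"
    using add.hyps assms(2) by (simp add: del_act_unit lift_add lift_scale_unit De_co w_closed)
  with add assms(2) show ?case
    using opD(1)[OF op_co] by (simp add: del_act_add lift_add lift_scale_unit act_add w_closed lift_closed)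
qed

lemma lift_class_act:
  assumes "P \<in> carrier D" "v \<in> MC"
  shows "lift (class_act (\<lambda>c. coeff_scale (cst c)) (gen_act X G) P v) = cact P (lift v)"
proof (rule intertwine[OF fan_module_rep[OF T_S] presented_rep_axioms])
  show "lift (gen_act X G g v) = act g (lift v)" if "g \<in> fan_gens X T" "v \<in> MC" for g v
    using that T_S by (cases g) (auto simp: lift_z lift_Q lift_y lift_Th lift_De)
qed (use assms in \<open>simp_all add: lift_add lift_cst lift_closed\<close>)

end

section \<open>Monomial operators\<close>

text \<open>Exponents are given for all lattice points, but only those in \<open>A\<close> count; a
  variable set \<open>A\<close> allows induction over the factors.\<close>

definition del_monomial ::
  "('n::ab_group_add) stacky_data \<Rightarrow> 'n set \<Rightarrow> ('n \<Rightarrow> nat) \<Rightarrow> 'n set \<Rightarrow> 'n fan_gen free_alg set" where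
  "del_monomial X T a A =
     finprod (fan_ring X T) (\<lambda>l. fan_op X T (gen (GDel l)) [^]\<^bsub>fan_ring X T\<^esub> a l) A"

text \<open>What takes the place of the powers of z\<partial>_i in the relations P': one falling
  factorial for each ray.\<close>

definition red_product ::
  "('n::ab_group_add) stacky_data \<Rightarrow> 'n set \<Rightarrow> 'n \<Rightarrow> ('n \<Rightarrow> nat) \<Rightarrow> nat set \<Rightarrow> 'n fan_gen free_alg set" where
  "red_product X T k a A =
     finprod (fan_ring X T) (\<lambda>i. finprod (fan_ring X T) (P_red_factor X T k i) {..<a (bvec X i)}) A"

context fan_rep
begin

lemma fan_ring_eq: "fan_ring X T = D" and fan_op_eq: "fan_op X T = cls"
  by (simp_all add: fan_ring_def fan_op_def)

lemma cact_gen: "g \<in> fan_gens X T \<Longrightarrow> v \<in> C \<Longrightarrow> cact (cls (gen g)) v = act g v"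
  by (simp add: cact_cls free_algebra_on_closed ext_gen)

lemma cls_gen_closed: "g \<in> fan_gens X T \<Longrightarrow> cls (gen g) \<in> carrier D"
  by (intro cls_closed free_algebra_on_closed)

lemma cact_pow: "P \<in> carrier D \<Longrightarrow> v \<in> C \<Longrightarrow> cact (P [^]\<^bsub>D\<^esub> (n::nat)) v = (cact P ^^ n) v"
proof (induction n arbitrary: v)
  case (Suc n)
  then show ?case by (simp add: cact_mult cact_closed funpow_swap1)
qed (simp add: cact_one)

lemma cact_gen_pow:
  assumes "g \<in> fan_gens X T" "v \<in> C"
  shows "cact (cls (gen g) [^]\<^bsub>D\<^esub> (n::nat)) v = (act g ^^ n) v"
proof -
  have "(cact (cls (gen g)) ^^ n) v = (act g ^^ n) v \<and> (act g ^^ n) v \<in> C"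
    using assms by (induction n) (simp_all add: cact_gen act_closed)
  then show ?thesis using assms by (simp add: cact_pow cls_gen_closed)
qed

lemma ring_eqI:
  assumes "P \<in> carrier D" "P' \<in> carrier D"
    and "\<And>sc act C and v :: nat \<Rightarrow>\<^sub>0 'n fan_gen free_alg. fan_rep X T sc act C \<Longrightarrow> v \<in> C \<Longrightarrow>
      class_act sc act P v = class_act sc act P' v"
  shows "P = P'"
  by (rule presented_ring_eqI[OF assms(1,2)], rule assms(3), rule fan_rep.intro[OF stacky_axioms])

lemma De_commuting: "D.commuting (\<lambda>l. cls (gen (GDel l))) T"
  unfolding D.commuting_def
proof (intro conjI ballI)
  fix k l assume kl: "k \<in> T" "l \<in> T"
  show "cls (gen (GDel k)) \<otimes>\<^bsub>D\<^esub> cls (gen (GDel l)) = cls (gen (GDel l)) \<otimes>\<^bsub>D\<^esub> cls (gen (GDel k))"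
  proof (rule ring_eqI)
    fix sc' act' C' and v :: "nat \<Rightarrow>\<^sub>0 'n fan_gen free_alg"
    assume "fan_rep X T sc' act' C'" and v: "v \<in> C'"
    then interpret W: fan_rep X T sc' act' C' by simp
    show "W.cact (cls (gen (GDel k)) \<otimes>\<^bsub>D\<^esub> cls (gen (GDel l))) v = W.cact (cls (gen (GDel l)) \<otimes>\<^bsub>D\<^esub> cls (gen (GDel k))) v"
      using kl v by (simp add: W.cact_mult cls_gen_closed W.cact_gen W.act_closed W.De_De)
  qed (use kl in \<open>auto intro!: cls_gen_closed\<close>)
qed (auto intro!: cls_gen_closed)

lemma del_monomial_closed: "finite A \<Longrightarrow> A \<subseteq> T \<Longrightarrow> del_monomial X T a A \<in> carrier D"
  unfolding del_monomial_def fan_ring_eq fan_op_eq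
  by (intro D.finprod_commuting_closed D.commuting_pow D.commuting_subset[OF De_commuting])

lemma cact_del_monomial_empty: "v \<in> C \<Longrightarrow> cact (del_monomial X T a {}) v = v"
  by (simp add: del_monomial_def fan_ring_eq finprod_def cact_one)

lemma cact_del_monomial_insert:
  assumes "finite A" "l \<notin> A" "insert l A \<subseteq> T" "v \<in> C"
  shows "cact (del_monomial X T a (insert l A)) v = (De l ^^ a l) (cact (del_monomial X T a A) v)"
proof -
  have c: "del_monomial X T a A \<in> carrier D" using assms by (simp add: del_monomial_closed)
  have "del_monomial X T a (insert l A) = cls (gen (GDel l)) [^]\<^bsub>D\<^esub> a l \<otimes>\<^bsub>D\<^esub> del_monomial X T a A"
    unfolding del_monomial_def fan_ring_eq fan_op_eq
    by (intro D.finprod_commuting_insert D.commuting_pow D.commuting_subset[OF De_commuting] assms)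
  then show ?thesis
    using assms c by (simp add: cact_mult cls_gen_closed cact_gen_pow cact_closed)
qed

lemma cact_del_monomial_0: "finite A \<Longrightarrow> A \<subseteq> T \<Longrightarrow> v \<in> C \<Longrightarrow> cact (del_monomial X T (\<lambda>_. 0) A) v = v"
  by (induction A rule: finite_induct) (simp_all add: cact_del_monomial_empty cact_del_monomial_insert)

lemma cact_del_monomial_Z:
  assumes "finite A" "A \<subseteq> T" "v \<in> C"
  shows "cact (del_monomial X T a A) (Z v) = Z (cact (del_monomial X T a A) v)"
  using assms
proof (induction A rule: finite_induct)
  case empty
  then show ?case by (simp add: cact_del_monomial_empty act_closed)
next
  case (insert l A)
  then have c: "cact (del_monomial X T a A) v \<in> C"
    by (intro cact_closed del_monomial_closed) auto
  have "(De l ^^ n) (Z u) = Z ((De l ^^ n) u)" if "u \<in> C" for n u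
    using that insert.prems by (intro commute_funpow[symmetric] op_act) (auto simp: Z_comm)
  then show ?case
    using insert c by (simp add: cact_del_monomial_insert act_closed)
qed

lemma De_del_monomial:
  assumes "finite T" "l \<in> T" "v \<in> C"
  shows "De l (cact (del_monomial X T a T) v) = cact (del_monomial X T (a(l := Suc (a l))) T) v"
proof -
  have "del_monomial X T (a(l := Suc (a l))) T = cls (gen (GDel l)) \<otimes>\<^bsub>D\<^esub> del_monomial X T a T"
    unfolding del_monomial_def fan_ring_eq fan_op_eq by (rule D.finprod_pow_Suc[OF assms(1) De_commuting assms(2)])
  then show ?thesis
    using assms by (simp add: cact_mult cls_gen_closed cact_gen cact_closed del_monomial_closed)
qed

text \<open>z\<vartheta>_i without the Euler part of the variables in \<open>T\<close>. For T = S it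
  acts on 1_k as the scalar z \<Psi>_i(k), which is the content of the relation R; for T = G the
  operator z y_i \<partial>_i is added to this scalar.\<close>

definition eul :: "nat \<Rightarrow> 'w \<Rightarrow> 'w" where
  "eul i v = Th i v - (\<Sum>l\<in>T. sc (of_rat (lookup (Psi X l) i)) (Y l (De l v)))"

lemma op_eul: "i \<in> rays X \<Longrightarrow> op (eul i)"
  unfolding op_def eul_def
  by (auto simp: act_add act_sc act_closed scale_right_distrib sum.distrib scale_right_diff_distrib
      scale_sum_right mult.commute intro!: C_diff C_sum C_sc)

lemma Th_eq_eul: "Th i v = eul i v + (\<Sum>l\<in>T. sc (of_rat (lookup (Psi X l) i)) (Y l (De l v)))"
  by (simp add: eul_def)

lemma eul_Z: "i \<in> rays X \<Longrightarrow> v \<in> C \<Longrightarrow> eul i (Z v) = Z (eul i v)"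
  by (simp add: eul_def act_diff act_sum act_sc act_closed C_sum C_sc Z_comm)

text \<open>Since z\<vartheta>_i commutes with z\<partial>_l, the commutator comes from moving
  z\<partial>_l past y_l. So \<open>eul i\<close> is a weight operator for which z\<partial>_l has
  weight z \<Psi>_i(l).\<close>

lemma eul_De:
  assumes "finite T" "i \<in> rays X" "l \<in> T" "v \<in> C"
  shows "eul i (De l v) = De l (eul i v) + sc (of_rat (lookup (Psi X l) i)) (Z (De l v))"
proof -
  have "De l (eul i v) = Th i (De l v) - (\<Sum>k\<in>T. sc (of_rat (lookup (Psi X k) i)) (De l (Y k (De k v))))"
    using assms by (simp add: eul_def act_diff act_sum act_sc act_closed C_sum C_sc Th_De)
  also have "(\<Sum>k\<in>T. sc (of_rat (lookup (Psi X k) i)) (De l (Y k (De k v)))) =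
     (\<Sum>k\<in>T. sc (of_rat (lookup (Psi X k) i)) (Y k (De k (De l v))) +
        (if k = l then sc (of_rat (lookup (Psi X k) i)) (Z (De k v)) else 0))"
    using assms by (intro sum.cong refl) (simp add: De_Y act_closed De_De scale_right_distrib)
  also have "\<dots> = (\<Sum>k\<in>T. sc (of_rat (lookup (Psi X k) i)) (Y k (De k (De l v)))) +
      sc (of_rat (lookup (Psi X l) i)) (Z (De l v))"
    using assms by (simp add: sum.distrib)
  finally show ?thesis by (simp add: eul_def)
qed

lemma eul_De_funpow:
  assumes "finite T" "i \<in> rays X" "l \<in> T" "v \<in> C"
  shows "eul i ((De l ^^ n) v) = (De l ^^ n) (eul i v) +
    sc (of_nat n * of_rat (lookup (Psi X l) i)) (Z ((De l ^^ n) v))"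
proof (induction n)
  case (Suc n)
  have c: "(De l ^^ n) u \<in> C" if "u \<in> C" for u
    using that assms(3) by (intro opD(1)[OF op_funpow[OF op_act]]) simp_all
  have e: "eul i v \<in> C" using opD(1)[OF op_eul] assms by simp
  have "eul i (De l ((De l ^^ n) v)) = De l ((De l ^^ n) (eul i v)) +
      sc (of_nat n * of_rat (lookup (Psi X l) i)) (Z (De l ((De l ^^ n) v))) +
      sc (of_rat (lookup (Psi X l) i)) (Z (De l ((De l ^^ n) v)))"
    using assms c e Suc by (simp add: eul_De act_add act_sc act_closed C_sc Z_comm)
  then show ?case by (simp add: scale_left_distrib algebra_simps)
qed simp

text \<open>Weights add up: the monomial with exponents \<open>a\<close> raises the weight by z
  times the sum of the a_l \<Psi>_i(l).\<close>

lemma eul_del_monomial: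
  assumes "finite T" "i \<in> rays X" "v \<in> C" "finite A" "A \<subseteq> T"
  shows "eul i (cact (del_monomial X T a A) v) = cact (del_monomial X T a A) (eul i v) +
    sc (\<Sum>l\<in>A. of_nat (a l) * of_rat (lookup (Psi X l) i)) (Z (cact (del_monomial X T a A) v))"
  using assms(4,5)
proof (induction A rule: finite_induct)
  case empty
  then show ?case using opD(1)[OF op_eul] assms by (simp add: cact_del_monomial_empty)
next
  case (insert l A)
  let ?m = "cact (del_monomial X T a A)"
  have l: "l \<in> T" and A: "A \<subseteq> T" using insert.prems by auto
  have e: "eul i v \<in> C" using opD(1)[OF op_eul] assms by simp
  have c: "?m u \<in> C" if "u \<in> C" for u
    using that insert.hyps A by (simp add: cact_closed del_monomial_closed)
  have op: "op (De l ^^ a l)" using l by (intro op_funpow op_act) simp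
  have ZD: "(De l ^^ n) (Z u) = Z ((De l ^^ n) u)" if "u \<in> C" for u n
    using that l by (intro commute_funpow[symmetric] op_act) (simp_all add: Z_comm)
  have "eul i ((De l ^^ a l) (?m v)) = (De l ^^ a l) (?m (eul i v)) +
      sc (\<Sum>l\<in>A. of_nat (a l) * of_rat (lookup (Psi X l) i)) (Z ((De l ^^ a l) (?m v))) +
      sc (of_nat (a l) * of_rat (lookup (Psi X l) i)) (Z ((De l ^^ a l) (?m v)))"
    using assms l c e insert.IH[OF A] by (simp add: eul_De_funpow opD[OF op] C_sc act_closed ZD)
  then show ?case
    using insert assms(3) e
    by (simp add: cact_del_monomial_insert scale_left_distrib algebra_simps)
qed

lemma YD_YD:
  assumes "l \<in> T" "k \<in> T" "v \<in> C"
  shows "Y l (De l (Y k (De k v))) = Y k (De k (Y l (De l v)))"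
proof (cases "k = l")
  case False
  then show ?thesis using assms by (simp add: De_Y act_closed De_De[of l k] Y_Y[of l k])
qed simp

text \<open>In the expansion the operators z\<vartheta>_i and z\<vartheta>_j commute, the two mixed
  sums trade places, and in the double sum the Euler operators y_l z\<partial>_l commute with each
  other.\<close>

lemma eul_eul:
  assumes "i \<in> rays X" "j \<in> rays X" "v \<in> C"
  shows "eul i (eul j v) = eul j (eul i v)"
proof -
  let ?c = "\<lambda>l i. of_rat (lookup (Psi X l) i) :: complex"
  have expand: "eul i (eul j v) = Th i (Th j v) - (\<Sum>l\<in>T. sc (?c l j) (Y l (De l (Th i v)))) -
      (\<Sum>l\<in>T. sc (?c l i) (Y l (De l (Th j v)))) +
      (\<Sum>l\<in>T. \<Sum>k\<in>T. sc (?c l i * ?c k j) (Y l (De l (Y k (De k v)))))"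
    if "i \<in> rays X" "j \<in> rays X" for i j
    using that assms(3)
    by (simp add: eul_def act_diff act_sum act_sc act_closed C_sum C_sc C_diff Th_De Th_Y
        scale_right_diff_distrib scale_sum_right sum_subtractf)
  have "(\<Sum>l\<in>T. \<Sum>k\<in>T. sc (?c l i * ?c k j) (Y l (De l (Y k (De k v))))) =
      (\<Sum>l\<in>T. \<Sum>k\<in>T. sc (?c l j * ?c k i) (Y l (De l (Y k (De k v)))))"
    by (subst sum.swap) (intro sum.cong refl arg_cong2[where f = sc], simp, rule YD_YD[OF _ _ assms(3)])
  then show ?thesis
    using assms by (simp add: expand Th_Th[of i j])
qed

subsection \<open>The factors of the reduced relations\<close>

lemma red_factor_closed: "i \<in> rays X \<Longrightarrow> P_red_factor X T k i \<nu> \<in> carrier D"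
  unfolding P_red_factor_def fan_op_eq
  by (intro cls_closed free_algebra_on_closed free_algebra_on_sum) simp_all

lemma cact_red_factor:
  assumes "i \<in> rays X" "v \<in> C"
  shows "cact (P_red_factor X T k i \<nu>) v = eul i v - sc (of_nat \<nu> + of_rat (lookup (Psi X k) i)) (Z v)"
proof -
  let ?c = "of_nat \<nu> + of_rat (lookup (Psi X k) i)"
  have "(\<Sum>l\<in>T. const (of_rat (lookup (Psi X l) i)) * gen (GY l) * gen (GDel l)) \<in> carrier FA"
    by (intro free_algebra_on_closed free_algebra_on_sum) simp_all
  moreover have "gen (GTheta i) - const ?c * gen GZ \<in> carrier FA"
    using assms by (intro free_algebra_on_closed) simp_all
  ultimately show ?thesis
    unfolding P_red_factor_def fan_op_eq
    using assms by (simp add: cact_cls free_algebra_on_closed ext_diff ext_sum ext_mult ext_gen ext_const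
        act_closed eul_def)
qed

text \<open>Each factor is \<open>eul\<close> shifted by a multiple of z, where z is central and the
  operators \<open>eul\<close> commute. The equation in the ring is tested in all
  representations.\<close>

lemma red_factor_commute:
  assumes "i \<in> rays X" "j \<in> rays X"
  shows "P_red_factor X T k i \<nu> \<otimes>\<^bsub>D\<^esub> P_red_factor X T k j \<mu> = P_red_factor X T k j \<mu> \<otimes>\<^bsub>D\<^esub> P_red_factor X T k i \<nu>"
proof (rule ring_eqI)
  fix sc' act' C' and v :: "nat \<Rightarrow>\<^sub>0 'n fan_gen free_alg"
  assume "fan_rep X T sc' act' C'" and v: "v \<in> C'"
  then interpret W: fan_rep X T sc' act' C' by simp
  have c: "W.eul i v \<in> C'" "W.eul j v \<in> C'" using W.opD(1)[OF W.op_eul] assms v by simp_all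
  show "W.cact (P_red_factor X T k i \<nu> \<otimes>\<^bsub>D\<^esub> P_red_factor X T k j \<mu>) v =
      W.cact (P_red_factor X T k j \<mu> \<otimes>\<^bsub>D\<^esub> P_red_factor X T k i \<nu>) v"
  proof -
    have d: "W.eul m (u - sc' c u') = W.eul m u - sc' c (W.eul m u')"
      if "u \<in> C'" "u' \<in> C'" "m \<in> rays X" for m u u' c
      using W.opD(2)[OF W.op_eul, of m "sc' (- c) u'" u] W.opD(3)[OF W.op_eul, of m u' "- c"] that
      by (simp add: W.C_sc W.C_neg add.commute)
    define \<alpha> :: complex where "\<alpha> = of_nat \<nu> + of_rat (lookup (Psi X k) i)"
    define \<beta> :: complex where "\<beta> = of_nat \<mu> + of_rat (lookup (Psi X k) j)"
    have F: "W.cact (P_red_factor X T k i \<nu>) u = W.eul i u - sc' \<alpha> (W.Z u)"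
      "W.cact (P_red_factor X T k j \<mu>) u = W.eul j u - sc' \<beta> (W.Z u)" if "u \<in> C'" for u
      using that assms by (simp_all add: W.cact_red_factor \<alpha>_def \<beta>_def)
    have "W.eul j v - sc' \<beta> (W.Z v) \<in> C'" "W.eul i v - sc' \<alpha> (W.Z v) \<in> C'"
      using v c by (auto intro!: W.C_diff W.C_sc W.act_closed)
    then show ?thesis
      using assms v c W.eul_eul[of i j v]
      by (simp add: W.cact_mult red_factor_closed F d W.act_closed W.C_sc W.eul_Z W.act_diff W.act_sc
          W.scale_right_diff_distrib mult.commute)
  qed
qed (use assms in \<open>auto intro!: red_factor_closed\<close>)

lemma red_factor_commuting: "i \<in> rays X \<Longrightarrow> D.commuting (P_red_factor X T k i) A"
  by (simp add: D.commuting_def red_factor_closed red_factor_commute)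

lemma red_inner_commute:
  assumes "i \<in> rays X" "j \<in> rays X"
  shows "P_red_factor X T k i \<nu> \<otimes>\<^bsub>D\<^esub> finprod D (P_red_factor X T k j) {..<n} =
    finprod D (P_red_factor X T k j) {..<n::nat} \<otimes>\<^bsub>D\<^esub> P_red_factor X T k i \<nu>"
  using assms by (intro D.finprod_commuting_commute red_factor_commuting red_factor_closed red_factor_commute) simp_all

lemma red_inner_closed: "i \<in> rays X \<Longrightarrow> finprod D (P_red_factor X T k i) {..<n::nat} \<in> carrier D"
  by (intro D.finprod_commuting_closed red_factor_commuting) simp_all

lemma red_outer_commuting:
  assumes "A \<subseteq> rays X"
  shows "D.commuting (\<lambda>i. finprod D (P_red_factor X T k i) {..<a (bvec X i)}) A"
  unfolding D.commuting_def
proof (intro conjI ballI)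
  fix i j assume "i \<in> A" "j \<in> A"
  with assms have ij: "i \<in> rays X" "j \<in> rays X" by auto
  show "finprod D (P_red_factor X T k i) {..<a (bvec X i)} \<otimes>\<^bsub>D\<^esub> finprod D (P_red_factor X T k j) {..<a (bvec X j)} =
      finprod D (P_red_factor X T k j) {..<a (bvec X j)} \<otimes>\<^bsub>D\<^esub> finprod D (P_red_factor X T k i) {..<a (bvec X i)}"
    using ij red_inner_commute[OF ij(2,1)]
    by (intro D.finprod_commuting_commute red_factor_commuting red_inner_closed) simp_all
qed (use assms in \<open>auto intro!: red_inner_closed\<close>)

lemma red_product_closed: "A \<subseteq> rays X \<Longrightarrow> red_product X T k a A \<in> carrier D"
  unfolding red_product_def fan_ring_eq
  by (intro D.finprod_commuting_closed red_outer_commuting) (auto intro: finite_subset)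

lemma red_inner_Suc:
  "i \<in> rays X \<Longrightarrow> finprod D (P_red_factor X T k i) {..<Suc n} =
    P_red_factor X T k i n \<otimes>\<^bsub>D\<^esub> finprod D (P_red_factor X T k i) {..<n}"
  unfolding lessThan_Suc by (intro D.finprod_commuting_insert red_factor_commuting) simp_all

lemma red_product_insert:
  assumes "finite A" "i \<notin> A" "insert i A \<subseteq> rays X"
  shows "red_product X T k a (insert i A) =
    finprod D (P_red_factor X T k i) {..<a (bvec X i)} \<otimes>\<^bsub>D\<^esub> red_product X T k a A"
  unfolding red_product_def fan_ring_eq by (intro D.finprod_commuting_insert red_outer_commuting assms)

lemma cact_red_product_0: "finite A \<Longrightarrow> A \<subseteq> rays X \<Longrightarrow> v \<in> C \<Longrightarrow> cact (red_product X T k (\<lambda>_. 0) A) v = v"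
proof (induction A rule: finite_induct)
  case empty
  then show ?case by (simp add: red_product_def fan_ring_eq finprod_def cact_one)
next
  case (insert i A)
  then show ?case
    by (simp add: red_product_insert finprod_def cact_mult red_product_closed cact_one)
qed

text \<open>Factors are numbered from 0, so the new one carries the old exponent as its index. No
  other ray is affected, because the b_i are distinct.\<close>

lemma red_product_Suc:
  assumes i: "i \<in> rays X"
  shows "red_product X T k (a(bvec X i := Suc (a (bvec X i)))) (rays X) =
    P_red_factor X T k i (a (bvec X i)) \<otimes>\<^bsub>D\<^esub> red_product X T k a (rays X)"
proof -
  let ?f = "\<lambda>a i. finprod D (P_red_factor X T k i) {..<a (bvec X i)}"
  let ?F = "P_red_factor X T k i (a (bvec X i))"
  have "red_product X T k (a(bvec X i := Suc (a (bvec X i)))) (rays X) = finprod D ((?f a)(i := ?F \<otimes>\<^bsub>D\<^esub> ?f a i)) (rays X)"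
    unfolding red_product_def fan_ring_eq
  proof (rule D.finprod_commuting_cong[OF finite_rays red_outer_commuting[OF subset_refl]])
    fix j assume j: "j \<in> rays X"
    show "?f (a(bvec X i := Suc (a (bvec X i)))) j = ((?f a)(i := ?F \<otimes>\<^bsub>D\<^esub> ?f a i)) j"
      using i j inj_bvec by (cases "j = i") (simp_all add: red_inner_Suc inj_on_eq_iff)
  qed
  also have "\<dots> = ?F \<otimes>\<^bsub>D\<^esub> finprod D (?f a) (rays X)"
    using i by (intro D.finprod_commuting_update red_outer_commuting red_factor_closed red_inner_commute) simp_all
  finally show ?thesis by (simp add: red_product_def fan_ring_eq)
qed

text \<open>The factor by which the larger product exceeds the smaller one is \<open>eul i\<close>
  minus a multiple of z; solving for \<open>eul i\<close> gives the formula. It shows that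
  z\<vartheta>_i raises the exponent of b_i, the role that z\<partial>_i has in the unreduced
  case.\<close>

lemma eul_red_product:
  assumes i: "i \<in> rays X" and v: "v \<in> C"
  shows "eul i (cact (red_product X T k a (rays X)) v) =
    cact (red_product X T k (a(bvec X i := Suc (a (bvec X i)))) (rays X)) v +
    sc (of_nat (a (bvec X i)) + of_rat (lookup (Psi X k) i)) (Z (cact (red_product X T k a (rays X)) v))"
  using i v red_product_closed[of "rays X" k a]
  by (simp add: red_product_Suc cact_mult red_factor_closed cact_red_factor cact_closed)

end

context fan_setting
begin

section \<open>The relations in the fan D-module\<close>

abbreviation mact where "mact \<equiv> class_act (\<lambda>c. coeff_scale (cst c)) (gen_act X G)"

lemma fan_module_fan_rep: "T \<subseteq> S \<Longrightarrow> fan_rep X T (\<lambda>c. coeff_scale (cst c)) (gen_act X G) MC"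
  by (rule fan_rep.intro[OF stacky_axioms fan_module_rep])

lemma fan_module_simps [simp]:
  "zero (fan_module X G) = 0" "add (fan_module X G) = (+)" "smult (fan_module X G) = mact"
  by (simp_all add: fan_module_def fun_eq_iff class_act_def alg_act_def free_act_def)

lemma fan_left_module:
  assumes "T \<subseteq> S"
  shows "left_module (fan_ring X T) (fan_module X G)"
proof -
  interpret M: fan_rep X T "\<lambda>c. coeff_scale (cst c)" "gen_act X G" MC by (rule fan_module_fan_rep[OF assms])
  show ?thesis unfolding M.fan_ring_eq by (rule M.class_act_module) simp_all
qed

lemma fan_finsum:
  assumes "finite I" "f \<in> I \<rightarrow> MC"
  shows "finsum (fan_module X G) f I = (\<Sum>i\<in>I. f i)"
proof -
  interpret M: left_module "fan_ring X S" "fan_module X G" by (rule fan_left_module) simp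
  show ?thesis
    using assms
  proof (induction I rule: finite_induct)
    case (insert i I)
    then have "f i \<in> MC" "f \<in> I \<rightarrow> MC" by auto
    with insert show ?case by simp
  qed simp
qed

text \<open>Every monomial is a product of a constant, a power of z, one Q^d and powers of single
  variables y_l, which can be applied one after the other.\<close>

lemma coeff_closed:
  assumes H: "\<And>c v. v \<in> H \<Longrightarrow> coeff_scale (cst c) v \<in> H" "\<And>v. v \<in> H \<Longrightarrow> coeff_scale zvar v \<in> H"
    "\<And>d v. d \<in> Lam_plus X \<Longrightarrow> v \<in> H \<Longrightarrow> coeff_scale (Qvar d) v \<in> H"
    "\<And>l v. l \<in> S \<Longrightarrow> v \<in> H \<Longrightarrow> coeff_scale (yvar l) v \<in> H"
    and add: "0 \<in> H" "\<And>u v. u \<in> H \<Longrightarrow> v \<in> H \<Longrightarrow> u + v \<in> H"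
    and f: "f \<in> CR" and v: "v \<in> H"
  shows "coeff_scale f v \<in> H"
  using f
proof (induction f rule: CR_induct)
  case (add n d e c f)
  have z: "coeff_scale (Poly_Mapping.single (n, 0, 0) 1) u \<in> H" if "u \<in> H" for n u
    using that
  proof (induction n)
    case (Suc n)
    have "Poly_Mapping.single (Suc n, 0, 0) 1 = zvar * (Poly_Mapping.single (n, 0, 0) 1 :: 'n fan_coeff)"
      by (simp add: zvar_def mult_single)
    with Suc H(2) show ?case by (simp flip: fv.scale_scale)
  qed (simp flip: zero_prod_def)
  have y1: "coeff_scale (Poly_Mapping.single (0, 0, Poly_Mapping.single l m) 1) u \<in> H" if "l \<in> S" "u \<in> H" for l m u
    using that
  proof (induction m)
    case (Suc m)
    have "Poly_Mapping.single (0, 0, Poly_Mapping.single l (Suc m)) 1 =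
        yvar l * (Poly_Mapping.single (0, 0, Poly_Mapping.single l m) 1 :: 'n fan_coeff)"
      by (simp add: yvar_def mult_single flip: single_add)
    with Suc H(4) show ?case by (simp flip: fv.scale_scale)
  qed (simp flip: zero_prod_def)
  have y: "coeff_scale (Poly_Mapping.single (0, 0, e) 1) u \<in> H" if "keys e \<subseteq> S" "u \<in> H" for e :: "'n \<Rightarrow>\<^sub>0 nat" and u
    using that
  proof (induction e rule: poly_mapping_add_induct)
    case (add l m e)
    have "keys e \<subseteq> S"
      using add.prems(1) by (auto simp: in_keys_iff lookup_add lookup_single subset_iff)
    moreover have "l \<in> keys (Poly_Mapping.single l m + e)" if "m \<noteq> 0"
      using that by (simp add: in_keys_iff lookup_add)
    then have "m = 0 \<or> l \<in> S"
      using add.prems(1) by blast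
    moreover have "Poly_Mapping.single (0, 0, Poly_Mapping.single l m + e) 1 =
        Poly_Mapping.single (0, 0, Poly_Mapping.single l m) 1 * (Poly_Mapping.single (0, 0, e) 1 :: 'n fan_coeff)"
      by (simp add: mult_single)
    ultimately show ?case
      using add y1 by (cases "m = 0") (simp_all flip: fv.scale_scale)
  qed (simp flip: zero_prod_def)
  have "Poly_Mapping.single (n, d, e) c =
      cst c * (Poly_Mapping.single (n, 0, 0) 1 * (Qvar d * Poly_Mapping.single (0, 0, e) 1))"
    by (simp add: cst_def Qvar_def zero_prod_def mult_single)
  then have "coeff_scale (Poly_Mapping.single (n, d, e) c) v \<in> H"
    using add v H z y by (simp flip: fv.scale_scale)
  with add assms(6) show ?case by (simp add: fv.scale_left_distrib)
qed (simp add: add(1))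

lemma MC_subsetI:
  assumes "\<And>c v. v \<in> H \<Longrightarrow> coeff_scale (cst c) v \<in> H" "\<And>v. v \<in> H \<Longrightarrow> coeff_scale zvar v \<in> H"
    "\<And>d v. d \<in> Lam_plus X \<Longrightarrow> v \<in> H \<Longrightarrow> coeff_scale (Qvar d) v \<in> H"
    "\<And>l v. l \<in> S \<Longrightarrow> v \<in> H \<Longrightarrow> coeff_scale (yvar l) v \<in> H"
    "0 \<in> H" "\<And>u v. u \<in> H \<Longrightarrow> v \<in> H \<Longrightarrow> u + v \<in> H"
    "\<And>k. k \<in> NSupp X \<Longrightarrow> unit_vec k \<in> H"
  shows "MC \<subseteq> H"
proof
  fix v assume "v \<in> MC"
  then show "v \<in> H"
    by (induction v rule: MC_induct) (auto intro!: assms(5,6,7) coeff_closed[of H, OF assms(1-6)])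
qed

lemma del_funpow_deg_vec:
  "(gen_act X G (GDel l) ^^ n) (deg_vec X x k) = deg_vec X (x + nmul n (Psi X l)) (k + nmul n l)"
  by (induction n) (simp_all add: del_deg_vec nmul_Suc ac_simps)

lemma del_monomial_deg_vec:
  assumes "T \<subseteq> S" "deg_vec X x k \<in> MC" "finite A" "A \<subseteq> T"
  shows "mact (del_monomial X T a A) (deg_vec X x k) =
    deg_vec X (x + (\<Sum>l\<in>A. nmul (a l) (Psi X l))) (k + (\<Sum>l\<in>A. nmul (a l) l))"
proof -
  interpret M: fan_rep X T "\<lambda>c. coeff_scale (cst c)" "gen_act X G" MC by (rule fan_module_fan_rep[OF assms(1)])
  show ?thesis
    using assms(3,4)
  proof (induction A rule: finite_induct)
    case empty
    then show ?case using assms(2) by (simp add: M.cact_del_monomial_empty)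
  next
    case (insert l A)
    then show ?case
      using assms(2) by (simp add: M.cact_del_monomial_insert del_funpow_deg_vec ac_simps)
  qed
qed

lemma unit_deg_MC: "k \<in> NSupp X \<Longrightarrow> deg_vec X (Psi X k) k \<in> MC"
  using MC_unit by (simp flip: unit_vec_deg)

lemma P_op_eq: "P_op X G d a = fan_op X S (gen (GQ d)) \<otimes>\<^bsub>fan_ring X S\<^esub> del_monomial X S a S"
  by (simp add: P_op_def del_monomial_def Let_def)

lemma P_op_closed:
  assumes "d \<in> Lam_plus X"
  shows "P_op X G d a \<in> carrier (fan_ring X S)"
proof -
  interpret M: fan_rep X S "\<lambda>c. coeff_scale (cst c)" "gen_act X G" MC by (rule fan_module_fan_rep) simp
  show ?thesis
    using assms finite_S unfolding P_op_eq M.fan_ring_eq M.fan_op_eq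
    by (intro M.D.m_closed M.cls_gen_closed M.del_monomial_closed) simp_all
qed

lemma P_op_unit:
  assumes "k \<in> NSupp X" "d \<in> Lam_plus X"
  shows "mact (P_op X G d a) (unit_vec k) =
    deg_vec X (d + (\<Sum>l\<in>S. nmul (a l) (Psi X l)) + Psi X k) (k + (\<Sum>l\<in>S. nmul (a l) l))"
proof -
  interpret M: fan_rep X S "\<lambda>c. coeff_scale (cst c)" "gen_act X G" MC by (rule fan_module_fan_rep) simp
  have m: "del_monomial X S a S \<in> carrier M.D" using finite_S by (intro M.del_monomial_closed) simp_all
  have "mact (P_op X G d a) (unit_vec k) = coeff_scale (Qvar d) (mact (del_monomial X S a S) (unit_vec k))"
    unfolding P_op_eq M.fan_ring_eq M.fan_op_eq
    using assms m by (simp add: M.cact_mult M.cls_gen_closed MC_unit M.cact_gen M.cact_closed)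
  also have "mact (del_monomial X S a S) (unit_vec k) =
      deg_vec X (Psi X k + (\<Sum>l\<in>S. nmul (a l) (Psi X l))) (k + (\<Sum>l\<in>S. nmul (a l) l))"
    unfolding unit_vec_deg[of k X]
    by (rule del_monomial_deg_vec[OF subset_refl unit_deg_MC finite_S subset_refl]) (rule assms(1))
  finally show ?thesis by (simp add: Q_deg_vec ac_simps)
qed

definition R_op :: "nat \<Rightarrow> 'n \<Rightarrow> 'n fan_gen free_alg set" where
  "R_op i k = fan_op X S (gen (GTheta i) -
     (const (of_rat (lookup (Psi X k) i)) * gen GZ + gen (GY (bvec X i)) * gen (GDel (bvec X i)) +
      (\<Sum>l\<in>G. const (of_rat (lookup (Psi X l) i)) * gen (GY l) * gen (GDel l))))"

text \<open>Because \<Psi>_i(b_j) is 1 for j = i and 0 otherwise, the separate term y_i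
  z\<partial>_i and the sum over \<open>G\<close> combine into one sum over
  \<open>S\<close>.\<close>

lemma R_op_act:
  assumes "fan_rep X S sc act C" and i: "i \<in> rays X" and v: "v \<in> C"
  shows "R_op i k \<in> carrier (fan_ring X S)"
    and "class_act sc act (R_op i k) v = act (GTheta i) v - sc (of_rat (lookup (Psi X k) i)) (act GZ v) -
      (\<Sum>l\<in>S. sc (of_rat (lookup (Psi X l) i)) (act (GY l) (act (GDel l) v)))"
proof -
  interpret W: fan_rep X S sc act C by fact
  let ?G = "\<Sum>l\<in>G. const (of_rat (lookup (Psi X l) i)) * gen (GY l) * gen (GDel l) :: 'n fan_gen free_alg"
  have G: "?G \<in> carrier W.FA"
    using G_subset_S by (intro free_algebra_on_sum free_algebra_on_closed) auto
  have b: "bvec X i \<in> S" using i by (rule bvec_S)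
  have p: "const (of_rat (lookup (Psi X k) i)) * gen GZ + gen (GY (bvec X i)) * gen (GDel (bvec X i)) + ?G \<in> carrier W.FA"
    "gen (GTheta i) \<in> carrier W.FA"
    using i b G by (auto intro!: free_algebra_on_closed)
  show "R_op i k \<in> carrier (fan_ring X S)"
    unfolding R_op_def W.fan_ring_eq W.fan_op_eq by (rule W.cls_closed[OF free_algebra_on_closed(6)[OF p(2,1)]])
  have "(\<Sum>l\<in>S. sc (of_rat (lookup (Psi X l) i)) (act (GY l) (act (GDel l) v))) =
     (\<Sum>j\<in>rays X. if j = i then act (GY (bvec X i)) (act (GDel (bvec X i)) v) else 0) +
     (\<Sum>l\<in>G. sc (of_rat (lookup (Psi X l) i)) (act (GY l) (act (GDel l) v)))"
    unfolding sum_S by (intro arg_cong2[where f = "(+)"] sum.cong refl)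
      (auto simp: Psi_bvec lookup_single when_def)
  then have S: "(\<Sum>l\<in>S. sc (of_rat (lookup (Psi X l) i)) (act (GY l) (act (GDel l) v))) =
     act (GY (bvec X i)) (act (GDel (bvec X i)) v) +
     (\<Sum>l\<in>G. sc (of_rat (lookup (Psi X l) i)) (act (GY l) (act (GDel l) v)))"
    using i by simp
  have mono: "W.ext (const c * gen (GY l) * gen (GDel l)) v = sc c (act (GY l) (act (GDel l) v))" if "l \<in> S" for c l
    using that v by (simp add: W.ext_mult free_algebra_on_closed W.ext_gen W.ext_const W.act_closed)
  have "W.ext (gen (GY (bvec X i)) * gen (GDel (bvec X i))) v = act (GY (bvec X i)) (act (GDel (bvec X i)) v)"
    "W.ext (const (of_rat (lookup (Psi X k) i)) * gen GZ) v = sc (of_rat (lookup (Psi X k) i)) (act GZ v)"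
    using b v by (simp_all add: W.ext_mult free_algebra_on_closed W.ext_gen W.ext_const)
  moreover have "W.ext ?G v = (\<Sum>l\<in>G. sc (of_rat (lookup (Psi X l) i)) (act (GY l) (act (GDel l) v)))"
    unfolding W.ext_sum using G_subset_S by (intro sum.cong refl mono) auto
  ultimately show "W.cact (R_op i k) v = act (GTheta i) v - sc (of_rat (lookup (Psi X k) i)) (act GZ v) -
      (\<Sum>l\<in>S. sc (of_rat (lookup (Psi X l) i)) (act (GY l) (act (GDel l) v)))"
    unfolding S R_op_def W.fan_op_eq W.cact_cls[OF free_algebra_on_closed(6)[OF p(2,1)] v]
    by (simp add: W.ext_diff W.ext_add W.ext_gen algebra_simps)
qed

lemma R_op_unit:
  assumes "i \<in> rays X" "k \<in> NSupp X"
  shows "mact (R_op i k) (unit_vec k) = 0"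
proof -
  have "mact (R_op i k) (unit_vec k) = 
     gen_act X G (GTheta i) (unit_vec k) - coeff_scale (cst (of_rat (lookup (Psi X k) i))) (coeff_scale zvar (unit_vec k)) -
      (\<Sum>l\<in>S. coeff_scale (cst (of_rat (lookup (Psi X l) i))) (coeff_scale (yvar l) (gen_act X G (GDel l) (unit_vec k))))"
    using R_op_act(2)[OF fan_module_fan_rep[OF subset_refl] assms(1) MC_unit[OF assms(2)]] by simp
  then show ?thesis
    by (simp add: unit_vec_deg[of k X] theta_deg_vec del_deg_vec mult.commute)
qed

section \<open>The reduced fan D-module\<close>

abbreviation Hr where "Hr \<equiv> red_submodule X G"

lemma CR_y_minus_1:
  assumes "i \<in> rays X"
  shows "yvar (bvec X i) - 1 \<in> CR"
proof -
  have "1 + cst (- 1) = (0 :: 'n fan_coeff)"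
    using cst_add[of 1 "- 1", symmetric] by (simp only: cst_1 cst_0 add.right_inverse)
  then have "yvar (bvec X i) - 1 = yvar (bvec X i) + (cst (- 1) :: 'n fan_coeff)"
    by (simp add: minus_unique flip: diff_conv_add_uminus)
  then show ?thesis using assms by (simp only: CR_add CR_vars bvec_S)
qed

text \<open>The derivations in D' annihilate y_i - 1: b_i is not in \<open>G\<close>, so
  z\<partial>_i is not among the generators. Multiplication by y_i - 1 therefore intertwines the
  action of D' with itself, and this makes \<open>Hr\<close> a D'-submodule.\<close>

lemma mact_y:
  assumes "P \<in> carrier (fan_ring X G)" "v \<in> MC" "i \<in> rays X"
  shows "mact P (coeff_scale (yvar (bvec X i) - 1) v) = coeff_scale (yvar (bvec X i) - 1) (mact P v)"
proof -
  let ?y = "yvar (bvec X i) - 1 :: 'n fan_coeff"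
  have y: "?y \<in> CR" by (rule CR_y_minus_1[OF assms(3)])
  have one: "theta_coeff j (1 :: 'n fan_coeff) = 0" "del_coeff l (1 :: 'n fan_coeff) = 0" for j l
    using theta_coeff_vars(3)[of j 1] del_coeff_vars(3)[of l 1] by simp_all
  have theta: "theta_coeff j ?y = 0" for j
    using theta_coeff_add[of j ?y 1] by (simp add: theta_coeff_vars one)
  have del: "del_coeff l ?y = 0" if "l \<in> G" for l
  proof -
    have "bvec X i \<noteq> l" using that G_disjoint assms(3) by auto
    then show ?thesis using del_coeff_add[of l ?y 1] by (simp add: del_coeff_vars one)
  qed
  have "coeff_scale ?y (mact P v) = mact P (coeff_scale ?y v)"
  proof (rule intertwine[OF fan_module_rep[OF G_subset_S] fan_module_rep[OF G_subset_S], where s = "coeff_scale ?y"])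
    fix g v assume "g \<in> fan_gens X G"
    then show "coeff_scale ?y (gen_act X G g v) = gen_act X G g (coeff_scale ?y v)"
      by (cases g) (simp_all add: theta_act_leibniz theta del_act_leibniz del mult.commute)
  next
    show "P \<in> carrier (presented_ring (fan_gens X G) (fan_rels X G))"
      using assms(1) by (simp add: fan_ring_def)
  qed (use assms y in \<open>simp_all add: fv.scale_right_distrib MC_scale mult.commute\<close>)
  then show ?thesis by simp
qed

lemma Hr_I:
  assumes "v \<in> MC" "i \<in> rays X"
  shows "coeff_scale (yvar (bvec X i) - 1) v \<in> Hr"
proof -
  let ?w = "\<lambda>j. if j = i then v else 0"
  have "(\<Sum>j\<in>rays X. coeff_scale (yvar (bvec X j) - 1) (?w j)) =
      (\<Sum>j\<in>rays X. if j = i then coeff_scale (yvar (bvec X i) - 1) v else 0)"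
    by (intro sum.cong) auto
  also have "\<dots> = coeff_scale (yvar (bvec X i) - 1) v"
    using assms(2) by simp
  finally have "coeff_scale (yvar (bvec X i) - 1) v = (\<Sum>j\<in>rays X. coeff_scale (yvar (bvec X j) - 1) (?w j))"
    by (rule sym)
  then show ?thesis
    unfolding red_submodule_def using assms MC_0 by (intro CollectI exI[of _ ?w]) auto
qed

lemma Hr_submodule: "submodule Hr (fan_ring X G) (fan_module X G)"
proof -
  interpret M: fan_rep X G "\<lambda>c. coeff_scale (cst c)" "gen_act X G" MC
    by (rule fan_module_fan_rep[OF G_subset_S])
  interpret L: left_module "fan_ring X G" "fan_module X G" by (rule fan_left_module[OF G_subset_S])
  note y = CR_y_minus_1
  show ?thesis
  proof (rule L.submodule_intro)
    show "Hr \<subseteq> MC" using y by (auto simp: red_submodule_def intro!: MC_sum MC_scale)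
    show "zero (fan_module X G) \<in> Hr"
      unfolding red_submodule_def using MC_0 by (auto intro!: exI[of _ "\<lambda>_. 0"])
  next
    fix u v assume "u \<in> Hr" "v \<in> Hr"
    then obtain f g where "u = (\<Sum>i\<in>rays X. coeff_scale (yvar (bvec X i) - 1) (f i))" "\<forall>i\<in>rays X. f i \<in> MC"
      "v = (\<Sum>i\<in>rays X. coeff_scale (yvar (bvec X i) - 1) (g i))" "\<forall>i\<in>rays X. g i \<in> MC"
      unfolding red_submodule_def by blast
    then show "add (fan_module X G) u v \<in> Hr"
      unfolding red_submodule_def
      by (intro CollectI exI[of _ "\<lambda>i. f i + g i"]) (auto simp: fv.scale_right_distrib sum.distrib intro: MC_add)
  next
    fix P v assume P: "P \<in> carrier (fan_ring X G)" and "v \<in> Hr"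
    then obtain f where f: "v = (\<Sum>i\<in>rays X. coeff_scale (yvar (bvec X i) - 1) (f i))" "\<forall>i\<in>rays X. f i \<in> MC"
      unfolding red_submodule_def by blast
    have PD: "P \<in> carrier M.D" using P by (simp add: M.fan_ring_eq)
    have "mact P v = (\<Sum>i\<in>rays X. coeff_scale (yvar (bvec X i) - 1) (mact P (f i)))"
      unfolding f(1) using f(2) y P by (subst M.op_sum[OF M.op_cact[OF PD]]) (auto simp: MC_scale mact_y)
    then show "smult (fan_module X G) P v \<in> Hr"
      unfolding red_submodule_def
      using f(2) M.cact_closed[OF PD] by (auto intro!: exI[of _ "\<lambda>i. mact P (f i)"])
  qed
qed

lemma Hr_facts:
  shows Hr_MC: "v \<in> Hr \<Longrightarrow> v \<in> MC" and Hr_0: "0 \<in> Hr" and Hr_add: "u \<in> Hr \<Longrightarrow> v \<in> Hr \<Longrightarrow> u + v \<in> Hr"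
    and Hr_mact: "P \<in> carrier (fan_ring X G) \<Longrightarrow> v \<in> Hr \<Longrightarrow> mact P v \<in> Hr"
    and Hr_minus: "v \<in> Hr \<Longrightarrow> - v \<in> Hr"
proof -
  interpret M: fan_rep X G "\<lambda>c. coeff_scale (cst c)" "gen_act X G" MC
    by (rule fan_module_fan_rep[OF G_subset_S])
  interpret L: left_module "fan_ring X G" "fan_module X G" by (rule fan_left_module[OF G_subset_S])
  note d = L.submodule_dest[OF Hr_submodule]
  show "v \<in> Hr \<Longrightarrow> v \<in> MC" "0 \<in> Hr" "u \<in> Hr \<Longrightarrow> v \<in> Hr \<Longrightarrow> u + v \<in> Hr"
    "P \<in> carrier (fan_ring X G) \<Longrightarrow> v \<in> Hr \<Longrightarrow> mact P v \<in> Hr"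
    using d(1-4) by auto
  show "- v \<in> Hr" if "v \<in> Hr"
  proof -
    have "v \<in> MC" using that d(1) by blast
    then have "\<ominus>\<^bsub>fan_module X G\<^esub> v = - v"
      by (intro L.M.minus_equality) (simp_all add: M.C_neg)
    with d(5)[OF that] show ?thesis by simp
  qed
qed

lemma mact_cong:
  assumes "P \<in> carrier (fan_ring X G)" "u \<in> MC" "v \<in> MC" "u - v \<in> Hr"
  shows "mact P u - mact P v \<in> Hr"
proof -
  interpret M: fan_rep X G "\<lambda>c. coeff_scale (cst c)" "gen_act X G" MC
    by (rule fan_module_fan_rep[OF G_subset_S])
  have "P \<in> carrier M.D" using assms(1) by (simp add: M.fan_ring_eq)
  then have "mact P (u - v) + mact P v = mact P u"
    using assms M.cact_add_right[of P "u - v" v] M.C_diff by simp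
  then show ?thesis using Hr_mact[OF assms(1,4)] by (metis add_diff_cancel_right')
qed

lemma Hr_trans: "u - v \<in> Hr \<Longrightarrow> v - w \<in> Hr \<Longrightarrow> u - w \<in> Hr"
  using Hr_add[of "u - v" "v - w"] by simp

lemma deg_vec_step: "deg_vec X x k \<in> MC \<Longrightarrow> l \<in> S \<Longrightarrow> deg_vec X (x + Psi X l) (k + l) \<in> MC"
  using MC_act[of "GDel l" "deg_vec X x k"] by (simp add: del_deg_vec)

lemma deg_vec_steps: "deg_vec X x k \<in> MC \<Longrightarrow> l \<in> S \<Longrightarrow> deg_vec X (x + nmul n (Psi X l)) (k + nmul n l) \<in> MC"
proof (induction n)
  case (Suc n)
  then show ?case using deg_vec_step[of "x + nmul n (Psi X l)" "k + nmul n l" l]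
    by (simp add: nmul_Suc ac_simps)
qed simp

text \<open>On a vector of degree x, \<open>eul i\<close> gives z x_i times the vector plus y_i
  times its translate. The shift \<nu> is such that the first term cancels; in the second, y_i is 1
  modulo \<open>Hr\<close>.\<close>

lemma red_factor_deg_vec:
  assumes i: "i \<in> rays X" and v: "deg_vec X x k \<in> MC" and x: "lookup x i = lookup (Psi X k0) i + of_nat \<nu>"
  shows "mact (P_red_factor X G k0 i \<nu>) (deg_vec X x k) - deg_vec X (x + Psi X (bvec X i)) (k + bvec X i) \<in> Hr"
proof -
  interpret M: fan_rep X G "\<lambda>c. coeff_scale (cst c)" "gen_act X G" MC
    by (rule fan_module_fan_rep[OF G_subset_S])
  let ?u = "deg_vec X (x + Psi X (bvec X i)) (k + bvec X i)"
  let ?f = "\<lambda>l. coeff_scale (cst (of_rat (lookup (Psi X l) i)) * yvar l) (deg_vec X (x + Psi X l) (k + l))"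
  have "(\<Sum>l\<in>S. ?f l) = (\<Sum>j\<in>rays X. if j = i then coeff_scale (yvar (bvec X i)) ?u else 0) + (\<Sum>l\<in>G. ?f l)"
    unfolding sum_S by (intro arg_cong2[where f = "(+)"] sum.cong refl)
      (auto simp: Psi_bvec lookup_single when_def)
  then have S: "(\<Sum>l\<in>S. ?f l) = coeff_scale (yvar (bvec X i)) ?u + (\<Sum>l\<in>G. ?f l)"
    using i by simp
  have c: "of_nat \<nu> + of_rat (lookup (Psi X k0) i) = (of_rat (lookup x i) :: complex)"
    by (simp add: x of_rat_add)
  have "mact (P_red_factor X G k0 i \<nu>) (deg_vec X x k) = coeff_scale (yvar (bvec X i)) ?u"
    unfolding M.cact_red_factor[OF i v] M.eul_def theta_deg_vec S c
    by (simp add: del_deg_vec mult.commute)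
  then have "mact (P_red_factor X G k0 i \<nu>) (deg_vec X x k) - ?u = coeff_scale (yvar (bvec X i) - 1) ?u"
    by (simp add: fv.scale_left_diff_distrib)
  then show ?thesis using Hr_I[OF deg_vec_step[OF v bvec_S[OF i]] i] by simp
qed

text \<open>Each factor raises x_i by 1, so after n of them the next index \<nu> = n is the one that
  cancels the weight.\<close>

lemma red_inner_deg_vec:
  assumes i: "i \<in> rays X" and v: "deg_vec X x k \<in> MC" and x: "lookup x i = lookup (Psi X k0) i"
  shows "mact (finprod (fan_ring X G) (P_red_factor X G k0 i) {..<n}) (deg_vec X x k) -
    deg_vec X (x + nmul n (Psi X (bvec X i))) (k + nmul n (bvec X i)) \<in> Hr"
proof (induction n)
  case 0
  interpret M: fan_rep X G "\<lambda>c. coeff_scale (cst c)" "gen_act X G" MC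
    by (rule fan_module_fan_rep[OF G_subset_S])
  show ?case using v by (simp add: M.fan_ring_eq finprod_def M.cact_one Hr_0)
next
  case (Suc n)
  interpret M: fan_rep X G "\<lambda>c. coeff_scale (cst c)" "gen_act X G" MC
    by (rule fan_module_fan_rep[OF G_subset_S])
  let ?p = "finprod M.D (P_red_factor X G k0 i) {..<n}" and ?F = "P_red_factor X G k0 i n"
  let ?u = "deg_vec X (x + nmul n (Psi X (bvec X i))) (k + nmul n (bvec X i))"
  have F: "?F \<in> carrier (fan_ring X G)" using M.red_factor_closed[OF i] by (simp add: M.fan_ring_eq)
  have u: "?u \<in> MC" by (rule deg_vec_steps[OF v bvec_S[OF i]])
  have "lookup (nmul n (Psi X (bvec X i))) i = of_nat n"
    by (induction n) (simp_all add: nmul_Suc Psi_bvec[OF i] lookup_add)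
  then have "lookup (x + nmul n (Psi X (bvec X i))) i = lookup (Psi X k0) i + of_nat n"
    by (simp add: lookup_add x)
  from red_factor_deg_vec[OF i u this] have "mact ?F ?u - deg_vec X (x + nmul (Suc n) (Psi X (bvec X i))) (k + nmul (Suc n) (bvec X i)) \<in> Hr"
    by (simp add: nmul_Suc ac_simps)
  moreover have "mact ?F (mact ?p (deg_vec X x k)) - mact ?F ?u \<in> Hr"
    using Suc u v M.red_inner_closed[OF i] by (intro mact_cong[OF F]) (simp_all add: M.cact_closed M.fan_ring_eq)
  ultimately have "mact ?F (mact ?p (deg_vec X x k)) - deg_vec X (x + nmul (Suc n) (Psi X (bvec X i))) (k + nmul (Suc n) (bvec X i)) \<in> Hr"
    by (rule Hr_trans[rotated])
  then show ?case
    using F v M.red_inner_closed[OF i] by (simp add: M.fan_ring_eq M.red_inner_Suc[OF i] M.cact_mult)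
qed

lemma lookup_nmul_Psi_bvec: "i \<in> rays X \<Longrightarrow> j \<in> rays X \<Longrightarrow> i \<noteq> j \<Longrightarrow> lookup (nmul n (Psi X (bvec X j))) i = 0"
  by (induction n) (simp_all add: nmul_Suc Psi_bvec lookup_add lookup_single)

lemma red_product_deg_vec:
  assumes v: "deg_vec X x k \<in> MC" and x: "\<And>i. i \<in> rays X \<Longrightarrow> lookup x i = lookup (Psi X k0) i"
    and A: "finite A" "A \<subseteq> rays X"
  shows "deg_vec X (x + (\<Sum>i\<in>A. nmul (a (bvec X i)) (Psi X (bvec X i)))) (k + (\<Sum>i\<in>A. nmul (a (bvec X i)) (bvec X i))) \<in> MC \<and>
    mact (red_product X G k0 a A) (deg_vec X x k) -
    deg_vec X (x + (\<Sum>i\<in>A. nmul (a (bvec X i)) (Psi X (bvec X i)))) (k + (\<Sum>i\<in>A. nmul (a (bvec X i)) (bvec X i))) \<in> Hr"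
proof -
  interpret M: fan_rep X G "\<lambda>c. coeff_scale (cst c)" "gen_act X G" MC
    by (rule fan_module_fan_rep[OF G_subset_S])
  show ?thesis
    using A
  proof (induction A rule: finite_induct)
    case empty
    show ?case using v by (simp add: red_product_def M.fan_ring_eq finprod_def M.cact_one Hr_0)
  next
    case (insert i A)
    let ?x = "x + (\<Sum>i\<in>A. nmul (a (bvec X i)) (Psi X (bvec X i)))" and ?k = "k + (\<Sum>i\<in>A. nmul (a (bvec X i)) (bvec X i))"
    let ?p = "finprod M.D (P_red_factor X G k0 i) {..<a (bvec X i)}" and ?r = "red_product X G k0 a A"
    have i: "i \<in> rays X" and A: "A \<subseteq> rays X" using insert.prems by auto
    note IH = insert.IH[OF A]
    have p: "?p \<in> carrier (fan_ring X G)" using M.red_inner_closed[OF i] by (simp add: M.fan_ring_eq)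
    have r: "?r \<in> carrier M.D" by (rule M.red_product_closed[OF A])
    \<comment> \<open>The rays treated before have \<Psi>_i(b_j) = 0, so the factors of
      \<open>i\<close> still start at x_i = \<Psi>_i(k0).\<close>
    have "lookup (\<Sum>j\<in>A. nmul (a (bvec X j)) (Psi X (bvec X j))) i = 0"
      unfolding lookup_sum using insert.hyps(2) A i by (intro sum.neutral) (auto intro!: lookup_nmul_Psi_bvec)
    then have xi: "lookup ?x i = lookup (Psi X k0) i" using x[OF i] by (simp add: lookup_add)
    have 1: "mact ?p (deg_vec X ?x ?k) - deg_vec X (?x + nmul (a (bvec X i)) (Psi X (bvec X i))) (?k + nmul (a (bvec X i)) (bvec X i)) \<in> Hr"
      using red_inner_deg_vec[OF i conjunct1[OF IH] xi, of "a (bvec X i)"] by (simp add: M.fan_ring_eq)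
    have 2: "mact ?p (mact ?r (deg_vec X x k)) - mact ?p (deg_vec X ?x ?k) \<in> Hr"
      using IH v r by (intro mact_cong[OF p]) (simp_all add: M.cact_closed)
    have "deg_vec X (?x + nmul (a (bvec X i)) (Psi X (bvec X i))) (?k + nmul (a (bvec X i)) (bvec X i)) \<in> MC"
      by (rule deg_vec_steps[OF conjunct1[OF IH] bvec_S[OF i]])
    moreover have "mact (red_product X G k0 a (insert i A)) (deg_vec X x k) = mact ?p (mact ?r (deg_vec X x k))"
      using insert p r v by (simp add: M.red_product_insert M.fan_ring_eq M.cact_mult)
    ultimately show ?case
      using Hr_trans[OF 2 1] insert.hyps by (simp add: ac_simps)
  qed
qed

lemma P_red_op_eq: "P_red_op X G k d a = fan_op X G (gen (GQ d)) \<otimes>\<^bsub>fan_ring X G\<^esub> del_monomial X G a G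
    \<otimes>\<^bsub>fan_ring X G\<^esub> red_product X G k a (rays X)"
  by (simp add: P_red_op_def del_monomial_def red_product_def Let_def)

lemma P_red_op_act:
  assumes "fan_rep X G sc act C" "d \<in> Lam_plus X" "v \<in> C"
  shows "P_red_op X G k d a \<in> carrier (fan_ring X G)"
    and "class_act sc act (P_red_op X G k d a) v =
      act (GQ d) (class_act sc act (del_monomial X G a G) (class_act sc act (red_product X G k a (rays X)) v))"
proof -
  interpret W: fan_rep X G sc act C by fact
  have c: "del_monomial X G a G \<in> carrier W.D" "red_product X G k a (rays X) \<in> carrier W.D"
    using finite_G by (simp_all add: W.del_monomial_closed W.red_product_closed)
  then show "P_red_op X G k d a \<in> carrier (fan_ring X G)"
    using assms unfolding P_red_op_eq W.fan_ring_eq W.fan_op_eq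
    by (intro W.D.m_closed W.cls_gen_closed) simp_all
  show "W.cact (P_red_op X G k d a) v =
      act (GQ d) (W.cact (del_monomial X G a G) (W.cact (red_product X G k a (rays X)) v))"
    using assms c unfolding P_red_op_eq W.fan_ring_eq W.fan_op_eq
    by (simp add: W.cact_mult W.cls_gen_closed W.cact_closed W.cact_gen)
qed

text \<open>The factors of the rays act on 1_k itself, where the degree is still \<Psi>(k), and the
  z\<partial>_l with l in \<open>G\<close> act afterwards; in the opposite order the shifts of the
  factors would in general not match the degree.\<close>

lemma P_red_op_unit:
  assumes "k \<in> NSupp X" "d \<in> Lam_plus X"
  shows "mact (P_red_op X G k d a) (unit_vec k) -
    deg_vec X (d + (\<Sum>l\<in>S. nmul (a l) (Psi X l)) + Psi X k) (k + (\<Sum>l\<in>S. nmul (a l) l)) \<in> Hr"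
proof -
  interpret M: fan_rep X G "\<lambda>c. coeff_scale (cst c)" "gen_act X G" MC
    by (rule fan_module_fan_rep[OF G_subset_S])
  let ?x = "Psi X k + (\<Sum>i\<in>rays X. nmul (a (bvec X i)) (Psi X (bvec X i)))"
  let ?k = "k + (\<Sum>i\<in>rays X. nmul (a (bvec X i)) (bvec X i))"
  let ?r = "red_product X G k a (rays X)" and ?m = "del_monomial X G a G" and ?q = "M.cls (gen (GQ d))"
  have r: "?r \<in> carrier M.D" by (rule M.red_product_closed) simp
  have m: "?m \<in> carrier (fan_ring X G)" using finite_G by (simp add: M.fan_ring_eq M.del_monomial_closed)
  have q: "?q \<in> carrier (fan_ring X G)" using assms(2) by (simp add: M.fan_ring_eq M.cls_gen_closed)
  have mq: "?m \<in> carrier M.D" "?q \<in> carrier M.D" using m q by (simp_all add: M.fan_ring_eq)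
  note * = red_product_deg_vec[OF unit_deg_MC[OF assms(1)] refl finite_rays subset_refl, of a]
  have 1: "mact ?r (unit_vec k) - deg_vec X ?x ?k \<in> Hr" and c: "deg_vec X ?x ?k \<in> MC"
    using * by (simp_all flip: unit_vec_deg)
  have "mact ?m (mact ?r (unit_vec k)) - mact ?m (deg_vec X ?x ?k) \<in> Hr"
    using 1 c r assms(1) by (intro mact_cong[OF m]) (simp_all add: M.cact_closed MC_unit)
  then have "mact ?q (mact ?m (mact ?r (unit_vec k))) - mact ?q (mact ?m (deg_vec X ?x ?k)) \<in> Hr"
    using c r mq assms(1) by (intro mact_cong[OF q]) (simp_all add: M.cact_closed MC_unit)
  also have "mact ?q (mact ?m (deg_vec X ?x ?k)) = coeff_scale (Qvar d) (mact ?m (deg_vec X ?x ?k))"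
    using assms(2) c mq by (simp add: M.cact_gen M.cact_closed)
  also have "mact ?m (deg_vec X ?x ?k) = deg_vec X (?x + (\<Sum>l\<in>G. nmul (a l) (Psi X l))) (?k + (\<Sum>l\<in>G. nmul (a l) l))"
    by (rule del_monomial_deg_vec[OF G_subset_S c finite_G subset_refl])
  also have "mact ?q (mact ?m (mact ?r (unit_vec k))) = mact (P_red_op X G k d a) (unit_vec k)"
    using P_red_op_act(2)[OF M.fan_rep_axioms assms(2) MC_unit[OF assms(1)]] assms mq r
    by (simp add: M.cact_gen M.cact_closed MC_unit)
  finally show ?thesis
    by (simp add: Q_deg_vec sum_S ac_simps)
qed

end

section \<open>Generators and relations\<close>

lemma sum_nmul_update:
  assumes "finite A" "l \<in> A"
  shows "(\<Sum>m\<in>A. nmul ((a(l := Suc (a l))) m) (f m)) = f l + (\<Sum>m\<in>A. nmul (a m) (f m))"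
proof -
  have "(\<Sum>m\<in>A. nmul ((a(l := Suc (a l))) m) (f m)) =
      (\<Sum>m\<in>A. (if m = l then f l else 0) + nmul (a m) (f m))"
    by (intro sum.cong) (auto simp: nmul_Suc)
  then show ?thesis using assms by (simp add: sum.distrib)
qed

lemma lookup_sum_nmul:
  "lookup (\<Sum>l\<in>A. nmul (a l) (f l)) i = (\<Sum>l\<in>A. of_nat (a l) * lookup (f l) i)"
  for f :: "_ \<Rightarrow> _ \<Rightarrow>\<^sub>0 'b::comm_semiring_1"
proof -
  have "lookup (nmul n p) i = of_nat n * lookup p i" for n and p :: "_ \<Rightarrow>\<^sub>0 'b"
    by (induction n) (simp_all add: nmul_Suc lookup_add distrib_right)
  then show ?thesis by (simp add: lookup_sum)
qed

locale fan_generators = fan_setting X G for X :: "('n::ab_group_add) stacky_data" and G +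
  fixes J :: "nat set" and \<kappa> :: "nat \<Rightarrow> 'n"
  assumes finite_J: "finite J" and \<kappa>_NSupp: "j \<in> J \<Longrightarrow> \<kappa> j \<in> NSupp X"
    and covering: "\<sigma> \<in> cones X \<Longrightarrow> max_dim \<sigma> \<Longrightarrow>
      {k. real_image k \<in> \<sigma>} =
        (\<Union>j\<in>{j\<in>J. real_image (\<kappa> j) \<in> \<sigma>}.
          {\<kappa> j + (\<Sum>l\<in>{l\<in>S_set X G. real_image l \<in> \<sigma>}. nmul (a l) l) | a. True})"
begin

lemma ex_decomposition:
  assumes "k \<in> NSupp X"
  shows "\<exists>j a. j \<in> J \<and> k = \<kappa> j + (\<Sum>l\<in>S. nmul (a l) l) \<and>
    Psi X k = Psi X (\<kappa> j) + (\<Sum>l\<in>S. nmul (a l) (Psi X l))"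
proof -
  obtain \<sigma> where \<sigma>: "\<sigma> \<in> cones X" "max_dim \<sigma>" "real_image k \<in> \<sigma>"
    using ex_max_cone_containing[OF assms] by blast
  let ?S = "{l\<in>S. real_image l \<in> \<sigma>}"
  from covering[OF \<sigma>(1,2)] \<sigma>(3) obtain j a where j: "j \<in> J" "real_image (\<kappa> j) \<in> \<sigma>"
    and k: "k = \<kappa> j + (\<Sum>l\<in>?S. nmul (a l) l)" by blast
  \<comment> \<open>Outside the cone the exponent is set to 0, so that sums over all of
    \<open>S\<close> can be used.\<close>
  define b where "b l = (if real_image l \<in> \<sigma> then a l else 0)" for l
  have b: "(\<Sum>l\<in>?S. nmul (a l) (f l)) = (\<Sum>l\<in>S. nmul (b l) (f l))" for f :: "'n \<Rightarrow> 'd::comm_monoid_add"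
    using finite_S by (intro sum.mono_neutral_cong_left) (auto simp: b_def)
  have S: "finite ?S" "\<And>l. l \<in> ?S \<Longrightarrow> real_image l \<in> \<sigma>" using finite_S by simp_all
  have "Psi X k = Psi X (\<kappa> j) + (\<Sum>l\<in>?S. nmul (a l) (Psi X l))"
    using Psi_add[OF \<sigma>(1) j(2) Psi_sum_nmul(1)[OF \<sigma>(1) S, of a]]
    by (simp only: k Psi_sum_nmul(2)[OF \<sigma>(1) S])
  with j(1) k show ?thesis
    unfolding b by (intro exI[of _ j] exI[of _ b] conjI)
qed

definition gen_index :: "'n \<Rightarrow> nat" where
  "gen_index k = (SOME j. \<exists>a. j \<in> J \<and> k = \<kappa> j + (\<Sum>l\<in>S. nmul (a l) l) \<and>
    Psi X k = Psi X (\<kappa> j) + (\<Sum>l\<in>S. nmul (a l) (Psi X l)))"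

definition gen_exponent :: "'n \<Rightarrow> 'n \<Rightarrow> nat" where
  "gen_exponent k = (SOME a. k = \<kappa> (gen_index k) + (\<Sum>l\<in>S. nmul (a l) l) \<and>
    Psi X k = Psi X (\<kappa> (gen_index k)) + (\<Sum>l\<in>S. nmul (a l) (Psi X l)))"

lemma decomposition:
  assumes "k \<in> NSupp X"
  shows "gen_index k \<in> J" "\<kappa> (gen_index k) + (\<Sum>l\<in>S. nmul (gen_exponent k l) l) = k"
    "Psi X (\<kappa> (gen_index k)) + (\<Sum>l\<in>S. nmul (gen_exponent k l) (Psi X l)) = Psi X k"
proof -
  have j: "\<exists>a. gen_index k \<in> J \<and> k = \<kappa> (gen_index k) + (\<Sum>l\<in>S. nmul (a l) l) \<and>
    Psi X k = Psi X (\<kappa> (gen_index k)) + (\<Sum>l\<in>S. nmul (a l) (Psi X l))"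
    unfolding gen_index_def by (rule someI_ex[OF ex_decomposition[OF assms]])
  then show "gen_index k \<in> J" by blast
  have "k = \<kappa> (gen_index k) + (\<Sum>l\<in>S. nmul (gen_exponent k l) l) \<and>
    Psi X k = Psi X (\<kappa> (gen_index k)) + (\<Sum>l\<in>S. nmul (gen_exponent k l) (Psi X l))"
    using someI_ex[of "\<lambda>a. k = \<kappa> (gen_index k) + (\<Sum>l\<in>S. nmul (a l) l) \<and>
      Psi X k = Psi X (\<kappa> (gen_index k)) + (\<Sum>l\<in>S. nmul (a l) (Psi X l))"] j
    unfolding gen_exponent_def[symmetric] by blast
  then show "\<kappa> (gen_index k) + (\<Sum>l\<in>S. nmul (gen_exponent k l) l) = k"
    "Psi X (\<kappa> (gen_index k)) + (\<Sum>l\<in>S. nmul (gen_exponent k l) (Psi X l)) = Psi X k" by simp_all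
qed

text \<open>Both monomials lead to the degree \<Psi>(k) + \<Psi>(l) over k + l: one adds
  \<open>l\<close> to the decomposition of \<open>k\<close>, the other takes the chosen
  decomposition of k + l and makes up the difference by the power d(k, l) of Q.\<close>

lemma admissible_step:
  assumes k: "k \<in> NSupp X" and l: "l \<in> S"
  shows "admissible X G 0 (ddeg X k l) ((gen_exponent k)(l := Suc (gen_exponent k l))) (gen_exponent (k + l))
    (\<kappa> (gen_index k)) (\<kappa> (gen_index (k + l)))"
proof -
  have kl: "k + l \<in> NSupp X" using k S_NSupp[OF l] by (rule NSupp_add)
  have "l + (\<Sum>m\<in>S. nmul (gen_exponent k m) m) + \<kappa> (gen_index k) = k + l"
    "Psi X l + (\<Sum>m\<in>S. nmul (gen_exponent k m) (Psi X m)) + Psi X (\<kappa> (gen_index k)) = Psi X k + Psi X l"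
    using decomposition[OF k] by (simp_all add: ac_simps)
  moreover have "(\<Sum>m\<in>S. nmul (gen_exponent (k + l) m) m) + \<kappa> (gen_index (k + l)) = k + l"
    "ddeg X k l + (\<Sum>m\<in>S. nmul (gen_exponent (k + l) m) (Psi X m)) + Psi X (\<kappa> (gen_index (k + l))) = Psi X k + Psi X l"
    using decomposition[OF kl] by (simp_all add: ddeg_def algebra_simps)
  moreover note sum_nmul_update[OF finite_S l, of "gen_exponent k" "\<lambda>m. m"]
    sum_nmul_update[OF finite_S l, of "gen_exponent k" "Psi X"]
  ultimately show ?thesis
    unfolding admissible_def using ddeg_Lam_plus[OF k S_NSupp[OF l]] Lam_plus_0
    by (simp add: add.commute del: fun_upd_apply)
qed

text \<open>The decomposition chosen for \<open>\<kappa> j\<close> need not be the trivial one. This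
  relation compares the two, so that the lift sends the basis vector of \<open>\<kappa> j\<close> to
  the prescribed vector.\<close>

lemma admissible_generator:
  assumes "j \<in> J"
  shows "admissible X G 0 0 (gen_exponent (\<kappa> j)) (\<lambda>_. 0) (\<kappa> (gen_index (\<kappa> j))) (\<kappa> j)"
  using decomposition[OF \<kappa>_NSupp[OF assms]] Lam_plus_0
  by (simp add: admissible_def ac_simps)

lemma generator_expansion:
  assumes "k \<in> NSupp X"
  shows "unit_vec k = deg_vec X (0 + (\<Sum>l\<in>S. nmul (gen_exponent k l) (Psi X l)) + Psi X (\<kappa> (gen_index k)))
    (\<kappa> (gen_index k) + (\<Sum>l\<in>S. nmul (gen_exponent k l) l))"
proof -
  have "0 + (\<Sum>l\<in>S. nmul (gen_exponent k l) (Psi X l)) + Psi X (\<kappa> (gen_index k)) = Psi X k"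
    using decomposition(3)[OF assms] by (simp add: add.commute)
  then show ?thesis by (simp only: decomposition(2)[OF assms] unit_vec_deg[symmetric])
qed

subsection \<open>Homomorphisms out of the fan D-module\<close>

lemma ex_lift:
  assumes W: "fan_rep X S sc act C" and \<epsilon>: "\<And>j. j \<in> J \<Longrightarrow> \<epsilon> j \<in> C"
    and R: "\<And>i j. i \<in> rays X \<Longrightarrow> j \<in> J \<Longrightarrow> class_act sc act (R_op i (\<kappa> j)) (\<epsilon> j) = 0"
    and P: "\<And>d1 d2 a a' j l. j \<in> J \<Longrightarrow> l \<in> J \<Longrightarrow> admissible X G d1 d2 a a' (\<kappa> j) (\<kappa> l) \<Longrightarrow>
      class_act sc act (P_op X G d1 a) (\<epsilon> j) = class_act sc act (P_op X G d2 a') (\<epsilon> l)"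
  shows "\<exists>L. L 0 = 0 \<and> (\<forall>u v. L (u + v) = L u + L v) \<and> (\<forall>j\<in>J. L (unit_vec (\<kappa> j)) = \<epsilon> j) \<and>
    (\<forall>P\<in>carrier (fan_ring X S). \<forall>v\<in>MC. L (mact P v) = class_act sc act P (L v))"
proof -
  interpret W: fan_rep X S sc act C by fact
  define m where "m a j = W.cact (del_monomial X S a S) (\<epsilon> j)" for a j
  define w where "w k = m (gen_exponent k) (gen_index k)" for k
  have mon: "del_monomial X S a S \<in> carrier W.D" for a using finite_S by (intro W.del_monomial_closed) simp_all
  have m_closed: "m a j \<in> C" if "j \<in> J" for a j
    unfolding m_def by (rule W.cact_closed[OF mon \<epsilon>[OF that]])
  have P_act: "W.cact (P_op X G d a) (\<epsilon> j) = W.Q d (m a j)" if "d \<in> Lam_plus X" "j \<in> J" for d a j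
    unfolding P_op_eq W.fan_ring_eq W.fan_op_eq m_def
    using that mon \<epsilon> by (simp add: W.cact_mult W.cls_gen_closed W.cact_gen W.cact_closed)
  have eq: "W.Q d1 (m a j) = W.Q d2 (m a' l)"
    if "j \<in> J" "l \<in> J" "admissible X G d1 d2 a a' (\<kappa> j) (\<kappa> l)" for d1 d2 a a' j l
  proof -
    have "d1 \<in> Lam_plus X" "d2 \<in> Lam_plus X" using that(3) by (simp_all add: admissible_def)
    then show ?thesis using P[OF that] that by (simp add: P_act)
  qed
  have w_closed: "w k \<in> C" if "k \<in> NSupp X" for k
    unfolding w_def by (rule m_closed[OF decomposition(1)[OF that]])
  have De_w: "W.De l (w k) = W.Q (ddeg X k l) (w (k + l))" if "k \<in> NSupp X" "l \<in> S" for k l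
  proof -
    have "W.De l (w k) = m ((gen_exponent k)(l := Suc (gen_exponent k l))) (gen_index k)"
      unfolding w_def m_def by (rule W.De_del_monomial[OF finite_S that(2) \<epsilon>[OF decomposition(1)[OF that(1)]]])
    \<comment> \<open>Q^0 is inserted to bring the left-hand side into the form of a relation
      P.\<close>
    also have "\<dots> = W.Q 0 \<dots>" using W.Q_0 m_closed decomposition(1) that by simp
    also have "\<dots> = W.Q (ddeg X k l) (w (k + l))"
      unfolding w_def
      by (rule eq[OF decomposition(1)[OF that(1)] decomposition(1)[OF NSupp_add[OF that(1) S_NSupp[OF that(2)]]]
        admissible_step[OF that]])
    finally show ?thesis .
  qed
  \<comment> \<open>The relation R says that \<open>eul i\<close> acts on the image of a generator
    by its weight.\<close>
  have eul_\<epsilon>: "W.eul i (\<epsilon> j) = sc (of_rat (lookup (Psi X (\<kappa> j)) i)) (W.Z (\<epsilon> j))" if "i \<in> rays X" "j \<in> J" for i j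
    using R[OF that] R_op_act(2)[OF W that(1) \<epsilon>[OF that(2)], of "\<kappa> j"]
    by (simp add: W.eul_def algebra_simps)
  \<comment> \<open>The monomial raises the weight from \<Psi>_i(k_j) to \<Psi>_i(k), because the
    chosen decomposition of \<open>k\<close> is compatible with \<Psi>.\<close>
  have eul_w: "W.eul i (w k) = sc (of_rat (lookup (Psi X k) i)) (W.Z (w k))" if k: "k \<in> NSupp X" and i: "i \<in> rays X" for i k
  proof -
    let ?j = "gen_index k" and ?a = "gen_exponent k"
    have j: "?j \<in> J" by (rule decomposition(1)[OF k])
    have "W.cact (del_monomial X S ?a S) (W.Z (\<epsilon> ?j)) = W.Z (w k)"
      unfolding w_def m_def by (rule W.cact_del_monomial_Z[OF finite_S subset_refl \<epsilon>[OF j]])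
    then have "W.eul i (w k) = sc (of_rat (lookup (Psi X (\<kappa> ?j)) i)) (W.Z (w k)) +
        sc (\<Sum>l\<in>S. of_nat (?a l) * of_rat (lookup (Psi X l) i)) (W.Z (w k))"
      using W.eul_del_monomial[OF finite_S i \<epsilon>[OF j] finite_S subset_refl, of ?a] eul_\<epsilon>[OF i j]
        W.opD(3)[OF W.op_cact[OF mon], of "W.Z (\<epsilon> ?j)"] \<epsilon>[OF j]
      by (simp add: w_def m_def W.act_closed)
    moreover have "lookup (Psi X k) i = lookup (Psi X (\<kappa> ?j)) i + (\<Sum>l\<in>S. of_nat (?a l) * lookup (Psi X l) i)"
      using arg_cong[OF decomposition(3)[OF k], of "\<lambda>p. lookup p i"] by (simp add: lookup_add lookup_sum_nmul)
    ultimately show ?thesis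
      by (simp add: of_rat_add of_rat_sum of_rat_mult W.scale_left_distrib)
  qed
  obtain xs where xs: "set xs = S" "distinct xs" using finite_distinct_list[OF finite_S] by blast
  interpret L: fan_mapping X G S sc act C xs w
  proof
    fix k i assume k: "k \<in> NSupp X" and i: "i \<in> rays X"
    have "(\<Sum>l\<in>S. sc (of_rat (lookup (Psi X l) i)) (W.Y l (W.De l (w k)))) =
      (\<Sum>l\<in>S. sc (of_rat (lookup (Psi X l) i)) ((if l \<in> S then W.Y l else id) (W.Q (ddeg X k l) (w (k + l)))))"
      using De_w[OF k] by (intro sum.cong) simp_all
    then show "W.Th i (w k) = sc (of_rat (lookup (Psi X k) i)) (W.Z (w k)) +
      (\<Sum>l\<in>S. sc (of_rat (lookup (Psi X l) i)) ((if l \<in> S then W.Y l else id) (W.Q (ddeg X k l) (w (k + l)))))"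
      using eul_w[OF k i] by (simp add: W.Th_eq_eul)
  qed (use xs w_closed De_w in simp_all)
  have "L.lift (unit_vec (\<kappa> j)) = \<epsilon> j" if j: "j \<in> J" for j
  proof -
    have "m (\<lambda>_. 0) j = \<epsilon> j"
      unfolding m_def by (rule W.cact_del_monomial_0[OF finite_S subset_refl \<epsilon>[OF j]])
    moreover have "W.Q 0 (w (\<kappa> j)) = W.Q 0 (m (\<lambda>_. 0) j)"
      unfolding w_def
      by (rule eq[OF decomposition(1)[OF \<kappa>_NSupp[OF j]] j admissible_generator[OF j]])
    ultimately show ?thesis
      using L.lift_unit[OF \<kappa>_NSupp[OF j]] w_closed[OF \<kappa>_NSupp[OF j]] \<epsilon>[OF j] by (simp add: W.Q_0)
  qed
  then show ?thesis
    using L.lift_0 L.lift_add L.lift_class_act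
    by (intro exI[of _ L.lift]) (simp add: W.fan_ring_eq)
qed

text \<open>The action of z\<vartheta>_i on \<open>w k\<close> is not prescribed by a relation of
  type R. It is read off from the relation P' that compares the decomposition of k, with one more
  b_i, with the decomposition of k + b_i.\<close>

lemma ex_red_lift:
  assumes W: "fan_rep X G sc act C" and \<epsilon>: "\<And>j. j \<in> J \<Longrightarrow> \<epsilon> j \<in> C"
    and P: "\<And>d1 d2 a a' j l. j \<in> J \<Longrightarrow> l \<in> J \<Longrightarrow> admissible X G d1 d2 a a' (\<kappa> j) (\<kappa> l) \<Longrightarrow>
      class_act sc act (P_red_op X G (\<kappa> j) d1 a) (\<epsilon> j) = class_act sc act (P_red_op X G (\<kappa> l) d2 a') (\<epsilon> l)"
  shows "\<exists>L. (\<forall>v\<in>Hr. L v = 0) \<and> L 0 = 0 \<and> (\<forall>u v. L (u + v) = L u + L v) \<and> (\<forall>j\<in>J. L (unit_vec (\<kappa> j)) = \<epsilon> j) \<and>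
    (\<forall>P\<in>carrier (fan_ring X G). \<forall>v\<in>MC. L (mact P v) = class_act sc act P (L v))"
proof -
  interpret W: fan_rep X G sc act C by fact
  let ?r = "\<lambda>a j. red_product X G (\<kappa> j) a (rays X)"
  define m where "m a j = W.cact (del_monomial X G a G) (W.cact (?r a j) (\<epsilon> j))" for a j
  define w where "w k = m (gen_exponent k) (gen_index k)" for k
  have mon: "del_monomial X G a G \<in> carrier W.D" for a using finite_G by (intro W.del_monomial_closed) simp_all
  have red: "?r a j \<in> carrier W.D" for a j by (rule W.red_product_closed) simp
  have r_closed: "W.cact (?r a j) (\<epsilon> j) \<in> C" if "j \<in> J" for a j
    by (rule W.cact_closed[OF red \<epsilon>[OF that]])
  have m_closed: "m a j \<in> C" if "j \<in> J" for a j
    unfolding m_def by (rule W.cact_closed[OF mon r_closed[OF that]])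
  have eq: "W.Q d1 (m a j) = W.Q d2 (m a' l)"
    if "j \<in> J" "l \<in> J" "admissible X G d1 d2 a a' (\<kappa> j) (\<kappa> l)" for d1 d2 a a' j l
  proof -
    have "d1 \<in> Lam_plus X" "d2 \<in> Lam_plus X" using that(3) by (simp_all add: admissible_def)
    then show ?thesis using P[OF that] that \<epsilon> by (simp add: P_red_op_act(2)[OF W] m_def)
  qed
  have w_closed: "w k \<in> C" if "k \<in> NSupp X" for k
    unfolding w_def by (rule m_closed[OF decomposition(1)[OF that]])
  have step: "m ((gen_exponent k)(l := Suc (gen_exponent k l))) (gen_index k) = W.Q (ddeg X k l) (w (k + l))"
    if "k \<in> NSupp X" "l \<in> S" for k l
  proof -
    have "m ((gen_exponent k)(l := Suc (gen_exponent k l))) (gen_index k) =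
        W.Q 0 (m ((gen_exponent k)(l := Suc (gen_exponent k l))) (gen_index k))"
      using W.Q_0 m_closed decomposition(1) that by simp
    also have "\<dots> = W.Q (ddeg X k l) (w (k + l))"
      unfolding w_def
      by (rule eq[OF decomposition(1)[OF that(1)] decomposition(1)[OF NSupp_add[OF that(1) S_NSupp[OF that(2)]]]
        admissible_step[OF that]])
    finally show ?thesis .
  qed
  have De_w: "W.De l (w k) = W.Q (ddeg X k l) (w (k + l))" if k: "k \<in> NSupp X" and l: "l \<in> G" for k l
  proof -
    let ?j = "gen_index k" and ?a = "gen_exponent k"
    \<comment> \<open>\<open>l\<close> lies in \<open>G\<close> and is not one of the b_i, so only
      the monomial in the z\<partial>_l changes.\<close>
    have "?r (?a(l := Suc (?a l))) ?j = ?r ?a ?j"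
    proof -
      have "(?a(l := Suc (?a l))) (bvec X i) = ?a (bvec X i)" if "i \<in> rays X" for i
        using l that G_disjoint by auto
      then show ?thesis
        unfolding red_product_def W.fan_ring_eq
        by (intro W.D.finprod_commuting_cong W.red_outer_commuting) simp_all
    qed
    then have "W.De l (w k) = m (?a(l := Suc (?a l))) ?j"
      unfolding w_def m_def using l r_closed[OF decomposition(1)[OF k]] by (simp add: W.De_del_monomial[OF finite_G])
    then show ?thesis using step[OF k] l G_subset_S by auto
  qed
  have eul_w: "W.eul i (w k) = sc (of_rat (lookup (Psi X k) i)) (W.Z (w k)) + W.Q (ddeg X k (bvec X i)) (w (k + bvec X i))"
    if k: "k \<in> NSupp X" and i: "i \<in> rays X" for i k
  proof -
    let ?j = "gen_index k" and ?a = "gen_exponent k" and ?b = "bvec X i"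
    let ?a' = "?a(?b := Suc (?a ?b))"
    let ?m = "W.cact (del_monomial X G ?a G)" and ?v = "W.cact (?r ?a ?j) (\<epsilon> ?j)"
    have j: "?j \<in> J" by (rule decomposition(1)[OF k])
    note v = r_closed[OF j]
    \<comment> \<open>Conversely, b_i is not in \<open>G\<close>, so only the product over the rays
      changes.\<close>
    have "del_monomial X G ?a' G = del_monomial X G ?a G"
    proof -
      have "?a' l = ?a l" if "l \<in> G" for l using i that G_disjoint by auto
      then show ?thesis
        unfolding del_monomial_def W.fan_ring_eq W.fan_op_eq
        by (intro W.D.finprod_commuting_cong W.D.commuting_pow W.De_commuting finite_G) simp_all
    qed
    then have m': "?m (W.cact (?r ?a' ?j) (\<epsilon> ?j)) = W.Q (ddeg X k ?b) (w (k + ?b))"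
      using step[OF k bvec_S[OF i]] by (simp add: m_def)
    have Zm: "?m (W.Z ?v) = W.Z (w k)"
      unfolding w_def m_def by (rule W.cact_del_monomial_Z[OF finite_G subset_refl v])
    have "?m (W.eul i ?v) = W.Q (ddeg X k ?b) (w (k + ?b)) +
        sc (of_nat (?a ?b) + of_rat (lookup (Psi X (\<kappa> ?j)) i)) (W.Z (w k))"
      unfolding W.eul_red_product[OF i \<epsilon>[OF j]]
      using v r_closed[OF j, of ?a'] m' Zm
      by (simp add: W.opD(2,3)[OF W.op_cact[OF mon]] W.C_sc W.act_closed)
    then have "W.eul i (w k) = W.Q (ddeg X k ?b) (w (k + ?b)) +
        sc (of_nat (?a ?b) + of_rat (lookup (Psi X (\<kappa> ?j)) i)) (W.Z (w k)) +
        sc (\<Sum>l\<in>G. of_nat (?a l) * of_rat (lookup (Psi X l) i)) (W.Z (w k))"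
      using W.eul_del_monomial[OF finite_G i v finite_G subset_refl, of ?a] by (simp add: w_def m_def)
    \<comment> \<open>The weight \<Psi>_i(k) splits into \<Psi>_i(k_j), the exponent of b_i and the
      contribution of \<open>G\<close>, which are the scalars obtained above.\<close>
    moreover have "lookup (Psi X k) i = lookup (Psi X (\<kappa> ?j)) i +
        (of_nat (?a ?b) + (\<Sum>l\<in>G. of_nat (?a l) * lookup (Psi X l) i))"
    proof -
      have "(\<Sum>j\<in>rays X. of_nat (?a (bvec X j)) * lookup (Psi X (bvec X j)) i) =
          (\<Sum>j\<in>rays X. if j = i then of_nat (?a ?b) else 0)"
        by (intro sum.cong) (auto simp: Psi_bvec lookup_single when_def)
      also have "\<dots> = of_nat (?a ?b)" using i by simp
      finally show ?thesis
        using arg_cong[OF decomposition(3)[OF k], of "\<lambda>p. lookup p i"]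
        by (simp add: lookup_add lookup_sum_nmul sum_S)
    qed
    ultimately show ?thesis
      by (simp add: of_rat_add of_rat_sum of_rat_mult W.scale_left_distrib ac_simps)
  qed
  obtain xs where xs: "set xs = G" "distinct xs" using finite_distinct_list[OF finite_G] by blast
  interpret L: fan_mapping X G G sc act C xs w
  proof
    fix k i assume k: "k \<in> NSupp X" and i: "i \<in> rays X"
    let ?f = "\<lambda>l. sc (of_rat (lookup (Psi X l) i)) ((if l \<in> G then W.Y l else id) (W.Q (ddeg X k l) (w (k + l))))"
    \<comment> \<open>Among the rays only \<open>i\<close> has \<Psi>_i(b_j) non-zero, and its
      variable acts as the identity.\<close>
    have "(\<Sum>j\<in>rays X. ?f (bvec X j)) = (\<Sum>j\<in>rays X. if j = i then W.Q (ddeg X k (bvec X i)) (w (k + bvec X i)) else 0)"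
      using G_disjoint by (intro sum.cong) (auto simp: Psi_bvec lookup_single when_def)
    also have "\<dots> = W.Q (ddeg X k (bvec X i)) (w (k + bvec X i))"
      using i by simp
    finally have 1: "(\<Sum>j\<in>rays X. ?f (bvec X j)) = W.Q (ddeg X k (bvec X i)) (w (k + bvec X i))" .
    have 2: "(\<Sum>l\<in>G. ?f l) = (\<Sum>l\<in>G. sc (of_rat (lookup (Psi X l) i)) (W.Y l (W.De l (w k))))"
      using De_w[OF k] by (intro sum.cong) simp_all
    show "W.Th i (w k) = sc (of_rat (lookup (Psi X k) i)) (W.Z (w k)) + (\<Sum>l\<in>S. ?f l)"
      unfolding sum_S 1 2 using eul_w[OF k i] by (simp add: W.Th_eq_eul)
  qed (use xs w_closed De_w G_subset_S in simp_all)
  have "L.lift (unit_vec (\<kappa> j)) = \<epsilon> j" if j: "j \<in> J" for j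
  proof -
    have "m (\<lambda>_. 0) j = \<epsilon> j"
      unfolding m_def using finite_G \<epsilon>[OF j]
      by (simp add: W.cact_red_product_0 W.cact_del_monomial_0)
    moreover have "W.Q 0 (w (\<kappa> j)) = W.Q 0 (m (\<lambda>_. 0) j)"
      unfolding w_def
      by (rule eq[OF decomposition(1)[OF \<kappa>_NSupp[OF j]] j admissible_generator[OF j]])
    ultimately show ?thesis
      using L.lift_unit[OF \<kappa>_NSupp[OF j]] w_closed[OF \<kappa>_NSupp[OF j]] \<epsilon>[OF j] by (simp add: W.Q_0)
  qed
  moreover have "L.lift v = 0" if "v \<in> Hr" for v
  proof -
    obtain f where f: "v = (\<Sum>i\<in>rays X. coeff_scale (yvar (bvec X i) - 1) (f i))" "\<forall>i\<in>rays X. f i \<in> MC"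
      using \<open>v \<in> Hr\<close> unfolding red_submodule_def by blast
    \<comment> \<open>In the target y_i acts as the identity, so multiples of y_i - 1 are sent to
      0.\<close>
    have "L.lift (coeff_scale (yvar (bvec X i) - 1) (f i)) = 0" if i: "i \<in> rays X" for i
    proof -
      have "bvec X i \<notin> G" using i G_disjoint by auto
      then have "L.lift (coeff_scale (yvar (bvec X i)) (f i)) = L.lift (f i)"
        using L.lift_y[of "f i" "bvec X i"] f(2) i bvec_S by simp
      moreover have "coeff_scale (yvar (bvec X i)) (f i) = coeff_scale (yvar (bvec X i) - 1) (f i) + f i"
        by (simp add: fv.scale_left_diff_distrib)
      ultimately show ?thesis by (simp add: L.lift_add)
    qed
    then show ?thesis by (simp add: f(1) L.lift_sum)
  qed
  ultimately show ?thesis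
    using L.lift_0 L.lift_add L.lift_class_act
    by (intro exI[of _ L.lift]) (simp add: W.fan_ring_eq)
qed

subsection \<open>Presentations of the fan D-module and its reduction\<close>

lemma unit_vecs: "(\<lambda>j. unit_vec (\<kappa> j)) \<in> J \<rightarrow> MC"
  using \<kappa>_NSupp MC_unit by auto

text \<open>Constants, z, Q^d and the y_l with l in \<open>T\<close> act through classes of elements
  of the fan ring; so submodules are stable under these coefficients.\<close>

lemma scalar_closed:
  assumes "T \<subseteq> S" "v \<in> MC" and H: "\<And>P. P \<in> carrier (fan_ring X T) \<Longrightarrow> mact P v \<in> H"
  shows "coeff_scale (cst c) v \<in> H" "coeff_scale zvar v \<in> H"
    "d \<in> Lam_plus X \<Longrightarrow> coeff_scale (Qvar d) v \<in> H" "l \<in> T \<Longrightarrow> coeff_scale (yvar l) v \<in> H"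
proof -
  interpret M: fan_rep X T "\<lambda>c. coeff_scale (cst c)" "gen_act X G" MC by (rule fan_module_fan_rep[OF assms(1)])
  have g: "gen_act X G g v \<in> H" if "g \<in> fan_gens X T" for g
    using H[unfolded M.fan_ring_eq, OF M.cls_gen_closed[OF that]] M.cact_gen[OF that assms(2)] by simp
  show "coeff_scale (cst c) v \<in> H"
    using H[unfolded M.fan_ring_eq, OF M.cls_closed[OF free_algebra_on_closed(7)[of c]]]
      M.cact_cls[OF free_algebra_on_closed(7)[of c] assms(2)] by (simp add: M.ext_const)
  show "coeff_scale zvar v \<in> H" using g[of GZ] by simp
  show "coeff_scale (Qvar d) v \<in> H" if "d \<in> Lam_plus X" using g[of "GQ d"] that by simp
  show "coeff_scale (yvar l) v \<in> H" if "l \<in> T" using g[of "GY l"] that by simp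
qed

theorem fan_module_generated:
  "submodule_generated (fan_ring X S) (fan_module X G) ((\<lambda>j. unit_vec (\<kappa> j)) ` J) = MC"
proof (rule submodule_generated_eqI)
  interpret M: left_module "fan_ring X S" "fan_module X G" by (rule fan_left_module[OF subset_refl])
  show "submodule MC (fan_ring X S) (fan_module X G)" by (rule M.submodule_carrier)
  show "(\<lambda>j. unit_vec (\<kappa> j)) ` J \<subseteq> MC" using unit_vecs by auto
  fix H assume "submodule H (fan_ring X S) (fan_module X G)" and gen: "(\<lambda>j. unit_vec (\<kappa> j)) ` J \<subseteq> H"
  note H = M.submodule_dest(1-4)[OF this(1), simplified]
  have act: "mact P v \<in> H" if "v \<in> H" "P \<in> carrier (fan_ring X S)" for P v
    using H(4) that by blast
  note sc = scalar_closed[OF subset_refl, where H = H, OF subsetD[OF H(1)] act]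
  show "MC \<subseteq> H"
  proof (rule MC_subsetI)
    show "unit_vec k \<in> H" if k: "k \<in> NSupp X" for k
    proof -
      \<comment> \<open>The chosen decomposition has degree \<Psi>(k) over \<open>k\<close>, so its
        monomial produces the basis vector itself, without a power of Q.\<close>
      have "unit_vec k = mact (P_op X G 0 (gen_exponent k)) (unit_vec (\<kappa> (gen_index k)))"
        using P_op_unit[OF \<kappa>_NSupp[OF decomposition(1)[OF k]] Lam_plus_0] generator_expansion[OF k] by simp
      moreover have "unit_vec (\<kappa> (gen_index k)) \<in> H" using gen decomposition(1)[OF k] by auto
      ultimately show ?thesis using act P_op_closed[OF Lam_plus_0] by simp
    qed
    show "coeff_scale (cst c) v \<in> H" "coeff_scale zvar v \<in> H" if "v \<in> H" for c v
      using sc(1,2)[OF that that] by blast+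
    show "coeff_scale (Qvar d) v \<in> H" if "d \<in> Lam_plus X" "v \<in> H" for d v
      using sc(3)[OF that(2,2) _ that(1)] by blast
    show "coeff_scale (yvar l) v \<in> H" if "l \<in> S" "v \<in> H" for l v
      using sc(4)[OF that(2,2) _ that(1)] by blast
    show "0 \<in> H" by (rule H(2))
    show "u + v \<in> H" if "u \<in> H" "v \<in> H" for u v using that by (rule H(3))
  qed
qed

theorem fan_module_relations:
  "relations_among (fan_ring X S) (fan_module X G) J (\<lambda>j. unit_vec (\<kappa> j)) =
    submodule_generated (fan_ring X S) (free_module (fan_ring X S) J)
      ({R_rel X G J \<kappa> i j | i j. i \<in> rays X \<and> j \<in> J} \<union>
       {P_rel X G J d1 d2 a a' j l | d1 d2 a a' j l.
          j \<in> J \<and> l \<in> J \<and> admissible X G d1 d2 a a' (\<kappa> j) (\<kappa> l)})"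
proof (rule submodule_generated_eqI[symmetric])
  interpret R: fan_rep X S "\<lambda>c. coeff_scale (cst c)" "gen_act X G" MC by (rule fan_module_fan_rep[OF subset_refl])
  interpret M: left_module "fan_ring X S" "fan_module X G" by (rule fan_left_module[OF subset_refl])
  have R_rel: "R_rel X G J \<kappa> i j = free_elt (fan_ring X S) J (R_op i (\<kappa> j)) j" for i j
    by (simp add: R_rel_def R_op_def Let_def)
  have P_rel: "P_rel X G J d1 d2 a a' j l = free_elt (fan_ring X S) J (P_op X G d1 a) j
      \<ominus>\<^bsub>free_module (fan_ring X S) J\<^esub> free_elt (fan_ring X S) J (P_op X G d2 a') l" for d1 d2 a a' j l
    by (simp add: P_rel_def Let_def)
  have R_closed: "R_op i k \<in> carrier (fan_ring X S)" if "i \<in> rays X" for i k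
    using R_op_act(1)[OF R.fan_rep_axioms that MC_0] .
  show "submodule (relations_among (fan_ring X S) (fan_module X G) J (\<lambda>j. unit_vec (\<kappa> j)))
     (fan_ring X S) (free_module (fan_ring X S) J)"
    by (rule M.submodule_relations_among[OF finite_J unit_vecs])
  have "R_rel X G J \<kappa> i j \<in> relations_among (fan_ring X S) (fan_module X G) J (\<lambda>j. unit_vec (\<kappa> j))"
    if "i \<in> rays X" "j \<in> J" for i j
    unfolding R_rel
    by (rule M.free_elt_relation[OF finite_J unit_vecs that(2) R_closed[OF that(1)]])
      (use R_op_unit[OF that(1) \<kappa>_NSupp[OF that(2)]] in simp)
  moreover have "P_rel X G J d1 d2 a a' j l \<in> relations_among (fan_ring X S) (fan_module X G) J (\<lambda>j. unit_vec (\<kappa> j))"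
    if "j \<in> J" "l \<in> J" "admissible X G d1 d2 a a' (\<kappa> j) (\<kappa> l)" for d1 d2 a a' j l
  proof -
    have d: "d1 \<in> Lam_plus X" "d2 \<in> Lam_plus X" using that(3) by (simp_all add: admissible_def)
    have "mact (P_op X G d1 a) (unit_vec (\<kappa> j)) = mact (P_op X G d2 a') (unit_vec (\<kappa> l))"
      using that d by (simp add: P_op_unit \<kappa>_NSupp admissible_def)
    then show ?thesis
      unfolding P_rel
      by (intro M.free_elt_diff_relation[OF finite_J unit_vecs that(1,2) P_op_closed[OF d(1)] P_op_closed[OF d(2)]]) simp
  qed
  ultimately show "{R_rel X G J \<kappa> i j | i j. i \<in> rays X \<and> j \<in> J} \<union>
       {P_rel X G J d1 d2 a a' j l | d1 d2 a a' j l. j \<in> J \<and> l \<in> J \<and> admissible X G d1 d2 a a' (\<kappa> j) (\<kappa> l)}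
     \<subseteq> relations_among (fan_ring X S) (fan_module X G) J (\<lambda>j. unit_vec (\<kappa> j))" by blast
  fix H assume H: "submodule H (fan_ring X S) (free_module (fan_ring X S) J)"
    and rel: "{R_rel X G J \<kappa> i j | i j. i \<in> rays X \<and> j \<in> J} \<union>
       {P_rel X G J d1 d2 a a' j l | d1 d2 a a' j l. j \<in> J \<and> l \<in> J \<and> admissible X G d1 d2 a a' (\<kappa> j) (\<kappa> l)} \<subseteq> H"
  obtain sc act C and \<epsilon> :: "nat \<Rightarrow> (nat \<Rightarrow>\<^sub>0 'n fan_gen free_alg)" where
    W: "presented_rep (fan_gens X S) (fan_rels X S) sc act C" and \<epsilon>: "\<And>j. j \<in> J \<Longrightarrow> \<epsilon> j \<in> C"
    and iff: "\<And>x. x \<in> carrier (free_module (fan_ring X S) J) \<Longrightarrow>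
      (\<Sum>j\<in>J. class_act sc act (x j) (\<epsilon> j)) = 0 \<longleftrightarrow> x \<in> H"
    using R.ex_quotient_rep[OF finite_J H[unfolded R.fan_ring_eq]] unfolding R.fan_ring_eq by blast
  interpret W: fan_rep X S sc act C by (rule fan_rep.intro[OF stacky_axioms W])
  interpret F: left_module "fan_ring X S" "free_module (fan_ring X S) J"
    unfolding R.fan_ring_eq by (rule R.D.free_left_module)
  have H0: "(\<Sum>j\<in>J. class_act sc act (x j) (\<epsilon> j)) = 0" if "x \<in> H" for x
    using iff F.submodule_dest(1)[OF H] that by blast
  have R0: "class_act sc act (R_op i (\<kappa> j)) (\<epsilon> j) = 0" if "i \<in> rays X" "j \<in> J" for i j
  proof -
    have "R_rel X G J \<kappa> i j \<in> H" using rel that by blast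
    from H0[OF this] show ?thesis
      unfolding R_rel R.fan_ring_eq using W.sum_free_elt[OF finite_J that(2) \<epsilon>] by simp
  qed
  have P0: "class_act sc act (P_op X G d1 a) (\<epsilon> j) = class_act sc act (P_op X G d2 a') (\<epsilon> l)"
    if jl: "j \<in> J" "l \<in> J" "admissible X G d1 d2 a a' (\<kappa> j) (\<kappa> l)" for d1 d2 a a' j l
  proof -
    have d: "d1 \<in> Lam_plus X" "d2 \<in> Lam_plus X" using jl(3) by (simp_all add: admissible_def)
    have "P_rel X G J d1 d2 a a' j l \<in> H" using rel jl by blast
    from H0[OF this] show ?thesis
      unfolding P_rel R.fan_ring_eq
      using W.sum_free_elt_diff[OF finite_J jl(1,2) \<epsilon> P_op_closed[OF d(1), unfolded R.fan_ring_eq]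
          P_op_closed[OF d(2), unfolded R.fan_ring_eq]] by simp
  qed
  obtain L where L: "L 0 = 0" "\<And>u v. L (u + v) = L u + L v" "\<And>j. j \<in> J \<Longrightarrow> L (unit_vec (\<kappa> j)) = \<epsilon> j"
    "\<And>P v. P \<in> carrier (fan_ring X S) \<Longrightarrow> v \<in> MC \<Longrightarrow> L (mact P v) = class_act sc act P (L v)"
    using ex_lift[where \<epsilon> = \<epsilon>, OF W.fan_rep_axioms \<epsilon> R0 P0] by blast
  show "relations_among (fan_ring X S) (fan_module X G) J (\<lambda>j. unit_vec (\<kappa> j)) \<subseteq> H"
  proof
    fix x assume x: "x \<in> relations_among (fan_ring X S) (fan_module X G) J (\<lambda>j. unit_vec (\<kappa> j))"
    have xc: "x \<in> carrier (free_module (fan_ring X S) J)" using x by (simp add: relations_among_def)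
    have xj: "x j \<in> carrier (fan_ring X S)" if "j \<in> J" for j using xc that by (auto simp: free_module_def)
    have f: "(\<lambda>j. mact (x j) (unit_vec (\<kappa> j))) \<in> J \<rightarrow> MC"
      using xj unit_vecs by (auto simp: R.fan_ring_eq intro!: R.cact_closed)
    have "(\<Sum>j\<in>J. mact (x j) (unit_vec (\<kappa> j))) = 0"
      using x fan_finsum[OF finite_J f] by (simp add: relations_among_def)
    from arg_cong[OF this, of L] have "(\<Sum>j\<in>J. L (mact (x j) (unit_vec (\<kappa> j)))) = 0"
      unfolding additive.sum[OF additive.intro, of L, OF L(2)] L(1) .
    moreover have "L (mact (x j) (unit_vec (\<kappa> j))) = class_act sc act (x j) (\<epsilon> j)" if "j \<in> J" for j
      using L(3)[OF that] L(4)[OF xj[OF that]] MC_unit[OF \<kappa>_NSupp[OF that]] by simp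
    ultimately show "x \<in> H" using iff[OF xc] by simp
  qed
qed

abbreviation Mr where "Mr \<equiv> quotient_module (fan_module X G) Hr"
abbreviation coset where "coset v \<equiv> Hr +>\<^bsub>fan_module X G\<^esub> v"

lemma coset_unit_vecs: "(\<lambda>j. coset (unit_vec (\<kappa> j))) \<in> J \<rightarrow> carrier Mr"
proof -
  interpret M: left_module "fan_ring X G" "fan_module X G" by (rule fan_left_module[OF G_subset_S])
  show ?thesis using unit_vecs by (auto simp: M.quotient_carrier)
qed

lemma coset_eqI:
  assumes "u \<in> MC" "v \<in> MC" "u - v \<in> Hr"
  shows "coset u = coset v"
proof -
  interpret M: left_module "fan_ring X G" "fan_module X G" by (rule fan_left_module[OF G_subset_S])
  interpret H: abelian_subgroup Hr "fan_module X G" by (rule M.abelian_subgroup_submodule[OF Hr_submodule])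
  have "u \<in> coset v" using assms(3) by (auto simp: a_r_coset_def' intro!: bexI[of _ "u - v"])
  then show ?thesis using H.a_repr_independence'[OF _ assms(2)] by simp
qed

lemma coset_mact: "P \<in> carrier (fan_ring X G) \<Longrightarrow> v \<in> MC \<Longrightarrow> P \<odot>\<^bsub>Mr\<^esub> coset v = coset (mact P v)"
  using left_module.quotient_smult[OF fan_left_module[OF G_subset_S] Hr_submodule, of P v] by simp

lemma P_red_op_coset:
  assumes "k \<in> NSupp X" "d \<in> Lam_plus X" "k' \<in> NSupp X" "d' \<in> Lam_plus X"
    and deg: "d + (\<Sum>l\<in>S. nmul (a l) (Psi X l)) + Psi X k = d' + (\<Sum>l\<in>S. nmul (a' l) (Psi X l)) + Psi X k'"
      "k + (\<Sum>l\<in>S. nmul (a l) l) = k' + (\<Sum>l\<in>S. nmul (a' l) l)"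
  shows "coset (mact (P_red_op X G k d a) (unit_vec k)) = coset (mact (P_red_op X G k' d' a') (unit_vec k'))"
proof (rule coset_eqI)
  interpret M: fan_rep X G "\<lambda>c. coeff_scale (cst c)" "gen_act X G" MC
    by (rule fan_module_fan_rep[OF G_subset_S])
  have c: "mact (P_red_op X G k d a) (unit_vec k) \<in> MC" if "k \<in> NSupp X" "d \<in> Lam_plus X" for k d a
    using P_red_op_act(1)[OF M.fan_rep_axioms that(2) MC_0] MC_unit[OF that(1)]
    by (auto simp: M.fan_ring_eq intro: M.cact_closed)
  show "mact (P_red_op X G k d a) (unit_vec k) \<in> MC" "mact (P_red_op X G k' d' a') (unit_vec k') \<in> MC"
    using assms c by blast+
  have 1: "mact (P_red_op X G k d a) (unit_vec k) -
      deg_vec X (d' + (\<Sum>l\<in>S. nmul (a' l) (Psi X l)) + Psi X k') (k' + (\<Sum>l\<in>S. nmul (a' l) l)) \<in> Hr"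
    using P_red_op_unit[OF assms(1,2), of a] by (simp only: deg)
  have "deg_vec X (d' + (\<Sum>l\<in>S. nmul (a' l) (Psi X l)) + Psi X k') (k' + (\<Sum>l\<in>S. nmul (a' l) l)) -
      mact (P_red_op X G k' d' a') (unit_vec k') \<in> Hr"
    using Hr_minus[OF P_red_op_unit[OF assms(3,4), of a']] by (simp only: minus_diff_eq)
  with 1 show "mact (P_red_op X G k d a) (unit_vec k) - mact (P_red_op X G k' d' a') (unit_vec k') \<in> Hr"
    by (rule Hr_trans)
qed

theorem red_fan_module_generated:
  "submodule_generated (fan_ring X G) Mr ((\<lambda>j. coset (unit_vec (\<kappa> j))) ` J) = carrier Mr"
proof (rule submodule_generated_eqI)
  interpret R: fan_rep X G "\<lambda>c. coeff_scale (cst c)" "gen_act X G" MC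
    by (rule fan_module_fan_rep[OF G_subset_S])
  interpret M: left_module "fan_ring X G" "fan_module X G" by (rule fan_left_module[OF G_subset_S])
  interpret Q: left_module "fan_ring X G" Mr by (rule M.quotient_left_module[OF Hr_submodule])
  show "submodule (carrier Mr) (fan_ring X G) Mr" by (rule Q.submodule_carrier)
  show "(\<lambda>j. coset (unit_vec (\<kappa> j))) ` J \<subseteq> carrier Mr" using coset_unit_vecs by auto
  fix H assume H: "submodule H (fan_ring X G) Mr" and gen: "(\<lambda>j. coset (unit_vec (\<kappa> j))) ` J \<subseteq> H"
  \<comment> \<open>The preimage of \<open>H\<close> in the fan module. It contains
    \<open>Hr\<close> and is therefore stable under the variables y_i of the rays, although these
    are not in D'.\<close>
  let ?K = "{v \<in> MC. coset v \<in> H}"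
  have add: "u + v \<in> ?K" if "u \<in> ?K" "v \<in> ?K" for u v
    using that Q.submodule_dest(3)[OF H, of "coset u" "coset v"] M.quotient_add[OF Hr_submodule, of u v]
    by (simp add: MC_add)
  have act: "mact P v \<in> ?K" if "v \<in> ?K" "P \<in> carrier (fan_ring X G)" for P v
    using that Q.submodule_dest(4)[OF H that(2), of "coset v"] coset_mact[OF that(2), of v]
      R.cact_closed[of P v] by (simp add: R.fan_ring_eq)
  have Hr: "v \<in> ?K" if "v \<in> Hr" for v
    using M.quotient_eq_zero_iff[OF Hr_submodule, of v] that Q.submodule_dest(2)[OF H] Hr_MC[OF that] by simp
  have MCK: "v \<in> MC" if "v \<in> ?K" for v using that by simp
  note sc = scalar_closed[OF G_subset_S, where H = ?K, OF MCK act]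
  have "MC \<subseteq> ?K"
  proof (rule MC_subsetI)
    show "coeff_scale (cst c) v \<in> ?K" "coeff_scale zvar v \<in> ?K" if "v \<in> ?K" for c v
      using sc(1,2)[OF that that] by blast+
    show "coeff_scale (Qvar d) v \<in> ?K" if "d \<in> Lam_plus X" "v \<in> ?K" for d v
      using sc(3)[OF that(2,2) _ that(1)] by blast
    show "0 \<in> ?K" by (rule Hr[OF Hr_0])
    show "u + v \<in> ?K" if "u \<in> ?K" "v \<in> ?K" for u v using that by (rule add)
    show "coeff_scale (yvar l) v \<in> ?K" if "l \<in> S" "v \<in> ?K" for l v
    proof (cases "l \<in> G")
      case True
      then show ?thesis using sc(4)[OF that(2,2)] by blast
    next
      case False
      with \<open>l \<in> S\<close> obtain i where i: "i \<in> rays X" "l = bvec X i" by (auto simp: S_set_def)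
      have "coeff_scale (yvar l - 1) v + v \<in> ?K"
        using Hr[OF Hr_I[OF MCK[OF that(2)] i(1)]] that(2) unfolding i(2) by (rule add)
      then show ?thesis by (simp add: fv.scale_left_diff_distrib)
    qed
    show "unit_vec k \<in> ?K" if k: "k \<in> NSupp X" for k
    proof -
      let ?j = "gen_index k" and ?P = "P_red_op X G (\<kappa> (gen_index k)) 0 (gen_exponent k)"
      have j: "?j \<in> J" and \<kappa>: "\<kappa> ?j \<in> NSupp X" using decomposition(1)[OF k] \<kappa>_NSupp by auto
      have "unit_vec (\<kappa> ?j) \<in> ?K" using gen j MC_unit[OF \<kappa>] by auto
      then have P: "mact ?P (unit_vec (\<kappa> ?j)) \<in> ?K"
        using P_red_op_act(1)[OF R.fan_rep_axioms Lam_plus_0 MC_0] by (rule act)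
      \<comment> \<open>In the fan module itself the operator of P' reproduces the basis vector only
        modulo \<open>Hr\<close>.\<close>
      have "unit_vec k - mact ?P (unit_vec (\<kappa> ?j)) \<in> Hr"
        using Hr_minus[OF P_red_op_unit[OF \<kappa> Lam_plus_0, of "gen_exponent k"]]
        unfolding generator_expansion[OF k, symmetric] by (simp only: minus_diff_eq)
      from add[OF Hr[OF this] P] show ?thesis by simp
    qed
  qed
  then show "carrier Mr \<subseteq> H" by (auto simp: M.quotient_carrier)
qed

theorem red_fan_module_relations:
  "relations_among (fan_ring X G) Mr J (\<lambda>j. coset (unit_vec (\<kappa> j))) =
    submodule_generated (fan_ring X G) (free_module (fan_ring X G) J)
      {P_red_rel X G J \<kappa> d1 d2 a a' j l | d1 d2 a a' j l.
         j \<in> J \<and> l \<in> J \<and> admissible X G d1 d2 a a' (\<kappa> j) (\<kappa> l)}"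
proof (rule submodule_generated_eqI[symmetric])
  interpret R: fan_rep X G "\<lambda>c. coeff_scale (cst c)" "gen_act X G" MC
    by (rule fan_module_fan_rep[OF G_subset_S])
  interpret M: left_module "fan_ring X G" "fan_module X G" by (rule fan_left_module[OF G_subset_S])
  interpret Q: left_module "fan_ring X G" Mr by (rule M.quotient_left_module[OF Hr_submodule])
  have P_rel: "P_red_rel X G J \<kappa> d1 d2 a a' j l = free_elt (fan_ring X G) J (P_red_op X G (\<kappa> j) d1 a) j
      \<ominus>\<^bsub>free_module (fan_ring X G) J\<^esub> free_elt (fan_ring X G) J (P_red_op X G (\<kappa> l) d2 a') l" for d1 d2 a a' j l
    by (simp add: P_red_rel_def Let_def)
  have P_closed: "P_red_op X G k d a \<in> carrier (fan_ring X G)" if "d \<in> Lam_plus X" for k d a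
    by (rule P_red_op_act(1)[OF R.fan_rep_axioms that MC_0])
  show "submodule (relations_among (fan_ring X G) Mr J (\<lambda>j. coset (unit_vec (\<kappa> j))))
     (fan_ring X G) (free_module (fan_ring X G) J)"
    by (rule Q.submodule_relations_among[OF finite_J coset_unit_vecs])
  have "P_red_rel X G J \<kappa> d1 d2 a a' j l \<in> relations_among (fan_ring X G) Mr J (\<lambda>j. coset (unit_vec (\<kappa> j)))"
    if jl: "j \<in> J" "l \<in> J" "admissible X G d1 d2 a a' (\<kappa> j) (\<kappa> l)" for d1 d2 a a' j l
  proof -
    have d: "d1 \<in> Lam_plus X" "d2 \<in> Lam_plus X" using jl(3) by (simp_all add: admissible_def)
    have "P_red_op X G (\<kappa> j) d1 a \<odot>\<^bsub>Mr\<^esub> coset (unit_vec (\<kappa> j)) = P_red_op X G (\<kappa> l) d2 a' \<odot>\<^bsub>Mr\<^esub> coset (unit_vec (\<kappa> l))"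
      unfolding coset_mact[OF P_closed[OF d(1)] MC_unit[OF \<kappa>_NSupp[OF jl(1)]]]
        coset_mact[OF P_closed[OF d(2)] MC_unit[OF \<kappa>_NSupp[OF jl(2)]]]
      by (rule P_red_op_coset) (use jl d \<kappa>_NSupp in \<open>auto simp: admissible_def\<close>)
    then show ?thesis
      unfolding P_rel
      by (rule Q.free_elt_diff_relation[OF finite_J coset_unit_vecs jl(1,2) P_closed[OF d(1)] P_closed[OF d(2)]])
  qed
  then show "{P_red_rel X G J \<kappa> d1 d2 a a' j l | d1 d2 a a' j l.
       j \<in> J \<and> l \<in> J \<and> admissible X G d1 d2 a a' (\<kappa> j) (\<kappa> l)}
     \<subseteq> relations_among (fan_ring X G) Mr J (\<lambda>j. coset (unit_vec (\<kappa> j)))" by blast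
  fix H assume H: "submodule H (fan_ring X G) (free_module (fan_ring X G) J)"
    and rel: "{P_red_rel X G J \<kappa> d1 d2 a a' j l | d1 d2 a a' j l.
       j \<in> J \<and> l \<in> J \<and> admissible X G d1 d2 a a' (\<kappa> j) (\<kappa> l)} \<subseteq> H"
  obtain sc act C and \<epsilon> :: "nat \<Rightarrow> (nat \<Rightarrow>\<^sub>0 'n fan_gen free_alg)" where
    W: "presented_rep (fan_gens X G) (fan_rels X G) sc act C" and \<epsilon>: "\<And>j. j \<in> J \<Longrightarrow> \<epsilon> j \<in> C"
    and iff: "\<And>x. x \<in> carrier (free_module (fan_ring X G) J) \<Longrightarrow>
      (\<Sum>j\<in>J. class_act sc act (x j) (\<epsilon> j)) = 0 \<longleftrightarrow> x \<in> H"
    using R.ex_quotient_rep[OF finite_J H[unfolded R.fan_ring_eq]] unfolding R.fan_ring_eq by blast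
  interpret W: fan_rep X G sc act C by (rule fan_rep.intro[OF stacky_axioms W])
  interpret F: left_module "fan_ring X G" "free_module (fan_ring X G) J"
    unfolding R.fan_ring_eq by (rule R.D.free_left_module)
  have P0: "class_act sc act (P_red_op X G (\<kappa> j) d1 a) (\<epsilon> j) = class_act sc act (P_red_op X G (\<kappa> l) d2 a') (\<epsilon> l)"
    if jl: "j \<in> J" "l \<in> J" "admissible X G d1 d2 a a' (\<kappa> j) (\<kappa> l)" for d1 d2 a a' j l
  proof -
    have d: "d1 \<in> Lam_plus X" "d2 \<in> Lam_plus X" using jl(3) by (simp_all add: admissible_def)
    have "P_red_rel X G J \<kappa> d1 d2 a a' j l \<in> H" using rel jl by blast
    then have "(\<Sum>i\<in>J. class_act sc act (P_red_rel X G J \<kappa> d1 d2 a a' j l i) (\<epsilon> i)) = 0"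
      using iff F.submodule_dest(1)[OF H] by blast
    then show ?thesis
      unfolding P_rel R.fan_ring_eq
      using W.sum_free_elt_diff[OF finite_J jl(1,2) \<epsilon> P_closed[OF d(1), unfolded R.fan_ring_eq]
          P_closed[OF d(2), unfolded R.fan_ring_eq]] by simp
  qed
  obtain L where L: "\<And>v. v \<in> Hr \<Longrightarrow> L v = 0" "L 0 = 0" "\<And>u v. L (u + v) = L u + L v"
    "\<And>j. j \<in> J \<Longrightarrow> L (unit_vec (\<kappa> j)) = \<epsilon> j"
    "\<And>P v. P \<in> carrier (fan_ring X G) \<Longrightarrow> v \<in> MC \<Longrightarrow> L (mact P v) = class_act sc act P (L v)"
    using ex_red_lift[where \<epsilon> = \<epsilon>, OF W.fan_rep_axioms \<epsilon> P0] by blast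
  show "relations_among (fan_ring X G) Mr J (\<lambda>j. coset (unit_vec (\<kappa> j))) \<subseteq> H"
  proof
    fix x assume x: "x \<in> relations_among (fan_ring X G) Mr J (\<lambda>j. coset (unit_vec (\<kappa> j)))"
    have xc: "x \<in> carrier (free_module (fan_ring X G) J)" using x by (simp add: relations_among_def)
    have xj: "x j \<in> carrier (fan_ring X G)" if "j \<in> J" for j using xc that by (auto simp: free_module_def)
    have f: "(\<lambda>j. mact (x j) (unit_vec (\<kappa> j))) \<in> J \<rightarrow> MC"
      using xj unit_vecs by (auto simp: R.fan_ring_eq intro!: R.cact_closed)
    have "(\<Oplus>\<^bsub>Mr\<^esub>j\<in>J. x j \<odot>\<^bsub>Mr\<^esub> coset (unit_vec (\<kappa> j))) = (\<Oplus>\<^bsub>Mr\<^esub>j\<in>J. coset (mact (x j) (unit_vec (\<kappa> j))))"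
      using f by (intro Q.M.finsum_cong')
        (auto simp: coset_mact[OF xj MC_unit[OF \<kappa>_NSupp]] M.quotient_carrier)
    also have "\<dots> = coset (\<Sum>j\<in>J. mact (x j) (unit_vec (\<kappa> j)))"
      using M.quotient_finsum[OF Hr_submodule finite_J f] fan_finsum[OF finite_J f] by simp
    \<comment> \<open>A relation in the quotient is a combination that falls into \<open>Hr\<close>,
      and there the lift vanishes.\<close>
    finally have "(\<Sum>j\<in>J. mact (x j) (unit_vec (\<kappa> j))) \<in> Hr"
      using x f M.quotient_eq_zero_iff[OF Hr_submodule MC_sum[of J "\<lambda>j. mact (x j) (unit_vec (\<kappa> j))"]]
      by (auto simp: relations_among_def)
    from L(1)[OF this] have "(\<Sum>j\<in>J. L (mact (x j) (unit_vec (\<kappa> j)))) = 0"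
      unfolding additive.sum[OF additive.intro, of L, OF L(3)] .
    moreover have "L (mact (x j) (unit_vec (\<kappa> j))) = class_act sc act (x j) (\<epsilon> j)" if "j \<in> J" for j
      using L(4)[OF that] L(5)[OF xj[OF that]] MC_unit[OF \<kappa>_NSupp[OF that]] by simp
    ultimately show "x \<in> H" using iff[OF xc] by simp
  qed
qed

end

theorem theorem5p9:
  fixes X :: "('n::ab_group_add) stacky_data" and G :: "'n set"
    and s :: nat and \<kappa> :: "nat \<Rightarrow> 'n"
  assumes "stacky_fan X"
    and "finite G" and "G \<subseteq> NSupp X" and "G \<inter> bvec X ` rays X = {}"
    and "\<forall>j\<in>{1..s}. \<kappa> j \<in> NSupp X"
    and "\<forall>\<sigma>\<in>cones X. max_dim \<sigma> \<longrightarrow>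
      {k. real_image k \<in> \<sigma>} =
        (\<Union>j\<in>{j\<in>{1..s}. real_image (\<kappa> j) \<in> \<sigma>}.
          {\<kappa> j + (\<Sum>l\<in>{l\<in>S_set X G. real_image l \<in> \<sigma>}. nmul (a l) l) | a. True})"
  shows
    "(submodule_generated (fan_ring X (S_set X G)) (fan_module X G)
        ((\<lambda>j. unit_vec (\<kappa> j)) ` {1..s}) = carrier (fan_module X G) \<and>
      relations_among (fan_ring X (S_set X G)) (fan_module X G) {1..s} (\<lambda>j. unit_vec (\<kappa> j)) =
        submodule_generated (fan_ring X (S_set X G)) (free_module (fan_ring X (S_set X G)) {1..s})
          ({R_rel X G {1..s} \<kappa> i j | i j. i \<in> rays X \<and> j \<in> {1..s}} \<union>
           {P_rel X G {1..s} d1 d2 a a' j l | d1 d2 a a' j l.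
              j \<in> {1..s} \<and> l \<in> {1..s} \<and> admissible X G d1 d2 a a' (\<kappa> j) (\<kappa> l)})) \<and>
     (submodule_generated (fan_ring X G) (red_fan_module X G)
        ((\<lambda>j. red_unit_vec X G (\<kappa> j)) ` {1..s}) = carrier (red_fan_module X G) \<and>
      relations_among (fan_ring X G) (red_fan_module X G) {1..s} (\<lambda>j. red_unit_vec X G (\<kappa> j)) =
        submodule_generated (fan_ring X G) (free_module (fan_ring X G) {1..s})
          {P_red_rel X G {1..s} \<kappa> d1 d2 a a' j l | d1 d2 a a' j l.
             j \<in> {1..s} \<and> l \<in> {1..s} \<and> admissible X G d1 d2 a a' (\<kappa> j) (\<kappa> l)})"
proof -
  interpret fan_generators X G "{1..s}" \<kappa>
  proof (intro fan_generators.intro fan_setting.intro stacky.intro fan_setting_axioms.intro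
      fan_generators_axioms.intro assms(1-4) finite_atLeastAtMost)
    show "\<kappa> j \<in> NSupp X" if "j \<in> {1..s}" for j using assms(5) that by blast
    show "{k. real_image k \<in> \<sigma>} =
        (\<Union>j\<in>{j\<in>{1..s}. real_image (\<kappa> j) \<in> \<sigma>}.
          {\<kappa> j + (\<Sum>l\<in>{l\<in>S_set X G. real_image l \<in> \<sigma>}. nmul (a l) l) | a. True})"
      if "\<sigma> \<in> cones X" "max_dim \<sigma>" for \<sigma>
      using assms(6)[rule_format, OF that] .
  qed
  show ?thesis
    unfolding red_fan_module_def red_unit_vec_def
    by (intro conjI fan_module_generated fan_module_relations red_fan_module_generated red_fan_module_relations)
qed

end
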